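(* Let $0<\varepsilon<1$, $k\ge1$, and let $T$ be the operator of the index cycle (see context). (i) ($n=2k-1$) There is a unitary isomorphism $U$ from $\widetilde{\mathcal E}\otimes_{C_0(\mathbb{R}^{2k})}L^2(\mathbb{R}^{2k},\mathcal S)$ to $L^2(\mathbb{S}^{2k-1},\mathcal S^+\otimes\mathbb{C}^2)\otimes L^2((-\varepsilon,\varepsilon),\mathbb{C}^2)$ such that $$UD_\times U^*=\widetilde{D_{\mathbb{S}^{2k-1}}}\otimes\frac1{1+s}+\gamma_3\otimes T .$$ (ii) ($n=2k$) There is a unitary isomorphism $U$ from $\widetilde{\mathcal E}\otimes_{C_0(\mathbb{R}^{2k+1})\otimes\mathbb{C}l_1}(L^2(\mathbb{R}^{2k+1},\mathcal S)\otimes\mathbb{C}^2)$ to $L^2(\mathbb{S}^{2k},\mathcal S)\otimes L^2((-\varepsilon,\varepsilon),\mathbb{C}^2)$ such that $$UD_\times U^*=D_{\mathbb{S}^{2k}}\otimes\frac1{1+s}+\gamma_r\otimes T .$$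
   Context: Matrices: $\gamma^1=\gamma_1=\begin{pmatrix}0&1\\1&0\end{pmatrix}$, $\gamma^2=\gamma_2=\begin{pmatrix}0&-i\\i&0\end{pmatrix}$, $\gamma^3=\gamma_3=\begin{pmatrix}1&0\\0&-1\end{pmatrix}$; $\mathbb{C}l_1$ is the complex Clifford algebra on one odd generator. $\frac1{1+s}$ is the multiplication operator on $L^2((-\varepsilon,\varepsilon),\mathbb{C}^2)$. Geometry. In spherical coordinates $\tilde\imath:\mathbb{S}^n\times(-\varepsilon,\varepsilon)\to\mathbb{R}^{n+1}$, $\tilde\imath(\vec\theta,s)=(\vec\theta,s+1)$ (radius $r=s+1$). $\mathcal S$ is the spinor bundle of the standard spin$^c$ structure of $\mathbb{R}^{n+1}$ with Clifford multiplication $c$ ($c(v)^2=|v|^2$, $c(v)^*=c(v)$); $D_{\mathbb{R}^{n+1}}=i\sum_jc(e_j)\partial_j$; $\gamma_r=c(\partial_r)$. $T\mathbb{S}^n$ acts on $\mathcal S|_{\mathbb{S}^n}$ by $\rho(v)=i\,c(v)c(\partial_r)$. For $n=2k-1$: $\mathcal S=\mathcal S^+\oplus\mathcal S^-$ is graded by $\Gamma$; $\rho$ restricted to $\mathcal S^+$ makes $\mathcal S^+|_{\mathbb{S}^n}$ a spinor bundle with Dirac operator $D^+_{\mathbb{S}^{2k-1}}$, and $\widetilde{D_{\mathbb{S}^{2k-1}}}=D^+_{\mathbb{S}^{2k-1}}\otimes\gamma^2$ on $L^2(\mathbb{S}^{2k-1},\mathcal S^+)\otimes\mathbb{C}^2$;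 $\gamma_3$ in (i) is $1\otimes\gamma_3$ on this space. Identifying $\mathcal S\cong\mathcal S^+\otimes\mathbb{C}^2$, $\gamma_r\equiv1\otimes\gamma^1$, $\Gamma\equiv1\otimes\gamma^3$, one has $D_{\mathbb{R}^{2k}}=\frac1rD^+_{\mathbb{S}^{2k-1}}\otimes\gamma^2+i\frac{2k-1}{2r}(1\otimes\gamma^1)+i\partial_r(1\otimes\gamma^1)$. For $n=2k$: $\mathcal S|_{\mathbb{S}^{2k}}$ with $\rho$ is a spinor bundle graded by $\gamma_r$, with Dirac operator $D_{\mathbb{S}^{2k}}$, and $D_{\mathbb{R}^{2k+1}}=i\frac1r\gamma_rD_{\mathbb{S}^{2k}}+i\frac{2k}{2r}\gamma_r+i\gamma_r\partial_r$. Put $\widetilde{D_{\mathbb{R}^{2k+1}}}=D_{\mathbb{R}^{2k+1}}\otimes\gamma^2$ on $L^2(\mathbb{R}^{2k+1},\mathcal S)\otimes\mathbb{C}^2$, where $\mathbb{C}l_1$ acts on the left with generator $1\otimes\gamma^1$. Module. $\alpha=\frac\pi{2\varepsilon}$, $f(s)=\alpha\tan(\alpha s)$. $\mathcal E=C_0(\mathbb{S}^n\times(-\varepsilon,\varepsilon))$ with inner product $\langle\psi,\phi\rangle_{\mathcal E}(\vec\theta,r)=\frac1{r^n}\overline\psi(\tilde\imath^{-1}(\vec\theta,r))\phi(\tilde\imath^{-1}(\vec\theta,r))$ on the image of $\tilde\imath$ and $0$ elsewhere, and actions $(g\cdot\psi\cdot h)(\vec\theta,s)=g(\vec\theta)\psi(\vec\theta,s)h(\tilde\imath(\vec\theta,s))$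 of $g\in C(\mathbb{S}^n)$, $h\in C_0(\mathbb{R}^{n+1})$. $S$ is multiplication by $f(s)$ on $\{\psi\in\mathcal E:f\psi\in\mathcal E\}$. $\widetilde{\mathcal E}=\mathcal E\otimes\mathbb{C}^2$, graded by $1\otimes\gamma^3$; for $n$ odd $\widetilde S=S\otimes\gamma^2$; for $n$ even $\widetilde S=S\otimes\gamma^1$ and $\widetilde{\mathcal E}$ is a right Hilbert $C_0(\mathbb{R}^{n+1})\otimes\mathbb{C}l_1$-module with the generator acting by $1\otimes\gamma^1$ (so $\mathbb{C}^2\cong\mathbb{C}l_1$). Product operator. Write $D$ for $D_{\mathbb{R}^{2k}}$ ($n$ odd) or $\widetilde{D_{\mathbb{R}^{2k+1}}}$ ($n$ even). In local spherical coordinates, $\nabla^{\mathcal E}(\psi)=\big(\frac{\partial\psi}{\partial s}-\frac n{2(s+1)}\psi\big)\otimes[D,r]+\sum_{i=1}^n\frac{\partial\psi}{\partial\theta^i}\otimes[D,\theta^i]$ for $\psi\in C^1_0(\mathbb{S}^n\times(-\varepsilon,\varepsilon))$, and $\nabla=\nabla^{\mathcal E}\otimes\mathrm{id}$ on $\widetilde{\mathcal E}$. Then $D_\times=\widetilde S\otimes1+\gamma^3\otimes_\nabla D$ with $(\gamma^3\otimes_\nabla D)(\xi\otimes\psi)=\gamma^3\xi\otimes D\psi+\nabla(\gamma^3\xi)\cdot\psi$, $(\eta\otimes\omega)\cdot\psi=\eta\otimes\omega\psi$, on the span of $\xi\otimes\psi$, $\xi\in\mathrm{dom}(\widetilde S)$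 also in the domain of $\nabla$, $\psi\in\mathrm{dom}(D)$. The equalities for $UD_\times U^*$ are equalities of the differential expressions by which the operators act. Index cycle operator. $T$ is the closure in $L^2((-\varepsilon,\varepsilon),\mathbb{C}^2)$ of $T_0=i\gamma^1\partial_s+\gamma^2f(s)$ with domain $C_c^\infty((-\varepsilon,\varepsilon),\mathbb{C}^2)$. *)

theory Defs
  imports "HOL-Analysis.Analysis" "HOL-Library.Multiset"
begin

section \<open>Hilbert spaces and unbounded operators\<close>

text \<open>A Hilbert space is represented by a complete semi-inner product space on a carrier set:
  two elements at distance zero (\<open>veq\<close>) represent the same vector, as for functions that agree
  almost everywhere.  Inner products are antilinear in the first argument.\<close>

record 'a hspace =
  carr :: "'a set"
  vadd :: "'a \<Rightarrow> 'a \<Rightarrow> 'a"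
  vscale :: "complex \<Rightarrow> 'a \<Rightarrow> 'a"
  ip :: "'a \<Rightarrow> 'a \<Rightarrow> complex"

definition vdist :: "'a hspace \<Rightarrow> 'a \<Rightarrow> 'a \<Rightarrow> real" where
  "vdist H x y = (let d = vadd H x (vscale H (-1) y) in sqrt (Re (ip H d d)))"

definition veq :: "'a hspace \<Rightarrow> 'a \<Rightarrow> 'a \<Rightarrow> bool" where
  "veq H x y \<longleftrightarrow> vdist H x y = 0"

definition unitary_iso :: "'a hspace \<Rightarrow> 'b hspace \<Rightarrow> ('a \<Rightarrow> 'b) \<Rightarrow> bool" where
  "unitary_iso H K U \<longleftrightarrow>
     (\<forall>x\<in>carr H. U x \<in> carr K) \<and>
     (\<forall>x\<in>carr H. \<forall>y\<in>carr H. \<forall>a b.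
        veq K (U (vadd H (vscale H a x) (vscale H b y)))
              (vadd K (vscale K a (U x)) (vscale K b (U y)))) \<and>
     (\<forall>x\<in>carr H. \<forall>y\<in>carr H. ip K (U x) (U y) = ip H x y) \<and>
     (\<forall>z\<in>carr K. \<exists>x\<in>carr H. veq K (U x) z)"

text \<open>Unbounded operators are given by their graphs.\<close>

definition op_closure :: "'a hspace \<Rightarrow> ('a \<times> 'a) set \<Rightarrow> ('a \<times> 'a) set" where
  "op_closure H G = {(x, y). x \<in> carr H \<and> y \<in> carr H \<and>
     (\<exists>X Y. (\<forall>n. (X n, Y n) \<in> G) \<and>
       (\<lambda>n. vdist H (X n) x) \<longlonglongrightarrow> 0 \<and> (\<lambda>n. vdist H (Y n) y) \<longlonglongrightarrow> 0)}"

text \<open>The operator \<open>U A U\<^sup>*\<close>.\<close>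

definition transport :: "('a \<Rightarrow> 'b) \<Rightarrow> ('a \<times> 'a) set \<Rightarrow> ('b \<times> 'b) set" where
  "transport U A = (\<lambda>(x, y). (U x, U y)) ` A"

text \<open>Equality of two operators as differential expressions.  The operators \<open>A\<close> and \<open>B\<close> may have
  different domains.  \<open>C\<close> consists of the test sections, to which the (formally self-adjoint)
  expression of \<open>B\<close> applies classically.  \<open>A\<close> and \<open>B\<close> are both defined on \<open>C\<close> and coincide there;
  on the rest of their domains both are given by this expression in the sense of distributions,
  i.e. both are restrictions of the adjoint of \<open>B\<close> restricted to \<open>C\<close>.\<close>

definition same_differential_expression ::
    "'a hspace \<Rightarrow> 'a set \<Rightarrow> ('a \<times> 'a) set \<Rightarrow> ('a \<times> 'a) set \<Rightarrow> bool" where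
  "same_differential_expression H C A B \<longleftrightarrow>
     (\<forall>u\<in>C. \<exists>(x, x')\<in>A. \<exists>(y, y')\<in>B. veq H x u \<and> veq H y u \<and> veq H x' y') \<and>
     (\<forall>(x, x')\<in>A \<union> B. \<forall>(u, u')\<in>B. u \<in> C \<longrightarrow> ip H u' x = ip H u x')"

section \<open>Interior tensor products\<close>

text \<open>A finite sum of elementary tensors is the multiset of its summands.  For a Hilbert module
  \<open>E\<close> with inner product \<open>inn\<close> and a Hilbert space \<open>H\<close> on which the coefficient algebra acts by
  \<open>act\<close>, \<open>pre_tensor\<close> has
  \<open>\<langle>e \<otimes> h, e' \<otimes> h'\<rangle> = \<langle>h, \<langle>e, e'\<rangle> h'\<rangle>\<close>.
  The relations of the balanced tensor product, such as \<open>e b \<otimes> h = e \<otimes> b h\<close>, hold because the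
  difference of the two sides is a null vector.\<close>

definition pre_tensor :: "'e set \<Rightarrow> ('e \<Rightarrow> 'e \<Rightarrow> 'b) \<Rightarrow> ('b \<Rightarrow> 'h \<Rightarrow> 'h) \<Rightarrow> 'h hspace
    \<Rightarrow> ('e \<times> 'h) multiset hspace" where
  "pre_tensor E inn act H =
     \<lparr>carr = {M. set_mset M \<subseteq> E \<times> carr H},
      vadd = (+),
      vscale = (\<lambda>a. image_mset (\<lambda>(e, h). (e, vscale H a h))),
      ip = (\<lambda>M N. \<Sum>(e, h)\<in>#M. \<Sum>(e', h')\<in>#N. ip H h (act (inn e e') h'))\<rparr>"

definition completion :: "'a hspace \<Rightarrow> (nat \<Rightarrow> 'a) hspace" where
  "completion V =
     \<lparr>carr = {X. (\<forall>n. X n \<in> carr V) \<and>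
                 (\<forall>\<delta>>0. \<exists>N. \<forall>m\<ge>N. \<forall>n\<ge>N. vdist V (X m) (X n) < \<delta>)},
      vadd = (\<lambda>X Y n. vadd V (X n) (Y n)),
      vscale = (\<lambda>a X n. vscale V a (X n)),
      ip = (\<lambda>X Y. lim (\<lambda>n. ip V (X n) (Y n)))\<rparr>"

definition interior_tensor :: "'e set \<Rightarrow> ('e \<Rightarrow> 'e \<Rightarrow> 'b) \<Rightarrow> ('b \<Rightarrow> 'h \<Rightarrow> 'h) \<Rightarrow> 'h hspace
    \<Rightarrow> (nat \<Rightarrow> ('e \<times> 'h) multiset) hspace" where
  "interior_tensor E inn act H = completion (pre_tensor E inn act H)"

definition hilbert_tensor :: "'g hspace \<Rightarrow> 'h hspace \<Rightarrow> (nat \<Rightarrow> ('g \<times> 'h) multiset) hspace" where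
  "hilbert_tensor G H = interior_tensor (carr G) (ip G) (vscale H) H"

text \<open>A finite sum of elementary tensors as an element of the completion.\<close>

definition fin_tensor :: "('e \<times> 'h) multiset \<Rightarrow> (nat \<Rightarrow> ('e \<times> 'h) multiset)" where
  "fin_tensor M = (\<lambda>_. M)"

text \<open>The linear operator determined by its values on elementary tensors; its domain is the span
  of these tensors (the sets of elementary tensors below are closed under scalars).\<close>

definition span_op :: "(('e \<times> 'h) multiset \<times> ('e \<times> 'h) multiset) set
    \<Rightarrow> ((nat \<Rightarrow> ('e \<times> 'h) multiset) \<times> (nat \<Rightarrow> ('e \<times> 'h) multiset)) set" where
  "span_op G = {(fin_tensor (\<Sum>g\<in>#P. fst g), fin_tensor (\<Sum>g\<in>#P. snd g)) | P. set_mset P \<subseteq> G}"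

section \<open>Function spaces\<close>

fun iter_deriv :: "'a list \<Rightarrow> ('a::real_normed_vector \<Rightarrow> 'b::real_normed_vector) \<Rightarrow> 'a \<Rightarrow> 'b" where
  "iter_deriv [] f = f"
| "iter_deriv (v # vs) f = (\<lambda>x. frechet_derivative (iter_deriv vs f) (at x) v)"

definition smooth_on :: "'a::real_normed_vector set \<Rightarrow> ('a \<Rightarrow> 'b::real_normed_vector) \<Rightarrow> bool" where
  "smooth_on V f \<longleftrightarrow> (\<forall>vs. \<forall>x\<in>V. iter_deriv vs f differentiable at x)"

definition Cc_inf :: "'a::real_normed_vector set \<Rightarrow> ('a \<Rightarrow> 'b::real_normed_vector) set" where
  "Cc_inf V = {\<phi>. smooth_on V \<phi> \<and> (\<exists>K. compact K \<and> K \<subseteq> V \<and> (\<forall>x. x \<notin> K \<longrightarrow> \<phi> x = 0))}"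

definition C0 :: "'a::topological_space set \<Rightarrow> ('a \<Rightarrow> 'b::real_normed_vector) set" where
  "C0 X = {\<psi>. continuous_on X \<psi> \<and>
     (\<forall>\<delta>>0. \<exists>K. compact K \<and> K \<subseteq> X \<and> (\<forall>p\<in>X - K. norm (\<psi> p) < \<delta>))}"

definition cip :: "complex^'i \<Rightarrow> complex^'i \<Rightarrow> complex" where
  "cip v w = (\<Sum>i\<in>UNIV. cnj (v $ i) * w $ i)"

text \<open>Square integrable functions with values in the subspace \<open>F\<close>.\<close>

definition L2 :: "'x measure \<Rightarrow> (complex^'i) set \<Rightarrow> ('x \<Rightarrow> complex^'i) hspace" where
  "L2 M F =
     \<lparr>carr = {\<phi> \<in> borel_measurable M. integrable M (\<lambda>x. (norm (\<phi> x))\<^sup>2) \<and> (\<forall>x\<in>space M. \<phi> x \<in> F)},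
      vadd = (\<lambda>\<phi> \<psi> x. \<phi> x + \<psi> x),
      vscale = (\<lambda>a \<phi> x. a *s \<phi> x),
      ip = (\<lambda>\<phi> \<psi>. LINT x|M. cip (\<phi> x) (\<psi> x))\<rparr>"

text \<open>The surface measure of the unit sphere of \<open>\<real>\<^sup>m\<close>: the measure of \<open>A\<close> is \<open>m\<close> times the
  volume of the cone \<open>{t x | 0 < t < 1, x \<in> A}\<close>.\<close>

definition sphere_measure :: "(real^'m) measure" where
  "sphere_measure = scale_measure (ennreal (real CARD('m)))
     (distr (restrict_space lborel (ball 0 1 - {0})) (restrict_space borel (sphere 0 1))
        (\<lambda>x. x /\<^sub>R norm x))"

text \<open>Derivatives along the sphere are derivatives of the extension that is homogeneous of
  degree 0.\<close>

definition hom_ext :: "(real^'m \<Rightarrow> 'b) \<Rightarrow> real^'m \<Rightarrow> 'b" where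
  "hom_ext \<phi> = (\<lambda>z. \<phi> (z /\<^sub>R norm z))"

definition smooth_sphere_sections :: "(complex^'i) set \<Rightarrow> (real^'m \<Rightarrow> complex^'i) set" where
  "smooth_sphere_sections F = {\<phi>. smooth_on (- {0}) (hom_ext \<phi>) \<and> (\<forall>x\<in>sphere 0 1. \<phi> x \<in> F)}"

section \<open>Spinors and Dirac operators\<close>

definition pauli1 :: "complex^2^2" where
  "pauli1 = vector [vector [0, 1], vector [1, 0]]"

definition pauli2 :: "complex^2^2" where
  "pauli2 = vector [vector [0, - \<i>], vector [\<i>, 0]]"

definition pauli3 :: "complex^2^2" where
  "pauli3 = vector [vector [1, 0], vector [0, -1]]"

text \<open>\<open>\<complex>\<^sup>I \<otimes> \<complex>\<^sup>J\<close> is \<open>\<complex>\<^sup>I\<^sup>\<times>\<^sup>J\<close>; accordingly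
  \<open>L\<^sup>2(X, S) \<otimes> \<complex>\<^sup>2\<close> consists of functions with values in \<open>complex^('s \<times> 2)\<close>.\<close>

definition kron :: "complex^'i^'i \<Rightarrow> complex^'j^'j \<Rightarrow> complex^('i \<times> 'j)^('i \<times> 'j)" where
  "kron A B = (\<chi> p q. A $ fst p $ fst q * B $ snd p $ snd q)"

definition hermitian :: "complex^'i^'i \<Rightarrow> bool" where
  "hermitian A \<longleftrightarrow> (\<forall>i j. A $ i $ j = cnj (A $ j $ i))"

definition clifford_mult :: "(real^'m \<Rightarrow> complex^'s^'s) \<Rightarrow> bool" where
  "clifford_mult c \<longleftrightarrow> linear c \<and>
     (\<forall>v. c v ** c v = mat (of_real ((norm v)\<^sup>2)) \<and> hermitian (c v))"

definition grading :: "(real^'m \<Rightarrow> complex^'s^'s) \<Rightarrow> complex^'s^'s \<Rightarrow> bool" where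
  "grading c \<Gamma> \<longleftrightarrow> hermitian \<Gamma> \<and> \<Gamma> ** \<Gamma> = mat 1 \<and> (\<forall>v. \<Gamma> ** c v = - (c v ** \<Gamma>))"

text \<open>The differential expression \<open>i \<Sum>\<^sub>j c(e\<^sub>j) \<partial>\<^sub>j\<close>.\<close>

definition dirac :: "(real^'m \<Rightarrow> complex^'s^'s) \<Rightarrow> (real^'m \<Rightarrow> complex^'s) \<Rightarrow> real^'m \<Rightarrow> complex^'s" where
  "dirac c \<psi> x =
     \<i> *s (\<Sum>j\<in>UNIV. c (axis j 1) *v frechet_derivative \<psi> (at x) (axis j 1))"

text \<open>At \<open>x\<close> in the unit sphere, \<open>c(\<partial>\<^sub>r) = c(x)\<close>.\<close>

definition sphere_cliff :: "(real^'m \<Rightarrow> complex^'s^'s) \<Rightarrow> real^'m \<Rightarrow> real^'m \<Rightarrow> complex^'s \<Rightarrow> complex^'s" where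
  "sphere_cliff c x v w = \<i> *s (c v *v (c x *v w))"

text \<open>The spin connection of the sphere: by the Gauss formula it differs from the flat connection
  by \<open>- 1/2 c(v) c(\<partial>\<^sub>r)\<close>.\<close>

definition spin_connection ::
    "(real^'m \<Rightarrow> complex^'s^'s) \<Rightarrow> real^'m \<Rightarrow> (real^'m \<Rightarrow> complex^'s) \<Rightarrow> real^'m \<Rightarrow> complex^'s" where
  "spin_connection c v \<phi> x =
     frechet_derivative (hom_ext \<phi>) (at x) v - (1/2) *s (c v *v (c x *v \<phi> x))"

definition tangential :: "real^'m \<Rightarrow> real^'m \<Rightarrow> real^'m" where
  "tangential x v = v - (x \<bullet> v) *\<^sub>R x"

text \<open>The expression \<open>i \<Sum> \<rho>(t\<^sub>j) \<nabla>\<^bsub>t\<^sub>j\<^esub>\<close> over an orthonormal basis \<open>t\<^sub>j\<close> of the tangent space;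
  the tangential parts of the vectors \<open>e\<^sub>j\<close> give the same sum.\<close>

definition dirac_sphere ::
    "(real^'m \<Rightarrow> complex^'s^'s) \<Rightarrow> (real^'m \<Rightarrow> complex^'s) \<Rightarrow> real^'m \<Rightarrow> complex^'s" where
  "dirac_sphere c \<phi> x =
     \<i> *s (\<Sum>j\<in>UNIV. let t = tangential x (axis j 1) in
              sphere_cliff c x t (spin_connection c t \<phi> x))"

lemma mv_scaleR: "A *v (r *\<^sub>R w) = r *\<^sub>R (A *v (w::complex^'s))" for A :: "complex^'s^'s"
  by (simp add: vec_eq_iff matrix_vector_mult_def scaleR_sum_right)

lemma mv_scale: "A *v (a *s w) = a *s (A *v (w::complex^'s))" for A :: "complex^'s^'s"
  by (simp add: vec_eq_iff matrix_vector_mult_def sum_distrib_left mult_ac)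

lemma scaleR_mv: "(r *\<^sub>R A) *v w = r *\<^sub>R (A *v (w::complex^'s))" for A :: "complex^'s^'s"
  by (simp add: vec_eq_iff matrix_vector_mult_def scaleR_sum_right)

lemma scaleR_as_scale: "r *\<^sub>R w = complex_of_real r *s w" for w :: "complex^'s"
  by (simp add: vec_eq_iff scaleR_conv_of_real[where 'a=complex])

lemma sum_mv: "(\<Sum>j\<in>J. A j) *v w = (\<Sum>j\<in>J. A j *v (w::complex^'s))" for A :: "'j \<Rightarrow> complex^'s^'s"
  by (induction J rule: infinite_finite_induct) (simp_all add: matrix_vector_mult_add_rdistrib)

lemma hom_ext_deriv:
  fixes \<phi> :: "real^'m \<Rightarrow> 'b::real_normed_vector"
  assumes "\<phi> differentiable (at x)" "norm x = 1" "x \<bullet> v = 0"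
  shows "frechet_derivative (hom_ext \<phi>) (at x) v = frechet_derivative \<phi> (at x) v"
proof -
  have x0: "x \<noteq> 0" using assms by auto
  have N0: "(norm has_derivative (\<lambda>h. h \<bullet> x)) (at x)"
    using has_derivative_norm[OF x0] assms(2) unfolding sgn_div_norm by simp
  have I: "((\<lambda>z. inverse (norm z)) has_derivative (\<lambda>h. - (h \<bullet> x))) (at x)"
    using Deriv.has_derivative_inverse[OF _ N0] x0 assms(2) by simp
  have N: "((\<lambda>z. z /\<^sub>R norm z) has_derivative (\<lambda>h. h - (x \<bullet> h) *\<^sub>R x)) (at x)"
    using has_derivative_scaleR[OF I has_derivative_ident] assms(2)
    by (simp add: inner_commute)
  have "(\<phi> has_derivative frechet_derivative \<phi> (at x)) (at (x /\<^sub>R norm x))"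
    using assms frechet_derivative_works by auto
  from diff_chain_at[OF N this]
  have "(hom_ext \<phi> has_derivative (\<lambda>h. frechet_derivative \<phi> (at x) (h - (x \<bullet> h) *\<^sub>R x))) (at x)"
    by (simp add: o_def hom_ext_def)
  from frechet_derivative_at[OF this, symmetric] show ?thesis using assms(3) by simp
qed

text \<open>The Dirac operator of the ambient space in spherical coordinates:
  \<open>D = (i/r) \<gamma>\<^sub>r D\<^bsub>S\<^sup>n\<^esub> + i n/(2r) \<gamma>\<^sub>r + i \<gamma>\<^sub>r \<partial>\<^sub>r\<close>.\<close>

lemma dirac_polar:
  fixes c :: "real^'m \<Rightarrow> complex^'s^'s"
  assumes c: "clifford_mult c" and x: "norm x = 1" and r: "r > 0"
    and d: "\<psi> differentiable (at (r *\<^sub>R x))"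
  shows "dirac c \<psi> (r *\<^sub>R x) =
     (\<i> / of_real r) *s (c x *v dirac_sphere c (\<lambda>z. \<psi> (r *\<^sub>R z)) x)
     + (\<i> * of_nat (CARD('m) - 1) / (2 * of_real r)) *s (c x *v \<psi> (r *\<^sub>R x))
     + \<i> *s (c x *v frechet_derivative \<psi> (at (r *\<^sub>R x)) x)"
proof -
  define L where "L = frechet_derivative \<psi> (at (r *\<^sub>R x))"
  define w where "w = \<psi> (r *\<^sub>R x)"
  define t where "t j = tangential x (axis j 1)" for j
  have lc: "linear c" using c by (simp add: clifford_mult_def)
  have hL: "(\<psi> has_derivative L) (at (r *\<^sub>R x))"
    using d frechet_derivative_works L_def by auto
  have lL: "linear L" using hL by (simp add: has_derivative_linear)
  have sq: "c v *v (c v *v u) = (norm v)\<^sup>2 *\<^sub>R u" for v u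
  proof -
    have "c v *v (c v *v u) = mat (of_real ((norm v)\<^sup>2)) *v u"
      using c by (simp add: clifford_mult_def matrix_vector_mul_assoc)
    also have "\<dots> = (norm v)\<^sup>2 *\<^sub>R u"
      by (simp add: vec_eq_iff matrix_vector_mult_def mat_def if_distrib[of "\<lambda>a. a * _"] scaleR_conv_of_real[where 'a=complex] cong: if_cong)
    finally show ?thesis .
  qed
  have anti: "c v *v (c u *v z) + c u *v (c v *v z) = (2 * (v \<bullet> u)) *\<^sub>R z" for v u z
  proof -
    have "c (v + u) *v (c (v + u) *v z) = (norm (v + u))\<^sup>2 *\<^sub>R z" by (rule sq)
    moreover have "c (v + u) = c v + c u" using lc by (simp add: linear_add)
    moreover have "(norm (v + u))\<^sup>2 = (norm v)\<^sup>2 + (norm u)\<^sup>2 + 2 * (v \<bullet> u)"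
      by (simp add: power2_norm_eq_inner inner_add inner_commute)
    ultimately show ?thesis using sq[of v z] sq[of u z]
      by (simp add: matrix_vector_mult_add_rdistrib matrix_vector_right_distrib scaleR_add_left algebra_simps)
  qed
  have tx: "x \<bullet> t j = 0" for j
    using x by (simp add: t_def tangential_def inner_diff_right power2_norm_eq_inner[symmetric] dot_square_norm)
  have nt: "(norm (t j))\<^sup>2 = 1 - (x $ j)\<^sup>2" for j
  proof -
    have "(norm (t j))\<^sup>2 = t j \<bullet> t j" by (simp add: power2_norm_eq_inner)
    also have "\<dots> = t j \<bullet> axis j 1"
      using tx[of j] by (simp add: t_def tangential_def inner_diff_right inner_commute)
    also have "\<dots> = 1 - (x $ j)\<^sup>2"
      by (simp add: t_def tangential_def inner_diff_left inner_axis inner_axis_axis power2_eq_square)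
    finally show ?thesis .
  qed
  have sx: "(\<Sum>j\<in>UNIV. (x $ j)\<^sup>2) = 1"
    using x by (simp add: norm_eq_1 inner_vec_def power2_eq_square)
  have snt: "(\<Sum>j\<in>UNIV. (norm (t j))\<^sup>2) = real (CARD('m) - 1)"
    by (simp add: nt sum_subtractf sx of_nat_diff)
  have fr: "frechet_derivative (hom_ext (\<lambda>z. \<psi> (r *\<^sub>R z))) (at x) (t j) = r *\<^sub>R L (t j)" for j
  proof -
    have R: "((\<lambda>z. r *\<^sub>R z) has_derivative (\<lambda>h. r *\<^sub>R h)) (at x)"
      by (auto intro!: derivative_eq_intros)
    have h: "((\<lambda>z. \<psi> (r *\<^sub>R z)) has_derivative (\<lambda>h. L (r *\<^sub>R h))) (at x)"
      using diff_chain_at[OF R hL] by (simp add: o_def)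
    then have "(\<lambda>z. \<psi> (r *\<^sub>R z)) differentiable (at x)" using differentiable_def by blast
    from hom_ext_deriv[OF this x tx] frechet_derivative_at[OF h]
    show ?thesis by (metis lL linear_scale)
  qed
  have ii: "\<i> *s (\<i> *s u) = - u" for u :: "complex^'s"
    by (simp add: vec_eq_iff mult.assoc[symmetric])
  have summand: "c x *v (\<i> *s sphere_cliff c x (t j) (spin_connection c (t j) (\<lambda>z. \<psi> (r *\<^sub>R z)) x))
      = r *\<^sub>R (c (t j) *v L (t j)) - ((norm (t j))\<^sup>2 / 2) *\<^sub>R (c x *v w)" for j
  proof -
    define u where "u = r *\<^sub>R L (t j) - (1/2) *\<^sub>R (c (t j) *v (c x *v w))"
    have u: "spin_connection c (t j) (\<lambda>z. \<psi> (r *\<^sub>R z)) x = u"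
      by (simp add: spin_connection_def fr u_def w_def scaleR_as_scale)
    have "c x *v (\<i> *s sphere_cliff c x (t j) u) = - (c x *v (c (t j) *v (c x *v u)))"
      unfolding sphere_cliff_def mv_scale by (rule ii)
    also have "c x *v (c (t j) *v (c x *v u)) = - (c (t j) *v (c x *v (c x *v u)))"
      using anti[of x "t j" "c x *v u"] tx[of j] by (simp add: eq_neg_iff_add_eq_0)
    also have "c x *v (c x *v u) = u" using sq[of x u] x by simp
    finally have "c x *v (\<i> *s sphere_cliff c x (t j) u) = c (t j) *v u" by simp
    also have "\<dots> = r *\<^sub>R (c (t j) *v L (t j)) - ((norm (t j))\<^sup>2 / 2) *\<^sub>R (c x *v w)"
      by (simp add: u_def matrix_vector_mult_diff_distrib mv_scaleR sq del: scaleR_right_distrib)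
    finally show ?thesis by (simp add: u)
  qed
  have ds: "c x *v dirac_sphere c (\<lambda>z. \<psi> (r *\<^sub>R z)) x
      = r *\<^sub>R (\<Sum>j\<in>UNIV. c (t j) *v L (t j)) - (real (CARD('m) - 1) / 2) *\<^sub>R (c x *v w)"
  proof -
    have lin: "linear ((*v) (c x))" by simp
    have "dirac_sphere c (\<lambda>z. \<psi> (r *\<^sub>R z)) x =
      (\<Sum>j\<in>UNIV. \<i> *s sphere_cliff c x (t j) (spin_connection c (t j) (\<lambda>z. \<psi> (r *\<^sub>R z)) x))"
      by (simp add: dirac_sphere_def t_def Let_def vec_eq_iff sum_distrib_left)
    then have "c x *v dirac_sphere c (\<lambda>z. \<psi> (r *\<^sub>R z)) x =
      (\<Sum>j\<in>UNIV. c x *v (\<i> *s sphere_cliff c x (t j) (spin_connection c (t j) (\<lambda>z. \<psi> (r *\<^sub>R z)) x)))"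
      by (simp add: linear_sum[OF lin])
    also have "\<dots> = r *\<^sub>R (\<Sum>j\<in>UNIV. c (t j) *v L (t j)) - ((\<Sum>j\<in>UNIV. (norm (t j))\<^sup>2) / 2) *\<^sub>R (c x *v w)"
      unfolding summand by (simp add: sum_subtractf scaleR_sum_right scaleR_sum_left sum_divide_distrib)
    finally show ?thesis by (simp add: snt)
  qed
  have tang: "(\<Sum>j\<in>UNIV. c (t j) *v L (t j)) = (\<Sum>j\<in>UNIV. c (axis j 1) *v L (axis j 1)) - c x *v L x"
  proof -
    have tj: "t j = axis j 1 - (x $ j) *\<^sub>R x" for j
      by (simp add: t_def tangential_def inner_axis)
    have xs: "x = (\<Sum>j\<in>UNIV. (x $ j) *\<^sub>R axis j 1)"
      by (simp add: vec_eq_iff axis_def if_distrib cong: if_cong)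
    have Lx: "L x = (\<Sum>j\<in>UNIV. (x $ j) *\<^sub>R L (axis j 1))"
      by (subst (1) xs) (simp add: linear_sum[OF lL] linear_scale[OF lL])
    have cx: "c x *v u = (\<Sum>j\<in>UNIV. (x $ j) *\<^sub>R (c (axis j 1) *v u))" for u
    proof -
      have "c x = (\<Sum>j\<in>UNIV. (x $ j) *\<^sub>R c (axis j 1))"
        by (subst (1) xs) (simp add: linear_sum[OF lc] linear_scale[OF lc])
      then show ?thesis by (simp only: sum_mv scaleR_mv)
    qed
    have "c (t j) *v L (t j) = c (axis j 1) *v L (axis j 1) - (x $ j) *\<^sub>R (c (axis j 1) *v L x)
        - (x $ j) *\<^sub>R (c x *v L (axis j 1)) + (x $ j)\<^sup>2 *\<^sub>R (c x *v L x)" for j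
      by (simp add: tj linear_diff[OF lc] linear_scale[OF lc] linear_diff[OF lL] linear_scale[OF lL]
          matrix_vector_mult_diff_rdistrib matrix_vector_mult_diff_distrib mv_scaleR scaleR_mv power2_eq_square scaleR_diff_right)
    then have "(\<Sum>j\<in>UNIV. c (t j) *v L (t j)) = (\<Sum>j\<in>UNIV. c (axis j 1) *v L (axis j 1))
        - c x *v L x - c x *v (\<Sum>j\<in>UNIV. (x $ j) *\<^sub>R L (axis j 1)) + (\<Sum>j\<in>UNIV. (x $ j)\<^sup>2) *\<^sub>R (c x *v L x)"
      by (simp add: sum.distrib sum_subtractf cx[of "L x"] scaleR_sum_left linear_sum mv_scaleR)
    then show ?thesis by (simp add: sx Lx[symmetric])
  qed
  have "dirac c \<psi> (r *\<^sub>R x) = \<i> *s (\<Sum>j\<in>UNIV. c (axis j 1) *v L (axis j 1))"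
    by (simp add: dirac_def L_def)
  also have "(\<Sum>j\<in>UNIV. c (axis j 1) *v L (axis j 1)) = (\<Sum>j\<in>UNIV. c (t j) *v L (t j)) + c x *v L x"
    by (simp add: tang)
  finally have A: "dirac c \<psi> (r *\<^sub>R x) = \<i> *s (\<Sum>j\<in>UNIV. c (t j) *v L (t j)) + \<i> *s (c x *v L x)"
    by (simp add: vec.scale_right_distrib)
  have B: "(\<Sum>j\<in>UNIV. c (t j) *v L (t j)) =
     (1 / r) *\<^sub>R (c x *v dirac_sphere c (\<lambda>z. \<psi> (r *\<^sub>R z)) x) + (real (CARD('m) - 1) / (2 * r)) *\<^sub>R (c x *v w)"
    unfolding ds using r by (simp add: scaleR_diff_right)
  show ?thesis unfolding A B L_def[symmetric] w_def[symmetric]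
    using r by (simp add: vec_eq_iff scaleR_as_scale field_simps del: of_nat_diff)
qed

text \<open>\<open>D \<otimes> A\<close> on \<open>L\<^sup>2(X, S) \<otimes> \<complex>\<^sup>2\<close>.\<close>

definition op_tensor :: "(('x \<Rightarrow> complex^'s) \<Rightarrow> 'x \<Rightarrow> complex^'s) \<Rightarrow> complex^2^2
    \<Rightarrow> ('x \<Rightarrow> complex^('s::finite \<times> 2)) \<Rightarrow> 'x \<Rightarrow> complex^('s::finite \<times> 2)" where
  "op_tensor D A \<Psi> x =
     (\<chi> p. \<Sum>b\<in>UNIV. A $ snd p $ b * D (\<lambda>y. \<chi> s. \<Psi> y $ (s, b)) x $ fst p)"

definition op_on_Rm ::
    "((real^'m \<Rightarrow> complex^'i) \<Rightarrow> real^'m \<Rightarrow> complex^'i)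
      \<Rightarrow> ((real^'m \<Rightarrow> complex^'i) \<times> (real^'m \<Rightarrow> complex^'i)) set" where
  "op_on_Rm D = op_closure (L2 lborel UNIV) {(\<psi>, D \<psi>) | \<psi>. \<psi> \<in> Cc_inf UNIV}"

definition op_on_sphere :: "(complex^'i) set \<Rightarrow>
    ((real^'m \<Rightarrow> complex^'i) \<Rightarrow> real^'m \<Rightarrow> complex^'i)
      \<Rightarrow> ((real^'m \<Rightarrow> complex^'i) \<times> (real^'m \<Rightarrow> complex^'i)) set" where
  "op_on_sphere F D =
     op_closure (L2 sphere_measure F) {(\<phi>, D \<phi>) | \<phi>. \<phi> \<in> smooth_sphere_sections F}"

section \<open>The immersion module\<close>

text \<open>\<open>n = m - 1\<close> for the unit sphere of \<open>\<real>\<^sup>m\<close>.\<close>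

abbreviation sdim :: "'m::finite itself \<Rightarrow> nat" where
  "sdim _ \<equiv> CARD('m) - 1"

definition collar :: "real \<Rightarrow> ((real^'m) \<times> real) set" where
  "collar \<epsilon> = sphere 0 1 \<times> {-\<epsilon><..<\<epsilon>}"

definition immersion :: "(real^'m) \<times> real \<Rightarrow> real^'m" where
  "immersion p = (1 + snd p) *\<^sub>R fst p"

definition immersion_inv :: "real \<Rightarrow> real^'m \<Rightarrow> (real^'m) \<times> real" where
  "immersion_inv \<epsilon> = inv_into (collar \<epsilon>) immersion"

definition pot :: "real \<Rightarrow> real \<Rightarrow> real" where
  "pot \<epsilon> s = (let \<alpha> = pi / (2 * \<epsilon>) in \<alpha> * tan (\<alpha> * s))"

text \<open>\<open>E \<otimes> \<complex>\<^sup>2 = C\<^sub>0(S\<^sup>n \<times> (-\<epsilon>, \<epsilon>), \<complex>\<^sup>2)\<close>, first as a Hilbert module over \<open>C\<^sub>0(\<real>\<^sup>m)\<close>.\<close>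

type_synonym 'm mod2 = "(real^'m) \<times> real \<Rightarrow> complex^2"

definition Emod :: "real \<Rightarrow> ('m::finite) mod2 set" where
  "Emod \<epsilon> = C0 (collar \<epsilon>)"

definition inn_odd :: "real \<Rightarrow> ('m::finite) mod2 \<Rightarrow> 'm mod2 \<Rightarrow> real^'m \<Rightarrow> complex" where
  "inn_odd \<epsilon> \<xi> \<eta> y =
     (if y \<in> immersion ` collar \<epsilon>
      then cip (\<xi> (immersion_inv \<epsilon> y)) (\<eta> (immersion_inv \<epsilon> y)) / of_real (norm y ^ sdim TYPE('m))
      else 0)"

text \<open>The Clifford algebra \<open>Cl\<^sub>1\<close>: the vector \<open>(a\<^sub>1, a\<^sub>2)\<close> stands for \<open>a\<^sub>1 + a\<^sub>2 e\<close> with \<open>e\<^sup>2 = 1\<close>,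
  \<open>e\<^sup>* = e\<close>.  Multiplication by \<open>e\<close> is the matrix \<open>pauli1\<close>.  As a right Hilbert module over itself,
  \<open>Cl\<^sub>1\<close> has the inner product \<open>a\<^sup>* b\<close>.\<close>

definition cl1_mult :: "complex^2 \<Rightarrow> complex^2 \<Rightarrow> complex^2" where
  "cl1_mult a b = vector [a$1 * b$1 + a$2 * b$2, a$1 * b$2 + a$2 * b$1]"

definition cl1_star :: "complex^2 \<Rightarrow> complex^2" where
  "cl1_star a = vector [cnj (a$1), cnj (a$2)]"

definition cl1_matrix :: "complex^2 \<Rightarrow> complex^2^2" where
  "cl1_matrix a = mat (a$1) + mat (a$2) ** pauli1"

definition inn_even :: "real \<Rightarrow> ('m::finite) mod2 \<Rightarrow> 'm mod2 \<Rightarrow> real^'m \<Rightarrow> complex^2" where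
  "inn_even \<epsilon> \<xi> \<eta> y =
     (if y \<in> immersion ` collar \<epsilon>
      then (1 / of_real (norm y ^ sdim TYPE('m))) *s
             cl1_mult (cl1_star (\<xi> (immersion_inv \<epsilon> y))) (\<eta> (immersion_inv \<epsilon> y))
      else 0)"

text \<open>The operators \<open>S \<otimes> A\<close>.\<close>

definition dom_S :: "real \<Rightarrow> ('m::finite) mod2 set" where
  "dom_S \<epsilon> = {\<xi> \<in> Emod \<epsilon>. (\<lambda>p. of_real (pot \<epsilon> (snd p)) *s \<xi> p) \<in> Emod \<epsilon>}"

definition op_S :: "real \<Rightarrow> complex^2^2 \<Rightarrow> ('m::finite) mod2 \<Rightarrow> 'm mod2" where
  "op_S \<epsilon> A \<xi> = (\<lambda>p. of_real (pot \<epsilon> (snd p)) *s (A *v \<xi> p))"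

section \<open>The connection and the product operator\<close>

definition s_deriv :: "('m::finite) mod2 \<Rightarrow> 'm mod2" where
  "s_deriv \<xi> = (\<lambda>(x, s). vector_derivative (\<lambda>t. \<xi> (x, t)) (at s))"

text \<open>The partial derivatives along the sphere, with respect to the angular coordinates
  \<open>y\<^sub>j / norm y\<close>.\<close>

definition ang_deriv :: "'m \<Rightarrow> ('m::finite) mod2 \<Rightarrow> 'm mod2" where
  "ang_deriv j \<xi> = (\<lambda>(x, s). frechet_derivative (hom_ext (\<lambda>z. \<xi> (z, s))) (at x) (axis j 1))"

definition C10 :: "real \<Rightarrow> ('m::finite) mod2 set" where
  "C10 \<epsilon> = {\<xi> \<in> C0 (collar \<epsilon>).
     (\<forall>p\<in>collar \<epsilon>. (\<lambda>(z, t). \<xi> (z /\<^sub>R norm z, t)) differentiable at p) \<and>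
     s_deriv \<xi> \<in> C0 (collar \<epsilon>) \<and> (\<forall>j. ang_deriv j \<xi> \<in> C0 (collar \<epsilon>))}"

text \<open>For a first-order differential expression \<open>D\<close> the commutator \<open>[D, g]\<close> is a bundle
  endomorphism; its value on the spinor \<open>\<psi> y\<close> at \<open>y\<close> is computed on the constant extension of this
  spinor, so that \<open>\<psi>\<close> need not be differentiable.\<close>

definition commutator :: "((real^'m \<Rightarrow> complex^'i) \<Rightarrow> real^'m \<Rightarrow> complex^'i)
    \<Rightarrow> (real^'m \<Rightarrow> complex) \<Rightarrow> (real^'m \<Rightarrow> complex^'i) \<Rightarrow> real^'m \<Rightarrow> complex^'i" where
  "commutator D g \<psi> y = D (\<lambda>z. g z *s \<psi> y) y - g y *s D (\<lambda>z. \<psi> y) y"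

text \<open>The coordinates are used on the image of the immersion only.\<close>

definition one_form :: "((real^'m \<Rightarrow> complex^'i) \<Rightarrow> real^'m \<Rightarrow> complex^'i) \<Rightarrow> real
    \<Rightarrow> (real^'m \<Rightarrow> real) \<Rightarrow> (real^'m \<Rightarrow> complex^'i) \<Rightarrow> real^'m \<Rightarrow> complex^'i" where
  "one_form D \<epsilon> g \<psi> =
     (\<lambda>y. if y \<in> immersion ` collar \<epsilon> then commutator D (\<lambda>z. of_real (g z)) \<psi> y else 0)"

text \<open>The sum of tensors \<open>\<nabla>(\<xi>) \<cdot> \<psi>\<close>.  The angular part
  \<open>\<Sum>\<^sub>i \<partial>\<xi>/\<partial>\<theta>\<^sup>i \<otimes> [D, \<theta>\<^sup>i]\<close> does not depend on the local coordinates \<open>\<theta>\<close> of the sphere.  It is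
  written here in the globally defined, redundant coordinates \<open>y\<^sub>j / norm y\<close>; lemma
  \<open>angular_part_coordinate_independent\<close> below is the change of coordinates.\<close>

definition connection :: "((real^'m \<Rightarrow> complex^'i) \<Rightarrow> real^'m \<Rightarrow> complex^'i) \<Rightarrow> real
    \<Rightarrow> 'm mod2 \<Rightarrow> (real^'m \<Rightarrow> complex^'i) \<Rightarrow> ('m mod2 \<times> (real^'m \<Rightarrow> complex^'i)) multiset" where
  "connection D \<epsilon> \<xi> \<psi> =
     {#(\<lambda>p. s_deriv \<xi> p - of_real (real (sdim TYPE('m)) / (2 * (snd p + 1))) *s \<xi> p,
        one_form D \<epsilon> norm \<psi>)#}
     + image_mset (\<lambda>j. (ang_deriv j \<xi>, one_form D \<epsilon> (\<lambda>y. y $ j / norm y) \<psi>)) (mset_set UNIV)"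

lemma hom_ext_deriv_at:
  fixes \<phi> :: "real^'m \<Rightarrow> 'b::real_normed_vector"
  assumes y: "y \<noteq> 0" and d: "hom_ext \<phi> differentiable (at (y /\<^sub>R norm y))"
  shows "(hom_ext \<phi> has_derivative (\<lambda>h. \<Sum>j\<in>UNIV.
    frechet_derivative (\<lambda>z. z $ j / norm z) (at y) h *\<^sub>R
    frechet_derivative (hom_ext \<phi>) (at (y /\<^sub>R norm y)) (axis j 1))) (at y)"
proof -
  define F where "F = frechet_derivative (hom_ext \<phi>) (at (y /\<^sub>R norm y))"
  define P where "P = frechet_derivative (\<lambda>z::real^'m. z /\<^sub>R norm z) (at y)"
  have "(\<lambda>z::real^'m. z /\<^sub>R norm z) differentiable (at y)"
    using y by (auto intro!: derivative_intros differentiable_inverse differentiable_scaleR simp: differentiable_norm_at)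
  then have P: "((\<lambda>z. z /\<^sub>R norm z) has_derivative P) (at y)" using frechet_derivative_works P_def by auto
  have F: "(hom_ext \<phi> has_derivative F) (at (y /\<^sub>R norm y))" using d frechet_derivative_works F_def by auto
  have lF: "linear F" using F by (simp add: has_derivative_linear)
  have "hom_ext \<phi> \<circ> (\<lambda>z. z /\<^sub>R norm z) = hom_ext \<phi>"
  proof
    fix z :: "real^'m"
    show "(hom_ext \<phi> \<circ> (\<lambda>z. z /\<^sub>R norm z)) z = hom_ext \<phi> z"
      by (cases "z = 0") (auto simp: hom_ext_def)
  qed
  with diff_chain_at[OF P F] have 1: "(hom_ext \<phi> has_derivative (F \<circ> P)) (at y)" by simp
  have 2: "frechet_derivative (\<lambda>z. z $ j / norm z) (at y) h = P h $ j" for j h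
  proof -
    have "((\<lambda>z. (z /\<^sub>R norm z) $ j) has_derivative (\<lambda>h. P h $ j)) (at y)"
      using bounded_linear.has_derivative[OF bounded_linear_vec_nth P] .
    then have "((\<lambda>z. z $ j / norm z) has_derivative (\<lambda>h. P h $ j)) (at y)"
      by (simp add: divide_inverse mult.commute)
    from frechet_derivative_at[OF this] show ?thesis by metis
  qed
  have 3: "F (P h) = (\<Sum>j\<in>UNIV. (P h $ j) *\<^sub>R F (axis j 1))" for h
  proof -
    have "P h = (\<Sum>j\<in>UNIV. (P h $ j) *\<^sub>R axis j 1)"
      by (simp add: vec_eq_iff axis_def if_distrib cong: if_cong)
    then show ?thesis by (metis (no_types, lifting) lF linear_sum linear_scale sum.cong)
  qed
  show ?thesis using 1 by (simp only: o_def 3 2 F_def[symmetric])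
qed

lemma commutator_dirac:
  fixes c :: "real^'m \<Rightarrow> complex^'s^'s"
  assumes "g differentiable (at y)"
  shows "commutator (dirac c) (\<lambda>z. of_real (g z)) \<psi> y =
    \<i> *s (\<Sum>l\<in>UNIV. of_real (frechet_derivative g (at y) (axis l 1)) *s (c (axis l 1) *v \<psi> y))"
proof -
  define g' where "g' = frechet_derivative g (at y)"
  have g: "(g has_derivative g') (at y)" using assms frechet_derivative_works g'_def by auto
  have "((\<lambda>z. complex_of_real (g z) *s \<psi> y) has_derivative (\<lambda>h. complex_of_real (g' h) *s \<psi> y)) (at y)"
    unfolding scaleR_as_scale[symmetric] using g by (auto intro!: derivative_eq_intros)
  from frechet_derivative_at[OF this, symmetric] 
  show ?thesis by (simp add: commutator_def dirac_def mv_scale g'_def[symmetric])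
qed

text \<open>\<open>\<theta>\<close> are local coordinates in which \<open>\<xi>(\<cdot>, s)\<close> is the function \<open>G\<close>; \<open>a\<close> is a component of the
  \<open>\<complex>\<^sup>2\<close>-valued function \<open>\<xi>\<close>.\<close>

lemma angular_part_coordinate_independent:
  fixes c :: "real^'m \<Rightarrow> complex^'s^'s" and \<xi> :: "'m mod2" and \<theta> :: "real^'m \<Rightarrow> real^'n"
    and G :: "real^'n \<Rightarrow> complex^2"
  assumes y: "y \<noteq> 0"
    and xi: "hom_ext (\<lambda>z. \<xi> (z, s)) differentiable (at (y /\<^sub>R norm y))"
    and \<theta>: "\<theta> differentiable (at y)" and G: "G differentiable (at (\<theta> y))"
    and V: "open V" "y \<in> V" "\<And>z. z \<in> V \<Longrightarrow> hom_ext (\<lambda>z. \<xi> (z, s)) z = G (\<theta> z)"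
  shows "(\<Sum>i\<in>UNIV. frechet_derivative G (at (\<theta> y)) (axis i 1) $ a *s
            commutator (dirac c) (\<lambda>z. of_real (\<theta> z $ i)) \<psi> y) =
         (\<Sum>j\<in>UNIV. ang_deriv j \<xi> (y /\<^sub>R norm y, s) $ a *s
            commutator (dirac c) (\<lambda>z. of_real (z $ j / norm z)) \<psi> y)"
proof -
  define H where "H = frechet_derivative G (at (\<theta> y))"
  define T where "T = frechet_derivative \<theta> (at y)"
  define F where "F = (\<lambda>h. \<Sum>j\<in>UNIV. frechet_derivative (\<lambda>z. z $ j / norm z) (at y) h *\<^sub>R
    ang_deriv j \<xi> (y /\<^sub>R norm y, s))"
  have G': "(G has_derivative H) (at (\<theta> y))" using G frechet_derivative_works H_def by auto
  have T': "(\<theta> has_derivative T) (at y)" using \<theta> frechet_derivative_works T_def by auto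
  have lH: "linear H" using G' by (simp add: has_derivative_linear)
  have "((\<lambda>z. G (\<theta> z)) has_derivative (\<lambda>h. H (T h))) (at y)"
    using diff_chain_at[OF T' G'] by (simp add: o_def)
  then have 1: "(hom_ext (\<lambda>z. \<xi> (z, s)) has_derivative (\<lambda>h. H (T h))) (at y)"
    by (rule has_derivative_transform_within_open[OF _ V(1,2)]) (simp add: V(3))
  have 2: "(hom_ext (\<lambda>z. \<xi> (z, s)) has_derivative F) (at y)"
    using hom_ext_deriv_at[OF y xi] by (simp add: F_def ang_deriv_def)
  have HT: "H (T h) = F h" for h
    using has_derivative_unique[OF 1 2] by metis
  have Hs: "H v = (\<Sum>i\<in>UNIV. (v $ i) *\<^sub>R H (axis i 1))" for v
  proof -
    have "v = (\<Sum>j\<in>UNIV. (v $ j) *\<^sub>R axis j 1)"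
      by (simp add: vec_eq_iff axis_def if_distrib cong: if_cong)
    then show ?thesis by (metis (no_types, lifting) lH linear_sum linear_scale sum.cong)
  qed
  have dT: "(\<lambda>z. \<theta> z $ i) differentiable (at y)"
    "frechet_derivative (\<lambda>z. \<theta> z $ i) (at y) h = T h $ i" for i h
  proof -
    have *: "((\<lambda>z. \<theta> z $ i) has_derivative (\<lambda>h. T h $ i)) (at y)"
      using bounded_linear.has_derivative[OF bounded_linear_vec_nth T'] .
    then show "(\<lambda>z. \<theta> z $ i) differentiable (at y)" using differentiable_def by blast
    show "frechet_derivative (\<lambda>z. \<theta> z $ i) (at y) h = T h $ i"
      using frechet_derivative_at[OF *] by metis
  qed
  have dN: "(\<lambda>z::real^'m. z $ j / norm z) differentiable (at y)" for j
  proof (rule differentiable_divide)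
    show "(\<lambda>z::real^'m. z $ j) differentiable (at y)"
      by (rule bounded_linear_imp_differentiable[OF bounded_linear_vec_nth])
  qed (use y in \<open>auto simp: differentiable_norm_at\<close>)
  have swap: "(\<Sum>i\<in>UNIV. (w i :: complex) *s (\<i> *s (\<Sum>l\<in>UNIV. of_real (D i l) *s u l)))
     = \<i> *s (\<Sum>l\<in>UNIV. (\<Sum>i\<in>UNIV. of_real (D i l) * w i) *s (u l :: complex^'s))"
    for w :: "'q::finite \<Rightarrow> complex" and D and u :: "'m \<Rightarrow> complex^'s"
    unfolding vec_eq_iff
    by (simp add: sum_distrib_left sum_distrib_right mult_ac)
       (intro allI sum.swap)
  have L: "(\<Sum>i\<in>UNIV. of_real (T h $ i) * H (axis i 1) $ a) = F h $ a" for h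
    unfolding HT[symmetric] Hs[of "T h"] by (simp add: scaleR_conv_of_real[where 'a=complex])
  have R: "(\<Sum>j\<in>UNIV. of_real (frechet_derivative (\<lambda>z. z $ j / norm z) (at y) h) * ang_deriv j \<xi> (y /\<^sub>R norm y, s) $ a) = F h $ a" for h
    by (simp add: F_def scaleR_conv_of_real[where 'a=complex])
  show ?thesis
    unfolding H_def[symmetric] commutator_dirac[OF dT(1)] commutator_dirac[OF dN] dT(2) swap L R ..
qed

text \<open>The operator \<open>S \<otimes> A \<otimes> 1 + \<gamma>\<^sup>3 \<otimes>\<^sub>\<nabla> D\<close>.\<close>

definition product_op :: "((real^'m \<Rightarrow> complex^'i) \<Rightarrow> real^'m \<Rightarrow> complex^'i) \<Rightarrow> complex^2^2 \<Rightarrow> real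
    \<Rightarrow> ((nat \<Rightarrow> ('m mod2 \<times> (real^'m \<Rightarrow> complex^'i)) multiset)
        \<times> (nat \<Rightarrow> ('m mod2 \<times> (real^'m \<Rightarrow> complex^'i)) multiset)) set" where
  "product_op D A \<epsilon> = span_op
     {({#(\<xi>, \<psi>)#},
       {#(op_S \<epsilon> A \<xi>, \<psi>)#} + {#(\<lambda>p. pauli3 *v \<xi> p, \<psi>')#}
         + connection D \<epsilon> (\<lambda>p. pauli3 *v \<xi> p) \<psi>)
      | \<xi> \<psi> \<psi>'. \<xi> \<in> dom_S \<epsilon> \<inter> C10 \<epsilon> \<and> (\<psi>, \<psi>') \<in> op_on_Rm D}"

section \<open>The index cycle\<close>

definition interval_L2 :: "real \<Rightarrow> (real \<Rightarrow> complex^2) hspace" where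
  "interval_L2 \<epsilon> = L2 (restrict_space lborel {-\<epsilon><..<\<epsilon>}) UNIV"

definition T0 :: "real \<Rightarrow> (real \<Rightarrow> complex^2) \<Rightarrow> real \<Rightarrow> complex^2" where
  "T0 \<epsilon> \<phi> s = \<i> *s (pauli1 *v vector_derivative \<phi> (at s)) + of_real (pot \<epsilon> s) *s (pauli2 *v \<phi> s)"

definition op_T :: "real \<Rightarrow> ((real \<Rightarrow> complex^2) \<times> (real \<Rightarrow> complex^2)) set" where
  "op_T \<epsilon> = op_closure (interval_L2 \<epsilon>) {(\<phi>, T0 \<epsilon> \<phi>) | \<phi>. \<phi> \<in> Cc_inf {-\<epsilon><..<\<epsilon>}}"

text \<open>The operator \<open>D \<otimes> 1/(1+s) + G \<otimes> T\<close> on the algebraic tensor product of the domains of \<open>D\<close>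
  and \<open>T\<close>.\<close>

definition sphere_index_op ::
    "('g \<times> 'g) set \<Rightarrow> ('g \<Rightarrow> 'g) \<Rightarrow> real
      \<Rightarrow> ((nat \<Rightarrow> ('g \<times> (real \<Rightarrow> complex^2)) multiset)
          \<times> (nat \<Rightarrow> ('g \<times> (real \<Rightarrow> complex^2)) multiset)) set" where
  "sphere_index_op D G \<epsilon> = span_op
     {({#(\<phi>, t)#}, {#(\<phi>', \<lambda>s. of_real (1 / (1 + s)) *s t s)#} + {#(G \<phi>, t')#})
      | \<phi> \<phi>' t t'. (\<phi>, \<phi>') \<in> D \<and> (t, t') \<in> op_T \<epsilon>}"

definition test_tensors :: "(complex^'i) set \<Rightarrow> real
    \<Rightarrow> (nat \<Rightarrow> ((real^'m \<Rightarrow> complex^'i) \<times> (real \<Rightarrow> complex^2)) multiset) set" where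
  "test_tensors F \<epsilon> =
     fin_tensor ` {M. set_mset M \<subseteq> smooth_sphere_sections F \<times> Cc_inf {-\<epsilon><..<\<epsilon>}}"

section \<open>The two parities\<close>

text \<open>Odd-dimensional sphere: \<open>D = D\<^bsub>\<real>\<^sup>2\<^sup>k\<^esub>\<close>.\<close>

definition source_odd ::
    "real \<Rightarrow> (nat \<Rightarrow> (('m::finite) mod2 \<times> (real^'m \<Rightarrow> complex^'s)) multiset) hspace" where
  "source_odd \<epsilon> =
     interior_tensor (Emod \<epsilon>) (inn_odd \<epsilon>) (\<lambda>b \<psi> y. b y *s \<psi> y) (L2 lborel UNIV)"

text \<open>The fibre \<open>S\<^sup>+ \<otimes> \<complex>\<^sup>2\<close>.  \<open>dirac_sphere c\<close> commutes with \<open>\<Gamma>\<close>; on sections of \<open>S\<^sup>+\<close> it is the operator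
  \<open>D\<^sup>+\<close>.\<close>

definition splus2 :: "complex^'s^'s \<Rightarrow> (complex^('s::finite \<times> 2)) set" where
  "splus2 \<Gamma> = {w. kron \<Gamma> (mat 1) *v w = w}"

definition target_odd :: "complex^'s^'s \<Rightarrow> real
    \<Rightarrow> (nat \<Rightarrow> ((real^'m \<Rightarrow> complex^('s::finite \<times> 2)) \<times> (real \<Rightarrow> complex^2)) multiset) hspace" where
  "target_odd \<Gamma> \<epsilon> = hilbert_tensor (L2 sphere_measure (splus2 \<Gamma>)) (interval_L2 \<epsilon>)"

definition Dx_odd :: "(real^'m \<Rightarrow> complex^'s^'s) \<Rightarrow> real
    \<Rightarrow> ((nat \<Rightarrow> ('m mod2 \<times> (real^'m \<Rightarrow> complex^'s)) multiset)
        \<times> (nat \<Rightarrow> ('m mod2 \<times> (real^'m \<Rightarrow> complex^'s)) multiset)) set" where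
  "Dx_odd c \<epsilon> = product_op (dirac c) pauli2 \<epsilon>"

definition rhs_odd :: "(real^'m \<Rightarrow> complex^'s^'s) \<Rightarrow> complex^'s^'s \<Rightarrow> real
    \<Rightarrow> ((nat \<Rightarrow> ((real^'m \<Rightarrow> complex^('s::finite \<times> 2)) \<times> (real \<Rightarrow> complex^2)) multiset)
        \<times> (nat \<Rightarrow> ((real^'m \<Rightarrow> complex^('s::finite \<times> 2)) \<times> (real \<Rightarrow> complex^2)) multiset)) set" where
  "rhs_odd c \<Gamma> \<epsilon> =
     sphere_index_op (op_on_sphere (splus2 \<Gamma>) (op_tensor (dirac_sphere c) pauli2))
       (\<lambda>\<phi> x. kron (mat 1) pauli3 *v \<phi> x) \<epsilon>"

text \<open>Even-dimensional sphere: \<open>D = D\<^bsub>\<real>\<^sup>2\<^sup>k\<^sup>+\<^sup>1\<^esub> \<otimes> \<gamma>\<^sup>2\<close>.\<close>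

definition source_even ::
    "real \<Rightarrow> (nat \<Rightarrow> (('m::finite) mod2 \<times> (real^'m \<Rightarrow> complex^('s::finite \<times> 2))) multiset) hspace" where
  "source_even \<epsilon> =
     interior_tensor (Emod \<epsilon>) (inn_even \<epsilon>) (\<lambda>b \<psi> y. kron (mat 1) (cl1_matrix (b y)) *v \<psi> y)
       (L2 lborel UNIV)"

definition target_even ::
    "real \<Rightarrow> (nat \<Rightarrow> ((real^'m \<Rightarrow> complex^'s) \<times> (real \<Rightarrow> complex^2)) multiset) hspace" where
  "target_even \<epsilon> = hilbert_tensor (L2 sphere_measure UNIV) (interval_L2 \<epsilon>)"

definition Dx_even :: "(real^'m \<Rightarrow> complex^'s^'s) \<Rightarrow> real
    \<Rightarrow> ((nat \<Rightarrow> ('m mod2 \<times> (real^'m \<Rightarrow> complex^('s::finite \<times> 2))) multiset)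
        \<times> (nat \<Rightarrow> ('m mod2 \<times> (real^'m \<Rightarrow> complex^('s::finite \<times> 2))) multiset)) set" where
  "Dx_even c \<epsilon> = product_op (op_tensor (dirac c) pauli2) pauli1 \<epsilon>"

definition rhs_even :: "(real^'m \<Rightarrow> complex^'s^'s) \<Rightarrow> real
    \<Rightarrow> ((nat \<Rightarrow> ((real^'m \<Rightarrow> complex^'s) \<times> (real \<Rightarrow> complex^2)) multiset)
        \<times> (nat \<Rightarrow> ((real^'m \<Rightarrow> complex^'s) \<times> (real \<Rightarrow> complex^2)) multiset)) set" where
  "rhs_even c \<epsilon> =
     sphere_index_op (op_on_sphere UNIV (dirac_sphere c)) (\<lambda>\<phi> x. c x *v \<phi> x) \<epsilon>"

end

theory Submission
  imports Defs
begin

text \<open>The volume element of the collar is \<open>r\<^sup>n\<close> times the product measure and the inner product of the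
  module has the density \<open>1/r\<^sup>n\<close>, so both tensor products are completions of dense subspaces of one
  \<open>L\<^sup>2\<close> space of spinors on \<open>S\<^sup>n \<times> (-\<epsilon>, \<epsilon>)\<close>, and \<open>U\<close> acts by a unitary matrix on every fibre.
  The term \<open>- n/(2r)\<close> of the connection cancels the zeroth order term of the Dirac operator in polar
  coordinates.  Since \<open>D\<^bsub>S\<^esub> (\<gamma>\<^sub>r \<phi>) = - \<gamma>\<^sub>r D\<^bsub>S\<^esub> \<phi>\<close>, separation of variables reduces the equality on
  test sections to relations between Pauli matrices.  Test sections are in the domain of the product
  operator because they are divisible by \<open>cos\<^sup>2(\<pi>s/(2\<epsilon>))\<close>, which compensates the poles of the
  potential.  On the remaining elements of the domains, symmetry on test sections (the divergence
  theorem on the collar) extends by continuity in the graph norms.\<close>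

section \<open>Semi-inner product spaces and their completions\<close>

text \<open>Elements of the completions are Cauchy sequences of formal sums, so the unitary has no
  closed formula and vectors cannot be compared by equality. Every claim is decided by images in one
  concrete L2 space, and vector identities are replaced by equality of inner products. A fibre map
  that varies with the base point would in general add derivative terms of its own. It is therefore
  sought among matrices affine in c(x), and the angular, the radial and the potential part each
  impose one matrix equation on it. Their solutions are the source of the factors 1/sqrt 2 and of
  the phases. The poles of the potential are harmless as soon as one of two paired sections has
  compact support, so integration by parts is done once, between a test section and a section from
  the module. Symmetry of the right-hand operator with itself needs no second integration: a test
  tensor has the same image as an element of the domain of the product operator, so the mixed
  symmetry can be reused. The bound \<epsilon> < 1 keeps the shell away from the origin, where 1/r
  and 1/r^n blow up.\<close>

locale semi_ip =
  fixes H :: "'a hspace"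
  assumes vadd_closed: "x \<in> carr H \<Longrightarrow> y \<in> carr H \<Longrightarrow> vadd H x y \<in> carr H"
    and vscale_closed: "x \<in> carr H \<Longrightarrow> vscale H a x \<in> carr H"
    and ip_vadd: "x \<in> carr H \<Longrightarrow> y \<in> carr H \<Longrightarrow> z \<in> carr H \<Longrightarrow>
      ip H x (vadd H y z) = ip H x y + ip H x z"
    and ip_vscale: "x \<in> carr H \<Longrightarrow> y \<in> carr H \<Longrightarrow> ip H x (vscale H a y) = a * ip H x y"
    and ip_cnj: "x \<in> carr H \<Longrightarrow> y \<in> carr H \<Longrightarrow> ip H y x = cnj (ip H x y)"
    and ip_nonneg: "x \<in> carr H \<Longrightarrow> 0 \<le> Re (ip H x x)"
begin

lemma ip_vadd_left:
  assumes "x \<in> carr H" "y \<in> carr H" "z \<in> carr H"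
  shows "ip H (vadd H x y) z = ip H x z + ip H y z"
proof -
  have "ip H (vadd H x y) z = cnj (ip H z (vadd H x y))"
    using assms ip_cnj vadd_closed by blast
  also have "\<dots> = ip H x z + ip H y z"
    using assms ip_vadd ip_cnj[of z x] ip_cnj[of z y] by simp
  finally show ?thesis .
qed

lemma ip_vscale_left:
  assumes "x \<in> carr H" "y \<in> carr H"
  shows "ip H (vscale H a x) y = cnj a * ip H x y"
  using assms ip_cnj[of y "vscale H a x"] ip_cnj[of y x] ip_vscale[of y x a] vscale_closed by simp

lemma ip_self_real: "x \<in> carr H \<Longrightarrow> ip H x x = of_real (Re (ip H x x))"
  using ip_cnj[of x x] by (simp add: complex_eq_iff)

lemma ip_comb_self:
  assumes "x \<in> carr H" "y \<in> carr H"
  shows "Re (ip H (vadd H x (vscale H a y)) (vadd H x (vscale H a y)))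
    = Re (ip H x x) + 2 * Re (a * ip H x y) + (cmod a)\<^sup>2 * Re (ip H y y)"
proof -
  let ?y = "vscale H a y"
  have y: "?y \<in> carr H" using assms vscale_closed by blast
  have aa: "cnj a * (a * z) = of_real ((cmod a)\<^sup>2) * z" for z
    by (simp only: mult.assoc[symmetric] complex_norm_square mult.commute[of "cnj a"])
  have "ip H (vadd H x ?y) (vadd H x ?y)
      = ip H x x + a * ip H x y + (cnj a * cnj (ip H x y) + cnj a * (a * ip H y y))"
    using assms y by (simp add: ip_vadd ip_vadd_left vadd_closed ip_vscale ip_vscale_left
        ip_cnj[of x y] algebra_simps)
  then show ?thesis unfolding aa
    using ip_self_real[OF assms(2)] by (simp add: algebra_simps)
qed

lemma vdist_sq:
  assumes "x \<in> carr H" "y \<in> carr H"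
  shows "(vdist H x y)\<^sup>2 = Re (ip H x x) - 2 * Re (ip H x y) + Re (ip H y y)"
proof -
  have "0 \<le> Re (ip H (vadd H x (vscale H (-1) y)) (vadd H x (vscale H (-1) y)))"
    using assms ip_nonneg vadd_closed vscale_closed by blast
  then show ?thesis
    unfolding vdist_def Let_def using ip_comb_self[OF assms, of "-1"] by simp
qed

lemma vdist_nonneg: "x \<in> carr H \<Longrightarrow> y \<in> carr H \<Longrightarrow> 0 \<le> vdist H x y"
  using ip_nonneg vadd_closed vscale_closed by (simp add: vdist_def Let_def)

lemma vdist_commute: "x \<in> carr H \<Longrightarrow> y \<in> carr H \<Longrightarrow> vdist H x y = vdist H y x"
  using vdist_sq[of x y] vdist_sq[of y x] ip_cnj[of x y] vdist_nonneg[of x y] vdist_nonneg[of y x]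
  by (intro power2_eq_imp_eq[of "vdist H x y" "vdist H y x"]) simp_all

text \<open>The squared norm of x - r <y,x> y is a nonnegative quadratic polynomial in r. The form
  may be degenerate, so a null vector y is treated separately: the polynomial is then affine in r,
  and it can stay nonnegative only if <x,y> = 0.\<close>

lemma cauchy_schwarz:
  assumes x: "x \<in> carr H" and y: "y \<in> carr H"
  shows "(cmod (ip H x y))\<^sup>2 \<le> Re (ip H x x) * Re (ip H y y)"
proof -
  define c where "c = ip H x y"
  define A where "A = Re (ip H x x)"
  define B where "B = Re (ip H y y)"
  have nonneg: "0 \<le> A" "0 \<le> B" using ip_nonneg x y by (auto simp: A_def B_def)
  have quad: "0 \<le> A - 2 * r * (cmod c)\<^sup>2 + r\<^sup>2 * (cmod c)\<^sup>2 * B" for r :: real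
  proof -
    define a where "a = - of_real r * cnj c"
    have ac: "a * c = of_real (- r * (cmod c)\<^sup>2)"
      by (simp add: a_def mult.assoc) (simp add: complex_norm_square[symmetric] mult.commute)
    have "0 \<le> Re (ip H (vadd H x (vscale H a y)) (vadd H x (vscale H a y)))"
      using ip_nonneg x y vadd_closed vscale_closed by blast
    also have "\<dots> = A + 2 * Re (a * c) + (cmod a)\<^sup>2 * B"
      unfolding ip_comb_self[OF x y] by (simp add: A_def B_def c_def)
    also have "\<dots> = A - 2 * r * (cmod c)\<^sup>2 + r\<^sup>2 * (cmod c)\<^sup>2 * B"
      unfolding ac by (simp add: a_def norm_mult power_mult_distrib)
    finally show ?thesis .
  qed
  have "(cmod c)\<^sup>2 \<le> A * B"
  proof (cases "B = 0")
    case False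
    with nonneg have B: "B > 0" by simp
    have "0 \<le> A - (cmod c)\<^sup>2 / B"
      using quad[of "1 / B"] B by (simp add: power2_eq_square field_simps)
    then show ?thesis using B by (simp add: field_simps)
  next
    case True
    show ?thesis
    proof (rule ccontr)
      assume "\<not> ?thesis"
      then have p: "(cmod c)\<^sup>2 > 0" using True by simp
      \<comment> \<open>At this value of r the affine polynomial equals A - 2 (A + 1), which is
        negative.\<close>
      have "0 \<le> A - 2 * ((A + 1) / (cmod c)\<^sup>2) * (cmod c)\<^sup>2"
        using quad[of "(A + 1) / (cmod c)\<^sup>2"] True by simp
      then show False using p nonneg by simp
    qed
  qed
  then show ?thesis by (simp add: c_def A_def B_def)
qed

definition vnorm :: "'a \<Rightarrow> real" where "vnorm x = sqrt (Re (ip H x x))"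

lemma ip_bound:
  assumes "x \<in> carr H" "y \<in> carr H"
  shows "cmod (ip H x y) \<le> vnorm x * vnorm y"
proof -
  have "(cmod (ip H x y))\<^sup>2 \<le> (vnorm x * vnorm y)\<^sup>2"
    using cauchy_schwarz[OF assms] ip_nonneg assms by (simp add: vnorm_def power_mult_distrib)
  then show ?thesis
    by (rule power2_le_imp_le) (use ip_nonneg assms in \<open>simp add: vnorm_def\<close>)
qed

lemma vnorm_nonneg: "x \<in> carr H \<Longrightarrow> 0 \<le> vnorm x"
  using ip_nonneg by (simp add: vnorm_def)

lemma vnorm_vadd:
  assumes "x \<in> carr H" "y \<in> carr H"
  shows "vnorm (vadd H x y) \<le> vnorm x + vnorm y"
proof (rule power2_le_imp_le)
  have "(vnorm (vadd H x y))\<^sup>2 = Re (ip H (vadd H x y) (vadd H x y))"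
    using ip_nonneg vadd_closed assms by (simp add: vnorm_def)
  also have "\<dots> = Re (ip H x x) + 2 * Re (ip H x y) + Re (ip H y y)"
    using assms by (simp add: ip_vadd ip_vadd_left vadd_closed ip_cnj[of x y])
  also have "\<dots> \<le> (vnorm x)\<^sup>2 + 2 * (vnorm x * vnorm y) + (vnorm y)\<^sup>2"
    using complex_Re_le_cmod[of "ip H x y"] ip_bound[OF assms] ip_nonneg assms
    by (simp add: vnorm_def)
  finally show "(vnorm (vadd H x y))\<^sup>2 \<le> (vnorm x + vnorm y)\<^sup>2"
    by (simp add: power2_sum algebra_simps)
qed (use vnorm_nonneg assms in simp)

lemma ip_diff_bound:
  assumes "x \<in> carr H" "y \<in> carr H" "z \<in> carr H"
  shows "cmod (ip H z x - ip H z y) \<le> vnorm z * vdist H x y"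
proof -
  let ?d = "vadd H x (vscale H (-1) y)"
  have "ip H z x - ip H z y = ip H z ?d"
    using assms by (simp add: ip_vadd ip_vscale vscale_closed)
  moreover have "vdist H x y = vnorm ?d" by (simp add: vdist_def vnorm_def Let_def)
  ultimately show ?thesis using ip_bound[of z ?d] assms vadd_closed vscale_closed by simp
qed

text \<open>The axioms contain no vector space laws, and formal sums of tensors have no additive
  inverses. Hence (x - y) + (y - z) and x - z are different elements in general. They pair equally
  with every vector, and this already gives them the same norm.\<close>

lemma vdist_triangle:
  assumes "x \<in> carr H" "y \<in> carr H" "z \<in> carr H"
  shows "vdist H x z \<le> vdist H x y + vdist H y z"
proof -
  let ?u = "vadd H x (vscale H (-1) y)" and ?v = "vadd H y (vscale H (-1) z)"
  let ?w = "vadd H x (vscale H (-1) z)"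
  have u: "?u \<in> carr H" and v: "?v \<in> carr H" and w: "?w \<in> carr H"
    using assms vadd_closed vscale_closed by auto
  have e: "ip H p (vadd H ?u ?v) = ip H p ?w" if "p \<in> carr H" for p
    using that assms u v vscale_closed vadd_closed by (simp add: ip_vadd ip_vscale)
  have "ip H (vadd H ?u ?v) (vadd H ?u ?v) = ip H ?w ?w"
    using e[of "vadd H ?u ?v"] e[of ?w] u v w vadd_closed ip_cnj[of ?w "vadd H ?u ?v"]
      ip_cnj[of ?w ?w] by metis
  then have "vnorm ?w = vnorm (vadd H ?u ?v)" by (simp add: vnorm_def)
  then show ?thesis using vnorm_vadd[OF u v] by (simp add: vdist_def vnorm_def Let_def)
qed

lemma vdist_self: "x \<in> carr H \<Longrightarrow> vdist H x x = 0"
  using vdist_sq[of x x] by simp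

lemma vnorm_diff_le:
  assumes "x \<in> carr H" "y \<in> carr H"
  shows "vnorm x \<le> vnorm y + vdist H x y"
proof -
  let ?d = "vadd H x (vscale H (-1) y)"
  have d: "?d \<in> carr H" using assms vadd_closed vscale_closed by auto
  have e: "ip H p (vadd H y ?d) = ip H p x" if "p \<in> carr H" for p
    using that assms d vscale_closed vadd_closed by (simp add: ip_vadd ip_vscale)
  have "ip H (vadd H y ?d) (vadd H y ?d) = ip H x x"
    using e[of "vadd H y ?d"] e[of x] assms d vadd_closed ip_cnj[of x "vadd H y ?d"]
      ip_cnj[of x x] by metis
  then have "vnorm x = vnorm (vadd H y ?d)" by (simp add: vnorm_def)
  then show ?thesis using vnorm_vadd[OF assms(2) d] by (simp add: vdist_def vnorm_def Let_def)
qed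

lemma ip_tendsto_right:
  assumes "\<And>n. X n \<in> carr H" "x \<in> carr H" "z \<in> carr H" "(\<lambda>n. vdist H (X n) x) \<longlonglongrightarrow> 0"
  shows "(\<lambda>n. ip H z (X n)) \<longlonglongrightarrow> ip H z x"
proof (rule LIM_zero_cancel, rule tendsto_norm_zero_cancel, rule Lim_null_comparison)
  show "\<forall>\<^sub>F n in sequentially. norm (norm (ip H z (X n) - ip H z x)) \<le> vnorm z * vdist H (X n) x"
    using ip_diff_bound assms by simp
  show "(\<lambda>n. vnorm z * vdist H (X n) x) \<longlonglongrightarrow> 0"
    using tendsto_mult_right_zero[OF assms(4)] by simp
qed

lemma ip_tendsto_left:
  assumes "\<And>n. X n \<in> carr H" "x \<in> carr H" "z \<in> carr H" "(\<lambda>n. vdist H (X n) x) \<longlonglongrightarrow> 0"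
  shows "(\<lambda>n. ip H (X n) z) \<longlonglongrightarrow> ip H x z"
proof -
  have "ip H (X n) z = cnj (ip H z (X n))" for n using ip_cnj[of z "X n"] assms by simp
  moreover have "ip H x z = cnj (ip H z x)" using ip_cnj[of z x] assms by simp
  ultimately show ?thesis using tendsto_cnj[OF ip_tendsto_right[OF assms]] by simp
qed

definition cauchy_seq :: "(nat \<Rightarrow> 'a) \<Rightarrow> bool" where
  "cauchy_seq X \<longleftrightarrow> (\<forall>\<delta>>0. \<exists>N. \<forall>m\<ge>N. \<forall>n\<ge>N. vdist H (X m) (X n) < \<delta>)"

lemma completion_carr: "carr (completion H) = {X. (\<forall>n. X n \<in> carr H) \<and> cauchy_seq X}"
  by (simp add: completion_def cauchy_seq_def)

lemma cauchy_seq_bounded: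
  assumes "\<And>n. X n \<in> carr H" "cauchy_seq X"
  obtains B where "B > 0" "\<And>n. vnorm (X n) \<le> B"
proof -
  obtain N where N: "\<And>m n. m \<ge> N \<Longrightarrow> n \<ge> N \<Longrightarrow> vdist H (X m) (X n) < 1"
    using assms(2) unfolding cauchy_seq_def by (meson zero_less_one)
  define B where "B = (\<Sum>i\<le>N. vnorm (X i)) + 1"
  have nn: "0 \<le> vnorm (X i)" for i using assms vnorm_nonneg by blast
  have le: "vnorm (X i) \<le> (\<Sum>i\<le>N. vnorm (X i))" if "i \<le> N" for i
    using that nn by (intro member_le_sum) auto
  show thesis
  proof
    show "B > 0" unfolding B_def using nn by (simp add: add_nonneg_pos sum_nonneg)
    show "vnorm (X n) \<le> B" for n
    proof (cases "n \<le> N")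
      case False
      then have "vnorm (X n) \<le> vnorm (X N) + 1"
        using vnorm_diff_le[of "X n" "X N"] assms(1) N[of n N] by fastforce
      then show ?thesis unfolding B_def using le[of N] by simp
    qed (use le in \<open>force simp: B_def\<close>)
  qed
qed

text \<open>The inner product of the completion is a \<open>lim\<close>, meaningful only for
  convergent sequences. Convergence follows by changing one argument at a time, since Cauchy
  sequences are bounded in norm.\<close>

lemma ip_cauchy_convergent:
  assumes X: "\<And>n. X n \<in> carr H" "cauchy_seq X" and Y: "\<And>n. Y n \<in> carr H" "cauchy_seq Y"
  shows "convergent (\<lambda>n. ip H (X n) (Y n))"
proof -
  obtain A where A: "A > 0" "\<And>n. vnorm (X n) \<le> A" using cauchy_seq_bounded[OF X] by metis
  obtain B where B: "B > 0" "\<And>n. vnorm (Y n) \<le> B" using cauchy_seq_bounded[OF Y] by metis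
  have d: "cmod (ip H (X m) (Y m) - ip H (X n) (Y n))
      \<le> A * vdist H (Y m) (Y n) + B * vdist H (X m) (X n)" for m n
  proof -
    have "cmod (ip H (X m) (Y m) - ip H (X n) (Y n))
        \<le> cmod (ip H (X m) (Y m) - ip H (X m) (Y n)) + cmod (ip H (X m) (Y n) - ip H (X n) (Y n))"
      using norm_triangle_ineq[of "ip H (X m) (Y m) - ip H (X m) (Y n)"
          "ip H (X m) (Y n) - ip H (X n) (Y n)"] by simp
    moreover have "ip H (X m) (Y n) - ip H (X n) (Y n)
        = cnj (ip H (Y n) (X m) - ip H (Y n) (X n))"
      using ip_cnj[of "Y n" "X m"] ip_cnj[of "Y n" "X n"] X Y by simp
    then have "cmod (ip H (X m) (Y n) - ip H (X n) (Y n)) \<le> vnorm (Y n) * vdist H (X m) (X n)"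
      using ip_diff_bound X Y by (simp only: complex_mod_cnj)
    moreover have "cmod (ip H (X m) (Y m) - ip H (X m) (Y n)) \<le> vnorm (X m) * vdist H (Y m) (Y n)"
      using ip_diff_bound X Y by blast
    ultimately show ?thesis
      using mult_right_mono[OF A(2)[of m] vdist_nonneg[of "Y m" "Y n"]]
        mult_right_mono[OF B(2)[of n] vdist_nonneg[of "X m" "X n"]] X Y by fastforce
  qed
  have "Cauchy (\<lambda>n. ip H (X n) (Y n))"
  proof (rule metric_CauchyI)
    fix e :: real assume e: "e > 0"
    obtain N1 where N1: "\<And>m n. m \<ge> N1 \<Longrightarrow> n \<ge> N1 \<Longrightarrow> vdist H (X m) (X n) < e / (2 * B)"
      using X(2) e B(1) unfolding cauchy_seq_def by (metis divide_pos_pos mult_pos_pos zero_less_numeral)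
    obtain N2 where N2: "\<And>m n. m \<ge> N2 \<Longrightarrow> n \<ge> N2 \<Longrightarrow> vdist H (Y m) (Y n) < e / (2 * A)"
      using Y(2) e A(1) unfolding cauchy_seq_def by (metis divide_pos_pos mult_pos_pos zero_less_numeral)
    have "dist (ip H (X m) (Y m)) (ip H (X n) (Y n)) < e" if "m \<ge> max N1 N2" "n \<ge> max N1 N2" for m n
    proof -
      have "A * vdist H (Y m) (Y n) < e / 2" using N2[of m n] that A(1) by (simp add: field_simps)
      moreover have "B * vdist H (X m) (X n) < e / 2" using N1[of m n] that B(1) by (simp add: field_simps)
      ultimately show ?thesis using d[of m n] by (simp add: dist_norm)
    qed
    then show "\<exists>M. \<forall>m\<ge>M. \<forall>n\<ge>M. dist (ip H (X m) (Y m)) (ip H (X n) (Y n)) < e" by blast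
  qed
  then show ?thesis using Cauchy_convergent by blast
qed

end

section \<open>Vectors up to null vectors and asymptotically equal Cauchy sequences\<close>

context semi_ip begin

text \<open>A substitute for equality of x and y, which rearranging a linear combination does not
  provide here.\<close>

lemma ip_self_cong:
  assumes "x \<in> carr H" "y \<in> carr H" "\<And>z. z \<in> carr H \<Longrightarrow> ip H z x = ip H z y"
  shows "ip H x x = ip H y y"
proof -
  have "ip H x x = cnj (ip H y x)"
    using assms(3)[OF assms(1)] ip_cnj[OF assms(2,1)] by simp
  also have "\<dots> = ip H y y" using assms(3)[OF assms(2)] ip_cnj[OF assms(2,2)] by simp
  finally show ?thesis .
qed

lemma vnorm_vscale:
  assumes "z \<in> carr H"
  shows "vnorm (vscale H k z) = cmod k * vnorm z"
proof -
  have "ip H (vscale H k z) (vscale H k z) = of_real ((cmod k)\<^sup>2) * ip H z z"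
    using assms vscale_closed
    by (simp add: ip_vscale ip_vscale_left mult.assoc[symmetric])
      (simp add: complex_norm_square[symmetric])
  then show ?thesis by (simp add: vnorm_def real_sqrt_mult)
qed

lemma vdist_vadd_vscale:
  assumes "x \<in> carr H" "y \<in> carr H" "x' \<in> carr H" "y' \<in> carr H"
  shows "vdist H (vadd H (vscale H a x) (vscale H b y)) (vadd H (vscale H a x') (vscale H b y'))
    \<le> cmod a * vdist H x x' + cmod b * vdist H y y'"
proof -
  let ?d = "vadd H (vadd H (vscale H a x) (vscale H b y))
    (vscale H (-1) (vadd H (vscale H a x') (vscale H b y')))"
  let ?e1 = "vadd H x (vscale H (-1) x')" and ?e2 = "vadd H y (vscale H (-1) y')"
  let ?e = "vadd H (vscale H a ?e1) (vscale H b ?e2)"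
  have d: "?d \<in> carr H" and e: "?e \<in> carr H" "?e1 \<in> carr H" "?e2 \<in> carr H"
    using assms vadd_closed vscale_closed by auto
  have "ip H p ?d = ip H p ?e" if "p \<in> carr H" for p
    using that assms vscale_closed vadd_closed by (simp add: ip_vadd ip_vscale algebra_simps)
  then have "ip H ?d ?d = ip H ?e ?e"
    using d e by (intro ip_self_cong)
  then have "vnorm ?d = vnorm ?e" by (simp add: vnorm_def)
  also have "\<dots> \<le> vnorm (vscale H a ?e1) + vnorm (vscale H b ?e2)"
    using e vscale_closed by (intro vnorm_vadd) auto
  also have "\<dots> = cmod a * vnorm ?e1 + cmod b * vnorm ?e2" using e by (simp add: vnorm_vscale)
  finally show ?thesis by (simp add: vdist_def vnorm_def Let_def)
qed

lemma cauchy_seq_close: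
  assumes "\<And>n. X n \<in> carr H" "\<And>n. Y n \<in> carr H" "cauchy_seq X"
    and lim: "(\<lambda>n. vdist H (X n) (Y n)) \<longlonglongrightarrow> 0"
  shows "cauchy_seq Y"
  unfolding cauchy_seq_def
proof (intro allI impI)
  fix d :: real assume d: "d > 0"
  obtain N1 where N1: "\<And>m n. m \<ge> N1 \<Longrightarrow> n \<ge> N1 \<Longrightarrow> vdist H (X m) (X n) < d / 3"
    using assms(3) d unfolding cauchy_seq_def by (metis divide_pos_pos zero_less_numeral)
  obtain N2 where N2: "\<And>n. n \<ge> N2 \<Longrightarrow> vdist H (X n) (Y n) < d / 3"
    using LIMSEQ_D[OF lim, of "d/3"] d by fastforce
  have "vdist H (Y m) (Y n) < d" if "m \<ge> max N1 N2" "n \<ge> max N1 N2" for m n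
  proof -
    have "vdist H (Y m) (Y n) \<le> vdist H (Y m) (X m) + vdist H (X m) (Y n)"
      using assms vdist_triangle by blast
    also have "vdist H (X m) (Y n) \<le> vdist H (X m) (X n) + vdist H (X n) (Y n)"
      using assms vdist_triangle by blast
    also have "vdist H (Y m) (X m) = vdist H (X m) (Y m)" using assms vdist_commute by blast
    finally show ?thesis using N1[of m n] N2[of m] N2[of n] that by simp
  qed
  then show "\<exists>N. \<forall>m\<ge>N. \<forall>n\<ge>N. vdist H (Y m) (Y n) < d" by blast
qed

lemma ip_close:
  assumes X: "\<And>n. X n \<in> carr H" "\<And>n. X' n \<in> carr H" "cauchy_seq X" "(\<lambda>n. vdist H (X n) (X' n)) \<longlonglongrightarrow> 0"
    and Y: "\<And>n. Y n \<in> carr H" "\<And>n. Y' n \<in> carr H" "cauchy_seq Y" "(\<lambda>n. vdist H (Y n) (Y' n)) \<longlonglongrightarrow> 0"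
  shows "lim (\<lambda>n. ip H (X n) (Y n)) = lim (\<lambda>n. ip H (X' n) (Y' n))"
    and "convergent (\<lambda>n. ip H (X n) (Y n))"
proof -
  obtain A where A: "A > 0" "\<And>n. vnorm (X n) \<le> A" using cauchy_seq_bounded X by metis
  have "cauchy_seq Y'" using cauchy_seq_close Y by blast
  then obtain B where B: "B > 0" "\<And>n. vnorm (Y' n) \<le> B" using cauchy_seq_bounded Y by metis
  show conv: "convergent (\<lambda>n. ip H (X n) (Y n))" using ip_cauchy_convergent X Y by blast
  have d: "cmod (ip H (X n) (Y n) - ip H (X' n) (Y' n))
      \<le> A * vdist H (Y n) (Y' n) + B * vdist H (X n) (X' n)" for n
  proof -
    have "cmod (ip H (X n) (Y n) - ip H (X' n) (Y' n))
        \<le> cmod (ip H (X n) (Y n) - ip H (X n) (Y' n)) + cmod (ip H (X n) (Y' n) - ip H (X' n) (Y' n))"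
      using norm_triangle_ineq[of "ip H (X n) (Y n) - ip H (X n) (Y' n)"
          "ip H (X n) (Y' n) - ip H (X' n) (Y' n)"] by simp
    moreover have "ip H (X n) (Y' n) - ip H (X' n) (Y' n)
        = cnj (ip H (Y' n) (X n) - ip H (Y' n) (X' n))"
      using ip_cnj[of "Y' n" "X n"] ip_cnj[of "Y' n" "X' n"] X Y by simp
    then have "cmod (ip H (X n) (Y' n) - ip H (X' n) (Y' n)) \<le> vnorm (Y' n) * vdist H (X n) (X' n)"
      using ip_diff_bound X Y by (simp only: complex_mod_cnj)
    moreover have "cmod (ip H (X n) (Y n) - ip H (X n) (Y' n)) \<le> vnorm (X n) * vdist H (Y n) (Y' n)"
      using ip_diff_bound X Y by blast
    ultimately show ?thesis
      using mult_right_mono[OF A(2)[of n] vdist_nonneg[of "Y n" "Y' n"]]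
        mult_right_mono[OF B(2)[of n] vdist_nonneg[of "X n" "X' n"]] X Y by fastforce
  qed
  have "(\<lambda>n. ip H (X n) (Y n) - ip H (X' n) (Y' n)) \<longlonglongrightarrow> 0"
  proof (rule tendsto_norm_zero_cancel, rule Lim_null_comparison)
    show "(\<lambda>n. A * vdist H (Y n) (Y' n) + B * vdist H (X n) (X' n)) \<longlonglongrightarrow> 0"
      using tendsto_add[OF tendsto_mult_right_zero[OF Y(4)] tendsto_mult_right_zero[OF X(4)]] by simp
  qed (use d in simp)
  from tendsto_diff[OF convergent_LIMSEQ_iff[THEN iffD1, OF conv] this]
  have "(\<lambda>n. ip H (X' n) (Y' n)) \<longlonglongrightarrow> lim (\<lambda>n. ip H (X n) (Y n))" by simp
  then show "lim (\<lambda>n. ip H (X n) (Y n)) = lim (\<lambda>n. ip H (X' n) (Y' n))" by (simp add: limI)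
qed

lemma veq_completionI:
  assumes "\<And>n. X n \<in> carr H" "\<And>n. Y n \<in> carr H" and lim: "(\<lambda>n. vdist H (X n) (Y n)) \<longlonglongrightarrow> 0"
  shows "veq (completion H) X Y"
proof -
  let ?d = "\<lambda>n. vadd H (X n) (vscale H (-1) (Y n))"
  have "ip H (?d n) (?d n) = of_real ((vdist H (X n) (Y n))\<^sup>2)" for n
  proof -
    have "?d n \<in> carr H" using assms vadd_closed vscale_closed by blast
    then show ?thesis using ip_self_real[of "?d n"] ip_nonneg[of "?d n"]
      by (simp add: vdist_def Let_def)
  qed
  moreover have "(\<lambda>n. complex_of_real ((vdist H (X n) (Y n))\<^sup>2)) \<longlonglongrightarrow> of_real (0\<^sup>2)"
    by (intro tendsto_intros lim)
  ultimately have "lim (\<lambda>n. ip H (?d n) (?d n)) = 0" by (simp add: limI)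
  then show ?thesis by (simp add: veq_def vdist_def completion_def Let_def)
qed

end

section \<open>Isometric maps and the unitary between two completions\<close>

locale isometric_map = L: semi_ip L for L :: "'l hspace" +
  fixes P :: "'a hspace" and J :: "'a \<Rightarrow> 'l"
  assumes P_vadd: "x \<in> carr P \<Longrightarrow> y \<in> carr P \<Longrightarrow> vadd P x y \<in> carr P"
    and P_vscale: "x \<in> carr P \<Longrightarrow> vscale P a x \<in> carr P"
    and J_carr: "x \<in> carr P \<Longrightarrow> J x \<in> carr L"
    and J_vadd: "x \<in> carr P \<Longrightarrow> y \<in> carr P \<Longrightarrow> J (vadd P x y) = vadd L (J x) (J y)"
    and J_vscale: "x \<in> carr P \<Longrightarrow> J (vscale P a x) = vscale L a (J x)"
    and J_ip: "x \<in> carr P \<Longrightarrow> y \<in> carr P \<Longrightarrow> ip P x y = ip L (J x) (J y)"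
begin

lemma semi_ip: "semi_ip P"
proof
  fix x y assume "x \<in> carr P" "y \<in> carr P"
  then show "ip P y x = cnj (ip P x y)"
    using J_ip[of x y] J_ip[of y x] L.ip_cnj[of "J x" "J y"] J_carr by simp
qed (simp_all add: P_vadd P_vscale J_carr J_vadd J_vscale J_ip L.ip_vadd L.ip_vscale L.ip_nonneg)

lemma vdist: "x \<in> carr P \<Longrightarrow> y \<in> carr P \<Longrightarrow> vdist P x y = vdist L (J x) (J y)"
  by (simp add: vdist_def Let_def P_vadd P_vscale J_ip J_vadd J_vscale)

lemma cauchy_seq:
  "(\<And>n. X n \<in> carr P) \<Longrightarrow> semi_ip.cauchy_seq P X = L.cauchy_seq (\<lambda>n. J (X n))"
  by (simp add: semi_ip.cauchy_seq_def[OF semi_ip] L.cauchy_seq_def vdist)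

end

locale dense_isometries =
  J1: isometric_map L P J1 + J2: isometric_map L Q J2
  for L :: "'l hspace" and P :: "'a hspace" and J1 and Q :: "'b hspace" and J2 +
  assumes approx12: "x \<in> carr P \<Longrightarrow> \<delta> > 0 \<Longrightarrow> \<exists>y\<in>carr Q. vdist L (J1 x) (J2 y) < \<delta>"
    and approx21: "y \<in> carr Q \<Longrightarrow> \<delta> > 0 \<Longrightarrow> \<exists>x\<in>carr P. vdist L (J2 y) (J1 x) < \<delta>"
begin

text \<open>A Cauchy sequence X in P is sent to a sequence in Q whose images under \<open>J2\<close>
  approach those of X under \<open>J1\<close>. Sequences with asymptotically equal images represent
  the same vector, so linearity holds although every term is an arbitrary choice. The last two
  conclusions evaluate U on constant sequences, that is, on finite sums of tensors; besides
  unitarity they are what the later proofs use of U.\<close>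

lemma unitary_between_completions:
  obtains U where "unitary_iso (completion P) (completion Q) U"
    and "\<And>x y. x \<in> carr P \<Longrightarrow> y \<in> carr Q \<Longrightarrow>
      ip (completion Q) (\<lambda>_. y) (U (\<lambda>_. x)) = ip L (J2 y) (J1 x)"
    and "\<And>x y. x \<in> carr P \<Longrightarrow> y \<in> carr Q \<Longrightarrow> vdist L (J1 x) (J2 y) = 0 \<Longrightarrow>
      veq (completion Q) (U (\<lambda>_. x)) (\<lambda>_. y)"
proof -
  interpret P: semi_ip P by (rule J1.semi_ip)
  interpret Q: semi_ip Q by (rule J2.semi_ip)
  \<comment> \<open>The error 1/(n+1) makes the termwise chosen approximants asymptotic to
    X.\<close>
  define U where "U X n = (SOME y. y \<in> carr Q \<and> vdist L (J1 (X n)) (J2 y) < inverse (real (Suc n)))"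
    for X :: "nat \<Rightarrow> 'a" and n
  have U: "U X n \<in> carr Q" "vdist L (J1 (X n)) (J2 (U X n)) < inverse (real (Suc n))"
    if "X n \<in> carr P" for X n
  proof -
    have "\<exists>y. y \<in> carr Q \<and> vdist L (J1 (X n)) (J2 y) < inverse (real (Suc n))"
      using approx12[OF that, of "inverse (real (Suc n))"] by auto
    from someI_ex[OF this] show "U X n \<in> carr Q" "vdist L (J1 (X n)) (J2 (U X n)) < inverse (real (Suc n))"
      by (simp_all add: U_def)
  qed
  have Ulim: "(\<lambda>n. vdist L (J1 (X n)) (J2 (U X n))) \<longlonglongrightarrow> 0" if "\<And>n. X n \<in> carr P" for X
  proof (rule tendsto_sandwich[OF _ _ tendsto_const LIMSEQ_inverse_real_of_nat])
    show "\<forall>\<^sub>F n in sequentially. 0 \<le> vdist L (J1 (X n)) (J2 (U X n))"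
      using that U J1.J_carr J2.J_carr J1.L.vdist_nonneg by simp
    show "\<forall>\<^sub>F n in sequentially. vdist L (J1 (X n)) (J2 (U X n)) \<le> inverse (real (Suc n))"
      using U(2)[of X, OF that] by (simp add: less_imp_le)
  qed
  have cP: "X \<in> carr (completion P) \<longleftrightarrow> (\<forall>n. X n \<in> carr P) \<and> J1.L.cauchy_seq (\<lambda>n. J1 (X n))" for X
    using J1.cauchy_seq by (auto simp: P.completion_carr)
  have cQ: "Y \<in> carr (completion Q) \<longleftrightarrow> (\<forall>n. Y n \<in> carr Q) \<and> J1.L.cauchy_seq (\<lambda>n. J2 (Y n))" for Y
    using J2.cauchy_seq by (auto simp: Q.completion_carr)
  have Ucarr: "U X \<in> carr (completion Q)" if X: "X \<in> carr (completion P)" for X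
  proof -
    have "J1.L.cauchy_seq (\<lambda>n. J2 (U X n))"
      by (rule J1.L.cauchy_seq_close[of "\<lambda>n. J1 (X n)"])
        (use X cP Ulim U J1.J_carr J2.J_carr in auto)
    then show ?thesis using X U cP cQ by blast
  qed
  have close: "(\<lambda>n. vdist L (J2 (Y n)) (J2 (Y' n))) \<longlonglongrightarrow> 0"
    if "\<And>n. Y n \<in> carr Q" "\<And>n. Y' n \<in> carr Q" "\<And>n. Z n \<in> carr L"
      "(\<lambda>n. vdist L (Z n) (J2 (Y n))) \<longlonglongrightarrow> 0" "(\<lambda>n. vdist L (Z n) (J2 (Y' n))) \<longlonglongrightarrow> 0" for Y Y' Z
  proof (rule tendsto_sandwich[OF _ _ tendsto_const])
    show "\<forall>\<^sub>F n in sequentially. 0 \<le> vdist L (J2 (Y n)) (J2 (Y' n))"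
      using that J2.J_carr J1.L.vdist_nonneg by simp
    show "\<forall>\<^sub>F n in sequentially. vdist L (J2 (Y n)) (J2 (Y' n))
        \<le> vdist L (Z n) (J2 (Y n)) + vdist L (Z n) (J2 (Y' n))"
      using that J2.J_carr J1.L.vdist_triangle[of "J2 (Y n)" "Z n" "J2 (Y' n)" for n]
        J1.L.vdist_commute[of "J2 (Y n)" "Z n" for n] by (intro always_eventually) simp
    show "(\<lambda>n. vdist L (Z n) (J2 (Y n)) + vdist L (Z n) (J2 (Y' n))) \<longlonglongrightarrow> 0"
      using tendsto_add[OF that(4,5)] by simp
  qed
  have "unitary_iso (completion P) (completion Q) U"
    unfolding unitary_iso_def
  proof (intro conjI ballI allI)
    show "U X \<in> carr (completion Q)" if "X \<in> carr (completion P)" for X using Ucarr that .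
  next
    fix X Y a b assume X: "X \<in> carr (completion P)" and Y: "Y \<in> carr (completion P)"
    have Xn: "X n \<in> carr P" "Y n \<in> carr P" for n using X Y cP by auto
    define Z where "Z n = vadd P (vscale P a (X n)) (vscale P b (Y n))" for n
    define Z' where "Z' n = vadd Q (vscale Q a (U X n)) (vscale Q b (U Y n))" for n
    have Zn: "Z n \<in> carr P" "Z' n \<in> carr Q" for n
      unfolding Z_def Z'_def using Xn U P.vadd_closed P.vscale_closed Q.vadd_closed Q.vscale_closed by auto
    have lim2: "(\<lambda>n. vdist L (J1 (Z n)) (J2 (Z' n))) \<longlonglongrightarrow> 0"
    proof (rule tendsto_sandwich[OF _ _ tendsto_const])
      show "\<forall>\<^sub>F n in sequentially. 0 \<le> vdist L (J1 (Z n)) (J2 (Z' n))"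
        using Zn J1.J_carr J2.J_carr J1.L.vdist_nonneg by simp
      have "vdist L (J1 (Z n)) (J2 (Z' n)) \<le> cmod a * vdist L (J1 (X n)) (J2 (U X n))
          + cmod b * vdist L (J1 (Y n)) (J2 (U Y n))" for n
        unfolding Z_def Z'_def using Xn[of n] U(1)[OF Xn(1)] U(1)[OF Xn(2)]
        by (simp add: J1.J_vadd J2.J_vadd J1.J_vscale J2.J_vscale P.vscale_closed Q.vscale_closed
            J1.L.vdist_vadd_vscale J1.J_carr J2.J_carr)
      then show "\<forall>\<^sub>F n in sequentially. vdist L (J1 (Z n)) (J2 (Z' n))
          \<le> cmod a * vdist L (J1 (X n)) (J2 (U X n)) + cmod b * vdist L (J1 (Y n)) (J2 (U Y n))"
        by simp
      show "(\<lambda>n. cmod a * vdist L (J1 (X n)) (J2 (U X n)) + cmod b * vdist L (J1 (Y n)) (J2 (U Y n))) \<longlonglongrightarrow> 0"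
        using tendsto_add[OF tendsto_mult_right_zero[OF Ulim] tendsto_mult_right_zero[OF Ulim]] Xn
        by simp
    qed
    have "(\<lambda>n. vdist L (J2 (U Z n)) (J2 (Z' n))) \<longlonglongrightarrow> 0"
      by (rule close[of _ _ "\<lambda>n. J1 (Z n)"]) (use Zn U(1)[OF Zn(1)] Ulim[of Z] J1.J_carr lim2 in auto)
    then have "veq (completion Q) (U Z) Z'"
      using Q.veq_completionI[of "U Z" Z'] J2.vdist Zn U(1)[OF Zn(1)] by simp
    moreover have "Z = vadd (completion P) (vscale (completion P) a X) (vscale (completion P) b Y)"
      by (simp add: Z_def completion_def fun_eq_iff)
    moreover have "Z' = vadd (completion Q) (vscale (completion Q) a (U X)) (vscale (completion Q) b (U Y))"
      by (simp add: Z'_def completion_def fun_eq_iff)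
    ultimately show "veq (completion Q)
        (U (vadd (completion P) (vscale (completion P) a X) (vscale (completion P) b Y)))
        (vadd (completion Q) (vscale (completion Q) a (U X)) (vscale (completion Q) b (U Y)))"
      by simp
  next
    fix X Y assume X: "X \<in> carr (completion P)" and Y: "Y \<in> carr (completion P)"
    have Xn: "X n \<in> carr P" "Y n \<in> carr P" for n using X Y cP by auto
    have "lim (\<lambda>n. ip L (J1 (X n)) (J1 (Y n))) = lim (\<lambda>n. ip L (J2 (U X n)) (J2 (U Y n)))"
      by (rule J1.L.ip_close)
        (use X Y cP Xn U(1)[OF Xn(1)] U(1)[OF Xn(2)] J1.J_carr J2.J_carr Ulim[of X] Ulim[of Y] in auto)
    then show "ip (completion Q) (U X) (U Y) = ip (completion P) X Y"
      using Xn U(1)[OF Xn(1)] U(1)[OF Xn(2)] by (simp add: completion_def J1.J_ip J2.J_ip)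
  next
    fix Z assume Z: "Z \<in> carr (completion Q)"
    have "\<forall>n. \<exists>x\<in>carr P. vdist L (J2 (Z n)) (J1 x) < inverse (real (Suc n))"
      using Z cQ approx21 by simp
    then obtain X where X: "\<And>n. X n \<in> carr P" "\<And>n. vdist L (J2 (Z n)) (J1 (X n)) < inverse (real (Suc n))"
      by metis
    have Zn: "Z n \<in> carr Q" for n using Z cQ by blast
    have lim: "(\<lambda>n. vdist L (J2 (Z n)) (J1 (X n))) \<longlonglongrightarrow> 0"
    proof (rule tendsto_sandwich[OF _ _ tendsto_const LIMSEQ_inverse_real_of_nat])
      show "\<forall>\<^sub>F n in sequentially. 0 \<le> vdist L (J2 (Z n)) (J1 (X n))"
        using X Zn J1.J_carr J2.J_carr J1.L.vdist_nonneg by simp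
      show "\<forall>\<^sub>F n in sequentially. vdist L (J2 (Z n)) (J1 (X n)) \<le> inverse (real (Suc n))"
        using X(2) by (simp add: less_imp_le)
    qed
    have "J1.L.cauchy_seq (\<lambda>n. J1 (X n))"
      by (rule J1.L.cauchy_seq_close[OF _ _ _ lim]) (use X Zn J1.J_carr J2.J_carr Z cQ in auto)
    then have Xc: "X \<in> carr (completion P)" using X cP by blast
    have lim': "(\<lambda>n. vdist L (J1 (X n)) (J2 (Z n))) \<longlonglongrightarrow> 0"
      using lim J1.L.vdist_commute[of "J1 (X n)" "J2 (Z n)" for n] X Zn J1.J_carr J2.J_carr by simp
    have "(\<lambda>n. vdist L (J2 (U X n)) (J2 (Z n))) \<longlonglongrightarrow> 0"
      by (rule close[of _ _ "\<lambda>n. J1 (X n)"]) (use X Zn U(1)[OF X(1)] Ulim[of X] J1.J_carr lim' in auto)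
    then have "veq (completion Q) (U X) Z"
      using Q.veq_completionI[of "U X" Z] J2.vdist Zn U(1)[OF X(1)] by simp
    then show "\<exists>X\<in>carr (completion P). veq (completion Q) (U X) Z" using Xc by blast
  qed
  moreover have "ip (completion Q) (\<lambda>_. y) (U (\<lambda>_. x)) = ip L (J2 y) (J1 x)"
    if x: "x \<in> carr P" and y: "y \<in> carr Q" for x y
  proof -
    have u: "U (\<lambda>_. x) n \<in> carr Q" for n using U(1)[of "\<lambda>_. x" n] x by simp
    have "(\<lambda>n. ip L (J2 y) (J2 (U (\<lambda>_. x) n))) \<longlonglongrightarrow> ip L (J2 y) (J1 x)"
      by (rule J1.L.ip_tendsto_right)
        (use x y u J1.J_carr J2.J_carr Ulim[of "\<lambda>_. x"]
          J1.L.vdist_commute[of "J1 x" "J2 (U (\<lambda>_. x) n)" for n] in auto)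
    then show ?thesis using y u by (simp add: completion_def J2.J_ip limI)
  qed
  moreover have "veq (completion Q) (U (\<lambda>_. x)) (\<lambda>_. y)"
    if x: "x \<in> carr P" and y: "y \<in> carr Q" and d: "vdist L (J1 x) (J2 y) = 0" for x y
  proof -
    have u: "U (\<lambda>_. x) n \<in> carr Q" for n using U(1)[of "\<lambda>_. x" n] x by simp
    have "(\<lambda>n. vdist L (J2 (U (\<lambda>_. x) n)) (J2 y)) \<longlonglongrightarrow> 0"
      by (rule close[of _ _ "\<lambda>n. J1 x"]) (use x y u Ulim[of "\<lambda>_. x"] J1.J_carr d in auto)
    then show ?thesis using Q.veq_completionI[of "U (\<lambda>_. x)" "\<lambda>_. y"] J2.vdist y u by simp
  qed
  ultimately show thesis using that by blast
qed

end

section \<open>Square integrable functions\<close>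

lemma cip_add_right: "cip v (w + w') = cip v w + cip v w'"
  by (simp add: cip_def distrib_left sum.distrib)

lemma cip_add_left: "cip (v + v') w = cip v w + cip v' w"
  by (simp add: cip_def distrib_right sum.distrib)

lemma cip_scale_right: "cip v (a *s w) = a * cip v w"
  by (simp add: cip_def sum_distrib_left mult_ac)

lemma cip_scale_left: "cip (a *s v) w = cnj a * cip v w"
  by (simp add: cip_def sum_distrib_left mult_ac)

lemma cip_cnj: "cip w v = cnj (cip v w)"
  by (simp add: cip_def mult.commute)

lemma cip_self: "cip v v = of_real ((norm v)\<^sup>2)"
proof -
  have "cip v v = (\<Sum>i\<in>UNIV. of_real ((cmod (v $ i))\<^sup>2))"
    unfolding cip_def by (rule sum.cong[OF refl]) (metis complex_norm_square mult.commute)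
  also have "\<dots> = of_real ((norm v)\<^sup>2)"
    by (simp add: norm_vec_def L2_set_def sum_nonneg)
  finally show ?thesis .
qed

lemma norm_cip_le: "norm (cip v w) \<le> norm v * norm w"
proof -
  have "norm (cip v w) \<le> (\<Sum>i\<in>UNIV. norm (v $ i) * norm (w $ i))"
    unfolding cip_def by (rule sum_norm_le) (simp add: norm_mult)
  also have "\<dots> \<le> norm v * norm w"
    using L2_set_mult_ineq[of "\<lambda>i. norm (v $ i)" "\<lambda>i. norm (w $ i)" UNIV] by (simp add: norm_vec_def)
  finally show ?thesis .
qed

lemma norm_scale: "norm (a *s v) = cmod a * norm v" for v :: "complex^'i"
  by (simp add: norm_vec_def norm_mult L2_set_right_distrib)

lemma bounded_bilinear_cip: "bounded_bilinear (cip :: complex^'i \<Rightarrow> _)"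
proof
  show "\<exists>K. \<forall>a b :: complex^'i. norm (cip a b) \<le> norm a * norm b * K"
    using norm_cip_le by (metis mult.right_neutral)
qed (simp_all add: cip_add_left cip_add_right cip_scale_left cip_scale_right scaleR_as_scale
    scaleR_conv_of_real[where 'a=complex])

lemma bounded_bilinear_scale: "bounded_bilinear ((*s) :: complex \<Rightarrow> complex^'i \<Rightarrow> complex^'i)"
proof
  show "\<exists>K. \<forall>(a::complex) b::complex^'i. norm (a *s b) \<le> norm a * norm b * K"
    by (metis norm_scale mult.right_neutral order_refl)
qed (simp_all add: vec_eq_iff algebra_simps)

lemma bounded_bilinear_mv: "bounded_bilinear ((*v) :: complex^'i^'j \<Rightarrow> complex^'i \<Rightarrow> complex^'j)"
proof -
  have "bilinear ((*v) :: complex^'i^'j \<Rightarrow> complex^'i \<Rightarrow> complex^'j)"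
    unfolding bilinear_def
    by (auto intro!: linearI simp: matrix_vector_mult_add_rdistrib matrix_vector_right_distrib
        vec_eq_iff matrix_vector_mult_def scaleR_sum_right
        distrib_right sum.distrib)
  then show ?thesis by (simp add: bilinear_conv_bounded_bilinear)
qed

lemma borel_measurable_bilinear:
  fixes prod :: "'a::second_countable_topology \<Rightarrow> 'b::second_countable_topology \<Rightarrow> 'c::topological_space"
  assumes "continuous_on UNIV (\<lambda>p. prod (fst p) (snd p))" "f \<in> borel_measurable M" "g \<in> borel_measurable M"
  shows "(\<lambda>x. prod (f x) (g x)) \<in> borel_measurable M"
  using borel_measurable_continuous_Pair[OF assms(2,3), of prod] assms(1) by simp

lemma bounded_bilinear_measurable:
  fixes prod :: "'a::{second_countable_topology,real_normed_vector} \<Rightarrow> 'b::{second_countable_topology,real_normed_vector} \<Rightarrow> 'c::real_normed_vector"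
  assumes "bounded_bilinear prod" "f \<in> borel_measurable M" "g \<in> borel_measurable M"
  shows "(\<lambda>x. prod (f x) (g x)) \<in> borel_measurable M"
proof (rule borel_measurable_bilinear[OF _ assms(2,3)])
  show "continuous_on UNIV (\<lambda>p. prod (fst p) (snd p))"
    by (intro bounded_bilinear.continuous_on[OF assms(1)] continuous_intros)
qed

lemmas measurable_cip [measurable (raw)] = bounded_bilinear_measurable[OF bounded_bilinear_cip]
lemmas measurable_scale [measurable (raw)] = bounded_bilinear_measurable[OF bounded_bilinear_scale]
lemmas measurable_mv [measurable (raw)] = bounded_bilinear_measurable[OF bounded_bilinear_mv]

lemma L2_carr: "\<phi> \<in> carr (L2 M F) \<longleftrightarrow> \<phi> \<in> borel_measurable M \<and> integrable M (\<lambda>x. (norm (\<phi> x))\<^sup>2) \<and>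
    (\<forall>x\<in>space M. \<phi> x \<in> F)"
  by (simp add: L2_def)

lemma L2_vadd: "vadd (L2 M F) \<phi> \<psi> = (\<lambda>x. \<phi> x + \<psi> x)"
  and L2_vscale: "vscale (L2 M F) a \<phi> = (\<lambda>x. a *s \<phi> x)"
  and L2_ip: "ip (L2 M F) \<phi> \<psi> = (LINT x|M. cip (\<phi> x) (\<psi> x))"
  by (simp_all add: L2_def)

lemma square_integrable_bound:
  assumes "f \<in> borel_measurable M" "g \<in> carr (L2 M F)" "\<And>x. x \<in> space M \<Longrightarrow> norm (f x) \<le> C * norm (g x)"
  shows "integrable M (\<lambda>x. (norm (f x))\<^sup>2)"
proof (rule Bochner_Integration.integrable_bound)
  show "integrable M (\<lambda>x. C\<^sup>2 * (norm (g x))\<^sup>2)" using assms(2) by (simp add: L2_carr)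
  show "(\<lambda>x. (norm (f x))\<^sup>2) \<in> borel_measurable M" using assms(1) by measurable
  show "AE x in M. norm ((norm (f x))\<^sup>2) \<le> norm (C\<^sup>2 * (norm (g x))\<^sup>2)"
    using power_mono[OF assms(3), of _ 2] by (intro AE_I2) (simp add: power_mult_distrib)
qed

lemma integrable_cip:
  fixes F :: "(complex^'i) set"
  assumes "\<phi> \<in> carr (L2 M F)" "\<psi> \<in> carr (L2 M F')"
  shows "integrable M (\<lambda>x. cip (\<phi> x) (\<psi> x))"
proof (rule Bochner_Integration.integrable_bound)
  show "integrable M (\<lambda>x. (norm (\<phi> x))\<^sup>2 + (norm (\<psi> x))\<^sup>2)" using assms by (simp add: L2_carr)
  show "(\<lambda>x. cip (\<phi> x) (\<psi> x)) \<in> borel_measurable M"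
    using assms by (intro measurable_cip) (simp_all add: L2_carr)
  have "norm (cip v w) \<le> (norm v)\<^sup>2 + (norm w)\<^sup>2" for v w :: "complex^'i"
  proof -
    have "0 \<le> (norm v - norm w)\<^sup>2" "0 \<le> (norm v)\<^sup>2" "0 \<le> (norm w)\<^sup>2" by auto
    then show ?thesis using norm_cip_le[of v w] by (simp only: power2_diff)
  qed
  then show "AE x in M. norm (cip (\<phi> x) (\<psi> x)) \<le> norm ((norm (\<phi> x))\<^sup>2 + (norm (\<psi> x))\<^sup>2)" by simp
qed

lemma L2_vadd_closed:
  fixes F :: "(complex^'i) set"
  assumes "\<And>v w. v \<in> F \<Longrightarrow> w \<in> F \<Longrightarrow> v + w \<in> F" "\<phi> \<in> carr (L2 M F)" "\<psi> \<in> carr (L2 M F)"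
  shows "(\<lambda>x. \<phi> x + \<psi> x) \<in> carr (L2 M F)"
proof -
  have meas: "(\<lambda>x. \<phi> x + \<psi> x) \<in> borel_measurable M"
    using assms by (intro borel_measurable_add) (simp_all add: L2_carr)
  have "integrable M (\<lambda>x. (norm (\<phi> x + \<psi> x))\<^sup>2)"
  proof (rule Bochner_Integration.integrable_bound)
    show "integrable M (\<lambda>x. 2 * (norm (\<phi> x))\<^sup>2 + 2 * (norm (\<psi> x))\<^sup>2)" using assms by (simp add: L2_carr)
    have "(norm (v + w))\<^sup>2 \<le> 2 * (norm v)\<^sup>2 + 2 * (norm w)\<^sup>2" for v w :: "complex^'i"
    proof -
      have "(norm (v + w))\<^sup>2 \<le> (norm v + norm w)\<^sup>2" by (simp add: norm_triangle_ineq power_mono)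
      moreover have "0 \<le> (norm v - norm w)\<^sup>2" by auto
      ultimately show ?thesis by (simp only: power2_diff power2_sum)
    qed
    then show "AE x in M. norm ((norm (\<phi> x + \<psi> x))\<^sup>2) \<le> norm (2 * (norm (\<phi> x))\<^sup>2 + 2 * (norm (\<psi> x))\<^sup>2)"
      by simp
    show "(\<lambda>x. (norm (\<phi> x + \<psi> x))\<^sup>2) \<in> borel_measurable M"
      using meas by measurable
  qed
  then show ?thesis using assms meas by (simp add: L2_carr)
qed

lemma semi_ip_L2:
  assumes "\<And>v w. v \<in> F \<Longrightarrow> w \<in> F \<Longrightarrow> v + w \<in> F" "\<And>a v. v \<in> F \<Longrightarrow> a *s v \<in> F"
  shows "semi_ip (L2 M F)"
proof
  fix x y assume *: "x \<in> carr (L2 M F)" "y \<in> carr (L2 M F)"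
  show "vadd (L2 M F) x y \<in> carr (L2 M F)" using L2_vadd_closed[OF assms(1) *] by (simp add: L2_vadd)
  show "ip (L2 M F) y x = cnj (ip (L2 M F) x y)"
    unfolding L2_ip cip_cnj[of "y _" "x _"] by simp
next
  fix x a assume *: "x \<in> carr (L2 M F)"
  show "vscale (L2 M F) a x \<in> carr (L2 M F)"
    using * assms(2) measurable_scale[of "\<lambda>_. a" M x]
    by (simp add: L2_carr L2_vscale norm_scale power_mult_distrib)
  show "0 \<le> Re (ip (L2 M F) x x)" by (simp add: L2_ip cip_self del: of_real_power)
qed (simp_all add: L2_ip L2_vadd L2_vscale cip_add_right cip_scale_right integrable_cip)

lemma vdist_L2:
  "vdist (L2 M F) \<phi> \<psi> = sqrt (LINT x|M. (norm (\<phi> x - \<psi> x))\<^sup>2)"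
proof -
  have "\<phi> x + - 1 *s \<psi> x = \<phi> x - \<psi> x" for x by (simp add: vec_eq_iff)
  then show ?thesis
    by (simp add: vdist_def Let_def L2_ip L2_vadd L2_vscale cip_self del: of_real_power)
qed

section \<open>Smooth functions\<close>

lemma iter_deriv_cong:
  assumes "open V" "\<And>x. x \<in> V \<Longrightarrow> f x = g x"
  shows "x \<in> V \<Longrightarrow> iter_deriv vs f x = iter_deriv vs g x"
proof (induction vs arbitrary: x)
  case (Cons v vs)
  \<comment> \<open>\<open>frechet_derivative\<close> is a choice among all derivatives at the
    point, so equal sets of derivatives give equal values even where no derivative exists. The sets
    are equal because the functions agree on a neighbourhood.\<close>
  have "(iter_deriv vs f has_derivative L) (at x) \<longleftrightarrow> (iter_deriv vs g has_derivative L) (at x)" for L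
    using has_derivative_transform_within_open[OF _ assms(1) Cons.prems, of "iter_deriv vs f" L UNIV "iter_deriv vs g"]
      has_derivative_transform_within_open[OF _ assms(1) Cons.prems, of "iter_deriv vs g" L UNIV "iter_deriv vs f"]
      Cons.IH by metis
  then show ?case by (simp add: frechet_derivative_def)
qed (use assms in simp)

lemma smooth_on_cong:
  assumes "open V" "\<And>x. x \<in> V \<Longrightarrow> f x = g x" "smooth_on V f"
  shows "smooth_on V g"
  unfolding smooth_on_def
proof (intro allI ballI)
  fix vs x assume x: "x \<in> V"
  then have "iter_deriv vs f differentiable at x" using assms(3) by (simp add: smooth_on_def)
  then obtain L where "(iter_deriv vs f has_derivative L) (at x)" by (auto simp: differentiable_def)
  then have "(iter_deriv vs g has_derivative L) (at x)"
    by (rule has_derivative_transform_within_open[OF _ assms(1) x]) (rule iter_deriv_cong[OF assms(1,2)])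
  then show "iter_deriv vs g differentiable at x" by (auto simp: differentiable_def)
qed

lemma smooth_on_subset: "smooth_on V f \<Longrightarrow> W \<subseteq> V \<Longrightarrow> smooth_on W f"
  by (auto simp: smooth_on_def)

lemma smooth_on_Un: "smooth_on V f \<Longrightarrow> smooth_on W f \<Longrightarrow> smooth_on (V \<union> W) f"
  by (auto simp: smooth_on_def)

lemma smooth_on_iter_deriv: 
  assumes "smooth_on V f"
  shows "smooth_on V (iter_deriv vs f)"
proof -
  have "iter_deriv ws (iter_deriv vs f) = iter_deriv (ws @ vs) f" for ws
    by (induction ws) auto
  then show ?thesis using assms by (simp add: smooth_on_def)
qed

lemma smooth_on_frechet: "smooth_on V f \<Longrightarrow> smooth_on V (\<lambda>x. frechet_derivative f (at x) v)"
  using smooth_on_iter_deriv[of V f "[v]"] by simp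

lemma smooth_on_differentiable: "smooth_on V f \<Longrightarrow> x \<in> V \<Longrightarrow> f differentiable at x"
  unfolding smooth_on_def by (metis iter_deriv.simps(1))

lemma smooth_on_has_derivative:
  "smooth_on V f \<Longrightarrow> x \<in> V \<Longrightarrow> (f has_derivative frechet_derivative f (at x)) (at x)"
  using smooth_on_differentiable frechet_derivative_works by blast

lemma smooth_on_continuous: "smooth_on V f \<Longrightarrow> continuous_on V f"
  by (meson smooth_on_differentiable differentiable_imp_continuous_within continuous_at_imp_continuous_on)

text \<open>All smoothness proofs go through classes of functions closed under directional derivatives.\<close>

lemma smooth_on_class:
  assumes V: "open V" and f: "f \<in> \<F>"
    and d: "\<And>f v. f \<in> \<F> \<Longrightarrow> \<exists>g. (\<forall>x\<in>V. (f has_derivative (\<lambda>v. g v x)) (at x)) \<and> (\<forall>v. g v \<in> \<F>)"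
  shows "smooth_on V f"
proof -
  have *: "\<exists>g\<in>\<F>. \<forall>x\<in>V. iter_deriv vs f x = g x" for vs
  proof (induction vs)
    case (Cons v vs)
    then obtain g where g: "g \<in> \<F>" "\<And>x. x \<in> V \<Longrightarrow> iter_deriv vs f x = g x" by blast
    from d[OF g(1)] obtain h where h: "\<And>x. x \<in> V \<Longrightarrow> (g has_derivative (\<lambda>v. h v x)) (at x)"
      "\<And>v. h v \<in> \<F>" by blast
    have "frechet_derivative (iter_deriv vs f) (at x) v = h v x" if x: "x \<in> V" for x
    proof -
      have "(iter_deriv vs f has_derivative (\<lambda>v. h v x)) (at x)"
        by (rule has_derivative_transform_within_open[OF h(1)[OF x] V x]) (simp add: g)
      from frechet_derivative_at[OF this] show ?thesis by metis
    qed
    then show ?case using h(2) by auto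
  qed (use f in auto)
  show ?thesis unfolding smooth_on_def
  proof (intro allI ballI)
    fix vs x assume x: "x \<in> V"
    obtain g where g: "g \<in> \<F>" "\<And>x. x \<in> V \<Longrightarrow> iter_deriv vs f x = g x" using * by blast
    from d[OF g(1)] obtain L where "(g has_derivative L) (at x)" using x by blast
    then have "(iter_deriv vs f has_derivative L) (at x)"
      by (rule has_derivative_transform_within_open[OF _ V x]) (simp add: g)
    then show "iter_deriv vs f differentiable at x" by (auto simp: differentiable_def)
  qed
qed

lemma smooth_on_const: "smooth_on V (\<lambda>_. c)"
proof -
  have "smooth_on UNIV (\<lambda>_. c)"
    by (rule smooth_on_class[where \<F> = "{\<lambda>_. c, \<lambda>_. 0}"])
      (auto intro!: exI[of _ "\<lambda>_ _. 0"])
  then show ?thesis using smooth_on_subset by blast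
qed

lemma smooth_on_bounded_linear:
  assumes "bounded_linear f" shows "smooth_on V f"
proof -
  have "smooth_on UNIV f"
  proof (rule smooth_on_class[where \<F> = "insert f (range (\<lambda>c _. c))"])
    fix g assume "g \<in> insert f (range (\<lambda>c _. c))"
    then consider "g = f" | c where "g = (\<lambda>_. c)" by auto
    then show "\<exists>k. (\<forall>x\<in>UNIV. (g has_derivative (\<lambda>v. k v x)) (at x)) \<and> (\<forall>v. k v \<in> insert f (range (\<lambda>c _. c)))"
    proof cases
      case 1
      then show ?thesis
        by (intro exI[of _ "\<lambda>v _. f v"]) (auto intro: bounded_linear_imp_has_derivative assms)
    next
      case 2
      then show ?thesis by (intro exI[of _ "\<lambda>_ _. 0"]) auto
    qed
  qed auto
  then show ?thesis using smooth_on_subset by blast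
qed

text \<open>A derivative of a product is a sum of two products, so products alone are not closed
  under derivatives. Adding sums yields a class to which \<open>smooth_on_class\<close>
  applies.\<close>

inductive_set bilinear_span :: "('b \<Rightarrow> 'c \<Rightarrow> 'd::real_normed_vector) \<Rightarrow> ('a \<Rightarrow> 'b) set \<Rightarrow> ('a \<Rightarrow> 'c) set \<Rightarrow> ('a \<Rightarrow> 'd) set"
  for p F G where
    prod: "f \<in> F \<Longrightarrow> g \<in> G \<Longrightarrow> (\<lambda>x. p (f x) (g x)) \<in> bilinear_span p F G"
  | add: "h \<in> bilinear_span p F G \<Longrightarrow> k \<in> bilinear_span p F G \<Longrightarrow> (\<lambda>x. h x + k x) \<in> bilinear_span p F G"

lemma smooth_on_bilinear:
  assumes V: "open V" and p: "bounded_bilinear p" and f: "smooth_on V f" and g: "smooth_on V g"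
  shows "smooth_on V (\<lambda>x. p (f x) (g x))"
proof (rule smooth_on_class[OF V])
  let ?B = "bilinear_span p {f. smooth_on V f} {g. smooth_on V g}"
  show "(\<lambda>x. p (f x) (g x)) \<in> ?B" using f g by (auto intro: bilinear_span.prod)
  fix h assume "h \<in> ?B"
  then show "\<exists>k. (\<forall>x\<in>V. (h has_derivative (\<lambda>v. k v x)) (at x)) \<and> (\<forall>v. k v \<in> ?B)"
  proof induction
    case (prod f g)
    then have f: "smooth_on V f" and g: "smooth_on V g" by auto
    show ?case
    proof (intro exI conjI ballI allI)
      fix x assume "x \<in> V"
      then show "((\<lambda>x. p (f x) (g x)) has_derivative
          (\<lambda>v. p (f x) (frechet_derivative g (at x) v) + p (frechet_derivative f (at x) v) (g x))) (at x)"
        using bounded_bilinear.FDERIV[OF p smooth_on_has_derivative[OF f] smooth_on_has_derivative[OF g]]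
        by blast
    next
      fix v
      show "(\<lambda>x. p (f x) (frechet_derivative g (at x) v) + p (frechet_derivative f (at x) v) (g x)) \<in> ?B"
        using f g by (intro bilinear_span.intros) (auto intro: smooth_on_frechet)
    qed
  next
    case (add h k)
    then obtain h' k' where "\<And>x. x \<in> V \<Longrightarrow> (h has_derivative (\<lambda>v. h' v x)) (at x)" "\<And>v. h' v \<in> ?B"
      "\<And>x. x \<in> V \<Longrightarrow> (k has_derivative (\<lambda>v. k' v x)) (at x)" "\<And>v. k' v \<in> ?B" by metis
    then show ?case
      by (intro exI[of _ "\<lambda>v x. h' v x + k' v x"]) (auto intro: has_derivative_add bilinear_span.add)
  qed
qed

lemma smooth_on_add:
  assumes V: "open V" and f: "smooth_on V f" and g: "smooth_on V g"
  shows "smooth_on V (\<lambda>x. f x + g x)"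
proof (rule smooth_on_class[OF V, where \<F> = "{\<lambda>x. f x + g x | f g. smooth_on V f \<and> smooth_on V g}"])
  fix h assume "h \<in> {\<lambda>x. f x + g x | f g. smooth_on V f \<and> smooth_on V g}"
  then obtain f g where h: "h = (\<lambda>x. f x + g x)" "smooth_on V f" "smooth_on V g" by auto
  show "\<exists>k. (\<forall>x\<in>V. (h has_derivative (\<lambda>v. k v x)) (at x)) \<and>
      (\<forall>v. k v \<in> {\<lambda>x. f x + g x | f g. smooth_on V f \<and> smooth_on V g})"
  proof (intro exI conjI ballI allI)
    show "(h has_derivative (\<lambda>v. frechet_derivative f (at x) v + frechet_derivative g (at x) v)) (at x)"
      if "x \<in> V" for x
      unfolding h(1) by (intro has_derivative_add smooth_on_has_derivative[OF _ that] h)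
    show "(\<lambda>x. frechet_derivative f (at x) v + frechet_derivative g (at x) v)
        \<in> {\<lambda>x. f x + g x | f g. smooth_on V f \<and> smooth_on V g}" for v
      using smooth_on_frechet[OF h(2), of v] smooth_on_frechet[OF h(3), of v]
      by (intro CollectI exI[of _ "\<lambda>x. frechet_derivative f (at x) v"]
          exI[of _ "\<lambda>x. frechet_derivative g (at x) v"]) simp
  qed
qed (use f g in auto)

text \<open>Each derivative of t(\<rho> x) produces a scalar factor, the directional derivative of
  \<rho>, and these factors accumulate. The class closed under derivatives therefore consists of
  sums of q(x) t(\<rho> x) with smooth q; the coefficient 1 in the first claim of the proof places
  t(\<rho> x) in it.\<close>

lemma smooth_on_compose_real:
  fixes t :: "real \<Rightarrow> 'b::real_normed_vector" and \<rho> :: "'a::real_normed_vector \<Rightarrow> real"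
  assumes V: "open V" and t: "smooth_on I t" and \<rho>: "smooth_on V \<rho>" and I: "\<And>x. x \<in> V \<Longrightarrow> \<rho> x \<in> I"
  shows "smooth_on V (\<lambda>x. t (\<rho> x))"
proof -
  define G :: "('a \<Rightarrow> 'b) set" where "G = {\<lambda>x. t (\<rho> x) | t. smooth_on I t}"
  define F where "F = bilinear_span (*\<^sub>R) {q :: 'a \<Rightarrow> real. smooth_on V q} G"
  have "smooth_on V (\<lambda>x. 1 *\<^sub>R t (\<rho> x))"
  proof (rule smooth_on_class[OF V, where \<F> = F])
    show "(\<lambda>x. 1 *\<^sub>R t (\<rho> x)) \<in> F"
      unfolding F_def by (rule bilinear_span.prod[where f = "\<lambda>_. 1"]) (use t in \<open>auto simp: G_def intro: smooth_on_const\<close>)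
    fix h assume "h \<in> F"
    then show "\<exists>k. (\<forall>x\<in>V. (h has_derivative (\<lambda>v. k v x)) (at x)) \<and> (\<forall>v. k v \<in> F)"
      unfolding F_def
    proof induction
      case (prod q g)
      then obtain t where q: "smooth_on V q" and g: "g = (\<lambda>x. t (\<rho> x))" and t: "smooth_on I t" by (auto simp: G_def)
      let ?t' = "\<lambda>s. frechet_derivative t (at s) 1"
      show ?case
      proof (intro exI conjI ballI allI)
        fix x assume x: "x \<in> V"
        have "(g has_derivative (\<lambda>v. frechet_derivative t (at (\<rho> x)) (frechet_derivative \<rho> (at x) v))) (at x)"
          using diff_chain_at[OF smooth_on_has_derivative[OF \<rho> x] smooth_on_has_derivative[OF t I[OF x]]]
          by (simp add: g o_def)
        moreover define d where "d = ?t' (\<rho> x)"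
        have "frechet_derivative t (at (\<rho> x)) r = r *\<^sub>R d" for r
          unfolding d_def
          using linear_scale[OF has_derivative_linear[OF smooth_on_has_derivative[OF t I[OF x]]], of r 1]
          by (simp only: real_scaleR_def mult_1_right)
        ultimately have "(g has_derivative (\<lambda>v. frechet_derivative \<rho> (at x) v *\<^sub>R d)) (at x)" by simp
        from has_derivative_scaleR[OF smooth_on_has_derivative[OF q x] this]
        show "((\<lambda>x. q x *\<^sub>R g x) has_derivative
            (\<lambda>v. (q x * frechet_derivative \<rho> (at x) v) *\<^sub>R ?t' (\<rho> x) + frechet_derivative q (at x) v *\<^sub>R t (\<rho> x))) (at x)"
          by (simp add: g d_def)
      next
        fix v
        have "smooth_on V (\<lambda>x. q x * frechet_derivative \<rho> (at x) v)"
          by (rule smooth_on_bilinear[OF V bounded_bilinear_mult q smooth_on_frechet[OF \<rho>]])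
        then show "(\<lambda>x. (q x * frechet_derivative \<rho> (at x) v) *\<^sub>R ?t' (\<rho> x) + frechet_derivative q (at x) v *\<^sub>R t (\<rho> x))
            \<in> bilinear_span (*\<^sub>R) {q. smooth_on V q} G"
          using q t smooth_on_frechet[OF t, of 1]
          by (intro bilinear_span.intros) (auto simp: G_def intro: smooth_on_frechet)
      qed
    next
      case (add h k)
      then obtain h' k' where "\<And>x. x \<in> V \<Longrightarrow> (h has_derivative (\<lambda>v. h' v x)) (at x)"
        "\<And>v. h' v \<in> bilinear_span (*\<^sub>R) {q. smooth_on V q} G"
        "\<And>x. x \<in> V \<Longrightarrow> (k has_derivative (\<lambda>v. k' v x)) (at x)"
        "\<And>v. k' v \<in> bilinear_span (*\<^sub>R) {q. smooth_on V q} G" by metis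
      then show ?case
        by (intro exI[of _ "\<lambda>v x. h' v x + k' v x"]) (auto intro: has_derivative_add bilinear_span.add)
    qed
  qed
  then show ?thesis by simp
qed

section \<open>Elementary smooth functions: powers, the cosine and the norm\<close>

lemma smooth_on_powr: "smooth_on {0<..} (\<lambda>r::real. r powr a)"
proof (rule smooth_on_class[where \<F> = "{\<lambda>r. b * r powr a | a b. True}"])
  fix f :: "real \<Rightarrow> real" assume "f \<in> {\<lambda>r. b * r powr a | a b. True}"
  then obtain a b where f: "f = (\<lambda>r. b * r powr a)" by auto
  show "\<exists>g. (\<forall>x\<in>{0<..}. (f has_derivative (\<lambda>v. g v x)) (at x)) \<and> (\<forall>v. g v \<in> {\<lambda>r. b * r powr a | a b. True})"
  proof (intro exI conjI ballI allI)
    fix x :: real assume "x \<in> {0<..}"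
    then have "(f has_real_derivative b * (a * x powr (a - 1))) (at x)"
      unfolding f by (auto intro!: derivative_eq_intros)
    then show "(f has_derivative (\<lambda>v. (b * a * v) * x powr (a - 1))) (at x)"
      unfolding has_field_derivative_def by (rule has_derivative_eq_rhs) (simp add: fun_eq_iff)
  qed blast
next
  show "(\<lambda>r. r powr a) \<in> {\<lambda>r. b * r powr a | a b. True}"
    by (rule CollectI, rule exI[of _ a], rule exI[of _ 1]) simp
qed simp

lemma smooth_on_cos: "smooth_on V (\<lambda>s::real. cos (a * s))"
proof -
  have "smooth_on UNIV (\<lambda>s::real. cos (a * s))"
  proof (rule smooth_on_class[where \<F> = "{\<lambda>s. b * cos (a * s) + c * sin (a * s) | b c. True}"])
    show "(\<lambda>s::real. cos (a * s)) \<in> {\<lambda>s. b * cos (a * s) + c * sin (a * s) | b c. True}"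
      by (rule CollectI, rule exI[of _ 1], rule exI[of _ 0]) simp
    fix f :: "real \<Rightarrow> real" assume "f \<in> {\<lambda>s. b * cos (a * s) + c * sin (a * s) | b c. True}"
    then obtain b c where f: "f = (\<lambda>s. b * cos (a * s) + c * sin (a * s))" by auto
    show "\<exists>g. (\<forall>x\<in>UNIV. (f has_derivative (\<lambda>v. g v x)) (at x)) \<and>
        (\<forall>v. g v \<in> {\<lambda>s. b * cos (a * s) + c * sin (a * s) | b c. True})"
    proof (intro exI conjI ballI allI)
      fix x :: real
      show "(f has_derivative (\<lambda>v. (c * a * v) * cos (a * x) + (- b * a * v) * sin (a * x))) (at x)"
        unfolding f by (auto intro!: derivative_eq_intros simp: algebra_simps)
    qed blast
  qed simp
  then show ?thesis using smooth_on_subset by blast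
qed

text \<open>The function y \<bullet> y is bilinear, hence smooth, and positive off the origin. Its
  powers 1/2 and -1/2 are the norm and the inverse norm.\<close>

lemma smooth_on_norm_powr:
  fixes a :: real shows "smooth_on (- {0::'a::euclidean_space}) (\<lambda>y. (y \<bullet> y) powr a)"
proof (rule smooth_on_compose_real[where I = "{0<..}" and t = "\<lambda>r. r powr a"])
  show "smooth_on (- {0::'a}) (\<lambda>y. y \<bullet> y)"
    by (rule smooth_on_bilinear[OF _ bounded_bilinear_inner]) (auto intro: smooth_on_bounded_linear bounded_linear_ident)
qed (auto intro: smooth_on_powr)

lemma smooth_on_norm: "smooth_on (- {0::'a::euclidean_space}) norm"
  by (rule smooth_on_cong[OF _ _ smooth_on_norm_powr[of "1/2"]])
    (simp_all add: open_Compl powr_half_sqrt dot_square_norm)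

lemma smooth_on_inverse_norm: "smooth_on (- {0::'a::euclidean_space}) (\<lambda>y. inverse (norm y))"
  by (rule smooth_on_cong[OF _ _ smooth_on_norm_powr[of "-1/2"]])
    (simp_all add: open_Compl powr_half_sqrt dot_square_norm powr_minus[of _ "1/2"])

lemma smooth_on_normalize: "smooth_on (- {0::'a::euclidean_space}) (\<lambda>y. y /\<^sub>R norm y)"
  by (rule smooth_on_bilinear[OF _ bounded_bilinear_scaleR smooth_on_inverse_norm])
    (auto intro: smooth_on_bounded_linear bounded_linear_ident)

text \<open>Smoothness is a pointwise condition. It holds on V by assumption and off K because f
  vanishes on that open set, and the two sets cover the space.\<close>

lemma Cc_inf_extend:
  assumes V: "open V" and f: "smooth_on V f" and K: "compact K" "K \<subseteq> V" "\<And>x. x \<notin> K \<Longrightarrow> f x = 0"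
  shows "f \<in> Cc_inf UNIV"
proof -
  have "smooth_on (- K) f"
    by (rule smooth_on_cong[OF _ _ smooth_on_const[of "- K" 0]]) (use K compact_imp_closed in auto)
  moreover have "V \<union> - K = UNIV" using K(2) by auto
  ultimately have "smooth_on UNIV f" using smooth_on_Un[OF f, of "- K"] by simp
  then show ?thesis using K by (auto simp: Cc_inf_def)
qed

text \<open>Difference quotients have integral zero by translation invariance. The mean value
  inequality along v bounds them by B, and they vanish outside a fixed ball, so dominated
  convergence carries the result over to the derivative.\<close>

lemma integral_directional_derivative:
  fixes g :: "'a::euclidean_space \<Rightarrow> 'b::{banach, second_countable_topology}"
  assumes d: "\<And>y. g differentiable at y" and K: "compact K" "\<And>y. y \<notin> K \<Longrightarrow> g y = 0"
    and B: "\<And>y. norm (frechet_derivative g (at y) v) \<le> B"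
  shows "integrable lborel (\<lambda>y. frechet_derivative g (at y) v)"
    and "(LINT y|lborel. frechet_derivative g (at y) v) = 0"
proof -
  define h where "h n = inverse (real (Suc n))" for n
  define q where "q n y = (g (y + h n *\<^sub>R v) - g y) /\<^sub>R h n" for n y
  have h: "0 < h n" "h n \<le> 1" for n by (auto simp: h_def field_simps)
  have hlim: "h \<longlonglongrightarrow> 0" unfolding h_def by (rule LIMSEQ_inverse_real_of_nat)
  have gd: "(g has_derivative frechet_derivative g (at y)) (at y)" for y
    using d frechet_derivative_works by blast
  have cont: "continuous_on UNIV g"
    using d differentiable_imp_continuous_within continuous_at_imp_continuous_on by blast
  have line: "((\<lambda>t. g (y + t *\<^sub>R v)) has_derivative (\<lambda>r. r *\<^sub>R frechet_derivative g (at (y + t *\<^sub>R v)) v)) (at t)"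
    for y and t :: real
  proof -
    have "((\<lambda>t. y + t *\<^sub>R v) has_derivative (\<lambda>r. r *\<^sub>R v)) (at t)"
      by (auto intro!: derivative_eq_intros)
    from diff_chain_at[OF this gd[of "y + t *\<^sub>R v"]]
    show ?thesis using linear_scale[OF has_derivative_linear[OF gd]] by (simp add: o_def)
  qed
  have qB: "norm (q n y) \<le> B" for n y
  proof -
    have "norm ((\<lambda>t. g (y + t *\<^sub>R v)) (h n) - (\<lambda>t. g (y + t *\<^sub>R v)) 0) \<le> B * norm (h n - 0)"
    proof (rule differentiable_bound[of UNIV])
      show "((\<lambda>t. g (y + t *\<^sub>R v)) has_derivative (\<lambda>r. r *\<^sub>R frechet_derivative g (at (y + t *\<^sub>R v)) v)) (at t within UNIV)" for t
        using line by simp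
      show "onorm (\<lambda>r. r *\<^sub>R frechet_derivative g (at (y + t *\<^sub>R v)) v) \<le> B" for t :: real
      proof (rule onorm_le)
        show "norm (r *\<^sub>R frechet_derivative g (at (y + t *\<^sub>R v)) v) \<le> B * norm r" for r
          using mult_right_mono[OF B[of "y + t *\<^sub>R v"], of "norm r"] by (simp add: mult.commute)
      qed
    qed auto
    moreover have "norm (q n y) = norm (g (y + h n *\<^sub>R v) - g y) / h n"
      using h[of n] by (simp add: q_def divide_inverse_commute)
    ultimately show ?thesis using h[of n] by (simp add: divide_le_eq)
  qed
  have qlim: "(\<lambda>n. q n y) \<longlonglongrightarrow> frechet_derivative g (at y) v" for y
  proof -
    let ?D = "frechet_derivative g (at y) v"
    have "((\<lambda>k. norm (g (y + k *\<^sub>R v) - g y - k *\<^sub>R ?D) / norm k) \<longlongrightarrow> 0) (at 0)"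
      using line[of y 0] unfolding has_derivative_at by simp
    moreover have eq: "norm (w /\<^sub>R norm k) = norm w / norm k" for w :: 'b and k :: real
      by (simp add: divide_inverse_commute)
    ultimately have "((\<lambda>k. norm ((g (y + k *\<^sub>R v) - g y - k *\<^sub>R ?D) /\<^sub>R norm k)) \<longlongrightarrow> 0) (at 0)"
      by (simp only: eq)
    then have "((\<lambda>k. (g (y + k *\<^sub>R v) - g y - k *\<^sub>R ?D) /\<^sub>R norm k) \<longlongrightarrow> 0) (at 0)"
      by (rule tendsto_norm_zero_cancel)
    moreover have "filterlim h (at 0) sequentially"
      using hlim h by (simp add: filterlim_at less_imp_neq[symmetric])
    ultimately have "(\<lambda>n. (g (y + h n *\<^sub>R v) - g y - h n *\<^sub>R ?D) /\<^sub>R norm (h n)) \<longlonglongrightarrow> 0"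
      by (rule filterlim_compose)
    moreover have "(g (y + h n *\<^sub>R v) - g y - h n *\<^sub>R ?D) /\<^sub>R norm (h n) = q n y - ?D" for n
      using h[of n] by (simp add: q_def scaleR_diff_right)
    ultimately have "(\<lambda>n. q n y - ?D) \<longlonglongrightarrow> 0" by simp
    then show ?thesis by (rule LIM_zero_cancel)
  qed
  obtain R where R: "\<And>y. y \<in> K \<Longrightarrow> norm y \<le> R" using compact_imp_bounded[OF K(1)] bounded_iff by blast
  have gint: "integrable lborel g"
  proof -
    have "integrable lborel (\<lambda>x. indicator K x *\<^sub>R g x)"
      by (rule borel_integrable_compact[OF K(1)]) (use cont continuous_on_subset in blast)
    moreover have "(\<lambda>x. indicator K x *\<^sub>R g x) = g" using K(2) by (auto simp: indicator_def fun_eq_iff)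
    ultimately show ?thesis by simp
  qed
  have gm [measurable]: "g \<in> borel_measurable borel" using cont by (rule borel_measurable_continuous_onI)
  have trans: "integrable lborel (\<lambda>y. g (c + y))" "(LINT y|lborel. g (c + y)) = (LINT y|lborel. g y)" for c :: 'a
  proof -
    have "integrable (distr lborel borel ((+) c)) g" using gint by (simp add: lborel_distr_plus)
    then show "integrable lborel (\<lambda>y. g (c + y))" by (subst (asm) integrable_distr_eq) auto
    have "(LINT y|distr lborel borel ((+) c). g y) = (LINT y|lborel. g (c + y))"
      by (subst integral_distr) auto
    then show "(LINT y|lborel. g (c + y)) = (LINT y|lborel. g y)" by (simp add: lborel_distr_plus)
  qed
  have q0: "(LINT y|lborel. q n y) = 0" for n
    unfolding q_def add.commute[of _ "h n *\<^sub>R v"] using trans gint by (simp add: Bochner_Integration.integral_diff)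
  have B0: "0 \<le> B" using B[of 0] norm_ge_zero order_trans by blast
  \<comment> \<open>The dominating function: steps \<open>h n\<close> of size at most 1 move the
    support by at most norm v.\<close>
  define w where "w y = indicator (cball 0 (R + norm v)) y *\<^sub>R B" for y :: 'a
  have w: "integrable lborel w"
    unfolding w_def by (rule borel_integrable_compact) auto
  have qw: "norm (q n y) \<le> w y" for n y
  proof (cases "norm y \<le> R + norm v")
    case True then show ?thesis using qB by (simp add: w_def)
  next
    case False
    have "norm (h n *\<^sub>R v) \<le> norm v" using h[of n] by (simp add: mult_left_le_one_le)
    then have "norm y - norm v \<le> norm (y + h n *\<^sub>R v)"
      using norm_triangle_ineq4[of "y + h n *\<^sub>R v" "h n *\<^sub>R v"] by simp
    then have "g (y + h n *\<^sub>R v) = 0" "g y = 0"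
      using False R K(2) by (smt (verit) norm_ge_zero)+
    then show ?thesis using B0 by (simp add: q_def w_def)
  qed
  have qm: "q n \<in> borel_measurable lborel" for n unfolding q_def by measurable
  have fm: "(\<lambda>y. frechet_derivative g (at y) v) \<in> borel_measurable lborel"
    by (rule borel_measurable_LIMSEQ_metric[OF qm]) (rule qlim)
  show "integrable lborel (\<lambda>y. frechet_derivative g (at y) v)"
    by (rule integrable_dominated_convergence[OF fm _ w, of q]) (use qm in \<open>simp_all add: qlim qw\<close>)
  have "(\<lambda>n. LINT y|lborel. q n y) \<longlonglongrightarrow> (LINT y|lborel. frechet_derivative g (at y) v)"
    by (rule integral_dominated_convergence[OF fm qm w]) (simp_all add: qlim qw)
  then show "(LINT y|lborel. frechet_derivative g (at y) v) = 0"
    unfolding q0 by (rule LIMSEQ_unique) (rule tendsto_const)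
qed

section \<open>Polar coordinates\<close>

lemma space_sphere_measure: "space sphere_measure = sphere 0 1"
  by (simp add: sphere_measure_def space_scale_measure space_restrict_space)

lemma sets_sphere_measure: "sets sphere_measure = sets (restrict_space borel (sphere 0 1))"
  by (simp add: sphere_measure_def)

text \<open>The radius b is kept variable because homogeneity of Lebesgue measure in b is what
  produces the radial density r^n.\<close>

definition cone :: "(real^'m) set \<Rightarrow> real \<Rightarrow> (real^'m) set" where
  "cone A b = {y. y \<noteq> 0 \<and> norm y < b \<and> y /\<^sub>R norm y \<in> A}"

lemma measurable_normalize: "(\<lambda>x::real^'m. x /\<^sub>R norm x) \<in> borel_measurable borel"
  by measurable

lemma sets_cone:
  assumes "A \<in> sets (sphere_measure :: (real^'m) measure)"
  shows "cone A b \<in> sets (borel :: (real^'m) measure)"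
proof -
  obtain A' :: "(real^'m) set" where A': "A' \<in> sets borel" "A = sphere 0 1 \<inter> A'"
    using assms unfolding sets_sphere_measure sets_restrict_space by auto
  have "cone A b = (- {0} \<inter> ball 0 b) \<inter> ((\<lambda>x. x /\<^sub>R norm x) -` A' \<inter> space borel)"
    by (auto simp: cone_def A')
  also have "\<dots> \<in> sets borel"
    using measurable_sets[OF measurable_normalize A'(1)] by (intro sets.Int[of _ borel]) auto
  finally show ?thesis .
qed

lemma emeasure_sphere_measure:
  assumes "A \<in> sets (sphere_measure :: (real^'m) measure)"
  shows "emeasure sphere_measure A = ennreal (real CARD('m)) * emeasure lborel (cone A 1)"
proof -
  have m: "(\<lambda>x::real^'m. x /\<^sub>R norm x)
      \<in> restrict_space lborel (ball 0 1 - {0}) \<rightarrow>\<^sub>M restrict_space borel (sphere 0 1)"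
    by (rule measurable_restrict_space2) (auto simp: space_restrict_space intro!: measurable_restrict_space1)
  have "(\<lambda>x::real^'m. x /\<^sub>R norm x) -` A \<inter> (ball 0 1 - {0}) = cone A 1"
    by (auto simp: cone_def)
  then show ?thesis
    using assms unfolding sphere_measure_def sets_scale_measure
    by (simp add: emeasure_distr[OF m] space_restrict_space)
      (subst emeasure_restrict_space, auto simp: cone_def)
qed

lemma emeasure_cone:
  assumes A: "A \<in> sets (sphere_measure :: (real^'m) measure)" and b: "b > 0"
  shows "emeasure lborel (cone A b) = ennreal (b ^ CARD('m)) * emeasure lborel (cone A 1)"
proof -
  have "emeasure lborel (cone A b)
      = emeasure (density (distr lborel borel (\<lambda>x. 0 + b *\<^sub>R x)) (\<lambda>_. \<bar>b\<bar> ^ DIM(real^'m))) (cone A b)"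
    using lborel_affine[of b "0 :: real^'m"] b by simp
  also have "\<dots> = ennreal (b ^ CARD('m)) * emeasure lborel ((\<lambda>x. b *\<^sub>R x) -` cone A b)"
    using sets_cone[OF A, of b] b by (simp add: emeasure_density_const emeasure_distr)
  also have "(\<lambda>x. b *\<^sub>R x) -` cone A b = cone A 1"
    using b by (auto simp: cone_def abs_mult field_simps)
  finally show ?thesis .
qed

lemma nn_integral_power_Ioo:
  assumes "0 \<le> b" shows "(\<integral>\<^sup>+r. ennreal (r ^ n) * indicator {0<..<b} r \<partial>lborel) = ennreal (b ^ Suc n / real (Suc n))"
proof -
  have "(\<integral>\<^sup>+r. ennreal (r ^ n) * indicator {0<..<b} r \<partial>lborel) = (\<integral>\<^sup>+r. ennreal (r ^ n) * indicator {0..b} r \<partial>lborel)"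
  proof (rule nn_integral_cong_AE)
    show "AE r in lborel. ennreal (r ^ n) * indicator {0<..<b} r = ennreal (r ^ n) * indicator {0..b} r"
      using AE_lborel_singleton[of 0] AE_lborel_singleton[of b] by eventually_elim (auto simp: indicator_def)
  qed
  also have "\<dots> = ennreal (b ^ Suc n / real (Suc n) - 0 ^ Suc n / real (Suc n))"
    by (rule nn_integral_FTC_Icc) (use assms in \<open>auto intro!: derivative_eq_intros simp del: power_Suc\<close>)
  finally show ?thesis by simp
qed

text \<open>Let V be the volume of the unit cone over A, m the dimension and b the number x cut to
  [0, 2]. Both measures give the half line below x the mass V b^m: the left one by scaling of cones,
  the right one by integrating r^(m-1), where the factor m of \<open>sphere_measure\<close> cancels
  the 1/m. Radius 2 is large enough because the shell has outer radius 1 + \<epsilon> < 2.\<close>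

lemma radial_measure:
  assumes A: "A \<in> sets (sphere_measure :: (real^'m) measure)"
  shows "distr (density lborel (indicator (cone A 2))) borel norm
    = density lborel (\<lambda>r. emeasure sphere_measure A * (ennreal (r ^ (CARD('m) - 1)) * indicator {0<..<2} r))"
    (is "?L = ?R")
proof -
  let ?V = "emeasure lborel (cone A 1)"
  have n: "Suc (CARD('m) - 1) = CARD('m)" by simp
  have [measurable]: "cone A b \<in> sets borel" for b using sets_cone[OF A] .
  have L: "emeasure ?L {..<x} = ennreal ((max 0 (min x 2)) ^ CARD('m)) * ?V" for x
  proof -
    have "emeasure ?L {..<x} = emeasure lborel (cone A 2 \<inter> norm -` {..<x})"
    proof -
      have nb: "norm -` {..<x} = ball (0::real^'m) x" by auto
      have "emeasure ?L {..<x} = emeasure (density lborel (indicator (cone A 2))) (norm -` {..<x})"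
        by (subst emeasure_distr) auto
      also have "\<dots> = (\<integral>\<^sup>+y. indicator (cone A 2) y * indicator (norm -` {..<x}) y \<partial>lborel)"
        unfolding nb by (rule emeasure_density) auto
      also have "\<dots> = (\<integral>\<^sup>+y. indicator (cone A 2 \<inter> norm -` {..<x}) y \<partial>lborel)"
        by (rule nn_integral_cong) (simp add: indicator_inter_arith)
      also have "\<dots> = emeasure lborel (cone A 2 \<inter> norm -` {..<x})"
        unfolding nb by (intro nn_integral_indicator) auto
      finally show ?thesis .
    qed
    also have "cone A 2 \<inter> norm -` {..<x} = cone A (min x 2)" by (auto simp: cone_def)
    also have "emeasure lborel (cone A (min x 2)) = ennreal ((max 0 (min x 2)) ^ CARD('m)) * ?V"
    proof (cases "min x 2 > 0")
      case True then show ?thesis using emeasure_cone[OF A True] by simp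
    next
      case False
      then have "cone A (min x 2) = {}" by (auto simp: cone_def) (meson norm_ge_zero not_less order_trans less_imp_le)+
      then show ?thesis using False by (simp add: max_def)
    qed
    finally show ?thesis .
  qed
  have R: "emeasure ?R {..<x} = ennreal ((max 0 (min x 2)) ^ CARD('m)) * ?V" for x
  proof -
    let ?b = "max 0 (min x 2)"
    have "emeasure ?R {..<x} = (\<integral>\<^sup>+r. emeasure sphere_measure A * (ennreal (r ^ (CARD('m) - 1)) * indicator {0<..<2} r) * indicator {..<x} r \<partial>lborel)"
      by (simp add: emeasure_density)
    also have "\<dots> = (\<integral>\<^sup>+r. emeasure sphere_measure A * (ennreal (r ^ (CARD('m) - 1)) * indicator {0<..<?b} r) \<partial>lborel)"
      by (rule nn_integral_cong) (auto simp: indicator_def)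
    also have "\<dots> = emeasure sphere_measure A * ennreal (?b ^ CARD('m) / real CARD('m))"
      using nn_integral_power_Ioo[of ?b "CARD('m) - 1"] by (simp add: nn_integral_cmult n del: power_Suc)
    also have "\<dots> = ennreal (real CARD('m)) * ennreal (?b ^ CARD('m) / real CARD('m)) * ?V"
      by (simp add: emeasure_sphere_measure[OF A] mult_ac)
    also have "ennreal (real CARD('m)) * ennreal (?b ^ CARD('m) / real CARD('m)) = ennreal (?b ^ CARD('m))"
      by (simp add: ennreal_mult[symmetric])
    finally show ?thesis .
  qed
  have Vfin: "?V < \<infinity>"
  proof -
    have "?V \<le> emeasure lborel (ball 0 1 :: (real^'m) set)"
      by (rule emeasure_mono) (auto simp: cone_def)
    also have "\<dots> < \<infinity>" using emeasure_lborel_ball_finite by (simp add: less_top)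
    finally show ?thesis .
  qed
  show ?thesis
  proof (rule measure_eqI_generator_eq[where E = "range lessThan" and \<Omega> = UNIV and A = "\<lambda>i. {..<real i}"])
    show "Int_stable (range (lessThan :: real \<Rightarrow> _))"
      unfolding Int_stable_def
    proof (intro ballI)
      fix S T :: "real set" assume "S \<in> range lessThan" "T \<in> range lessThan"
      then obtain a b where "S = {..<a}" "T = {..<b}" by auto
      then have "S \<inter> T = {..<min a b}" by auto
      then show "S \<inter> T \<in> range lessThan" by blast
    qed
    show "sets ?L = sigma_sets UNIV (range lessThan)" "sets ?R = sigma_sets UNIV (range lessThan)"
      by (simp_all add: borel_Iio)
    show "(\<Union>i. {..<real i}) = UNIV" using reals_Archimedean2 by auto
    show "emeasure ?L {..<real i} \<noteq> \<infinity>" for i unfolding L using Vfin by (simp add: ennreal_mult_eq_top_iff)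
    show "emeasure ?L X = emeasure ?R X" if X: "X \<in> range lessThan" for X
    proof -
      obtain x :: real where "X = {..<x}" using X by (elim rangeE)
      then show ?thesis by (simp only: L R)
    qed
  qed auto
qed

section \<open>The collar and the shell as measure spaces\<close>

definition collar_measure :: "real \<Rightarrow> ((real^'m) \<times> real) measure" where
  "collar_measure \<epsilon> = sphere_measure \<Otimes>\<^sub>M restrict_space lborel {-\<epsilon><..<\<epsilon>}"

definition shell :: "real \<Rightarrow> (real^'m) set" where
  "shell \<epsilon> = {y. 1 - \<epsilon> < norm y \<and> norm y < 1 + \<epsilon>}"

text \<open>An explicit inverse of \<open>immersion\<close> on the shell, which replaces the
  \<open>inv_into\<close> in the inner product of the module.\<close>

definition polar :: "real^'m \<Rightarrow> (real^'m) \<times> real" where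
  "polar y = (y /\<^sub>R norm y, norm y - 1)"

lemma space_collar_measure: "space (collar_measure \<epsilon>) = collar \<epsilon>"
  by (simp add: collar_measure_def space_pair_measure space_sphere_measure space_restrict_space collar_def)

lemma open_shell: "open (shell \<epsilon>)"
  unfolding shell_def by (intro open_Collect_conj open_Collect_less continuous_intros)

lemma shell_measurable [measurable]: "shell \<epsilon> \<in> sets borel"
  by (rule borel_open) (rule open_shell)

lemma shell_nonzero: "\<epsilon> < 1 \<Longrightarrow> y \<in> shell \<epsilon> \<Longrightarrow> y \<noteq> 0 \<and> norm y > 0"
  by (auto simp: shell_def)

lemma polar_collar: "\<epsilon> < 1 \<Longrightarrow> y \<in> shell \<epsilon> \<Longrightarrow> polar y \<in> collar \<epsilon>"
  using shell_nonzero[of \<epsilon> y] by (auto simp: shell_def polar_def collar_def)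

lemma immersion_polar: "\<epsilon> < 1 \<Longrightarrow> y \<in> shell \<epsilon> \<Longrightarrow> immersion (polar y) = y"
  using shell_nonzero[of \<epsilon> y] by (auto simp: polar_def immersion_def)

lemma immersion_shell: "\<epsilon> < 1 \<Longrightarrow> p \<in> collar \<epsilon> \<Longrightarrow> immersion p \<in> shell \<epsilon>"
  by (auto simp: shell_def immersion_def collar_def)

lemma polar_immersion: "\<epsilon> < 1 \<Longrightarrow> p \<in> collar \<epsilon> \<Longrightarrow> polar (immersion p) = p"
  by (cases p) (auto simp: polar_def immersion_def collar_def)

lemma immersion_image: "\<epsilon> < 1 \<Longrightarrow> immersion ` collar \<epsilon> = shell \<epsilon>"
  using immersion_shell immersion_polar[of \<epsilon>, symmetric] polar_collar[of \<epsilon>] by blast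

lemma immersion_inv_polar: "\<epsilon> < 1 \<Longrightarrow> y \<in> shell \<epsilon> \<Longrightarrow> immersion_inv \<epsilon> y = polar y"
  unfolding immersion_inv_def
  by (rule inv_into_f_eq) (auto simp: polar_collar immersion_polar intro!: inj_on_inverseI[of _ polar] polar_immersion)

lemma polar_measurable:
  "polar \<in> restrict_space borel (shell \<epsilon>) \<rightarrow>\<^sub>M (collar_measure \<epsilon> :: ((real^'m) \<times> real) measure)" if "\<epsilon> < 1"
  unfolding collar_measure_def polar_def
proof (rule measurable_Pair)
  show "(\<lambda>y::real^'m. y /\<^sub>R norm y) \<in> restrict_space borel (shell \<epsilon>) \<rightarrow>\<^sub>M sphere_measure"
    by (subst measurable_cong_sets[OF refl sets_sphere_measure], intro measurable_restrict_space2)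
      (auto simp: space_restrict_space intro!: measurable_restrict_space1 dest!: shell_nonzero[OF that])
  show "(\<lambda>y::real^'m. norm y - 1) \<in> restrict_space borel (shell \<epsilon>) \<rightarrow>\<^sub>M restrict_space lborel {- \<epsilon><..<\<epsilon>}"
    by (intro measurable_restrict_space2)
      (auto simp: space_restrict_space shell_def intro!: measurable_restrict_space1)
qed


lemma emeasure_sphere_measure_finite: "emeasure (sphere_measure :: (real^'m) measure) A < \<infinity>"
proof -
  have "emeasure (sphere_measure :: (real^'m) measure) A \<le> emeasure sphere_measure (sphere 0 1 :: (real^'m) set)"
    using emeasure_space[of sphere_measure A] by (simp add: space_sphere_measure)
  also have "\<dots> = ennreal (real CARD('m)) * emeasure lborel (cone (sphere 0 1 :: (real^'m) set) 1)"
    by (rule emeasure_sphere_measure) (metis sets.top space_sphere_measure)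
  moreover have "emeasure lborel (cone (sphere 0 1 :: (real^'m) set) 1) < \<infinity>"
  proof -
    have "emeasure lborel (cone (sphere 0 1 :: (real^'m) set) 1) \<le> emeasure lborel (ball 0 1 :: (real^'m) set)"
      by (rule emeasure_mono) (auto simp: cone_def)
    also have "\<dots> < \<infinity>" using emeasure_lborel_ball_finite by (simp add: less_top)
    finally show ?thesis .
  qed
  ultimately show ?thesis by (auto simp: ennreal_mult_less_top intro: le_less_trans)
qed

lemma finite_sphere_measure: "finite_measure sphere_measure"
  by (rule finite_measureI) (metis emeasure_sphere_measure_finite less_irrefl)

lemma finite_interval_measure: "finite_measure (restrict_space lborel {-\<epsilon><..<\<epsilon>::real})"
  by (rule finite_measureI, cases "\<epsilon> \<ge> 0") (simp_all add: emeasure_restrict_space space_restrict_space)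

text \<open>By uniqueness of product measures it suffices to compare rectangles. The preimage of a
  rectangle is a piece of the cone over A, so \<open>radial_measure\<close> leaves one radial
  integral, in which r^n and its inverse cancel.\<close>

lemma collar_measure_eq:
  assumes \<epsilon>: "\<epsilon> < 1"
  shows "(collar_measure \<epsilon> :: ((real^'m) \<times> real) measure)
    = distr (density (restrict_space lborel (shell \<epsilon>)) (\<lambda>y. ennreal (inverse (norm y ^ (CARD('m) - 1)))))
        (collar_measure \<epsilon>) polar" (is "_ = distr ?M _ _")
proof -
  let ?n = "CARD('m) - 1"
  have pm: "polar \<in> ?M \<rightarrow>\<^sub>M (collar_measure \<epsilon> :: ((real^'m) \<times> real) measure)"
    using polar_measurable[OF \<epsilon>] by (simp add: measurable_cong_sets[OF sets_restrict_space_cong[OF sets_lborel]])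
  have "sphere_measure \<Otimes>\<^sub>M restrict_space lborel {-\<epsilon><..<\<epsilon>} = distr ?M (collar_measure \<epsilon>) polar"
  proof (rule pair_measure_eqI)
    show "sigma_finite_measure (sphere_measure :: (real^'m) measure)"
      using finite_sphere_measure finite_measure.axioms(1) by blast
    show "sigma_finite_measure (restrict_space lborel {-\<epsilon><..<\<epsilon>})"
      using finite_interval_measure finite_measure.axioms(1) by blast
    show "sets (sphere_measure \<Otimes>\<^sub>M restrict_space lborel {-\<epsilon><..<\<epsilon>}) = sets (distr ?M (collar_measure \<epsilon>) polar)"
      by (simp add: collar_measure_def)
  next
    fix A :: "(real^'m) set" and B
    assume A: "A \<in> sets sphere_measure" and B: "B \<in> sets (restrict_space lborel {-\<epsilon><..<\<epsilon>})"
    have [measurable]: "B \<in> sets borel" and B': "B \<subseteq> {-\<epsilon><..<\<epsilon>}"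
      using B by (auto simp: sets_restrict_space_iff)
    have [measurable]: "cone A 2 \<in> sets borel" using sets_cone[OF A] .
    have AB: "A \<times> B \<in> sets (collar_measure \<epsilon>)" using A B by (simp add: collar_measure_def)
    define g where "g r = ennreal (inverse (r ^ ?n)) * indicator B (r - 1)" for r :: real
    have [measurable]: "g \<in> borel_measurable borel" unfolding g_def by measurable
    have "polar -` (A \<times> B) \<inter> shell \<epsilon> \<in> sets (restrict_space lborel (shell \<epsilon>))"
      using measurable_sets[OF pm AB] by (simp add: space_restrict_space)
    then have [measurable]: "polar -` (A \<times> B) \<inter> shell \<epsilon> \<in> sets borel"
      by (auto simp: sets_restrict_space)
    have "emeasure (distr ?M (collar_measure \<epsilon>) polar) (A \<times> B)
        = emeasure ?M (polar -` (A \<times> B) \<inter> shell \<epsilon>)"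
      by (subst emeasure_distr[OF pm AB]) (simp add: space_restrict_space)
    also have "\<dots> = (\<integral>\<^sup>+y. ennreal (inverse (norm y ^ ?n)) * indicator (polar -` (A \<times> B) \<inter> shell \<epsilon>) y
        \<partial>restrict_space lborel (shell \<epsilon>))"
      by (rule emeasure_density) (auto intro: measurable_restrict_space1 simp: sets_restrict_space_iff)
    also have "\<dots> = (\<integral>\<^sup>+y. ennreal (inverse (norm y ^ ?n)) * indicator (polar -` (A \<times> B) \<inter> shell \<epsilon>) y
        * indicator (shell \<epsilon>) y \<partial>lborel)"
      by (rule nn_integral_restrict_space) simp
    \<comment> \<open>The cone conditions y \<noteq> 0 and norm y < 2 follow from norm y - 1 \<in>
      B, since B lies in (-\<epsilon>, \<epsilon>) and \<epsilon> < 1.\<close>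
    also have "\<dots> = (\<integral>\<^sup>+y. indicator (cone A 2) y * g (norm y) \<partial>lborel)"
    proof (rule nn_integral_cong)
      fix y :: "real^'m"
      show "ennreal (inverse (norm y ^ ?n)) * indicator (polar -` (A \<times> B) \<inter> shell \<epsilon>) y * indicator (shell \<epsilon>) y
          = indicator (cone A 2) y * g (norm y)"
        using B' \<epsilon> by (auto simp: g_def indicator_def polar_def cone_def shell_def)
    qed
    also have "\<dots> = (\<integral>\<^sup>+y. g (norm y) \<partial>density lborel (indicator (cone A 2)))"
      by (subst nn_integral_density) auto
    also have "\<dots> = (\<integral>\<^sup>+r. g r \<partial>distr (density lborel (indicator (cone A 2))) borel norm)"
      by (subst nn_integral_distr) auto
    also have "\<dots> = (\<integral>\<^sup>+r. emeasure sphere_measure A * (ennreal (r ^ ?n) * indicator {0<..<2} r) * g r \<partial>lborel)"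
      unfolding radial_measure[OF A] by (subst nn_integral_density) auto
    also have "\<dots> = (\<integral>\<^sup>+r. emeasure sphere_measure A * indicator B (r - 1) \<partial>lborel)"
    proof (rule nn_integral_cong)
      fix r :: real
      have "ennreal (r ^ ?n) * ennreal (inverse (r ^ ?n)) = 1" if "r > 0"
        using that by (simp add: ennreal_mult[symmetric])
      then show "emeasure sphere_measure A * (ennreal (r ^ ?n) * indicator {0<..<2} r) * g r
          = emeasure sphere_measure A * indicator B (r - 1)"
        using B' \<epsilon> by (auto simp: g_def indicator_def mult.assoc)
    qed
    also have "\<dots> = emeasure sphere_measure A * (\<integral>\<^sup>+r. indicator B (r - 1) \<partial>lborel)"
      by (rule nn_integral_cmult) simp
    also have "(\<integral>\<^sup>+r. indicator B (r - 1) \<partial>lborel) = (\<integral>\<^sup>+r. indicator B r \<partial>lborel)"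
      using nn_integral_real_affine[of "indicator B" 1 "-1"] by simp
    also have "\<dots> = emeasure lborel B" by simp
    finally show "emeasure sphere_measure A * emeasure (restrict_space lborel {-\<epsilon><..<\<epsilon>}) B
        = emeasure (distr ?M (collar_measure \<epsilon>) polar) (A \<times> B)"
      using B' by (simp add: emeasure_restrict_space)
  qed
  then show ?thesis by (simp add: collar_measure_def)
qed

lemma
  fixes g :: "(real^'m) \<times> real \<Rightarrow> 'b::{banach, second_countable_topology}"
  assumes \<epsilon>: "\<epsilon> < 1" and g: "g \<in> borel_measurable (collar_measure \<epsilon>)"
  shows integrable_collar_iff: "integrable (collar_measure \<epsilon>) g \<longleftrightarrow>
      integrable lborel (\<lambda>y. indicator (shell \<epsilon>) y *\<^sub>R (inverse (norm y ^ (CARD('m) - 1)) *\<^sub>R g (polar y)))"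
    and integral_collar: "(LINT p|collar_measure \<epsilon>. g p) =
      (LINT y|lborel. indicator (shell \<epsilon>) y *\<^sub>R (inverse (norm y ^ (CARD('m) - 1)) *\<^sub>R g (polar y)))"
proof -
  let ?n = "CARD('m) - 1"
  let ?r = "restrict_space lborel (shell \<epsilon>) :: (real^'m) measure"
  have p: "polar \<in> ?r \<rightarrow>\<^sub>M (collar_measure \<epsilon> :: ((real^'m) \<times> real) measure)"
    using polar_measurable[OF \<epsilon>] by (simp add: measurable_cong_sets[OF sets_restrict_space_cong[OF sets_lborel]])
  then have p': "polar \<in> density ?r (\<lambda>y. ennreal (inverse (norm y ^ ?n))) \<rightarrow>\<^sub>M (collar_measure \<epsilon> :: ((real^'m) \<times> real) measure)"
    by simp
  have gp: "(\<lambda>y. g (polar y)) \<in> borel_measurable ?r" using measurable_compose[OF p g] .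
  have i: "(\<lambda>y. inverse (norm y ^ ?n)) \<in> borel_measurable ?r"
    by (intro measurable_restrict_space1) measurable
  have "integrable (collar_measure \<epsilon>) g \<longleftrightarrow> integrable ?r (\<lambda>y. inverse (norm y ^ ?n) *\<^sub>R g (polar y))"
    by (subst collar_measure_eq[OF \<epsilon>], subst integrable_distr_eq[OF p' g],
        subst integrable_density[OF gp i]) auto
  then show "integrable (collar_measure \<epsilon>) g \<longleftrightarrow>
      integrable lborel (\<lambda>y. indicator (shell \<epsilon>) y *\<^sub>R (inverse (norm y ^ ?n) *\<^sub>R g (polar y)))"
    by (simp add: integrable_restrict_space)
  have "(LINT p|collar_measure \<epsilon>. g p) = (LINT y|?r. inverse (norm y ^ ?n) *\<^sub>R g (polar y))"
    by (subst collar_measure_eq[OF \<epsilon>], subst integral_distr[OF p' g],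
        subst integral_density[OF gp i]) auto
  then show "(LINT p|collar_measure \<epsilon>. g p) =
      (LINT y|lborel. indicator (shell \<epsilon>) y *\<^sub>R (inverse (norm y ^ ?n) *\<^sub>R g (polar y)))"
    by (simp add: integral_restrict_space)
qed

section \<open>Density of tensors in square integrable functions\<close>

lemma L2_limit_dominated:
  fixes X :: "nat \<Rightarrow> 'a \<Rightarrow> 'b::{banach, second_countable_topology}"
  assumes X: "\<And>i. X i \<in> borel_measurable M" and f: "f \<in> borel_measurable M" and w: "integrable M w"
    and b: "\<And>i x. x \<in> space M \<Longrightarrow> (norm (X i x))\<^sup>2 \<le> w x"
    and l: "\<And>x. x \<in> space M \<Longrightarrow> (\<lambda>i. X i x) \<longlonglongrightarrow> f x"
  shows "(\<lambda>i. LINT x|M. (norm (f x - X i x))\<^sup>2) \<longlonglongrightarrow> 0"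
proof -
  have fb: "(norm (f x))\<^sup>2 \<le> w x" if x: "x \<in> space M" for x
    by (rule LIMSEQ_le_const2[of "\<lambda>i. (norm (X i x))\<^sup>2"]) (use b[OF x] l[OF x] in \<open>auto intro!: tendsto_intros\<close>)
  have sq: "(norm (v - u))\<^sup>2 \<le> 2 * (norm v)\<^sup>2 + 2 * (norm u)\<^sup>2" for v u :: 'b
  proof -
    have "(norm (v - u))\<^sup>2 \<le> (norm v + norm u)\<^sup>2" by (simp add: norm_triangle_ineq4 power_mono)
    moreover have "0 \<le> (norm v - norm u)\<^sup>2" by auto
    ultimately show ?thesis by (simp only: power2_diff power2_sum)
  qed
  have "(\<lambda>i. LINT x|M. (norm (f x - X i x))\<^sup>2) \<longlonglongrightarrow> (LINT x|M. 0)"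
  proof (rule integral_dominated_convergence)
    show "integrable M (\<lambda>x. 4 * w x)" using w by simp
    show "(\<lambda>x. (norm (f x - X i x))\<^sup>2) \<in> borel_measurable M" for i using X[of i] f by measurable
    show "AE x in M. (\<lambda>i. (norm (f x - X i x))\<^sup>2) \<longlonglongrightarrow> 0"
    proof (rule AE_I2)
      fix x assume "x \<in> space M"
      from tendsto_diff[OF tendsto_const[of "f x"] l[OF this]]
      have "(\<lambda>i. (norm (f x - X i x))\<^sup>2) \<longlonglongrightarrow> (norm (f x - f x))\<^sup>2"
        by (intro tendsto_power tendsto_norm)
      then show "(\<lambda>i. (norm (f x - X i x))\<^sup>2) \<longlonglongrightarrow> 0" by simp
    qed
    show "AE x in M. norm ((norm (f x - X i x))\<^sup>2) \<le> 4 * w x" for i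
    proof (rule AE_I2)
      fix x assume x: "x \<in> space M"
      show "norm ((norm (f x - X i x))\<^sup>2) \<le> 4 * w x"
        using sq[of "f x" "X i x"] fb[OF x] b[OF x, of i] by simp
    qed
  qed simp
  then show ?thesis by simp
qed

text \<open>A Dynkin class argument followed by monotone approximation.\<close>

lemma L2_product_induct:
  fixes f :: "'a \<times> 'b \<Rightarrow> complex"
  assumes M1: "finite_measure M1" and M2: "finite_measure M2"
    and ind: "\<And>A B. A \<in> sets M1 \<Longrightarrow> B \<in> sets M2 \<Longrightarrow> P (indicator (A \<times> B))"
    and add: "\<And>f g. P f \<Longrightarrow> P g \<Longrightarrow> P (\<lambda>x. f x + g x)"
    and scale: "\<And>f c. P f \<Longrightarrow> P (\<lambda>x. c * f x)"
    and lim: "\<And>f X. (\<And>i. P (X i)) \<Longrightarrow> (\<And>i. X i \<in> borel_measurable (M1 \<Otimes>\<^sub>M M2)) \<Longrightarrow>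
      f \<in> borel_measurable (M1 \<Otimes>\<^sub>M M2) \<Longrightarrow> integrable (M1 \<Otimes>\<^sub>M M2) (\<lambda>x. (norm (f x))\<^sup>2) \<Longrightarrow>
      (\<lambda>i. LINT x|(M1 \<Otimes>\<^sub>M M2). (norm (f x - X i x))\<^sup>2) \<longlonglongrightarrow> 0 \<Longrightarrow> P f"
    and f: "f \<in> borel_measurable (M1 \<Otimes>\<^sub>M M2)" "integrable (M1 \<Otimes>\<^sub>M M2) (\<lambda>x. (norm (f x))\<^sup>2)"
  shows "P f"
proof -
  let ?N = "M1 \<Otimes>\<^sub>M M2"
  have fin: "finite_measure ?N" by (intro finite_measure_pair_measure M1 M2)
  have one: "integrable ?N (\<lambda>_. 1::real)" using finite_measure.integrable_const[OF fin] .
  have zero: "P (\<lambda>_. 0)" using scale[OF ind[of "{}" "{}"], of 0] by simp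
  have sumP: "P (\<lambda>x. \<Sum>i\<in>I. g i x)" if "\<And>i. i \<in> I \<Longrightarrow> P (g i)" for I and g :: "nat \<Rightarrow> 'a \<times> 'b \<Rightarrow> complex"
    using that by (induction I rule: infinite_finite_induct) (auto intro: zero add)
  have sets: "P (indicator S)" if "S \<in> sets ?N" for S
  proof -
    have mem: "S \<in> sigma_sets (space M1 \<times> space M2) {a \<times> b |a b. a \<in> sets M1 \<and> b \<in> sets M2}"
      using that by (simp add: sets_pair_measure)
    have cl: "{a \<times> b |a b. a \<in> sets M1 \<and> b \<in> sets M2} \<subseteq> Pow (space M1 \<times> space M2)"
      by (auto dest: sets.sets_into_space)
    from Int_stable_pair_measure_generator[of M1 M2] cl mem show ?thesis
    proof (induction S rule: sigma_sets_induct_disjoint)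
      case (basic A) then show ?case using ind by auto
    next
      case empty show ?case using zero by (simp add: indicator_def[abs_def])
    next
      case (compl A)
      have "A \<subseteq> space M1 \<times> space M2"
        using compl(1) sets.sets_into_space[of A ?N] by (simp add: sets_pair_measure space_pair_measure)
      then have "indicator (space M1 \<times> space M2 - A)
          = (\<lambda>x. indicator (space M1 \<times> space M2) x + (-1) * (indicator A x :: complex))"
        by (auto simp: indicator_def fun_eq_iff)
      then show ?case using add[OF ind[of "space M1" "space M2"] scale[OF compl(2), of "-1"]] by simp
    next
      \<comment> \<open>Disjointness turns partial sums of indicators into indicators of finite
        unions. These converge in L2 to the indicator of the countable union, and finiteness of the
        measure makes the constant 1 a dominating function.\<close>
      case (union A)
      have A: "A i \<in> sets ?N" for i using union(2) by (auto simp: sets_pair_measure)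
      have part: "(\<Sum>i<n. indicator (A i) x) = (indicator (\<Union>i<n. A i) x :: complex)" for n x
        using union(1) by (subst indicator_UN_disjoint) (auto simp: disjoint_family_on_def)
      show ?case
      proof (rule lim)
        show "P (\<lambda>x. \<Sum>i<n. indicator (A i) x)" for n by (rule sumP) (use union(3) in simp)
        show "(\<lambda>x. \<Sum>i<n. indicator (A i) x :: complex) \<in> borel_measurable ?N" for n
          using A by (intro borel_measurable_sum) simp
        show U: "(indicator (\<Union> (range A)) :: _ \<Rightarrow> complex) \<in> borel_measurable ?N" using A by simp
        show "integrable ?N (\<lambda>x. (norm (indicator (\<Union> (range A)) x :: complex))\<^sup>2)"
        proof (rule Bochner_Integration.integrable_bound[OF one])
          show "(\<lambda>x. (norm (indicator (\<Union> (range A)) x :: complex))\<^sup>2) \<in> borel_measurable ?N"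
            using U by measurable
        qed (simp add: indicator_def)
        show "(\<lambda>n. LINT x|?N. (norm (indicator (\<Union> (range A)) x - (\<Sum>i<n. indicator (A i) x) :: complex))\<^sup>2) \<longlonglongrightarrow> 0"
        proof (rule L2_limit_dominated[OF _ U one])
          show "(\<lambda>x. \<Sum>i<n. indicator (A i) x :: complex) \<in> borel_measurable ?N" for n
            using A by (intro borel_measurable_sum) simp
          show "(norm (\<Sum>i<n. indicator (A i) x :: complex))\<^sup>2 \<le> 1" for n x
            unfolding part by (simp add: indicator_def)
          show "(\<lambda>n. \<Sum>i<n. indicator (A i) x :: complex) \<longlonglongrightarrow> indicator (\<Union> (range A)) x" for x
            unfolding part by (rule LIMSEQ_indicator_UN)
        qed
      qed
    qed
  qed
  \<comment> \<open>The induction runs over all nonnegative measurable functions, so square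
    integrability belongs to the claim. It descends to summands and to increasing approximations
    because these are pointwise smaller.\<close>
  have nonneg: "integrable ?N (\<lambda>x. (u x)\<^sup>2) \<longrightarrow> P (\<lambda>x. of_real (u x))"
    if "u \<in> borel_measurable ?N" "\<And>x. 0 \<le> u x" for u :: "'a \<times> 'b \<Rightarrow> real"
    using that
  proof (induction rule: borel_measurable_induct_real)
    case (set A)
    have "(\<lambda>x. of_real (indicator A x)) = (indicator A :: _ \<Rightarrow> complex)" by (auto simp: indicator_def)
    then show ?case using sets[OF set] by simp
  next
    case (mult u c)
    show ?case
    proof (cases "c = 0")
      case False
      then have "integrable ?N (\<lambda>x. (c * u x)\<^sup>2) \<Longrightarrow> integrable ?N (\<lambda>x. (u x)\<^sup>2)"
        by (simp add: power_mult_distrib)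
      then show ?thesis using mult scale[of "\<lambda>x. of_real (u x)" "of_real c"] by simp
    qed (use zero in simp)
  next
    case (add u v)
    have "integrable ?N (\<lambda>x. (u x)\<^sup>2) \<and> integrable ?N (\<lambda>x. (v x)\<^sup>2)" if i: "integrable ?N (\<lambda>x. (v x + u x)\<^sup>2)"
    proof (intro conjI)
      show "integrable ?N (\<lambda>x. (u x)\<^sup>2)"
        by (rule Bochner_Integration.integrable_bound[OF i]) (use add in \<open>auto intro!: AE_I2 power_mono\<close>)
      show "integrable ?N (\<lambda>x. (v x)\<^sup>2)"
        by (rule Bochner_Integration.integrable_bound[OF i]) (use add in \<open>auto intro!: AE_I2 power_mono\<close>)
    qed
    then show ?case
      using add.IH assms(4)[of "\<lambda>x. of_real (v x)" "\<lambda>x. of_real (u x)"] by auto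
  next
    case (seq U)
    show ?case
    proof
      assume i: "integrable ?N (\<lambda>x. (u x)\<^sup>2)"
      have le: "U i x \<le> u x" if "x \<in> space ?N" for i x
        using seq.hyps(3) seq.hyps(4)[OF that] by (intro incseq_le[of "\<lambda>i. U i x"]) (simp_all add: incseq_def le_fun_def del: split_paired_All)
      have Ui: "integrable ?N (\<lambda>x. (U i x)\<^sup>2)" for i
        by (rule Bochner_Integration.integrable_bound[OF i])
          (use seq le in \<open>auto intro!: AE_I2 power_mono\<close>)
      have um: "u \<in> borel_measurable ?N" by (rule borel_measurable_LIMSEQ_metric[OF seq.hyps(1)]) (rule seq.hyps(4))
      show "P (\<lambda>x. of_real (u x))"
      proof (rule lim)
        show "P (\<lambda>x. of_real (U i x))" for i using seq.IH Ui by blast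
        show "(\<lambda>x. complex_of_real (U i x)) \<in> borel_measurable ?N" for i using seq.hyps(1) by simp
        show uc: "(\<lambda>x. complex_of_real (u x)) \<in> borel_measurable ?N" using um by simp
        show "integrable ?N (\<lambda>x. (norm (complex_of_real (u x)))\<^sup>2)" using i by simp
        show "(\<lambda>i. LINT x|?N. (norm (complex_of_real (u x) - complex_of_real (U i x)))\<^sup>2) \<longlonglongrightarrow> 0"
          by (rule L2_limit_dominated[OF _ uc i])
            (use seq le in \<open>auto intro!: tendsto_intros power_mono\<close>)
      qed
    qed
  qed
  have part: "P (\<lambda>x. of_real (max 0 (g x)))"
    if g: "g \<in> borel_measurable ?N" "\<And>x. \<bar>g x\<bar> \<le> norm (f x)" for g
  proof -
    have "integrable ?N (\<lambda>x. (max 0 (g x))\<^sup>2)"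
    proof (rule Bochner_Integration.integrable_bound[OF f(2)])
      show "AE x in ?N. norm ((max 0 (g x))\<^sup>2) \<le> norm ((norm (f x))\<^sup>2)"
        using g(2) by (intro AE_I2) (simp add: power_mono max_def abs_le_iff)
    qed (use g in simp)
    then show ?thesis using nonneg[of "\<lambda>x. max 0 (g x)"] g by simp
  qed
  have "P (\<lambda>x. (of_real (max 0 (Re (f x))) + (-1) * of_real (max 0 (- Re (f x))))
      + \<i> * (of_real (max 0 (Im (f x))) + (-1) * of_real (max 0 (- Im (f x)))))"
    using f(1) abs_Re_le_cmod abs_Im_le_cmod by (intro add scale part) auto
  moreover have "(\<lambda>x. (of_real (max 0 (Re (f x))) + (-1) * of_real (max 0 (- Re (f x))))
      + \<i> * (of_real (max 0 (Im (f x))) + (-1) * of_real (max 0 (- Im (f x))))) = f"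
    by (auto simp: fun_eq_iff complex_eq_iff max_def)
  ultimately show ?thesis by simp
qed

section \<open>Formal sums of tensors inside an L2 space\<close>

lemma L2_sum_mset:
  fixes j :: "'x \<Rightarrow> 'a \<Rightarrow> complex^'i"
  assumes "\<And>x. x \<in># M \<Longrightarrow> j x \<in> carr (L2 N UNIV)"
  shows "(\<lambda>p. \<Sum>x\<in>#M. j x p) \<in> carr (L2 N UNIV)"
    and "g \<in> carr (L2 N UNIV) \<Longrightarrow> ip (L2 N UNIV) g (\<lambda>p. \<Sum>x\<in>#M. j x p) = (\<Sum>x\<in>#M. ip (L2 N UNIV) g (j x))"
proof -
  interpret L: semi_ip "L2 N (UNIV :: (complex^'i) set)" by (rule semi_ip_L2) auto
  have *: "(\<lambda>p. \<Sum>x\<in>#M. j x p) \<in> carr (L2 N UNIV) \<and>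
    (g \<in> carr (L2 N UNIV) \<longrightarrow> ip (L2 N UNIV) g (\<lambda>p. \<Sum>x\<in>#M. j x p) = (\<Sum>x\<in>#M. ip (L2 N UNIV) g (j x)))" for g
    using assms
  proof (induction M)
    case empty
    then show ?case by (simp add: L2_carr L2_ip cip_def)
  next
    case (add x M)
    then show ?case
      using L.vadd_closed[of "j x" "\<lambda>p. \<Sum>x\<in>#M. j x p"] L.ip_vadd[of g "j x" "\<lambda>p. \<Sum>x\<in>#M. j x p"]
      by (simp add: L2_vadd)
  qed
  show "(\<lambda>p. \<Sum>x\<in>#M. j x p) \<in> carr (L2 N UNIV)"
    and "g \<in> carr (L2 N UNIV) \<Longrightarrow> ip (L2 N UNIV) g (\<lambda>p. \<Sum>x\<in>#M. j x p) = (\<Sum>x\<in>#M. ip (L2 N UNIV) g (j x))"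
    using * by blast+
qed

text \<open>The inner product of \<open>pre_tensor\<close> is a double sum over elementary tensors,
  so agreement on elementary tensors extends by summation. Additivity is exact, since adding
  multisets only joins the two lists of summands.\<close>

lemma isometric_pre_tensor:
  fixes j :: "'e \<times> 'h \<Rightarrow> 'a \<Rightarrow> complex^'i"
  assumes vs: "\<And>a h. h \<in> carr H \<Longrightarrow> vscale H a h \<in> carr H"
    and j: "\<And>e h. e \<in> E \<Longrightarrow> h \<in> carr H \<Longrightarrow> j (e, h) \<in> carr (L2 N UNIV)"
    and js: "\<And>e h a p. e \<in> E \<Longrightarrow> h \<in> carr H \<Longrightarrow> j (e, vscale H a h) p = a *s j (e, h) p"
    and jip: "\<And>e h e' h'. e \<in> E \<Longrightarrow> h \<in> carr H \<Longrightarrow> e' \<in> E \<Longrightarrow> h' \<in> carr H \<Longrightarrow>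
      ip H h (act (inn e e') h') = ip (L2 N UNIV) (j (e, h)) (j (e', h'))"
  shows "isometric_map (L2 N UNIV) (pre_tensor E inn act H) (\<lambda>M p. \<Sum>x\<in>#M. j x p)"
proof -
  interpret L: semi_ip "L2 N (UNIV :: (complex^'i) set)" by (rule semi_ip_L2) auto
  have jm: "j x \<in> carr (L2 N UNIV)" if "M \<in> carr (pre_tensor E inn act H)" "x \<in># M" for M x
    using that j by (cases x) (auto simp: pre_tensor_def)
  show ?thesis
  proof
    fix x y assume xy: "x \<in> carr (pre_tensor E inn act H)" "y \<in> carr (pre_tensor E inn act H)"
    show "vadd (pre_tensor E inn act H) x y \<in> carr (pre_tensor E inn act H)"
      using xy by (simp add: pre_tensor_def)
    show "(\<lambda>p. \<Sum>x\<in>#vadd (pre_tensor E inn act H) x y. j x p)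
        = vadd (L2 N UNIV) (\<lambda>p. \<Sum>x\<in>#x. j x p) (\<lambda>p. \<Sum>x\<in>#y. j x p)"
      by (simp add: pre_tensor_def L2_vadd)
    have left: "ip (L2 N UNIV) (\<lambda>p. \<Sum>x\<in>#x. j x p) g = (\<Sum>x\<in>#x. ip (L2 N UNIV) (j x) g)"
      if g: "g \<in> carr (L2 N UNIV)" for g
    proof -
      have "ip (L2 N UNIV) (\<lambda>p. \<Sum>x\<in>#x. j x p) g = cnj (ip (L2 N UNIV) g (\<lambda>p. \<Sum>x\<in>#x. j x p))"
        using L.ip_cnj[OF g L2_sum_mset(1)[of x j]] jm[OF xy(1)] by simp
      also have "\<dots> = cnj (\<Sum>x\<in>#x. ip (L2 N UNIV) g (j x))"
        using L2_sum_mset(2)[of x j N g] jm[OF xy(1)] g by simp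
      also have "\<dots> = (\<Sum>x\<in>#x. cnj (ip (L2 N UNIV) g (j x)))"
        by (induction x) auto
      also have "\<dots> = (\<Sum>x\<in>#x. ip (L2 N UNIV) (j x) g)"
        using L.ip_cnj[OF g] jm[OF xy(1)] by (intro arg_cong[where f = sum_mset] image_mset_cong) simp
      finally show ?thesis .
    qed
    have "ip (L2 N UNIV) (\<lambda>p. \<Sum>x\<in>#x. j x p) (\<lambda>p. \<Sum>x\<in>#y. j x p)
        = (\<Sum>a\<in>#x. \<Sum>b\<in>#y. ip (L2 N UNIV) (j a) (j b))"
      using left[OF L2_sum_mset(1)[of y j]] L2_sum_mset(2)[of y j N] jm xy
      by (auto intro!: arg_cong[where f = sum_mset] image_mset_cong)
    also have "\<dots> = (\<Sum>a\<in>#x. \<Sum>b\<in>#y. ip H (snd a) (act (inn (fst a) (fst b)) (snd b)))"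
    proof (intro arg_cong[where f = sum_mset] image_mset_cong)
      fix a b assume "a \<in># x" "b \<in># y"
      then have "a \<in> E \<times> carr H" "b \<in> E \<times> carr H" using xy by (auto simp: pre_tensor_def)
      then show "ip (L2 N UNIV) (j a) (j b) = ip H (snd a) (act (inn (fst a) (fst b)) (snd b))"
        using jip[of "fst a" "snd a" "fst b" "snd b"] by (simp add: mem_Times_iff)
    qed
    finally show "ip (pre_tensor E inn act H) x y = ip (L2 N UNIV) (\<lambda>p. \<Sum>x\<in>#x. j x p) (\<lambda>p. \<Sum>x\<in>#y. j x p)"
      by (simp add: pre_tensor_def case_prod_unfold)
  next
    fix x a assume x: "x \<in> carr (pre_tensor E inn act H)"
    show "vscale (pre_tensor E inn act H) a x \<in> carr (pre_tensor E inn act H)"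
      using x vs by (auto simp: pre_tensor_def)
    show "(\<lambda>p. \<Sum>x\<in>#x. j x p) \<in> carr (L2 N UNIV)" by (rule L2_sum_mset(1)) (use jm x in blast)
    show "(\<lambda>p. \<Sum>x\<in>#vscale (pre_tensor E inn act H) a x. j x p) = vscale (L2 N UNIV) a (\<lambda>p. \<Sum>x\<in>#x. j x p)"
    proof
      fix p
      have "set_mset x \<subseteq> E \<times> carr H" using x by (simp add: pre_tensor_def)
      then show "(\<Sum>x\<in>#vscale (pre_tensor E inn act H) a x. j x p) = vscale (L2 N UNIV) a (\<lambda>p. \<Sum>x\<in>#x. j x p) p"
        by (induction x) (auto simp: pre_tensor_def L2_vscale js vec.scale_right_distrib)
    qed
  qed
qed

text \<open>Compares the product of the restricted \<sigma>-algebras with the Borel sets of the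
  ambient product, so that continuity on the collar implies measurability.\<close>

lemma measurable_collar_ident: "(\<lambda>p. p) \<in> borel_measurable (collar_measure \<epsilon> :: ((real^'m) \<times> real) measure)"
proof -
  have "fst \<in> (collar_measure \<epsilon> :: ((real^'m) \<times> real) measure) \<rightarrow>\<^sub>M restrict_space borel (sphere 0 1)"
    unfolding collar_measure_def measurable_cong_sets[OF refl sets_sphere_measure[symmetric]] by (rule measurable_fst)
  then have 1: "fst \<in> borel_measurable (collar_measure \<epsilon> :: ((real^'m) \<times> real) measure)"
    unfolding measurable_restrict_space2_iff by blast
  have "snd \<in> (collar_measure \<epsilon> :: ((real^'m) \<times> real) measure) \<rightarrow>\<^sub>M restrict_space lborel {-\<epsilon><..<\<epsilon>}"
    unfolding collar_measure_def by (rule measurable_snd)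
  then have 2: "snd \<in> borel_measurable (collar_measure \<epsilon> :: ((real^'m) \<times> real) measure)"
    by (simp add: measurable_restrict_space2_iff)
  from borel_measurable_Pair[OF 1 2] show ?thesis by simp
qed

lemma measurable_collar:
  assumes "continuous_on (collar \<epsilon>) f"
  shows "f \<in> borel_measurable (collar_measure \<epsilon> :: ((real^'m) \<times> real) measure)"
proof (rule measurable_compose[of "\<lambda>p. p"])
  show "(\<lambda>p. p) \<in> (collar_measure \<epsilon> :: ((real^'m) \<times> real) measure) \<rightarrow>\<^sub>M restrict_space borel (collar \<epsilon>)"
    using measurable_collar_ident
    by (simp add: measurable_restrict_space2_iff space_collar_measure)
  show "f \<in> borel_measurable (restrict_space borel (collar \<epsilon>))"
    by (rule borel_measurable_continuous_on_restrict[OF assms])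
qed

lemma measurable_immersion: "immersion \<in> borel_measurable (collar_measure \<epsilon>)"
  by (rule measurable_collar) (auto simp: immersion_def[abs_def] intro!: continuous_intros)

section \<open>Tensors of vectors\<close>

definition tens :: "complex^'q \<Rightarrow> complex^'r \<Rightarrow> complex^('q::finite \<times> 'r::finite)" where
  "tens v w = (\<chi> i. v $ fst i * w $ snd i)"

lemma tens_add_left: "tens (v + v') w = tens v w + tens v' w"
  and tens_add_right: "tens v (w + w') = tens v w + tens v w'"
  and tens_scale_left: "tens (a *s v) w = a *s tens v w"
  and tens_scale_right: "tens v (a *s w) = a *s tens v w"
  by (simp_all add: tens_def vec_eq_iff algebra_simps)

lemma tens_diff_left: "tens (v - v') w = tens v w - tens v' w"
  and tens_diff_right: "tens v (w - w') = tens v w - tens v w'"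
  by (simp_all add: tens_def vec_eq_iff algebra_simps)

lemma complex_bilinear_bounded:
  fixes b :: "complex^'i \<Rightarrow> complex^'j \<Rightarrow> complex^'k"
  assumes "\<And>v v' w. b (v + v') w = b v w + b v' w" "\<And>v w w'. b v (w + w') = b v w + b v w'"
    and "\<And>a v w. b (a *s v) w = a *s b v w" "\<And>a v w. b v (a *s w) = a *s b v w"
  shows "bounded_bilinear b"
proof -
  have "bilinear b" unfolding bilinear_def
    by (auto intro!: linearI simp: assms scaleR_as_scale)
  then show ?thesis by (simp add: bilinear_conv_bounded_bilinear)
qed

lemma bounded_bilinear_tens: "bounded_bilinear tens"
  by (rule complex_bilinear_bounded)
    (simp_all add: tens_add_left tens_add_right tens_scale_left tens_scale_right)

lemma cip_tens: "cip (tens v w) (tens v' w') = cip v v' * cip w w'"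
proof -
  have "cip (tens v w) (tens v' w')
      = (\<Sum>i\<in>UNIV \<times> UNIV. (cnj (v $ fst i) * v' $ fst i) * (cnj (w $ snd i) * w' $ snd i))"
    unfolding cip_def tens_def by (simp add: mult_ac)
  also have "\<dots> = cip v v' * cip w w'"
    unfolding cip_def sum_product sum.cartesian_product by (simp add: case_prod_unfold)
  finally show ?thesis .
qed

lemmas measurable_tens [measurable (raw)] = bounded_bilinear_measurable[OF bounded_bilinear_tens]

lemma linear_measurable:
  fixes f :: "'a::euclidean_space \<Rightarrow> 'b::euclidean_space"
  assumes "linear f" "g \<in> borel_measurable M" shows "(\<lambda>x. f (g x)) \<in> borel_measurable M"
  using measurable_compose[OF assms(2) borel_measurable_continuous_onI[OF linear_continuous_on]] assms(1)
  by (simp add: linear_conv_bounded_linear)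

lemma vec_sum_axis: "v = (\<Sum>i\<in>UNIV. v $ i *s axis i (1::complex))"
  by (simp add: vec_eq_iff axis_def if_distrib cong: if_cong)

lemma mv_sum_axis: "A *v v = (\<Sum>i\<in>UNIV. v $ i *s (A *v axis i (1::complex)))"
proof -
  have "A *v v = (\<Sum>i\<in>UNIV. A *v (v $ i *s axis i 1))"
    by (subst vec_sum_axis) (rule linear_sum, simp)
  then show ?thesis by (simp add: vector_scalar_commute)
qed

section \<open>Functions vanishing at infinity and the cutoff\<close>

lemma C0_bounded:
  assumes "\<psi> \<in> C0 X"
  obtains B where "B \<ge> 0" "\<And>p. p \<in> X \<Longrightarrow> norm (\<psi> p) \<le> B"
proof -
  have c: "continuous_on X \<psi>" using assms by (simp add: C0_def)
  have "\<forall>\<delta>>0. \<exists>K. compact K \<and> K \<subseteq> X \<and> (\<forall>p\<in>X - K. norm (\<psi> p) < \<delta>)"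
    using assms by (simp add: C0_def)
  from this[rule_format, of 1]
  obtain K where K: "compact K" "K \<subseteq> X" "\<And>p. p \<in> X - K \<Longrightarrow> norm (\<psi> p) < 1" by auto
  have "bounded (\<psi> ` K)"
    using compact_continuous_image[OF continuous_on_subset[OF c K(2)] K(1)] compact_imp_bounded by blast
  then obtain B where B: "\<And>p. p \<in> K \<Longrightarrow> norm (\<psi> p) \<le> B" by (auto simp: bounded_iff)
  show thesis
  proof (rule that[of "max 1 B"])
    show "norm (\<psi> p) \<le> max 1 B" if "p \<in> X" for p
      using K(3)[of p] B[of p] that by (cases "p \<in> K") auto
  qed simp
qed

lemma C0_cong: "(\<And>p. p \<in> X \<Longrightarrow> \<psi> p = \<phi> p) \<Longrightarrow> \<psi> \<in> C0 X \<longleftrightarrow> \<phi> \<in> C0 X"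
  unfolding C0_def using continuous_on_cong[of X X \<psi> \<phi>] by auto

text \<open>On the compact closed collar the set where the norm of g is at least \<delta> is
  compact, and it misses both boundary spheres because g is zero there.\<close>

lemma C0_collar_vanishing_boundary:
  fixes g :: "(real^'m) \<times> real \<Rightarrow> 'b::real_normed_vector"
  assumes c: "continuous_on (sphere 0 1 \<times> {-\<epsilon>..\<epsilon>}) g"
    and 0: "\<And>x. x \<in> sphere 0 1 \<Longrightarrow> g (x, \<epsilon>) = 0" "\<And>x. x \<in> sphere 0 1 \<Longrightarrow> g (x, -\<epsilon>) = 0"
  shows "g \<in> C0 (collar \<epsilon>)"
  unfolding C0_def
proof (intro CollectI conjI allI impI)
  show "continuous_on (collar \<epsilon>) g" by (rule continuous_on_subset[OF c]) (auto simp: collar_def)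
  fix \<delta> :: real assume \<delta>: "\<delta> > 0"
  let ?S = "sphere 0 1 \<times> {-\<epsilon>..\<epsilon>} :: ((real^'m) \<times> real) set"
  let ?K = "?S \<inter> (\<lambda>p. norm (g p)) -` {\<delta>..}"
  have S: "compact ?S" by (intro compact_Times) auto
  have "closed ?K"
    by (rule continuous_closed_preimage) (use c S in \<open>auto intro!: continuous_intros compact_imp_closed\<close>)
  then have "compact ?K" using S by (metis compact_Int_closed inf.left_idem)
  moreover have "?K \<subseteq> collar \<epsilon>"
  proof
    fix p assume p: "p \<in> ?K"
    obtain x s where ps: "p = (x, s)" by (cases p)
    with p have x: "x \<in> sphere 0 1" and s: "-\<epsilon> \<le> s" "s \<le> \<epsilon>" and n: "\<delta> \<le> norm (g (x, s))" by auto
    have "s \<noteq> \<epsilon>" "s \<noteq> -\<epsilon>" using n 0[OF x] \<delta> by auto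
    then show "p \<in> collar \<epsilon>" using x s ps by (auto simp: collar_def)
  qed
  moreover have "norm (g p) < \<delta>" if "p \<in> collar \<epsilon> - ?K" for p
    using that by (auto simp: collar_def not_le)
  ultimately show "\<exists>K. compact K \<and> K \<subseteq> collar \<epsilon> \<and> (\<forall>p\<in>collar \<epsilon> - K. norm (g p) < \<delta>)" by blast
qed

lemma measurable_fst_collar: "fst \<in> collar_measure \<epsilon> \<rightarrow>\<^sub>M sphere_measure"
  and measurable_snd_collar: "snd \<in> collar_measure \<epsilon> \<rightarrow>\<^sub>M restrict_space lborel {-\<epsilon><..<\<epsilon>}"
  by (simp_all add: collar_measure_def)

lemma measurable_fst_collar_borel: "fst \<in> borel_measurable (collar_measure \<epsilon>)"
  and measurable_snd_collar_borel: "snd \<in> borel_measurable (collar_measure \<epsilon>)"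
  using measurable_compose[OF measurable_collar_ident borel_measurable_continuous_onI[OF continuous_on_fst[OF continuous_on_id]]]
    measurable_compose[OF measurable_collar_ident borel_measurable_continuous_onI[OF continuous_on_snd[OF continuous_on_id]]]
  by auto

lemma collar_product_integral:
  fixes a :: "real^'m \<Rightarrow> complex"
  assumes a: "integrable sphere_measure a" and b: "integrable (restrict_space lborel {-\<epsilon><..<\<epsilon>}) b"
  shows "integrable (collar_measure \<epsilon>) (\<lambda>p. a (fst p) * b (snd p))"
    and "(LINT p|collar_measure \<epsilon>. a (fst p) * b (snd p))
      = (LINT x|sphere_measure. a x) * (LINT s|restrict_space lborel {-\<epsilon><..<\<epsilon>}. b s)"
proof -
  interpret S: finite_measure "sphere_measure :: (real^'m) measure" by (rule finite_sphere_measure)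
  interpret I: finite_measure "restrict_space lborel {-\<epsilon><..<\<epsilon>}" by (rule finite_interval_measure)
  interpret pair_sigma_finite "sphere_measure :: (real^'m) measure" "restrict_space lborel {-\<epsilon><..<\<epsilon>}" ..
  have am: "a \<in> borel_measurable sphere_measure" and bm: "b \<in> borel_measurable (restrict_space lborel {-\<epsilon><..<\<epsilon>})"
    using a b by auto
  have m: "(\<lambda>p. a (fst p) * b (snd p)) \<in> borel_measurable (sphere_measure \<Otimes>\<^sub>M restrict_space lborel {-\<epsilon><..<\<epsilon>})"
    by (intro borel_measurable_times measurable_compose[OF measurable_fst am] measurable_compose[OF measurable_snd bm])
  have i: "integrable (sphere_measure \<Otimes>\<^sub>M restrict_space lborel {-\<epsilon><..<\<epsilon>}) (\<lambda>p. a (fst p) * b (snd p))"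
  proof (rule Fubini_integrable[OF m])
    show "integrable sphere_measure (\<lambda>x. LINT y|restrict_space lborel {-\<epsilon><..<\<epsilon>}. norm (a (fst (x, y)) * b (snd (x, y))))"
      using a b by (simp add: norm_mult)
    show "AE x in sphere_measure. integrable (restrict_space lborel {-\<epsilon><..<\<epsilon>}) (\<lambda>y. a (fst (x, y)) * b (snd (x, y)))"
      using b by simp
  qed
  then show "integrable (collar_measure \<epsilon>) (\<lambda>p. a (fst p) * b (snd p))" by (simp add: collar_measure_def)
  show "(LINT p|collar_measure \<epsilon>. a (fst p) * b (snd p))
      = (LINT x|sphere_measure. a x) * (LINT s|restrict_space lborel {-\<epsilon><..<\<epsilon>}. b s)"
    unfolding collar_measure_def using integral_fst'[OF i] by simp
qed

text \<open>One power of the cosine would not do: the potential times cos is a multiple of sin,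
  which does not vanish at both ends, while the potential times cos^2 is a multiple of sin cos,
  which does. The derivative of cos^2 is again a multiple of sin cos, as \<open>C10\<close>
  demands.\<close>

definition bump :: "real \<Rightarrow> real \<Rightarrow> real" where
  "bump \<epsilon> s = (cos (pi / (2 * \<epsilon>) * s))\<^sup>2"

lemma bump_cos_pos: "0 < \<epsilon> \<Longrightarrow> - \<epsilon> < s \<Longrightarrow> s < \<epsilon> \<Longrightarrow> cos (pi / (2 * \<epsilon>) * s) > 0"
proof (rule cos_gt_zero_pi)
  assume e: "0 < \<epsilon>" "- \<epsilon> < s" "s < \<epsilon>"
  have "pi / (2 * \<epsilon>) * (- \<epsilon>) < pi / (2 * \<epsilon>) * s" "pi / (2 * \<epsilon>) * s < pi / (2 * \<epsilon>) * \<epsilon>"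
    using e by (intro mult_strict_left_mono; simp)+
  then show "- (pi / 2) < pi / (2 * \<epsilon>) * s" "pi / (2 * \<epsilon>) * s < pi / 2" using e by auto
qed

lemma bump_pos: "0 < \<epsilon> \<Longrightarrow> - \<epsilon> < s \<Longrightarrow> s < \<epsilon> \<Longrightarrow> bump \<epsilon> s > 0"
  using bump_cos_pos[of \<epsilon> s] by (simp add: bump_def)

lemma bump_boundary: "0 < \<epsilon> \<Longrightarrow> bump \<epsilon> \<epsilon> = 0" "0 < \<epsilon> \<Longrightarrow> bump \<epsilon> (- \<epsilon>) = 0"
  by (simp_all add: bump_def)

lemma C0_bump: "0 < \<epsilon> \<Longrightarrow> (\<lambda>p. of_real (bump \<epsilon> (snd p)) *s v) \<in> C0 (collar \<epsilon> :: ((real^'m) \<times> real) set)"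
  for v :: "complex^2"
  unfolding scaleR_as_scale[symmetric]
  by (rule C0_collar_vanishing_boundary)
    (auto simp: bump_boundary bump_def intro!: continuous_intros)

text \<open>The change of variables introduces the weight r^n, which is at most 2^n on the
  shell.\<close>

lemma L2_polar:
  fixes g :: "(real^'m) \<times> real \<Rightarrow> complex^'i"
  assumes \<epsilon>: "\<epsilon> < 1" and g: "g \<in> carr (L2 (collar_measure \<epsilon>) UNIV)"
  shows "(\<lambda>y. indicator (shell \<epsilon>) y *\<^sub>R g (polar y)) \<in> carr (L2 lborel UNIV)"
proof -
  let ?n = "CARD('m) - 1"
  have gm: "g \<in> borel_measurable (collar_measure \<epsilon>)" using g by (simp add: L2_carr)
  have "(\<lambda>y. g (polar y)) \<in> borel_measurable (restrict_space borel (shell \<epsilon>))"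
    using measurable_compose[OF polar_measurable[OF \<epsilon>] gm] .
  then have m: "(\<lambda>y. indicator (shell \<epsilon>) y *\<^sub>R g (polar y)) \<in> borel_measurable borel"
    by (simp add: borel_measurable_restrict_space_iff)
  have gi: "integrable (collar_measure \<epsilon>) (\<lambda>p. (1 + snd p) ^ ?n * (norm (g p))\<^sup>2)"
  proof (rule Bochner_Integration.integrable_bound)
    show "integrable (collar_measure \<epsilon>) (\<lambda>p. 2 ^ ?n * (norm (g p))\<^sup>2)" using g by (simp add: L2_carr)
    show "(\<lambda>p. (1 + snd p) ^ ?n * (norm (g p))\<^sup>2) \<in> borel_measurable (collar_measure \<epsilon>)"
      using gm measurable_snd_collar_borel[of \<epsilon>] by measurable
    show "AE p in collar_measure \<epsilon>. norm ((1 + snd p) ^ ?n * (norm (g p))\<^sup>2) \<le> norm (2 ^ ?n * (norm (g p))\<^sup>2)"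
    proof (rule AE_I2)
      fix p assume "p \<in> space (collar_measure \<epsilon> :: ((real^'m) \<times> real) measure)"
      then have "0 \<le> 1 + snd p" "1 + snd p \<le> 2" using \<epsilon> by (auto simp: space_collar_measure collar_def)
      then have "(1 + snd p) ^ ?n \<le> 2 ^ ?n" by (rule power_mono[rotated])
      with \<open>0 \<le> 1 + snd p\<close> show "norm ((1 + snd p) ^ ?n * (norm (g p))\<^sup>2) \<le> norm (2 ^ ?n * (norm (g p))\<^sup>2)"
        by (simp add: abs_mult mult_right_mono)
    qed
  qed
  then have "integrable lborel (\<lambda>y. indicator (shell \<epsilon>) y *\<^sub>R (inverse (norm y ^ ?n) *\<^sub>R
      ((1 + snd (polar y)) ^ ?n * (norm (g (polar y)))\<^sup>2)))"
    using integrable_collar_iff[OF \<epsilon>, of "\<lambda>p. (1 + snd p) ^ ?n * (norm (g p))\<^sup>2"] by simp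
  also have "(\<lambda>y. indicator (shell \<epsilon>) y *\<^sub>R (inverse (norm y ^ ?n) *\<^sub>R
      ((1 + snd (polar y)) ^ ?n * (norm (g (polar y)))\<^sup>2)))
      = (\<lambda>y. (norm (indicator (shell \<epsilon>) y *\<^sub>R g (polar y)))\<^sup>2)"
  proof
    fix y
    show "indicator (shell \<epsilon>) y *\<^sub>R (inverse (norm y ^ ?n) *\<^sub>R ((1 + snd (polar y)) ^ ?n * (norm (g (polar y)))\<^sup>2))
        = (norm (indicator (shell \<epsilon>) y *\<^sub>R g (polar y)))\<^sup>2"
      using shell_nonzero[OF \<epsilon>, of y] by (cases "y \<in> shell \<epsilon>") (simp_all add: polar_def)
  qed
  finally show ?thesis using m by (simp add: L2_carr)
qed

text \<open>On the shell the density 1/r^n is bounded by its value at the inner radius 1 -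
  \<epsilon>. The second claim is the resulting bound on the operator, which carries L2 convergence
  of spinors to the collar.\<close>

lemma L2_immersion:
  fixes h :: "real^'m \<Rightarrow> complex^'i"
  assumes \<epsilon>: "0 < \<epsilon>" "\<epsilon> < 1" and h: "h \<in> carr (L2 lborel UNIV)"
  shows "(\<lambda>p. h (immersion p)) \<in> carr (L2 (collar_measure \<epsilon>) UNIV)"
    and "(LINT p|collar_measure \<epsilon>. (norm (h (immersion p)))\<^sup>2)
      \<le> inverse ((1 - \<epsilon>) ^ (CARD('m) - 1)) * (LINT y|lborel. (norm (h y))\<^sup>2)"
proof -
  let ?n = "CARD('m) - 1"
  let ?C = "inverse ((1 - \<epsilon>) ^ ?n)"
  let ?k = "\<lambda>y. indicator (shell \<epsilon>) y *\<^sub>R (inverse (norm y ^ ?n) *\<^sub>R (norm (h (immersion (polar y))))\<^sup>2)"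
  have hm: "h \<in> borel_measurable borel" and hi: "integrable lborel (\<lambda>y. (norm (h y))\<^sup>2)"
    using h by (auto simp: L2_carr)
  have hi': "integrable lborel (\<lambda>y. ?C * (norm (h y))\<^sup>2)" using hi by simp
  have m: "(\<lambda>p. h (immersion p)) \<in> borel_measurable (collar_measure \<epsilon>)"
    using measurable_compose[OF measurable_immersion hm] .
  have m2: "(\<lambda>p. (norm (h (immersion p)))\<^sup>2) \<in> borel_measurable (collar_measure \<epsilon>)"
    using m by measurable
  have keq: "indicator (shell \<epsilon>) y *\<^sub>R (inverse (norm y ^ ?n) *\<^sub>R (norm (h (immersion (polar y))))\<^sup>2)
      = indicator (shell \<epsilon>) y *\<^sub>R (inverse (norm y ^ ?n) *\<^sub>R (norm (h y))\<^sup>2)" for y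
    using immersion_polar[OF \<epsilon>(2), of y] by (cases "y \<in> shell \<epsilon>") simp_all
  have le: "norm (?k y) \<le> ?C * (norm (h y))\<^sup>2" for y
  proof (cases "y \<in> shell \<epsilon>")
    case True
    then have "(1 - \<epsilon>) ^ ?n \<le> norm y ^ ?n" using \<epsilon> by (intro power_mono) (auto simp: shell_def)
    then have "inverse (norm y ^ ?n) \<le> ?C" using \<epsilon> by (intro le_imp_inverse_le) auto
    then show ?thesis using True unfolding keq by (simp add: abs_mult mult_right_mono)
  qed (use \<epsilon> in simp)
  have ki: "integrable lborel ?k"
  proof (rule Bochner_Integration.integrable_bound[OF hi'])
    show "?k \<in> borel_measurable lborel" unfolding keq using hm by measurable
    have "norm (?k y) \<le> norm (?C * (norm (h y))\<^sup>2)" for y using le[of y] \<epsilon> by simp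
    then show "AE y in lborel. norm (?k y) \<le> norm (?C * (norm (h y))\<^sup>2)" by blast
  qed
  then show "(\<lambda>p. h (immersion p)) \<in> carr (L2 (collar_measure \<epsilon>) UNIV)"
    using m integrable_collar_iff[OF \<epsilon>(2) m2] by (simp add: L2_carr)
  have "(LINT p|collar_measure \<epsilon>. (norm (h (immersion p)))\<^sup>2) = (LINT y|lborel. ?k y)"
    using integral_collar[OF \<epsilon>(2) m2] by simp
  also have "\<dots> \<le> (LINT y|lborel. ?C * (norm (h y))\<^sup>2)"
  proof (rule integral_mono[OF ki hi'])
    show "?k y \<le> ?C * (norm (h y))\<^sup>2" for y using le[of y] by (simp only: real_norm_def abs_le_iff)
  qed
  also have "\<dots> = ?C * (LINT y|lborel. (norm (h y))\<^sup>2)" by simp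
  finally show "(LINT p|collar_measure \<epsilon>. (norm (h (immersion p)))\<^sup>2)
      \<le> ?C * (LINT y|lborel. (norm (h y))\<^sup>2)" .
qed

section \<open>Fibrewise unitary maps\<close>

text \<open>Both parities are instances of one construction.  The source embeds into \<open>L\<^sup>2\<close> of the collar by
  \<open>\<xi> \<otimes> h \<mapsto> m \<xi> h\<close>, and \<open>eb\<close>, \<open>pr\<close> split a fibre vector into such products.  The target
  embeds by the matrix \<open>K0 + K1 x\<close> on the fibre over \<open>x\<close>, which is affine in \<open>x\<close> because it involves
  \<open>x\<close> only through \<open>c x\<close>; its inverse is \<open>R0 + R1 x\<close> followed by the projection \<open>P\<close> onto \<open>F\<close>.\<close>

locale collar_model =
  fixes \<epsilon> :: real
    and m :: "complex^2 \<Rightarrow> complex^'h \<Rightarrow> complex^'p"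
    and F :: "(complex^'q) set" and P :: "complex^'q^'q"
    and K0 :: "complex^('q::finite \<times> 2)^'p" and K1 :: "real^'m \<Rightarrow> complex^('q \<times> 2)^'p"
    and R0 :: "complex^'p^('q \<times> 2)" and R1 :: "real^'m \<Rightarrow> complex^'p^('q \<times> 2)"
    and eb :: "2 \<Rightarrow> complex^2" and pr :: "2 \<Rightarrow> complex^'p^'h"
    and inn :: "('m::finite) mod2 \<Rightarrow> 'm mod2 \<Rightarrow> real^'m \<Rightarrow> 'b"
    and act :: "(real^'m \<Rightarrow> 'b) \<Rightarrow> (real^'m \<Rightarrow> complex^'h) \<Rightarrow> real^'m \<Rightarrow> complex^'h"
  assumes eps: "0 < \<epsilon>" "\<epsilon> < 1"
    and m_add_left: "m (v + v') w = m v w + m v' w"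
    and m_add_right: "m v (w + w') = m v w + m v w'"
    and m_scale_left: "m (a *s v) w = a *s m v w"
    and m_scale_right: "m v (a *s w) = a *s m v w"
    and m_basis: "(\<Sum>i\<in>UNIV. m (eb i) (pr i *v u)) = u"
    and P_F: "P *v z'' \<in> F" and P_id: "z \<in> F \<Longrightarrow> P *v z = z"
    and K1_linear: "linear K1" and R1_linear: "linear R1"
    and pull_isometric: "norm x = 1 \<Longrightarrow> z \<in> F \<Longrightarrow> z' \<in> F \<Longrightarrow>
      cip ((K0 + K1 x) *v tens z t) ((K0 + K1 x) *v tens z' t') = cip z z' * cip t t'"
    and pull_push: "norm x = 1 \<Longrightarrow> (K0 + K1 x) *v (kron P (mat 1) *v ((R0 + R1 x) *v u)) = u"
    and inn_act: "cip (h y) (act (inn \<xi> \<eta>) h' y) = (if y \<in> shell \<epsilon>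
      then cip (m (\<xi> (polar y)) (h y)) (m (\<eta> (polar y)) (h' y)) / of_real (norm y ^ (CARD('m) - 1)) else 0)"
begin

abbreviation N :: "((real^'m) \<times> real) measure" where "N \<equiv> collar_measure \<epsilon>"
abbreviation L :: "((real^'m) \<times> real \<Rightarrow> complex^'p) hspace" where "L \<equiv> L2 (collar_measure \<epsilon>) UNIV"
abbreviation H :: "(real^'m \<Rightarrow> complex^'h) hspace" where "H \<equiv> L2 lborel UNIV"
abbreviation G :: "(real^'m \<Rightarrow> complex^'q) hspace" where "G \<equiv> L2 sphere_measure F"
abbreviation src where "src \<equiv> pre_tensor (Emod \<epsilon>) inn act H"
abbreviation tgt where "tgt \<equiv> pre_tensor (carr G) (ip G) (vscale (interval_L2 \<epsilon>)) (interval_L2 \<epsilon>)"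

definition pull :: "real^'m \<Rightarrow> complex^('q \<times> 2) \<Rightarrow> complex^'p" where
  "pull x u = (K0 + K1 x) *v u"

definition j1 :: "'m mod2 \<times> (real^'m \<Rightarrow> complex^'h) \<Rightarrow> (real^'m) \<times> real \<Rightarrow> complex^'p" where
  "j1 x p = m (fst x p) (snd x (immersion p))"

definition j2 :: "(real^'m \<Rightarrow> complex^'q) \<times> (real \<Rightarrow> complex^2) \<Rightarrow> (real^'m) \<times> real \<Rightarrow> complex^'p" where
  "j2 x p = pull (fst p) (tens (fst x (fst p)) (snd x (snd p)))"

definition J1 :: "('m mod2 \<times> (real^'m \<Rightarrow> complex^'h)) multiset \<Rightarrow> (real^'m) \<times> real \<Rightarrow> complex^'p" where
  "J1 M p = (\<Sum>x\<in>#M. j1 x p)"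

definition J2 :: "((real^'m \<Rightarrow> complex^'q) \<times> (real \<Rightarrow> complex^2)) multiset \<Rightarrow> (real^'m) \<times> real \<Rightarrow> complex^'p" where
  "J2 M p = (\<Sum>x\<in>#M. j2 x p)"

sublocale L: semi_ip L by (rule semi_ip_L2) auto
sublocale H: semi_ip H by (rule semi_ip_L2) auto

lemma F_add: "z \<in> F \<Longrightarrow> z' \<in> F \<Longrightarrow> z + z' \<in> F"
  using P_F[of "z + z'"] P_id by (simp add: matrix_vector_right_distrib)

lemma F_scale: "z \<in> F \<Longrightarrow> a *s z \<in> F"
  using P_F[of "a *s z"] P_id[of z] by (simp add: vector_scalar_commute)

sublocale G: semi_ip G by (rule semi_ip_L2) (auto simp: F_add F_scale)
sublocale I: semi_ip "interval_L2 \<epsilon>" unfolding interval_L2_def by (rule semi_ip_L2) auto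

lemma bounded_bilinear_m: "bounded_bilinear m"
  by (rule complex_bilinear_bounded) (simp_all add: m_add_left m_add_right m_scale_left m_scale_right)

lemma m_bound: obtains B where "B \<ge> 0" "\<And>v w. norm (m v w) \<le> B * norm v * norm w"
  using bounded_bilinear.nonneg_bounded[OF bounded_bilinear_m] by (metis mult.assoc mult.commute)

lemma m_diff_right: "m v (w - w') = m v w - m v w'"
  by (rule bounded_bilinear.diff_right[OF bounded_bilinear_m])

lemma pull_scale: "pull x (a *s u) = a *s pull x u"
  and pull_diff: "pull x (u - u') = pull x u - pull x u'"
  by (simp_all add: pull_def matrix_vector_right_distrib vector_scalar_commute matrix_vector_mult_diff_distrib)

lemma pull_cip: "norm x = 1 \<Longrightarrow> z \<in> F \<Longrightarrow> z' \<in> F \<Longrightarrow>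
    cip (pull x (tens z t)) (pull x (tens z' t')) = cip z z' * cip t t'"
  by (simp add: pull_def pull_isometric)

lemma norm_pull:
  assumes "norm x = 1" "z \<in> F"
  shows "norm (pull x (tens z t)) = norm z * norm t"
proof -
  have "complex_of_real ((norm (pull x (tens z t)))\<^sup>2) = of_real ((norm z * norm t)\<^sup>2)"
    using pull_cip[OF assms(1) assms(2) assms(2), of t t] unfolding cip_self by (simp add: power_mult_distrib)
  then have "(norm (pull x (tens z t)))\<^sup>2 = (norm z * norm t)\<^sup>2" by (simp only: of_real_eq_iff)
  then show ?thesis by simp
qed

lemma measurable_pull:
  "f \<in> borel_measurable N \<Longrightarrow> (\<lambda>p. pull (fst p) (f p)) \<in> borel_measurable N"
  unfolding pull_def
  by (intro measurable_mv borel_measurable_add borel_measurable_const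
      linear_measurable[OF K1_linear] measurable_fst_collar_borel)

lemma interval_carr: "t \<in> carr (interval_L2 \<epsilon>) \<longleftrightarrow> t \<in> borel_measurable (restrict_space lborel {-\<epsilon><..<\<epsilon>})
    \<and> integrable (restrict_space lborel {-\<epsilon><..<\<epsilon>}) (\<lambda>s. (norm (t s))\<^sup>2)"
  by (simp add: interval_L2_def L2_carr)

lemma collar_D: "p \<in> space N \<Longrightarrow> norm (fst p) = 1 \<and> - \<epsilon> < snd p \<and> snd p < \<epsilon>"
  by (auto simp: space_collar_measure collar_def)

lemma j2_carr:
  assumes "\<phi> \<in> carr G" "t \<in> carr (interval_L2 \<epsilon>)"
  shows "j2 (\<phi>, t) \<in> carr L"
proof -
  have \<phi>: "\<phi> \<in> borel_measurable sphere_measure" "integrable sphere_measure (\<lambda>x. (norm (\<phi> x))\<^sup>2)"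
      "\<And>x. norm x = 1 \<Longrightarrow> \<phi> x \<in> F"
    using assms(1) by (auto simp: L2_carr space_sphere_measure)
  have t: "t \<in> borel_measurable (restrict_space lborel {-\<epsilon><..<\<epsilon>})"
      "integrable (restrict_space lborel {-\<epsilon><..<\<epsilon>}) (\<lambda>s. (norm (t s))\<^sup>2)"
    using assms(2) by (auto simp: interval_carr)
  have m: "j2 (\<phi>, t) \<in> borel_measurable N"
    unfolding j2_def[abs_def] fst_conv snd_conv
    by (intro measurable_pull measurable_tens measurable_compose[OF measurable_fst_collar \<phi>(1)]
        measurable_compose[OF measurable_snd_collar t(1)])
  have "integrable N (\<lambda>p. complex_of_real ((norm (\<phi> (fst p)))\<^sup>2) * complex_of_real ((norm (t (snd p)))\<^sup>2))"
    by (intro collar_product_integral(1) integrable_of_real \<phi>(2) t(2))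
  then have "integrable N (\<lambda>p. complex_of_real ((norm (\<phi> (fst p)))\<^sup>2 * (norm (t (snd p)))\<^sup>2))" by simp
  then have "integrable N (\<lambda>p. (norm (\<phi> (fst p)))\<^sup>2 * (norm (t (snd p)))\<^sup>2)"
    using integrable_Re by force
  then have "integrable N (\<lambda>p. (norm (j2 (\<phi>, t) p))\<^sup>2)"
    by (rule Bochner_Integration.integrable_cong[THEN iffD1, rotated -1])
      (use collar_D \<phi>(3) in \<open>auto simp: j2_def norm_pull power_mult_distrib\<close>)
  with m show ?thesis by (simp add: L2_carr)
qed

lemma j2_ip:
  assumes "\<phi> \<in> carr G" "t \<in> carr (interval_L2 \<epsilon>)" "\<phi>' \<in> carr G" "t' \<in> carr (interval_L2 \<epsilon>)"
  shows "ip L (j2 (\<phi>, t)) (j2 (\<phi>', t')) = ip G \<phi> \<phi>' * ip (interval_L2 \<epsilon>) t t'"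
proof -
  have F: "\<And>x. norm x = 1 \<Longrightarrow> \<phi> x \<in> F" "\<And>x. norm x = 1 \<Longrightarrow> \<phi>' x \<in> F"
    using assms by (auto simp: L2_carr space_sphere_measure)
  have "ip L (j2 (\<phi>, t)) (j2 (\<phi>', t'))
      = (LINT p|N. cip (\<phi> (fst p)) (\<phi>' (fst p)) * cip (t (snd p)) (t' (snd p)))"
    unfolding L2_ip
    by (rule Bochner_Integration.integral_cong) (use collar_D F in \<open>auto simp: j2_def pull_cip\<close>)
  also have "\<dots> = ip G \<phi> \<phi>' * ip (interval_L2 \<epsilon>) t t'"
    unfolding interval_L2_def L2_ip
    by (rule collar_product_integral)
      (use assms in \<open>auto intro!: integrable_cip simp: interval_L2_def\<close>)
  finally show ?thesis .
qed

lemma J2_isometric: "isometric_map L tgt J2"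
  unfolding J2_def[abs_def]
proof (rule isometric_pre_tensor)
  fix \<phi> t \<phi>' t' assume *: "\<phi> \<in> carr G" "t \<in> carr (interval_L2 \<epsilon>)" "\<phi>' \<in> carr G" "t' \<in> carr (interval_L2 \<epsilon>)"
  show "ip (interval_L2 \<epsilon>) t (vscale (interval_L2 \<epsilon>) (ip G \<phi> \<phi>') t') = ip L (j2 (\<phi>, t)) (j2 (\<phi>', t'))"
    using * by (simp add: j2_ip I.ip_vscale)
next
  show "j2 (\<phi>, vscale (interval_L2 \<epsilon>) a t) p = a *s j2 (\<phi>, t) p" for \<phi> t a p
    by (simp add: j2_def interval_L2_def L2_vscale tens_scale_right pull_scale)
qed (simp_all add: j2_carr I.vscale_closed)

lemma Emod_D:
  assumes "\<xi> \<in> Emod \<epsilon>"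
  shows "\<xi> \<in> borel_measurable N" and "\<exists>B\<ge>0. \<forall>p\<in>space N. norm (\<xi> p) \<le> B"
proof -
  show "\<xi> \<in> borel_measurable N"
    by (rule measurable_collar) (use assms in \<open>simp add: Emod_def C0_def\<close>)
  show "\<exists>B\<ge>0. \<forall>p\<in>space N. norm (\<xi> p) \<le> B"
    using C0_bounded[of \<xi> "collar \<epsilon>"] assms unfolding Emod_def space_collar_measure by metis
qed

text \<open>Elements of \<open>C0\<close> are bounded, so restriction to the collar followed by
  multiplication with \<xi> is a bounded operator in h. The second claim is this bound in the form
  needed for limits.\<close>

lemma j1_carr:
  assumes \<xi>: "\<xi> \<in> Emod \<epsilon>" and h: "h \<in> carr H"
  shows "j1 (\<xi>, h) \<in> carr L"
    and "\<exists>C\<ge>0. \<forall>h'\<in>carr H. vdist L (j1 (\<xi>, h)) (j1 (\<xi>, h')) \<le> C * vdist H h h'"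
proof -
  obtain B where B: "B \<ge> 0" "\<And>p. p \<in> space N \<Longrightarrow> norm (\<xi> p) \<le> B" using Emod_D(2)[OF \<xi>] by blast
  obtain A where A: "A \<ge> 0" "\<And>v w. norm (m v w) \<le> A * norm v * norm w" using m_bound by blast
  have le: "norm (m (\<xi> p) w) \<le> (A * B) * norm w" if "p \<in> space N" for p w
  proof -
    have "A * norm (\<xi> p) * norm w \<le> A * B * norm w"
      using B(2)[OF that] A(1) by (intro mult_right_mono mult_left_mono) auto
    then show ?thesis using A(2)[of "\<xi> p" w] by simp
  qed
  have meas: "(\<lambda>p. m (\<xi> p) (k (immersion p))) \<in> borel_measurable N" if "k \<in> carr H" for k
    using bounded_bilinear_measurable[OF bounded_bilinear_m Emod_D(1)[OF \<xi>]] L2_immersion(1)[OF eps that]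
    by (simp add: L2_carr)
  show "j1 (\<xi>, h) \<in> carr L"
    using meas[OF h] square_integrable_bound[OF meas[OF h] L2_immersion(1)[OF eps h], of "A * B"] le
    by (simp add: L2_carr j1_def[abs_def])
  define C where "C = A * B * sqrt (inverse ((1 - \<epsilon>) ^ (CARD('m) - 1)))"
  have "vdist L (j1 (\<xi>, h)) (j1 (\<xi>, h')) \<le> C * vdist H h h'" if h': "h' \<in> carr H" for h'
  proof -
    define d where "d y = h y - h' y" for y
    have "vadd H h (vscale H (-1) h') \<in> carr H" using h h' H.vadd_closed H.vscale_closed by blast
    moreover have "vadd H h (vscale H (-1) h') = d" by (simp add: d_def fun_eq_iff L2_vadd L2_vscale vec_eq_iff)
    ultimately have d: "d \<in> carr H" by simp
    have di: "integrable N (\<lambda>p. (norm (d (immersion p)))\<^sup>2)" using L2_immersion(1)[OF eps d] by (simp add: L2_carr)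
    have "(LINT p|N. (norm (j1 (\<xi>, h) p - j1 (\<xi>, h') p))\<^sup>2) = (LINT p|N. (norm (m (\<xi> p) (d (immersion p))))\<^sup>2)"
      by (simp add: j1_def d_def m_diff_right)
    also have "\<dots> \<le> (LINT p|N. (A * B)\<^sup>2 * (norm (d (immersion p)))\<^sup>2)"
    proof (rule integral_mono)
      show "integrable N (\<lambda>p. (norm (m (\<xi> p) (d (immersion p))))\<^sup>2)"
        using square_integrable_bound[OF meas[OF d] L2_immersion(1)[OF eps d], of "A * B"] le by blast
      show "integrable N (\<lambda>p. (A * B)\<^sup>2 * (norm (d (immersion p)))\<^sup>2)" using di by simp
      show "(norm (m (\<xi> p) (d (immersion p))))\<^sup>2 \<le> (A * B)\<^sup>2 * (norm (d (immersion p)))\<^sup>2"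
        if "p \<in> space N" for p
        using power_mono[OF le[OF that, of "d (immersion p)"], of 2] by (simp add: power_mult_distrib)
    qed
    also have "\<dots> = (A * B)\<^sup>2 * (LINT p|N. (norm (d (immersion p)))\<^sup>2)" by simp
    also have "\<dots> \<le> (A * B)\<^sup>2 * (inverse ((1 - \<epsilon>) ^ (CARD('m) - 1)) * (LINT y|lborel. (norm (d y))\<^sup>2))"
      by (rule mult_left_mono[OF L2_immersion(2)[OF eps d]]) simp
    finally have "sqrt (LINT p|N. (norm (j1 (\<xi>, h) p - j1 (\<xi>, h') p))\<^sup>2)
        \<le> sqrt ((A * B)\<^sup>2 * (inverse ((1 - \<epsilon>) ^ (CARD('m) - 1)) * (LINT y|lborel. (norm (d y))\<^sup>2)))"
      by (rule real_sqrt_le_mono)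
    also have "\<dots> = C * sqrt (LINT y|lborel. (norm (d y))\<^sup>2)"
      using A B by (simp add: real_sqrt_mult C_def)
    finally show ?thesis by (simp add: vdist_L2 d_def)
  qed
  moreover have "C \<ge> 0" using A B eps by (simp add: C_def)
  ultimately show "\<exists>C\<ge>0. \<forall>h'\<in>carr H. vdist L (j1 (\<xi>, h)) (j1 (\<xi>, h')) \<le> C * vdist H h h'" by blast
qed

lemma j1_tendsto:
  assumes \<xi>: "\<xi> \<in> Emod \<epsilon>" and h: "h \<in> carr H" "\<And>n. X n \<in> carr H" "(\<lambda>n. vdist H (X n) h) \<longlonglongrightarrow> 0"
  shows "(\<lambda>n. vdist L (j1 (\<xi>, X n)) (j1 (\<xi>, h))) \<longlonglongrightarrow> 0"
proof -
  obtain C where C: "C \<ge> 0" "\<And>h'. h' \<in> carr H \<Longrightarrow> vdist L (j1 (\<xi>, h)) (j1 (\<xi>, h')) \<le> C * vdist H h h'"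
    using j1_carr(2)[OF \<xi> h(1)] by blast
  show ?thesis
  proof (rule tendsto_sandwich[OF _ _ tendsto_const])
    show "\<forall>\<^sub>F n in sequentially. 0 \<le> vdist L (j1 (\<xi>, X n)) (j1 (\<xi>, h))"
      using j1_carr(1)[OF \<xi>] h L.vdist_nonneg by simp
    show "\<forall>\<^sub>F n in sequentially. vdist L (j1 (\<xi>, X n)) (j1 (\<xi>, h)) \<le> C * vdist H (X n) h"
      using C(2)[OF h(2)] L.vdist_commute[OF j1_carr(1)[OF \<xi> h(1)] j1_carr(1)[OF \<xi> h(2)]]
        H.vdist_commute[OF h(1) h(2)] by simp
    show "(\<lambda>n. C * vdist H (X n) h) \<longlonglongrightarrow> 0" using tendsto_mult_right_zero[OF h(3)] .
  qed
qed

text \<open>The identity \<open>inn_act\<close>, integrated: the density 1/r^n of the module is the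
  density of \<open>collar_measure\<close> in Cartesian coordinates.\<close>

lemma j1_ip:
  assumes \<xi>: "\<xi> \<in> Emod \<epsilon>" "\<eta> \<in> Emod \<epsilon>" and h: "h \<in> carr H" "h' \<in> carr H"
  shows "ip H h (act (inn \<xi> \<eta>) h') = ip L (j1 (\<xi>, h)) (j1 (\<eta>, h'))"
proof -
  have m: "(\<lambda>p. cip (j1 (\<xi>, h) p) (j1 (\<eta>, h') p)) \<in> borel_measurable N"
    using j1_carr(1)[OF \<xi>(1) h(1)] j1_carr(1)[OF \<xi>(2) h(2)] by (intro measurable_cip) (simp_all add: L2_carr)
  have "cip (h y) (act (inn \<xi> \<eta>) h' y) = indicator (shell \<epsilon>) y *\<^sub>R (inverse (norm y ^ (CARD('m) - 1)) *\<^sub>R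
      cip (j1 (\<xi>, h) (polar y)) (j1 (\<eta>, h') (polar y)))" for y
  proof (cases "y \<in> shell \<epsilon>")
    case True
    then show ?thesis
      using immersion_polar[OF eps(2) True] by (simp add: inn_act j1_def scaleR_conv_of_real divide_inverse mult.commute)
  qed (simp add: inn_act)
  then show ?thesis unfolding L2_ip integral_collar[OF eps(2) m] by simp
qed

lemma J1_isometric: "isometric_map L src J1"
  unfolding J1_def[abs_def]
proof (rule isometric_pre_tensor)
  show "j1 (\<xi>, vscale H a h) p = a *s j1 (\<xi>, h) p" for \<xi> h a p
    by (simp add: j1_def L2_vscale m_scale_right)
qed (simp_all add: j1_carr j1_ip H.vscale_closed)

definition J2_closure :: "((real^'m) \<times> real \<Rightarrow> complex^'p) set" where
  "J2_closure = {g \<in> carr L. \<forall>\<delta>>0. \<exists>y\<in>carr tgt. vdist L g (J2 y) < \<delta>}"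

lemma J2_closure_D: "g \<in> J2_closure \<Longrightarrow> \<delta> > 0 \<Longrightarrow> \<exists>y\<in>carr tgt. vdist L g (J2 y) < \<delta>"
  by (simp add: J2_closure_def)

lemma J2_closure_comb:
  assumes "g \<in> J2_closure" "g' \<in> J2_closure"
  shows "(\<lambda>p. a *s g p + b *s g' p) \<in> J2_closure"
proof -
  interpret J2: isometric_map L tgt J2 by (rule J2_isometric)
  have g: "g \<in> carr L" "g' \<in> carr L" using assms by (auto simp: J2_closure_def)
  have eq: "(\<lambda>p. a *s g p + b *s g' p) = vadd L (vscale L a g) (vscale L b g')" by (simp add: L2_vadd L2_vscale)
  have "\<exists>y\<in>carr tgt. vdist L (vadd L (vscale L a g) (vscale L b g')) (J2 y) < \<delta>" if \<delta>: "\<delta> > 0" for \<delta>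
  proof -
    define k where "k = cmod a + cmod b + 1"
    have k: "k > 0" by (simp add: k_def add_nonneg_pos)
    have "\<delta> / k > 0" using \<delta> k by simp
    from J2_closure_D[OF assms(1) this] J2_closure_D[OF assms(2) this] obtain y y'
      where y: "y \<in> carr tgt" "y' \<in> carr tgt" "vdist L g (J2 y) < \<delta> / k" "vdist L g' (J2 y') < \<delta> / k"
      by blast
    let ?y = "vadd tgt (vscale tgt a y) (vscale tgt b y')"
    have "J2 ?y = vadd L (vscale L a (J2 y)) (vscale L b (J2 y'))"
      using y by (simp add: J2.J_vadd J2.J_vscale J2.P_vscale)
    then have "vdist L (vadd L (vscale L a g) (vscale L b g')) (J2 ?y)
        \<le> cmod a * vdist L g (J2 y) + cmod b * vdist L g' (J2 y')"
      using L.vdist_vadd_vscale[OF g J2.J_carr[OF y(1)] J2.J_carr[OF y(2)]] by simp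
    also have "\<dots> \<le> cmod a * (\<delta> / k) + cmod b * (\<delta> / k)"
      using y by (intro add_mono mult_left_mono) auto
    also have "\<dots> = (cmod a + cmod b) * (\<delta> / k)" by (simp only: distrib_right)
    also have "\<dots> < k * (\<delta> / k)" using \<delta> k by (intro mult_strict_right_mono) (auto simp: k_def)
    finally have "vdist L (vadd L (vscale L a g) (vscale L b g')) (J2 ?y) < \<delta>" using k by simp
    moreover have "?y \<in> carr tgt" using y J2.P_vadd J2.P_vscale by blast
    ultimately show ?thesis by blast
  qed
  then show ?thesis unfolding eq J2_closure_def using g L.vadd_closed L.vscale_closed by blast
qed

lemma J2_closure_lim:
  assumes X: "\<And>i. X i \<in> J2_closure" and g: "g \<in> carr L" and l: "(\<lambda>i. vdist L g (X i)) \<longlonglongrightarrow> 0"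
  shows "g \<in> J2_closure"
proof -
  interpret J2: isometric_map L tgt J2 by (rule J2_isometric)
  have "\<exists>y\<in>carr tgt. vdist L g (J2 y) < \<delta>" if \<delta>: "\<delta> > 0" for \<delta>
  proof -
    have "\<exists>i. vdist L g (X i) < \<delta> / 2"
    proof -
      obtain n where "\<forall>i\<ge>n. norm (vdist L g (X i) - 0) < \<delta> / 2"
        using LIMSEQ_D[OF l half_gt_zero[OF \<delta>]] by blast
      then have "\<bar>vdist L g (X n)\<bar> < \<delta> / 2" by simp
      then show ?thesis by (intro exI[of _ n]) simp
    qed
    then obtain i where i: "vdist L g (X i) < \<delta> / 2" by blast
    obtain y where y: "y \<in> carr tgt" "vdist L (X i) (J2 y) < \<delta> / 2"
      using X[of i] half_gt_zero[OF \<delta>] unfolding J2_closure_def by blast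
    have "vdist L g (J2 y) \<le> vdist L g (X i) + vdist L (X i) (J2 y)"
      using g X[of i] J2.J_carr[OF y(1)] by (intro L.vdist_triangle) (auto simp: J2_closure_def)
    then show ?thesis using i y by (intro bexI[of _ y]) auto
  qed
  then show ?thesis using g by (simp add: J2_closure_def)
qed

lemma J2_range_closure: "y \<in> carr tgt \<Longrightarrow> J2 y \<in> J2_closure"
  using isometric_map.J_carr[OF J2_isometric, of y] L.vdist_self[of "J2 y"]
  by (auto simp: J2_closure_def intro!: bexI[of _ y])

text \<open>Induction over the coefficient f in front of a fixed section. The indicator of a
  rectangle splits into a tensor of two indicators, so it lies in the range of \<open>J2\<close>.
  The section has constant norm, hence L2 limits of coefficients give L2 limits of the
  products.\<close>

lemma J2_closure_product:
  assumes f: "f \<in> borel_measurable N" "integrable N (\<lambda>p. (norm (f p :: complex))\<^sup>2)"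
  shows "(\<lambda>p. f p *s pull (fst p) (tens (P *v v) w)) \<in> J2_closure"
proof -
  define v0 where "v0 p = pull (fst p) (tens (P *v v) w)" for p :: "(real^'m) \<times> real"
  define c where "c = norm (P *v v) * norm w"
  have v0: "norm (v0 p) = c" if "p \<in> space N" for p
    using collar_D[OF that] norm_pull[OF _ P_F] by (simp add: v0_def c_def)
  have v0m: "v0 \<in> borel_measurable N" unfolding v0_def[abs_def] by (intro measurable_pull borel_measurable_const)
  have carr: "(\<lambda>p. f p *s v0 p) \<in> carr L"
    if "f \<in> borel_measurable N" "integrable N (\<lambda>p. (norm (f p))\<^sup>2)" for f
  proof -
    have "integrable N (\<lambda>p. c\<^sup>2 * (norm (f p))\<^sup>2)" using that by simp
    then have "integrable N (\<lambda>p. (norm (f p *s v0 p))\<^sup>2)"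
      by (rule Bochner_Integration.integrable_cong[THEN iffD1, rotated -1])
        (simp_all add: norm_scale v0 power_mult_distrib mult.commute)
    then show ?thesis using measurable_scale[OF that(1) v0m] by (simp add: L2_carr)
  qed
  have "(\<lambda>p. f p *s v0 p) \<in> J2_closure"
  proof (rule L2_product_induct[where P = "\<lambda>f. (\<lambda>p. f p *s v0 p) \<in> J2_closure", OF finite_sphere_measure finite_interval_measure])
    fix A :: "(real^'m) set" and B assume A: "A \<in> sets sphere_measure" and B: "B \<in> sets (restrict_space lborel {-\<epsilon><..<\<epsilon>})"
    define \<phi> where "\<phi> x = indicator A x *s (P *v v)" for x
    define t where "t s = indicator B s *s w" for s
    have \<phi>: "\<phi> \<in> carr G"
    proof -
      have "integrable sphere_measure (\<lambda>x. (norm (P *v v))\<^sup>2 * indicator A x)"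
        using A emeasure_sphere_measure_finite[of A] by (intro integrable_mult_right integrable_real_indicator)
      then have "integrable sphere_measure (\<lambda>x. (norm (\<phi> x))\<^sup>2)"
        by (rule Bochner_Integration.integrable_cong[THEN iffD1, rotated -1])
          (simp_all add: \<phi>_def norm_scale indicator_def)
      moreover have "\<phi> \<in> borel_measurable sphere_measure"
        unfolding \<phi>_def[abs_def] using A by (intro measurable_scale) simp_all
      ultimately show ?thesis by (simp add: L2_carr \<phi>_def F_scale P_F)
    qed
    have t: "t \<in> carr (interval_L2 \<epsilon>)"
    proof -
      have "integrable (restrict_space lborel {-\<epsilon><..<\<epsilon>}) (\<lambda>s. (norm w)\<^sup>2 * indicator B s)"
        using B finite_measure.emeasure_finite[OF finite_interval_measure, of \<epsilon> B]
        by (intro integrable_mult_right integrable_real_indicator) (auto simp: less_top[symmetric])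
      then have "integrable (restrict_space lborel {-\<epsilon><..<\<epsilon>}) (\<lambda>s. (norm (t s))\<^sup>2)"
        by (rule Bochner_Integration.integrable_cong[THEN iffD1, rotated -1])
          (simp_all add: t_def norm_scale indicator_def)
      moreover have "t \<in> borel_measurable (restrict_space lborel {-\<epsilon><..<\<epsilon>})"
        unfolding t_def[abs_def] using B by (intro measurable_scale) simp_all
      ultimately show ?thesis by (simp add: interval_carr)
    qed
    have "{#(\<phi>, t)#} \<in> carr tgt" using \<phi> t by (simp add: pre_tensor_def)
    moreover have "J2 {#(\<phi>, t)#} = (\<lambda>p. indicator (A \<times> B) p *s v0 p)"
    proof
      fix p :: "(real^'m) \<times> real"
      show "J2 {#(\<phi>, t)#} p = indicator (A \<times> B) p *s v0 p"
        by (simp add: J2_def j2_def \<phi>_def t_def v0_def tens_scale_left tens_scale_right pull_scale indicator_times)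
    qed
    ultimately show "(\<lambda>p. indicator (A \<times> B) p *s v0 p) \<in> J2_closure" using J2_range_closure[of "{#(\<phi>, t)#}"] by simp
  next
    fix f g assume "(\<lambda>p. f p *s v0 p) \<in> J2_closure" "(\<lambda>p. g p *s v0 p) \<in> J2_closure"
    from J2_closure_comb[OF this, of 1 1] show "(\<lambda>p. (f p + g p) *s v0 p) \<in> J2_closure" by (simp add: vec.scale_left_distrib)
  next
    fix f c assume "(\<lambda>p. f p *s v0 p) \<in> J2_closure"
    from J2_closure_comb[OF this this, of c 0] show "(\<lambda>p. (c * f p) *s v0 p) \<in> J2_closure" by simp
  next
    fix f X
    assume *: "\<And>i. (\<lambda>p. X i p *s v0 p) \<in> J2_closure" "\<And>i. X i \<in> borel_measurable (sphere_measure \<Otimes>\<^sub>M restrict_space lborel {-\<epsilon><..<\<epsilon>})"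
      "f \<in> borel_measurable (sphere_measure \<Otimes>\<^sub>M restrict_space lborel {-\<epsilon><..<\<epsilon>})"
      "integrable (sphere_measure \<Otimes>\<^sub>M restrict_space lborel {-\<epsilon><..<\<epsilon>}) (\<lambda>x. (cmod (f x))\<^sup>2)"
      "(\<lambda>i. LINT x|(sphere_measure \<Otimes>\<^sub>M restrict_space lborel {-\<epsilon><..<\<epsilon>}). (cmod (f x - X i x))\<^sup>2) \<longlonglongrightarrow> 0"
    show "(\<lambda>p. f p *s v0 p) \<in> J2_closure"
    proof (rule J2_closure_lim[OF *(1)])
      show "(\<lambda>p. f p *s v0 p) \<in> carr L" using carr *(3,4) by (simp add: collar_measure_def)
      have "vdist L (\<lambda>p. f p *s v0 p) (\<lambda>p. X i p *s v0 p) = sqrt (c\<^sup>2 * (LINT x|N. (cmod (f x - X i x))\<^sup>2))" for i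
      proof -
        have "(LINT p|N. (norm (f p *s v0 p - X i p *s v0 p))\<^sup>2) = (LINT p|N. c\<^sup>2 * (cmod (f p - X i p))\<^sup>2)"
        proof (rule Bochner_Integration.integral_cong)
          fix p assume "p \<in> space N"
          then have "norm (f p *s v0 p - X i p *s v0 p) = c * cmod (f p - X i p)"
            by (simp only: vec.scale_left_diff_distrib[symmetric] norm_scale v0 mult.commute)
          then show "(norm (f p *s v0 p - X i p *s v0 p))\<^sup>2 = c\<^sup>2 * (cmod (f p - X i p))\<^sup>2"
            by (simp only: power_mult_distrib)
        qed simp
        then show ?thesis by (simp add: vdist_L2)
      qed
      moreover have "(\<lambda>i. sqrt (c\<^sup>2 * (LINT x|N. (cmod (f x - X i x))\<^sup>2))) \<longlonglongrightarrow> sqrt (c\<^sup>2 * 0)"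
        using *(5) unfolding collar_measure_def by (intro tendsto_intros)
      ultimately show "(\<lambda>i. vdist L (\<lambda>p. f p *s v0 p) (\<lambda>p. X i p *s v0 p)) \<longlonglongrightarrow> 0" by simp
    qed
  qed (use f in \<open>simp_all add: collar_measure_def\<close>)
  then show ?thesis by (simp add: v0_def)
qed

end

section \<open>Density of the two embeddings and the unitary map\<close>

lemma mv_axis: "(A *v axis i (1::complex)) $ j = A $ j $ i"
  by (simp add: matrix_vector_mult_def axis_def if_distrib cong: if_cong)

lemma kron_one_mv:
  fixes P :: "complex^'q^'q" and v :: "complex^('q::finite \<times> 'r::finite)"
  shows "kron P (mat 1) *v v = (\<Sum>i\<in>UNIV. v $ i *s tens (P *v axis (fst i) 1) (axis (snd i) 1))"
proof -
  have "kron P (mat 1 :: complex^'r^'r) *v axis i 1 = tens (P *v axis (fst i) 1) (axis (snd i) 1)" for i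
    by (simp add: vec_eq_iff tens_def mv_axis kron_def mat_def) (simp add: axis_def)
  then show ?thesis by (subst mv_sum_axis) simp
qed

lemma vdist_L2_cong:
  assumes "\<And>x. x \<in> space M \<Longrightarrow> f x = g x" shows "vdist (L2 M F) f g = 0"
proof -
  have "(LINT x|M. (norm (f x - g x))\<^sup>2) = (LINT x|M. 0)"
    by (rule Bochner_Integration.integral_cong) (simp_all add: assms)
  then show ?thesis by (simp add: vdist_L2)
qed

context collar_model begin

lemma J2_closure_cong:
  assumes "g \<in> J2_closure" "g' \<in> carr L" "\<And>p. p \<in> space N \<Longrightarrow> g' p = g p"
  shows "g' \<in> J2_closure"
  by (rule J2_closure_lim[of "\<lambda>_. g"]) (use assms vdist_L2_cong[of N g' g UNIV] in auto)

lemma J2_closure_zero: "(\<lambda>_. 0) \<in> J2_closure"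
proof -
  have "J2 {#} \<in> J2_closure" by (rule J2_range_closure) (simp add: pre_tensor_def)
  then show ?thesis by (simp add: J2_def[abs_def])
qed

lemma J2_closure_sum: "(\<And>i. i \<in> I \<Longrightarrow> f i \<in> J2_closure) \<Longrightarrow> (\<lambda>p. \<Sum>i\<in>I. f i p) \<in> J2_closure"
proof (induction I rule: infinite_finite_induct)
  case (insert i I)
  then show ?case using J2_closure_comb[of "f i" "\<lambda>p. \<Sum>i\<in>I. f i p" 1 1] by simp
qed (simp_all add: J2_closure_zero)

lemma push_bound:
  obtains B where "B \<ge> 0" "\<And>x (w::complex^'p). norm x = 1 \<Longrightarrow> norm ((R0 + R1 x) *v w) \<le> B * norm w"
proof -
  obtain K where K: "K \<ge> 0" "\<And>(A::complex^'p^('q \<times> 2)) w. norm (A *v w) \<le> norm A * norm w * K"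
    using bounded_bilinear.nonneg_bounded[OF bounded_bilinear_mv] by blast
  obtain K' where K': "\<And>x. norm (R1 x) \<le> K' * norm x" using linear_bounded[OF R1_linear] by blast
  have K'0: "K' \<ge> 0" using order_trans[OF norm_ge_zero K'[of "axis undefined 1"]] by (simp add: norm_axis_1)
  show thesis
  proof (rule that[of "(norm R0 + K') * K"])
    fix x :: "real^'m" and w :: "complex^'p" assume x: "norm x = 1"
    have "norm (R0 + R1 x) \<le> norm R0 + K'" using norm_triangle_ineq[of R0 "R1 x"] K'[of x] x by simp
    then have "norm (R0 + R1 x) * norm w * K \<le> (norm R0 + K') * norm w * K"
      using K by (intro mult_right_mono) auto
    then show "norm ((R0 + R1 x) *v w) \<le> (norm R0 + K') * K * norm w"
      using K(2)[of "R0 + R1 x" w] by (simp add: mult_ac)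
  qed (use K K'0 in simp)
qed

text \<open>The inverse fibre map turns g into finitely many coordinate functions with respect to
  the sections treated in \<open>J2_closure_product\<close>. The coordinates are square integrable
  because this inverse is bounded on the sphere.\<close>

lemma J2_closure_all:
  assumes g: "g \<in> carr L"
  shows "g \<in> J2_closure"
proof -
  obtain B where B: "B \<ge> 0" "\<And>x (w::complex^'p). norm x = 1 \<Longrightarrow> norm ((R0 + R1 x) *v w) \<le> B * norm w"
    using push_bound by blast
  define f where "f i p = ((R0 + R1 (fst p)) *v g p) $ i" for i p
  have gm: "g \<in> borel_measurable N" using g by (simp add: L2_carr)
  have fv: "(\<lambda>p. (R0 + R1 (fst p)) *v g p) \<in> borel_measurable N"
    by (intro measurable_mv borel_measurable_add borel_measurable_const
      linear_measurable[OF R1_linear] measurable_fst_collar_borel gm)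
  have fm: "f i \<in> borel_measurable N" for i
    unfolding f_def[abs_def]
    using measurable_compose[OF fv borel_measurable_continuous_onI[OF linear_continuous_on[OF bounded_linear_vec_nth]]] .
  have fi: "integrable N (\<lambda>p. (norm (f i p))\<^sup>2)" for i
  proof (rule square_integrable_bound[OF fm g])
    fix p assume "p \<in> space N"
    then have "norm ((R0 + R1 (fst p)) *v g p) \<le> B * norm (g p)" using B(2) collar_D by blast
    then show "norm (f i p) \<le> B * norm (g p)"
      unfolding f_def using order_trans[OF Finite_Cartesian_Product.norm_nth_le] by blast
  qed
  have "(\<lambda>p. \<Sum>i\<in>UNIV. f i p *s pull (fst p) (tens (P *v axis (fst i) 1) (axis (snd i) 1))) \<in> J2_closure"
    by (rule J2_closure_sum) (rule J2_closure_product[OF fm fi])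
  then show ?thesis
  proof (rule J2_closure_cong[OF _ g])
    fix p assume "p \<in> space N"
    then have x: "norm (fst p) = 1" using collar_D by blast
    have lin: "linear (pull (fst p))" unfolding pull_def by simp
    have "g p = pull (fst p) (kron P (mat 1) *v ((R0 + R1 (fst p)) *v g p))"
      unfolding pull_def using pull_push[OF x] by simp
    also have "\<dots> = (\<Sum>i\<in>UNIV. f i p *s pull (fst p) (tens (P *v axis (fst i) 1) (axis (snd i) 1)))"
      unfolding kron_one_mv linear_sum[OF lin] pull_scale f_def by simp
    finally show "g p = (\<Sum>i\<in>UNIV. f i p *s pull (fst p) (tens (P *v axis (fst i) 1) (axis (snd i) 1)))" .
  qed
qed

text \<open>The generators \<open>eb i\<close> are constant sections, which do not vanish at the
  boundary; damping by the cutoff makes them elements of the module.\<close>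

definition bump_frame :: "2 \<Rightarrow> 'm mod2" where
  "bump_frame i = (\<lambda>p. of_real (bump \<epsilon> (snd p)) *s eb i)"

lemma m_bump_frame_sum:
  "(\<Sum>i\<in>UNIV. m (bump_frame i p) (a *s (pr i *v u))) = (of_real (bump \<epsilon> (snd p)) * a) *s u"
proof -
  have "(\<Sum>i\<in>UNIV. m (bump_frame i p) (a *s (pr i *v u)))
      = (\<Sum>i\<in>UNIV. (of_real (bump \<epsilon> (snd p)) * a) *s m (eb i) (pr i *v u))"
    by (simp add: bump_frame_def m_scale_left m_scale_right mult.commute)
  also have "\<dots> = (of_real (bump \<epsilon> (snd p)) * a) *s (\<Sum>i\<in>UNIV. m (eb i) (pr i *v u))"
    by (simp add: vec.scale_sum_right)
  finally show ?thesis by (simp only: m_basis)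
qed

text \<open>Dividing by the cutoff undoes the damping of the frame, but 1/cos^2 is unbounded.
  Truncating to the set where the cutoff exceeds 1/(k+1) keeps the coefficients square integrable,
  and these sets exhaust the collar.\<close>

lemma approximation_by_src:
  assumes g: "g \<in> carr L" and \<delta>: "\<delta> > 0"
  shows "\<exists>x\<in>carr src. vdist L g (J1 x) < \<delta>"
proof -
  define c where "c k p = (if bump \<epsilon> (snd p) > 1 / real (Suc k) then complex_of_real (inverse (bump \<epsilon> (snd p))) else 0)"
    for k and p :: "(real^'m) \<times> real"
  define gk where "gk k i p = c k p *s (pr i *v g p)" for k i p
  define h where "h k i y = indicator (shell \<epsilon>) y *\<^sub>R gk k i (polar y)" for k i y
  define X where "X k = image_mset (\<lambda>i. (bump_frame i, h k i)) (mset_set UNIV)" for k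
  have gm: "g \<in> borel_measurable N" using g by (simp add: L2_carr)
  have bm: "(\<lambda>p. bump \<epsilon> (snd p)) \<in> borel_measurable N"
    using measurable_compose[OF measurable_snd_collar_borel, of "bump \<epsilon>" borel \<epsilon>]
    by (simp add: bump_def[abs_def] borel_measurable_continuous_onI continuous_intros)
  have cm: "c k \<in> borel_measurable N" for k
    unfolding c_def[abs_def] using bm by measurable
  have cb: "cmod (c k p) \<le> real (Suc k)" for k p
  proof (cases "bump \<epsilon> (snd p) > 1 / real (Suc k)")
    case True
    then have "inverse (bump \<epsilon> (snd p)) \<le> inverse (1 / real (Suc k))"
      by (intro le_imp_inverse_le) auto
    then show ?thesis using True by (simp add: c_def bump_def norm_inverse norm_power)
  qed (simp add: c_def)
  have hk: "h k i \<in> carr H" for k i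
  proof -
    have "bounded_linear ((*v) (pr i))" by (rule bounded_bilinear.bounded_linear_right[OF bounded_bilinear_mv])
    then obtain K where K: "K \<ge> 0" "\<And>w. norm (pr i *v w) \<le> norm w * K"
      using bounded_linear.nonneg_bounded by blast
    have m: "gk k i \<in> borel_measurable N"
      unfolding gk_def[abs_def] by (intro measurable_scale cm measurable_mv gm borel_measurable_const)
    have "norm (gk k i p) \<le> (real (Suc k) * K) * norm (g p)" for p
      using mult_mono[OF cb[of k p] K(2)[of "g p"]] by (simp add: gk_def norm_scale mult_ac)
    then have "gk k i \<in> carr (L2 N UNIV)"
      using m square_integrable_bound[OF m g, of "real (Suc k) * K"] by (simp add: L2_carr)
    then show ?thesis unfolding h_def[abs_def] by (rule L2_polar[OF eps(2)])
  qed
  have xiE: "bump_frame i \<in> Emod \<epsilon>" for i unfolding bump_frame_def Emod_def by (rule C0_bump[OF eps(1)])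
  have Xc: "X k \<in> carr src" for k using hk xiE by (auto simp: X_def pre_tensor_def)
  interpret J1: isometric_map L src J1 by (rule J1_isometric)
  define Y where "Y k p = (if bump \<epsilon> (snd p) > 1 / real (Suc k) then g p else 0)" for k p
  have JX: "J1 (X k) p = Y k p" if p: "p \<in> space N" for k p
  proof -
    have pc: "p \<in> collar \<epsilon>" using p by (simp add: space_collar_measure)
    have "J1 (X k) p = (\<Sum>i\<in>UNIV. m (bump_frame i p) (c k p *s (pr i *v g p)))"
      using immersion_shell[OF eps(2) pc] polar_immersion[OF eps(2) pc]
      by (simp add: J1_def X_def j1_def h_def gk_def sum_unfold_sum_mset image_mset.compositionality o_def)
    also have "\<dots> = (of_real (bump \<epsilon> (snd p)) * c k p) *s g p" by (rule m_bump_frame_sum)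
    also have "\<dots> = Y k p"
      using bump_pos[OF eps(1), of "snd p"] collar_D[OF p] by (simp add: c_def Y_def)
    finally show ?thesis .
  qed
  have "(\<lambda>k. LINT p|N. (norm (g p - Y k p))\<^sup>2) \<longlonglongrightarrow> 0"
  proof (rule L2_limit_dominated[OF _ gm])
    show "integrable N (\<lambda>p. (norm (g p))\<^sup>2)" using g by (simp add: L2_carr)
    show "Y k \<in> borel_measurable N" for k unfolding Y_def[abs_def] using bm gm by measurable
    show "(norm (Y k p))\<^sup>2 \<le> (norm (g p))\<^sup>2" for k p by (simp add: Y_def)
    show "(\<lambda>k. Y k p) \<longlonglongrightarrow> g p" if p: "p \<in> space N" for p
    proof (rule tendsto_eventually)
      obtain n where n: "1 / real (Suc n) < bump \<epsilon> (snd p)"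
        using reals_Archimedean bump_pos[OF eps(1), of "snd p"] collar_D[OF p] by (metis inverse_eq_divide)
      show "\<forall>\<^sub>F k in sequentially. Y k p = g p"
        unfolding eventually_sequentially
      proof (intro exI[of _ n] allI impI)
        fix k assume "n \<le> k"
        then have "1 / real (Suc k) \<le> 1 / real (Suc n)" by (simp add: frac_le)
        then show "Y k p = g p" using n by (simp add: Y_def)
      qed
    qed
  qed
  moreover have "(LINT p|N. (norm (g p - J1 (X k) p))\<^sup>2) = (LINT p|N. (norm (g p - Y k p))\<^sup>2)" for k
    by (rule Bochner_Integration.integral_cong) (simp_all add: JX)
  ultimately have "(\<lambda>k. sqrt (LINT p|N. (norm (g p - J1 (X k) p))\<^sup>2)) \<longlonglongrightarrow> sqrt 0"
    by (intro tendsto_intros) simp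
  then have "(\<lambda>k. vdist L g (J1 (X k))) \<longlonglongrightarrow> 0" by (simp add: vdist_L2)
  then obtain n where "\<forall>k\<ge>n. norm (vdist L g (J1 (X k)) - 0) < \<delta>" using LIMSEQ_D \<delta> by blast
  then have "\<bar>vdist L g (J1 (X n))\<bar> < \<delta>" by simp
  then show ?thesis using Xc by (intro bexI[of _ "X n"]) auto
qed

lemma dense: "dense_isometries L src J1 tgt J2"
proof -
  interpret J1: isometric_map L src J1 by (rule J1_isometric)
  interpret J2: isometric_map L tgt J2 by (rule J2_isometric)
  show ?thesis
  proof
    show "\<exists>y\<in>carr tgt. vdist L (J1 x) (J2 y) < \<delta>" if "x \<in> carr src" "\<delta> > 0" for x \<delta>
      using J2_closure_D[OF J2_closure_all[OF J1.J_carr]] that by blast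
    show "\<exists>x\<in>carr src. vdist L (J2 y) (J1 x) < \<delta>" if "y \<in> carr tgt" "\<delta> > 0" for y \<delta>
      using approximation_by_src[OF J2.J_carr] that by blast
  qed
qed

lemma unitary:
  obtains U where "unitary_iso (interior_tensor (Emod \<epsilon>) inn act H) (hilbert_tensor G (interval_L2 \<epsilon>)) U"
    and "\<And>x y. x \<in> carr src \<Longrightarrow> y \<in> carr tgt \<Longrightarrow>
      ip (hilbert_tensor G (interval_L2 \<epsilon>)) (fin_tensor y) (U (fin_tensor x)) = ip L (J2 y) (J1 x)"
    and "\<And>x y. x \<in> carr src \<Longrightarrow> y \<in> carr tgt \<Longrightarrow> (\<And>p. p \<in> space N \<Longrightarrow> J1 x p = J2 y p) \<Longrightarrow>
      veq (hilbert_tensor G (interval_L2 \<epsilon>)) (U (fin_tensor x)) (fin_tensor y)"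
proof -
  interpret dense_isometries L src J1 tgt J2 by (rule dense)
  obtain U where U: "unitary_iso (completion src) (completion tgt) U"
    "\<And>x y. x \<in> carr src \<Longrightarrow> y \<in> carr tgt \<Longrightarrow> ip (completion tgt) (\<lambda>_. y) (U (\<lambda>_. x)) = ip L (J2 y) (J1 x)"
    "\<And>x y. x \<in> carr src \<Longrightarrow> y \<in> carr tgt \<Longrightarrow> vdist L (J1 x) (J2 y) = 0 \<Longrightarrow>
      veq (completion tgt) (U (\<lambda>_. x)) (\<lambda>_. y)"
    by (rule unitary_between_completions) (rule that, assumption, blast, blast)
  show thesis
  proof (rule that[unfolded interior_tensor_def hilbert_tensor_def fin_tensor_def, OF U(1)])
    fix x y assume *: "x \<in> carr src" "y \<in> carr tgt" 
    show "ip (completion tgt) (\<lambda>_. y) (U (\<lambda>_. x)) = ip L (J2 y) (J1 x)" by (rule U(2)[OF *])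
    assume "\<And>p. p \<in> space N \<Longrightarrow> J1 x p = J2 y p"
    then have "vdist L (J1 x) (J2 y) = 0" by (rule vdist_L2_cong)
    then show "veq (completion tgt) (U (\<lambda>_. x)) (\<lambda>_. y)" by (rule U(3)[OF *])
  qed
qed

lemma fin_tensor_ip:
  assumes "x \<in> carr tgt" "y \<in> carr tgt"
  shows "ip (hilbert_tensor G (interval_L2 \<epsilon>)) (fin_tensor x) (fin_tensor y) = ip L (J2 x) (J2 y)"
  using isometric_map.J_ip[OF J2_isometric assms]
  by (simp add: hilbert_tensor_def interior_tensor_def completion_def fin_tensor_def)

lemma fin_tensor_veq:
  assumes "x \<in> carr tgt"
  shows "veq (hilbert_tensor G (interval_L2 \<epsilon>)) (fin_tensor x) (fin_tensor x)"
proof -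
  interpret T: semi_ip tgt by (rule isometric_map.semi_ip[OF J2_isometric])
  show ?thesis
    unfolding hilbert_tensor_def interior_tensor_def fin_tensor_def
    by (rule T.veq_completionI) (use assms T.vdist_self in auto)
qed

end

section \<open>The product operator as a differential expression\<close>

text \<open>The product operator in Cartesian coordinates.  The middle term is the effect of the density
  \<open>1/r\<^sup>n\<close> in the inner product of the module.\<close>

definition flat_op :: "real \<Rightarrow> (real^'m \<Rightarrow> complex^'p^'p) \<Rightarrow> complex^'p^'p \<Rightarrow>
    (real^'m \<Rightarrow> complex^'p) \<Rightarrow> real^'m \<Rightarrow> complex^'p" where
  "flat_op \<epsilon> b \<alpha> \<Psi> y =
     \<i> *s (\<Sum>l\<in>UNIV. b (axis l 1) *v frechet_derivative \<Psi> (at y) (axis l 1))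
     - (\<i> * of_real (real (CARD('m) - 1) / (2 * norm y))) *s (b (y /\<^sub>R norm y) *v \<Psi> y)
     + of_real (pot \<epsilon> (norm y - 1)) *s (\<alpha> *v \<Psi> y)"

lemma frechet_derivative_cong_open:
  assumes "open V" "y \<in> V" "\<And>z. z \<in> V \<Longrightarrow> f z = g z"
  shows "frechet_derivative f (at y) = frechet_derivative g (at y)"
proof -
  have "(f has_derivative L) (at y) \<longleftrightarrow> (g has_derivative L) (at y)" for L
    using has_derivative_transform_within_open[of f L y UNIV V g]
      has_derivative_transform_within_open[of g L y UNIV V f] assms by metis
  then show ?thesis by (simp add: frechet_derivative_def)
qed

lemma flat_op_cong:
  assumes "open V" "y \<in> V" "\<And>z. z \<in> V \<Longrightarrow> \<Psi> z = \<Theta> z"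
  shows "flat_op \<epsilon> b \<alpha> \<Psi> y = flat_op \<epsilon> b \<alpha> \<Theta> y"
proof -
  have "frechet_derivative \<Psi> (at y) = frechet_derivative \<Theta> (at y)"
    by (rule frechet_derivative_cong_open[OF assms])
  moreover have "\<Psi> y = \<Theta> y" using assms by blast
  ultimately show ?thesis by (simp only: flat_op_def)
qed

lemma flat_op_sum:
  fixes \<Psi> :: "'i \<Rightarrow> real^'m \<Rightarrow> complex^'p"
  assumes "\<And>i. i \<in> I \<Longrightarrow> \<Psi> i differentiable at y" "finite I"
  shows "flat_op \<epsilon> b \<alpha> (\<lambda>z. \<Sum>i\<in>I. \<Psi> i z) y = (\<Sum>i\<in>I. flat_op \<epsilon> b \<alpha> (\<Psi> i) y)"
proof -
  have "((\<lambda>z. \<Sum>i\<in>I. \<Psi> i z) has_derivative (\<lambda>h. \<Sum>i\<in>I. frechet_derivative (\<Psi> i) (at y) h)) (at y)"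
    by (rule has_derivative_sum) (use assms frechet_derivative_works in blast)
  from frechet_derivative_at[OF this, symmetric]
  have d: "frechet_derivative (\<lambda>z. \<Sum>i\<in>I. \<Psi> i z) (at y) = (\<lambda>h. \<Sum>i\<in>I. frechet_derivative (\<Psi> i) (at y) h)" .
  have mv: "A *v (\<Sum>i\<in>I. f i) = (\<Sum>i\<in>I. A *v f i)" for A :: "complex^'p^'p" and f :: "'i \<Rightarrow> complex^'p"
    by (rule linear_sum) simp
  show ?thesis
    unfolding flat_op_def d mv
    by (simp add: sum.distrib sum_subtractf vec.scale_sum_right sum.swap[of _ I UNIV])
qed

lemma linear_axis_sum:
  fixes b :: "real^'m \<Rightarrow> 'a::real_vector"
  assumes "linear b" shows "b y = (\<Sum>l\<in>UNIV. (y $ l) *\<^sub>R b (axis l 1))"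
proof -
  have "y = (\<Sum>l\<in>UNIV. (y $ l) *\<^sub>R axis l 1)"
    by (simp add: vec_eq_iff axis_def if_distrib cong: if_cong)
  then have "b y = b (\<Sum>l\<in>UNIV. (y $ l) *\<^sub>R axis l 1)" by simp
  then show ?thesis by (simp add: linear_sum[OF assms] linear_scale[OF assms])
qed

lemma has_derivative_norm_at: "y \<noteq> 0 \<Longrightarrow> (norm has_derivative (\<lambda>h. (y /\<^sub>R norm y) \<bullet> h)) (at y)"
  for y :: "'a::real_inner"
  using has_derivative_norm[of y] by (simp add: sgn_div_norm inner_commute)

lemma inverse_norm_power_deriv:
  fixes y :: "'a::real_inner"
  assumes "y \<noteq> 0"
  shows "((\<lambda>z. inverse (norm z ^ n)) has_derivative
    (\<lambda>h. - (real n / norm y) * inverse (norm y ^ n) * ((y /\<^sub>R norm y) \<bullet> h))) (at y)"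
proof -
  have "((\<lambda>r. inverse (r ^ n)) has_real_derivative - (real n / norm y) * inverse (norm y ^ n)) (at (norm y))"
  proof (cases n)
    case (Suc k)
    have "((\<lambda>r. inverse (r ^ Suc k)) has_real_derivative
        - (inverse (norm y ^ Suc k) * (real (Suc k) * norm y ^ k) * inverse (norm y ^ Suc k))) (at (norm y))"
      using assms by (auto intro!: derivative_eq_intros simp del: power_Suc)
    moreover have "- (inverse (norm y ^ Suc k) * (real (Suc k) * norm y ^ k) * inverse (norm y ^ Suc k))
        = - (real (Suc k) / norm y) * inverse (norm y ^ Suc k)"
      using assms by (simp add: field_simps)
    ultimately show ?thesis using Suc by simp
  qed simp
  from diff_chain_at[OF has_derivative_norm_at[OF assms] this[unfolded has_field_derivative_def]]
  show ?thesis by (simp add: o_def)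
qed

text \<open>Divergence theorem for the field \<open>g l\<close> with components r^(-n) <\<Psi>,
  b(e_l) \<Theta>>. Differentiating the density produces -n/r, which is the sum of the two
  contributions n/(2r) from the middle terms of \<open>flat_op\<close>; the potential terms cancel
  because \<alpha> is Hermitian. Only \<Psi> has compact support, so \<Theta> may be built from any
  section in the domains of the potential and the connection.\<close>

lemma flat_op_symmetric:
  fixes \<Psi> \<Theta> :: "real^'m \<Rightarrow> complex^'p" and b :: "real^'m \<Rightarrow> complex^'p^'p"
  assumes \<epsilon>: "0 < \<epsilon>" "\<epsilon> < 1" and b: "linear b"
    and bh: "\<And>v z w. cip (b v *v z) w = cip z (b v *v w)" and \<alpha>h: "\<And>z w. cip (\<alpha> *v z) w = cip z (\<alpha> *v w)"
    and K: "compact K" "K \<subseteq> shell \<epsilon>" "\<And>y. y \<notin> K \<Longrightarrow> \<Psi> y = 0"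
    and \<Psi>: "\<And>y. y \<in> shell \<epsilon> \<Longrightarrow> \<Psi> differentiable at y"
      "\<And>v. continuous_on (shell \<epsilon>) (\<lambda>y. frechet_derivative \<Psi> (at y) v)"
    and \<Theta>: "\<And>y. y \<in> shell \<epsilon> \<Longrightarrow> \<Theta> differentiable at y"
      "\<And>v. continuous_on (shell \<epsilon>) (\<lambda>y. frechet_derivative \<Theta> (at y) v)"
    and int: "integrable (collar_measure \<epsilon>) (\<lambda>p. cip (flat_op \<epsilon> b \<alpha> \<Psi> (immersion p)) (\<Theta> (immersion p)))"
      "integrable (collar_measure \<epsilon>) (\<lambda>p. cip (\<Psi> (immersion p)) (flat_op \<epsilon> b \<alpha> \<Theta> (immersion p)))"
  shows "(LINT p|collar_measure \<epsilon>. cip (flat_op \<epsilon> b \<alpha> \<Psi> (immersion p)) (\<Theta> (immersion p)))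
    = (LINT p|collar_measure \<epsilon>. cip (\<Psi> (immersion p)) (flat_op \<epsilon> b \<alpha> \<Theta> (immersion p)))"
proof -
  define n where "n = CARD('m) - 1"
  define w where "w y = inverse (norm y ^ n)" for y :: "real^'m"
  define g where "g l y = w y *\<^sub>R cip (\<Psi> y) (b (axis l 1) *v \<Theta> y)" for l y
  let ?\<Psi>' = "\<lambda>y. frechet_derivative \<Psi> (at y)" and ?\<Theta>' = "\<lambda>y. frechet_derivative \<Theta> (at y)"
  define gd where "gd l y h = w y *\<^sub>R (cip (\<Psi> y) (b (axis l 1) *v ?\<Theta>' y h) + cip (?\<Psi>' y h) (b (axis l 1) *v \<Theta> y))
      + (- (real n / norm y) * w y * ((y /\<^sub>R norm y) \<bullet> h)) *\<^sub>R cip (\<Psi> y) (b (axis l 1) *v \<Theta> y)" for l y h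
  have nz: "y \<noteq> 0" if "y \<in> shell \<epsilon>" for y :: "real^'m" using shell_nonzero[OF \<epsilon>(2) that] by blast
  have Kc: "open (- K)" using K(1) by (simp add: compact_imp_closed open_Compl)
  have g0: "(g l has_derivative (\<lambda>_. 0)) (at y)" if y: "y \<notin> K" for l y
    by (rule has_derivative_transform_within_open[OF has_derivative_const Kc])
      (use y K(3) in \<open>auto simp: g_def cip_def\<close>)
  have gs: "(g l has_derivative gd l y) (at y)" if y: "y \<in> shell \<epsilon>" for l y
  proof -
    have "(\<Psi> has_derivative ?\<Psi>' y) (at y)" "(\<Theta> has_derivative ?\<Theta>' y) (at y)"
      using \<Psi>(1)[OF y] \<Theta>(1)[OF y] frechet_derivative_works by blast+
    moreover from this(2) have "((\<lambda>z. b (axis l 1) *v \<Theta> z) has_derivative (\<lambda>h. b (axis l 1) *v ?\<Theta>' y h)) (at y)"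
      by (rule bounded_linear.has_derivative[OF bounded_bilinear.bounded_linear_right[OF bounded_bilinear_mv]])
    ultimately have "((\<lambda>z. cip (\<Psi> z) (b (axis l 1) *v \<Theta> z)) has_derivative
        (\<lambda>h. cip (\<Psi> y) (b (axis l 1) *v ?\<Theta>' y h) + cip (?\<Psi>' y h) (b (axis l 1) *v \<Theta> y))) (at y)"
      by (intro bounded_bilinear.FDERIV[OF bounded_bilinear_cip])
    from has_derivative_scaleR[OF inverse_norm_power_deriv[OF nz[OF y], of n] this]
    show ?thesis unfolding g_def[abs_def] gd_def[abs_def] w_def .
  qed
  have gfr: "frechet_derivative (g l) (at y) = gd l y" if "y \<in> shell \<epsilon>" for l y
    using frechet_derivative_at[OF gs[OF that], symmetric] .
  have gfr0: "frechet_derivative (g l) (at y) = (\<lambda>_. 0)" if "y \<notin> K" for l y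
    using frechet_derivative_at[OF g0[OF that], symmetric] .
  have \<Psi>c: "continuous_on (shell \<epsilon>) \<Psi>" and \<Theta>c: "continuous_on (shell \<epsilon>) \<Theta>"
    using \<Psi>(1) \<Theta>(1) differentiable_imp_continuous_within continuous_at_imp_continuous_on by blast+
  have bc: "continuous_on (shell \<epsilon>) (\<lambda>y. A *v f y)" if "continuous_on (shell \<epsilon>) f"
    for A :: "complex^'p^'p" and f :: "real^'m \<Rightarrow> complex^'p"
    by (rule bounded_bilinear.continuous_on[OF bounded_bilinear_mv continuous_on_const that])
  have gdc: "continuous_on (shell \<epsilon>) (\<lambda>y. gd l y h)" for l h
    unfolding gd_def w_def using nz
    by (intro continuous_intros bounded_bilinear.continuous_on[OF bounded_bilinear_cip] bc \<Psi>c \<Theta>c \<Psi>(2) \<Theta>(2)) auto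
  have gB: "\<exists>B. \<forall>y. norm (frechet_derivative (g l) (at y) h) \<le> B" for l h
  proof -
    have "bounded ((\<lambda>y. gd l y h) ` K)"
      using compact_continuous_image[OF continuous_on_subset[OF gdc K(2)] K(1)] compact_imp_bounded by blast
    then obtain B where B: "\<And>y. y \<in> K \<Longrightarrow> norm (gd l y h) \<le> B" by (auto simp: bounded_iff)
    have "norm (frechet_derivative (g l) (at y) h) \<le> max 0 B" for y
    proof (cases "y \<in> K")
      case True
      then have "y \<in> shell \<epsilon>" using K(2) by blast
      then show ?thesis using B[OF True] gfr by simp
    qed (simp add: gfr0)
    then show ?thesis by blast
  qed
  have gdiff: "g l differentiable at y" for l y
  proof (cases "y \<in> K")
    case True
    then have "y \<in> shell \<epsilon>" using K(2) by blast
    then show ?thesis using gs differentiable_def by blast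
  qed (use g0 differentiable_def in blast)
  have gK: "g l y = 0" if "y \<notin> K" for l y using K(3)[OF that] by (simp add: g_def cip_def)
  have ibp: "integrable lborel (\<lambda>y. frechet_derivative (g l) (at y) h)"
    "(LINT y|lborel. frechet_derivative (g l) (at y) h) = 0" for l h
    using integral_directional_derivative[OF gdiff K(1) gK] gB[of l h] by blast+
  define d where "d y = cip (flat_op \<epsilon> b \<alpha> \<Psi> y) (\<Theta> y) - cip (\<Psi> y) (flat_op \<epsilon> b \<alpha> \<Theta> y)" for y
  have cip_suml: "cip (\<Sum>l\<in>UNIV. f l) z = (\<Sum>l\<in>UNIV. cip (f l) z)"
    and cip_sumr: "cip z (\<Sum>l\<in>UNIV. f l) = (\<Sum>l\<in>UNIV. cip z (f l))" for f :: "'m \<Rightarrow> complex^'p" and z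
    using bounded_bilinear.sum_left[OF bounded_bilinear_cip] bounded_bilinear.sum_right[OF bounded_bilinear_cip] by blast+
  have pointwise: "indicator (shell \<epsilon>) y *\<^sub>R (w y *\<^sub>R d y)
      = - \<i> * (\<Sum>l\<in>UNIV. frechet_derivative (g l) (at y) (axis l 1))" for y
  proof (cases "y \<in> shell \<epsilon>")
    case True
    define X where "X = (\<Sum>l\<in>UNIV. cip (?\<Psi>' y (axis l 1)) (b (axis l 1) *v \<Theta> y))"
    define X' where "X' = (\<Sum>l\<in>UNIV. cip (\<Psi> y) (b (axis l 1) *v ?\<Theta>' y (axis l 1)))"
    define Y where "Y = cip (\<Psi> y) (b (y /\<^sub>R norm y) *v \<Theta> y)"
    define k where "k = complex_of_real (real n / (2 * norm y))"
    have cip_uminus: "cip (- z) z' = - cip z z'" "cip z (- z') = - cip z z'" for z z' :: "complex^'p"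
      by (simp_all add: cip_def sum_negf)
    have cip_diff: "cip (z - z'') z' = cip z z' - cip z'' z'" "cip z (z' - z'') = cip z z' - cip z z''" for z z' z'' :: "complex^'p"
      by (simp_all add: cip_def algebra_simps sum_subtractf)
    have "cip (flat_op \<epsilon> b \<alpha> \<Psi> y) (\<Theta> y) = - \<i> * X + \<i> * k * Y
        + of_real (pot \<epsilon> (norm y - 1)) * cip (\<Psi> y) (\<alpha> *v \<Theta> y)"
      unfolding flat_op_def X_def Y_def k_def n_def
      by (simp add: cip_add_left cip_diff cip_scale_left cip_suml bh \<alpha>h)
    moreover have "cip (\<Psi> y) (flat_op \<epsilon> b \<alpha> \<Theta> y) = \<i> * X' - \<i> * k * Y
        + of_real (pot \<epsilon> (norm y - 1)) * cip (\<Psi> y) (\<alpha> *v \<Theta> y)"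
      unfolding flat_op_def X'_def Y_def k_def n_def
      by (simp add: cip_add_right cip_diff cip_scale_right cip_sumr)
    ultimately have d: "d y = - \<i> * (X + X' - 2 * k * Y)" by (simp add: d_def algebra_simps)
    have Y: "Y = (\<Sum>l\<in>UNIV. of_real ((y /\<^sub>R norm y) \<bullet> axis l 1) * cip (\<Psi> y) (b (axis l 1) *v \<Theta> y))"
      unfolding Y_def linear_axis_sum[OF b, of "y /\<^sub>R norm y"] sum_mv scaleR_mv cip_sumr
      by (simp add: scaleR_as_scale cip_scale_right inner_axis)
    have "(\<Sum>l\<in>UNIV. gd l y (axis l 1)) = of_real (w y) * (X' + X) + of_real (- (real n / norm y) * w y) * Y"
      unfolding gd_def X_def X'_def Y
      by (simp add: sum.distrib sum_subtractf scaleR_conv_of_real sum_distrib_left sum_distrib_right distrib_left mult_ac sum_negf)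
    also have "\<dots> = of_real (w y) * (X + X' - 2 * k * Y)" by (simp add: k_def algebra_simps)
    finally show ?thesis using True gfr d by (simp add: scaleR_conv_of_real)
  next
    case False
    then have "y \<notin> K" using K(2) by blast
    then show ?thesis using False gfr0 by simp
  qed
  have "integrable (collar_measure \<epsilon>) (\<lambda>p. d (immersion p))"
    unfolding d_def using int by (rule Bochner_Integration.integrable_diff)
  then have dm: "(\<lambda>p. d (immersion p)) \<in> borel_measurable (collar_measure \<epsilon>)"
    by (rule borel_measurable_integrable)
  have "(LINT p|collar_measure \<epsilon>. d (immersion p)) = (LINT y|lborel. indicator (shell \<epsilon>) y *\<^sub>R (w y *\<^sub>R d y))"
    unfolding integral_collar[OF \<epsilon>(2) dm] w_def n_def
  proof (rule Bochner_Integration.integral_cong)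
    show "indicator (shell \<epsilon>) y *\<^sub>R (inverse (norm y ^ (CARD('m) - 1)) *\<^sub>R d (immersion (polar y)))
        = indicator (shell \<epsilon>) y *\<^sub>R (inverse (norm y ^ (CARD('m) - 1)) *\<^sub>R d y)" for y
      using immersion_polar[OF \<epsilon>(2), of y] by (cases "y \<in> shell \<epsilon>") simp_all
  qed simp
  also have "\<dots> = - \<i> * (\<Sum>l\<in>UNIV. LINT y|lborel. frechet_derivative (g l) (at y) (axis l 1))"
    unfolding pointwise using ibp(1) by simp
  also have "\<dots> = 0" by (simp add: ibp(2))
  finally show ?thesis
    unfolding d_def using Bochner_Integration.integral_diff[OF int] by simp
qed

section \<open>Smoothness and square integrability of the test data\<close>

lemma smooth_on_bounded_linear_compose:
  assumes "open V" "bounded_linear f" "smooth_on V g"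
  shows "smooth_on V (\<lambda>x. f (g x))"
  using smooth_on_bilinear[OF assms(1) bounded_bilinear.comp[OF bounded_bilinear_scaleR bounded_linear_ident assms(2)]
      smooth_on_const[of V "1::real"] assms(3)] by simp

lemma smooth_on_frechet_continuous: "smooth_on V f \<Longrightarrow> continuous_on V (\<lambda>y. frechet_derivative f (at y) v)"
  by (intro smooth_on_continuous smooth_on_frechet)

text \<open>When f' and g' arise from f and g by a fibrewise linear operator, this is its
  boundedness on L2. It serves Clifford multiplication on the sphere, multiplication by 1/(1+s) and
  the one-forms [D, g].\<close>

lemma vdist_L2_pointwise_bound:
  fixes f g :: "'a \<Rightarrow> complex^'i" and f' g' :: "'a \<Rightarrow> complex^'j"
  assumes "semi_ip (L2 M F)" "f \<in> carr (L2 M F)" "g \<in> carr (L2 M F)"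
    and "f' \<in> borel_measurable M" "g' \<in> borel_measurable M" and C: "C \<ge> 0"
    and b: "\<And>x. x \<in> space M \<Longrightarrow> norm (f' x - g' x) \<le> C * norm (f x - g x)"
  shows "vdist (L2 M F') f' g' \<le> C * vdist (L2 M F) f g"
proof -
  interpret semi_ip "L2 M F" by fact
  have "vadd (L2 M F) f (vscale (L2 M F) (-1) g) = (\<lambda>x. f x - g x)"
    by (simp add: L2_vadd L2_vscale vec_eq_iff fun_eq_iff)
  then have d: "(\<lambda>x. f x - g x) \<in> carr (L2 M F)" using vadd_closed vscale_closed assms by metis
  have m: "(\<lambda>x. f' x - g' x) \<in> borel_measurable M" using assms by (intro borel_measurable_diff)
  have "(LINT x|M. (norm (f' x - g' x))\<^sup>2) \<le> (LINT x|M. C\<^sup>2 * (norm (f x - g x))\<^sup>2)"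
  proof (rule integral_mono)
    show "integrable M (\<lambda>x. (norm (f' x - g' x))\<^sup>2)" by (rule square_integrable_bound[OF m d b])
    show "integrable M (\<lambda>x. C\<^sup>2 * (norm (f x - g x))\<^sup>2)" using d by (simp add: L2_carr)
    show "(norm (f' x - g' x))\<^sup>2 \<le> C\<^sup>2 * (norm (f x - g x))\<^sup>2" if "x \<in> space M" for x
      using power_mono[OF b[OF that], of 2] by (simp add: power_mult_distrib)
  qed
  then have "sqrt (LINT x|M. (norm (f' x - g' x))\<^sup>2) \<le> sqrt (C\<^sup>2 * (LINT x|M. (norm (f x - g x))\<^sup>2))" by simp
  then show ?thesis using C by (simp add: vdist_L2 real_sqrt_mult)
qed

lemma L2_compact_support:
  fixes f :: "real^'m \<Rightarrow> complex^'i"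
  assumes "continuous_on UNIV f" "compact K" "\<And>y. y \<notin> K \<Longrightarrow> f y = 0"
  shows "f \<in> carr (L2 lborel UNIV)"
proof -
  have "integrable lborel (\<lambda>y. indicator K y *\<^sub>R (norm (f y))\<^sup>2)"
    by (rule borel_integrable_compact[OF assms(2)])
      (intro continuous_intros continuous_on_subset[OF assms(1)], auto)
  also have "(\<lambda>y. indicator K y *\<^sub>R (norm (f y))\<^sup>2) = (\<lambda>y. (norm (f y))\<^sup>2)"
    using assms(3) by (auto simp: indicator_def fun_eq_iff)
  finally show ?thesis using borel_measurable_continuous_onI[OF assms(1)] by (simp add: L2_carr)
qed

lemma L2_sphere_continuous:
  fixes f :: "real^'m \<Rightarrow> complex^'i"
  assumes c: "continuous_on (sphere 0 1) f" and F: "\<And>x. norm x = 1 \<Longrightarrow> f x \<in> F"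
  shows "f \<in> carr (L2 sphere_measure F)"
proof -
  have m: "f \<in> borel_measurable sphere_measure"
    unfolding measurable_cong_sets[OF sets_sphere_measure refl]
    by (rule borel_measurable_continuous_on_restrict[OF c])
  have "bounded (f ` sphere 0 1)"
    using compact_imp_bounded[OF compact_continuous_image[OF c compact_sphere]] .
  then obtain B where "\<forall>z\<in>f ` sphere 0 1. norm z \<le> B" unfolding bounded_iff by blast
  then have B: "\<And>x. norm x = 1 \<Longrightarrow> norm (f x) \<le> B" by simp
  have "integrable sphere_measure (\<lambda>x. (norm (f x))\<^sup>2)"
  proof (rule Bochner_Integration.integrable_bound)
    show "integrable (sphere_measure :: (real^'m) measure) (\<lambda>x. B\<^sup>2)"
      by (rule finite_measure.integrable_const[OF finite_sphere_measure])
    show "(\<lambda>x. (norm (f x))\<^sup>2) \<in> borel_measurable sphere_measure" using m by measurable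
    show "AE x in sphere_measure. norm ((norm (f x))\<^sup>2) \<le> norm (B\<^sup>2)"
      using power_mono[OF B, of _ 2] by (intro AE_I2) (simp add: space_sphere_measure)
  qed
  then show ?thesis using m F by (simp add: L2_carr space_sphere_measure)
qed

lemma L2_interval_compact_support:
  fixes t :: "real \<Rightarrow> complex^2"
  assumes c: "continuous_on {-\<epsilon><..<\<epsilon>} t" and K: "compact K" "K \<subseteq> {-\<epsilon><..<\<epsilon>}" "\<And>s. s \<notin> K \<Longrightarrow> t s = 0"
  shows "t \<in> carr (interval_L2 \<epsilon>)"
proof -
  let ?I = "restrict_space lborel {-\<epsilon><..<\<epsilon>}"
  have m: "t \<in> borel_measurable ?I"
    unfolding measurable_cong_sets[OF sets_restrict_space_cong[OF sets_lborel] refl]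
    by (rule borel_measurable_continuous_on_restrict[OF c])
  have "bounded (t ` K)"
    using compact_continuous_image[OF continuous_on_subset[OF c K(2)] K(1)] compact_imp_bounded by blast
  then obtain B where B: "\<And>s. s \<in> K \<Longrightarrow> norm (t s) \<le> B" by (auto simp: bounded_iff)
  have B': "norm (t s) \<le> max 0 B" for s using B[of s] K(3)[of s] by (cases "s \<in> K") auto
  have "integrable ?I (\<lambda>s. (norm (t s))\<^sup>2)"
  proof (rule Bochner_Integration.integrable_bound)
    show "integrable ?I (\<lambda>x. (max 0 B)\<^sup>2)"
      by (rule finite_measure.integrable_const[OF finite_interval_measure])
    show "(\<lambda>x. (norm (t x))\<^sup>2) \<in> borel_measurable ?I" using m by measurable
    show "AE x in ?I. norm ((norm (t x))\<^sup>2) \<le> norm ((max 0 B)\<^sup>2)"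
      using power_mono[OF B', of _ 2] by (intro AE_I2) simp
  qed
  then show ?thesis using m by (simp add: interval_L2_def L2_carr)
qed

lemma smooth_sphere_carr:
  assumes "\<phi> \<in> smooth_sphere_sections F" shows "\<phi> \<in> carr (L2 sphere_measure F)"
proof (rule L2_sphere_continuous)
  have "continuous_on (sphere 0 1) (hom_ext \<phi>)"
    by (rule continuous_on_subset[OF smooth_on_continuous])
      (use assms in \<open>auto simp: smooth_sphere_sections_def\<close>)
  then show "continuous_on (sphere 0 1) \<phi>"
    by (rule continuous_on_cong[THEN iffD1, rotated -1]) (auto simp: hom_ext_def)
qed (use assms in \<open>auto simp: smooth_sphere_sections_def\<close>)

lemma Cc_inf_carr: "t \<in> Cc_inf {-\<epsilon><..<\<epsilon>} \<Longrightarrow> t \<in> carr (interval_L2 \<epsilon>)"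
  unfolding Cc_inf_def using L2_interval_compact_support[OF smooth_on_continuous] by blast

lemma pot_continuous: "0 < \<epsilon> \<Longrightarrow> continuous_on {-\<epsilon><..<\<epsilon>} (pot \<epsilon>)"
  unfolding pot_def Let_def
proof (intro continuous_intros ballI)
  fix s assume "0 < \<epsilon>" "s \<in> {-\<epsilon><..<\<epsilon>}"
  then show "cos (pi / (2 * \<epsilon>) * s) \<noteq> 0" using bump_cos_pos[of \<epsilon> s] by simp
qed

lemma vector_derivative_frechet:
  "t differentiable (at s) \<Longrightarrow> vector_derivative t (at s) = frechet_derivative t (at s) 1" for s :: real
  by (simp add: frechet_derivative_eq_vector_derivative)

lemma T0_carr:
  assumes e: "0 < \<epsilon>" and t: "t \<in> Cc_inf {-\<epsilon><..<\<epsilon>}"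
  shows "T0 \<epsilon> t \<in> carr (interval_L2 \<epsilon>)"
proof -
  obtain K where K: "compact K" "K \<subseteq> {-\<epsilon><..<\<epsilon>}" "\<And>s. s \<notin> K \<Longrightarrow> t s = 0" "smooth_on {-\<epsilon><..<\<epsilon>} t"
    using t unfolding Cc_inf_def by blast
  show ?thesis
  proof (rule L2_interval_compact_support[OF _ K(1,2)])
    have "continuous_on {-\<epsilon><..<\<epsilon>} (\<lambda>s. \<i> *s (pauli1 *v frechet_derivative t (at s) 1)
        + of_real (pot \<epsilon> s) *s (pauli2 *v t s))"
      by (intro continuous_intros bounded_bilinear.continuous_on[OF bounded_bilinear_scale]
          bounded_bilinear.continuous_on[OF bounded_bilinear_mv] smooth_on_frechet_continuous K
          smooth_on_continuous[OF K(4)] pot_continuous[OF e])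
    then show "continuous_on {-\<epsilon><..<\<epsilon>} (T0 \<epsilon> t)"
      by (rule continuous_on_cong[THEN iffD1, rotated -1])
        (use smooth_on_differentiable[OF K(4)] in \<open>auto simp: T0_def vector_derivative_frechet\<close>)
    show "T0 \<epsilon> t s = 0" if s: "s \<notin> K" for s
    proof -
      have "open (- K)" using K(1) by (simp add: compact_imp_closed open_Compl)
      then have "(t has_derivative (\<lambda>_. 0)) (at s)"
        by (rule has_derivative_transform_within_open[OF has_derivative_const]) (use s K(3) in auto)
      then have "(t has_vector_derivative 0) (at s)" by (simp add: has_vector_derivative_def)
      then show ?thesis using K(3)[OF s] by (simp add: T0_def vector_derivative_at)
    qed
  qed
qed

text \<open>On the open interval the cosine is positive and 1/cos^2 is its power -2, hence smooth.
  The support of t stays away from the ends, where 1/cos^2 has its poles.\<close>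

lemma bump_inverse_Cc_inf:
  assumes e: "0 < \<epsilon>" and t: "t \<in> Cc_inf {-\<epsilon><..<\<epsilon>}"
  shows "(\<lambda>s. inverse (bump \<epsilon> s) *\<^sub>R t s) \<in> Cc_inf {-\<epsilon><..<\<epsilon>}"
proof -
  obtain K where K: "compact K" "K \<subseteq> {-\<epsilon><..<\<epsilon>}" "\<And>s. s \<notin> K \<Longrightarrow> t s = 0" "smooth_on {-\<epsilon><..<\<epsilon>} t"
    using t unfolding Cc_inf_def by blast
  have "smooth_on {-\<epsilon><..<\<epsilon>} (\<lambda>s. (cos (pi / (2 * \<epsilon>) * s)) powr (-2))"
    by (rule smooth_on_compose_real[OF _ smooth_on_powr smooth_on_cos]) (use bump_cos_pos[OF e] in auto)
  then have "smooth_on {-\<epsilon><..<\<epsilon>} (\<lambda>s. inverse (bump \<epsilon> s))"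
  proof (rule smooth_on_cong[rotated -1])
    fix s assume "s \<in> {-\<epsilon><..<\<epsilon>}"
    then have "cos (pi / (2 * \<epsilon>) * s) > 0" using bump_cos_pos[OF e, of s] by simp
    then show "cos (pi / (2 * \<epsilon>) * s) powr (-2) = inverse (bump \<epsilon> s)"
      unfolding bump_def powr_minus by (simp only: powr_numeral)
  qed simp
  then have "smooth_on {-\<epsilon><..<\<epsilon>} (\<lambda>s. inverse (bump \<epsilon> s) *\<^sub>R t s)"
    by (rule smooth_on_bilinear[OF _ bounded_bilinear_scaleR _ K(4), rotated]) simp
  then show ?thesis using K by (auto simp: Cc_inf_def)
qed

lemma smooth_polar_normalize: "smooth_on (shell \<epsilon>) (\<lambda>y::real^'m. y /\<^sub>R norm y)" if "\<epsilon> < 1"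
  by (rule smooth_on_subset[OF smooth_on_normalize]) (use shell_nonzero[OF that] in auto)

lemma smooth_radial: "smooth_on (shell \<epsilon>) (\<lambda>y::real^'m. norm y - 1)" if "\<epsilon> < 1"
proof -
  have "smooth_on (shell \<epsilon>) (norm :: real^'m \<Rightarrow> real)"
    by (rule smooth_on_subset[OF smooth_on_norm]) (use shell_nonzero[OF that] in auto)
  from smooth_on_add[OF open_shell this smooth_on_const[of _ "-1"]] show ?thesis by simp
qed

lemma compact_shell_support:
  assumes e: "\<epsilon> < 1" and K: "compact K" "K \<subseteq> {-\<epsilon><..<\<epsilon>}"
  shows "compact {y::real^'m. norm y - 1 \<in> K}" and "{y::real^'m. norm y - 1 \<in> K} \<subseteq> shell \<epsilon>"
proof -
  have "closed ((\<lambda>y::real^'m. norm y - 1) -` K)"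
    using K(1) by (intro closed_vimage compact_imp_closed continuous_intros)
  moreover have "bounded {y::real^'m. norm y - 1 \<in> K}"
    unfolding bounded_iff
  proof (intro exI[of _ "1 + \<epsilon>"] ballI)
    fix y :: "real^'m" assume "y \<in> {y. norm y - 1 \<in> K}"
    then have "norm y - 1 < \<epsilon>" using K(2) by auto
    then show "norm y \<le> 1 + \<epsilon>" by simp
  qed
  ultimately show "compact {y::real^'m. norm y - 1 \<in> K}" by (simp add: compact_eq_bounded_closed vimage_def)
  show "{y::real^'m. norm y - 1 \<in> K} \<subseteq> shell \<epsilon>"
  proof
    fix y :: "real^'m" assume "y \<in> {y. norm y - 1 \<in> K}"
    then have "norm y - 1 \<in> {-\<epsilon><..<\<epsilon>}" using K(2) by auto
    then show "y \<in> shell \<epsilon>" by (simp add: shell_def)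
  qed
qed

text \<open>Chain rule through \<open>polar\<close>. The auxiliary \<zeta> is \<xi> extended to be
  homogeneous of degree 0 in the sphere variable, the function whose differentiability
  \<open>C10\<close> requires. Its derivative splits into a radial part and a part along the sphere,
  the latter in the redundant coordinates y_j / norm y.\<close>

lemma module_section_deriv:
  fixes \<xi> :: "('m::finite) mod2"
  assumes e: "\<epsilon> < 1" and \<xi>: "\<xi> \<in> C10 \<epsilon>" and y: "y \<in> shell \<epsilon>"
  shows "((\<lambda>z. \<xi> (polar z)) has_derivative (\<lambda>h. ((y /\<^sub>R norm y) \<bullet> h) *\<^sub>R s_deriv \<xi> (polar y)
      + (\<Sum>j\<in>UNIV. frechet_derivative (\<lambda>z. z $ j / norm z) (at y) h *\<^sub>R ang_deriv j \<xi> (polar y)))) (at y)"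
    and "(\<lambda>t. \<xi> (fst (polar y), t)) differentiable (at (snd (polar y)))"
    and "hom_ext (\<lambda>z. \<xi> (z, snd (polar y))) differentiable (at (fst (polar y)))"
proof -
  have y0: "y \<noteq> 0" using shell_nonzero[OF e y] by blast
  define x where "x = y /\<^sub>R norm y"
  define s where "s = norm y - 1"
  have p: "polar y = (x, s)" by (simp add: polar_def x_def s_def)
  have x1: "norm x = 1" using y0 by (simp add: x_def)
  define \<zeta> where "\<zeta> = (\<lambda>(z, t). \<xi> (z /\<^sub>R norm z, t))"
  define Z where "Z = frechet_derivative \<zeta> (at (x, s))"
  have "\<zeta> differentiable at (x, s)"
    using \<xi> polar_collar[OF e y] p unfolding C10_def \<zeta>_def by fastforce
  then have Z: "(\<zeta> has_derivative Z) (at (x, s))" using frechet_derivative_works Z_def by auto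
  have linZ: "linear Z" using Z by (simp add: has_derivative_linear)
  define Q where "Q = frechet_derivative (\<lambda>z::real^'m. z /\<^sub>R norm z) (at y)"
  have Q: "((\<lambda>z::real^'m. z /\<^sub>R norm z) has_derivative Q) (at y)"
    unfolding Q_def by (rule smooth_on_has_derivative[OF smooth_on_normalize]) (use y0 in simp)
  have "(polar has_derivative (\<lambda>h. (Q h, x \<bullet> h))) (at y)"
    unfolding polar_def[abs_def] x_def
    using has_derivative_diff[OF has_derivative_norm_at[OF y0] has_derivative_const[of 1]]
    by (intro has_derivative_Pair[OF Q]) simp
  moreover have "(\<zeta> has_derivative Z) (at (polar y))" using Z p by simp
  ultimately have "(\<zeta> \<circ> polar has_derivative Z \<circ> (\<lambda>h. (Q h, x \<bullet> h))) (at y)" by (rule diff_chain_at)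
  then have 1: "((\<lambda>z. \<zeta> (polar z)) has_derivative (\<lambda>h. Z (Q h, x \<bullet> h))) (at y)" by (simp add: o_def)
  have sect: "((\<lambda>t. \<xi> (x, t)) has_derivative (\<lambda>r. Z (0, r))) (at s)"
  proof -
    have "((\<lambda>t. (x, t)) has_derivative (\<lambda>r. (0, r))) (at s)"
      by (auto intro!: derivative_eq_intros)
    from diff_chain_at[OF this Z] show ?thesis using x1 by (simp add: o_def \<zeta>_def)
  qed
  then show "(\<lambda>t. \<xi> (fst (polar y), t)) differentiable (at (snd (polar y)))"
    using p differentiable_def by auto
  have sd: "s_deriv \<xi> (x, s) = Z (0, 1)"
  proof -
    define z1 where "z1 = Z (0, 1)"
    have "Z (0, r) = r *\<^sub>R z1" for r using linear_scale[OF linZ, of r "(0, 1)"] by (simp add: z1_def)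
    then have "((\<lambda>t. \<xi> (x, t)) has_vector_derivative z1) (at s)"
      using sect unfolding has_vector_derivative_def by simp
    then show ?thesis by (simp add: s_deriv_def vector_derivative_at z1_def)
  qed
  have hx: "((\<lambda>z. \<zeta> (z, s)) has_derivative (\<lambda>h. Z (h, 0))) (at x)"
  proof -
    have "((\<lambda>z. (z, s)) has_derivative (\<lambda>h. (h, 0))) (at x)"
      by (auto intro!: derivative_eq_intros)
    from diff_chain_at[OF this Z] show ?thesis by (simp add: o_def)
  qed
  have he: "hom_ext (\<lambda>z. \<xi> (z, s)) = (\<lambda>z. \<zeta> (z, s))" by (simp add: hom_ext_def \<zeta>_def fun_eq_iff)
  have hd: "hom_ext (\<lambda>z. \<xi> (z, s)) differentiable (at x)" using hx he differentiable_def by auto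
  then show "hom_ext (\<lambda>z. \<xi> (z, snd (polar y))) differentiable (at (fst (polar y)))" using p by simp
  have ad: "ang_deriv j \<xi> (x, s) = frechet_derivative (hom_ext (\<lambda>z. \<xi> (z, s))) (at x) (axis j 1)" for j
    by (simp add: ang_deriv_def)
  have "((\<lambda>z. \<zeta> (z /\<^sub>R norm z, s)) has_derivative (\<lambda>h. Z (Q h, 0))) (at y)"
    using diff_chain_at[OF Q hx[unfolded x_def]] by (simp add: o_def)
  moreover have "(\<lambda>z. \<zeta> (z /\<^sub>R norm z, s)) = hom_ext (\<lambda>z. \<xi> (z, s))"
  proof
    fix z show "\<zeta> (z /\<^sub>R norm z, s) = hom_ext (\<lambda>z. \<xi> (z, s)) z"
      by (cases "z = 0") (simp_all add: \<zeta>_def hom_ext_def)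
  qed
  ultimately have "(hom_ext (\<lambda>z. \<xi> (z, s)) has_derivative (\<lambda>h. Z (Q h, 0))) (at y)" by simp
  note 3 = has_derivative_unique[OF this hom_ext_deriv_at[OF y0 hd[unfolded x_def]]]
  have Zang: "Z (Q h, 0) = (\<Sum>j\<in>UNIV. frechet_derivative (\<lambda>z. z $ j / norm z) (at y) h *\<^sub>R ang_deriv j \<xi> (x, s))" for h
    unfolding ad unfolding x_def using fun_cong[OF 3, of h] by simp
  have "Z (Q h, x \<bullet> h) = (x \<bullet> h) *\<^sub>R s_deriv \<xi> (x, s)
      + (\<Sum>j\<in>UNIV. frechet_derivative (\<lambda>z. z $ j / norm z) (at y) h *\<^sub>R ang_deriv j \<xi> (x, s))" for h
  proof -
    have "Z (Q h, x \<bullet> h) = Z ((x \<bullet> h) *\<^sub>R (0, 1) + (Q h, 0))" by simp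
    also have "\<dots> = (x \<bullet> h) *\<^sub>R Z (0, 1) + Z (Q h, 0)"
      by (simp only: linear_add[OF linZ] linear_scale[OF linZ])
    finally show ?thesis by (simp only: sd Zang)
  qed
  then have 2: "((\<lambda>z. \<zeta> (polar z)) has_derivative (\<lambda>h. (x \<bullet> h) *\<^sub>R s_deriv \<xi> (polar y)
      + (\<Sum>j\<in>UNIV. frechet_derivative (\<lambda>z. z $ j / norm z) (at y) h *\<^sub>R ang_deriv j \<xi> (polar y)))) (at y)"
    using 1 p by simp
  have "((\<lambda>z. \<xi> (polar z)) has_derivative (\<lambda>h. (x \<bullet> h) *\<^sub>R s_deriv \<xi> (polar y)
      + (\<Sum>j\<in>UNIV. frechet_derivative (\<lambda>z. z $ j / norm z) (at y) h *\<^sub>R ang_deriv j \<xi> (polar y)))) (at y)"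
  proof (rule has_derivative_transform_within_open[OF 2 open_shell y])
    fix z :: "real^'m" assume "z \<in> shell \<epsilon>"
    then have "norm (z /\<^sub>R norm z) = 1" using shell_nonzero[OF e, of z] by simp
    then show "\<zeta> (polar z) = \<xi> (polar z)" unfolding \<zeta>_def polar_def by (simp del: norm_scaleR)
  qed
  then show "((\<lambda>z. \<xi> (polar z)) has_derivative (\<lambda>h. ((y /\<^sub>R norm y) \<bullet> h) *\<^sub>R s_deriv \<xi> (polar y)
      + (\<Sum>j\<in>UNIV. frechet_derivative (\<lambda>z. z $ j / norm z) (at y) h *\<^sub>R ang_deriv j \<xi> (polar y)))) (at y)"
    by (simp only: x_def)
qed

lemma smooth_coordinate: "smooth_on (- {0}) (\<lambda>z::real^'m. z $ j / norm z)"
proof -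
  have "smooth_on (- {0}) (\<lambda>z::real^'m. (z /\<^sub>R norm z) $ j)"
    by (rule smooth_on_bounded_linear_compose[OF _ bounded_linear_vec_nth smooth_on_normalize]) auto
  then show ?thesis by (simp add: divide_inverse mult.commute)
qed

lemma continuous_polar: "continuous_on (shell \<epsilon>) (\<lambda>y. f (polar y))"
  if "\<epsilon> < 1" "continuous_on (collar \<epsilon>) f" for f :: "(real^'m) \<times> real \<Rightarrow> 'b::topological_space"
proof -
  have "continuous_on (shell \<epsilon>) (polar :: real^'m \<Rightarrow> _)"
    unfolding polar_def[abs_def] by (intro continuous_intros) (use shell_nonzero[OF that(1)] in auto)
  then show ?thesis
    using continuous_on_compose2[OF that(2)] polar_collar[OF that(1)] by blast
qed

text \<open>\<open>b\<close> is the symbol and \<open>\<alpha>\<close> the coefficient of the potential of the product operator after the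
  embedding \<open>m\<close>; \<open>intertwine\<close> is the equality of operators on elementary test tensors, evaluated at
  a point.\<close>

locale collar_dirac = collar_model \<epsilon> m F P K0 K1 R0 R1 eb pr inn act
  for \<epsilon> :: real
    and m :: "complex^2 \<Rightarrow> complex^'h \<Rightarrow> complex^'p"
    and F :: "(complex^'q) set" and P :: "complex^'q^'q"
    and K0 :: "complex^('q::finite \<times> 2)^'p" and K1 :: "real^'m \<Rightarrow> complex^('q \<times> 2)^'p"
    and R0 :: "complex^'p^('q \<times> 2)" and R1 :: "real^'m \<Rightarrow> complex^'p^('q \<times> 2)"
    and eb :: "2 \<Rightarrow> complex^2" and pr :: "2 \<Rightarrow> complex^'p^'h"
    and inn :: "('m::finite) mod2 \<Rightarrow> 'm mod2 \<Rightarrow> real^'m \<Rightarrow> 'b"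
    and act :: "(real^'m \<Rightarrow> 'b) \<Rightarrow> (real^'m \<Rightarrow> complex^'h) \<Rightarrow> real^'m \<Rightarrow> complex^'h" +
  fixes D :: "(real^'m \<Rightarrow> complex^'h) \<Rightarrow> real^'m \<Rightarrow> complex^'h"
    and a :: "real^'m \<Rightarrow> complex^'h^'h" and b :: "real^'m \<Rightarrow> complex^'p^'p"
    and A :: "complex^2^2" and \<alpha> :: "complex^'p^'p"
    and Dq :: "(real^'m \<Rightarrow> complex^'q) \<Rightarrow> real^'m \<Rightarrow> complex^'q"
    and Gm :: "real^'m \<Rightarrow> complex^'q^'q"
  assumes D_eq: "\<psi> differentiable (at y) \<Longrightarrow>
      D \<psi> y = \<i> *s (\<Sum>l\<in>UNIV. a (axis l 1) *v frechet_derivative \<psi> (at y) (axis l 1))"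
    and b_linear: "linear b"
    and m_ab: "m (pauli3 *v v) (a w *v z) = b w *v m v z"
    and b_herm: "cip (b w *v u) u' = cip u (b w *v u')"
    and m_A: "m (A *v v) z = \<alpha> *v m v z"
    and \<alpha>_herm: "cip (\<alpha> *v u) u' = cip u (\<alpha> *v u')"
    and Dq_carr: "\<phi> \<in> smooth_sphere_sections F \<Longrightarrow> Dq \<phi> \<in> carr (L2 sphere_measure F)"
    and Gm_linear: "linear (\<lambda>x. Gm x - Gm 0)"
    and Gm_F: "norm x = 1 \<Longrightarrow> f \<in> F \<Longrightarrow> Gm x *v f \<in> F"
    and intertwine: "\<phi> \<in> smooth_sphere_sections F \<Longrightarrow> t \<in> Cc_inf {-\<epsilon><..<\<epsilon>} \<Longrightarrow> norm x = 1 \<Longrightarrow>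
      -\<epsilon> < s \<Longrightarrow> s < \<epsilon> \<Longrightarrow>
      flat_op \<epsilon> b \<alpha> (\<lambda>y. (K0 + K1 (y /\<^sub>R norm y)) *v tens (\<phi> (y /\<^sub>R norm y)) (t (norm y - 1))) ((1 + s) *\<^sub>R x)
      = (K0 + K1 x) *v (tens (Dq \<phi> x) (of_real (1 / (1 + s)) *s t s) + tens (Gm x *v \<phi> x) (T0 \<epsilon> t s))"
begin

abbreviation flat where "flat \<equiv> flat_op \<epsilon> b \<alpha>"
abbreviation Gop where "Gop \<phi> \<equiv> \<lambda>x. Gm x *v \<phi> x"
abbreviation \<tau> :: "(real \<Rightarrow> complex^2) \<Rightarrow> real \<Rightarrow> complex^2" where
  "\<tau> t \<equiv> \<lambda>s. of_real (1 / (1 + s)) *s t s"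

lemma test_section:
  assumes \<phi>: "\<phi> \<in> smooth_sphere_sections F" and t: "t \<in> Cc_inf {-\<epsilon><..<\<epsilon>}"
  obtains K where "compact K" "K \<subseteq> shell \<epsilon>" "\<And>y. y \<notin> K \<Longrightarrow> j2 (\<phi>, t) (polar y) = 0"
    "smooth_on (shell \<epsilon>) (\<lambda>y. j2 (\<phi>, t) (polar y))"
proof -
  obtain K where K: "compact K" "K \<subseteq> {-\<epsilon><..<\<epsilon>}" "\<And>s. s \<notin> K \<Longrightarrow> t s = 0" "smooth_on {-\<epsilon><..<\<epsilon>} t"
    using t unfolding Cc_inf_def by blast
  have "smooth_on (shell \<epsilon>) (hom_ext \<phi>)"
    by (rule smooth_on_subset[of "- {0}"]) (use \<phi> shell_nonzero[OF eps(2)] in \<open>auto simp: smooth_sphere_sections_def\<close>)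
  then have s1: "smooth_on (shell \<epsilon>) (\<lambda>y. \<phi> (y /\<^sub>R norm y))" by (simp add: hom_ext_def[abs_def])
  have s2: "smooth_on (shell \<epsilon>) (\<lambda>y::real^'m. t (norm y - 1))"
    by (rule smooth_on_compose_real[OF open_shell K(4) smooth_radial[OF eps(2)]]) (auto simp: shell_def)
  have s3: "smooth_on (shell \<epsilon>) (\<lambda>y. K0 + K1 (y /\<^sub>R norm y))"
    by (rule smooth_on_add[OF open_shell smooth_on_const
          smooth_on_bounded_linear_compose[OF open_shell _ smooth_polar_normalize[OF eps(2)]]])
      (use K1_linear in \<open>simp add: linear_conv_bounded_linear\<close>)
  show thesis
  proof (rule that)
    show "compact {y::real^'m. norm y - 1 \<in> K}" "{y::real^'m. norm y - 1 \<in> K} \<subseteq> shell \<epsilon>"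
      by (rule compact_shell_support[OF eps(2) K(1,2)])+
    show "j2 (\<phi>, t) (polar y) = 0" if "y \<notin> {y. norm y - 1 \<in> K}" for y
      using that K(3) by (simp add: j2_def polar_def pull_def tens_def vec_eq_iff matrix_vector_mult_def)
    show "smooth_on (shell \<epsilon>) (\<lambda>y. j2 (\<phi>, t) (polar y))"
      unfolding j2_def pull_def polar_def fst_conv snd_conv
      by (intro smooth_on_bilinear[OF open_shell bounded_bilinear_mv]
          smooth_on_bilinear[OF open_shell bounded_bilinear_tens] s1 s2 s3)
  qed
qed

text \<open>\<open>Gm\<close> is affine in x, since it is constant for odd spheres and equal to c
  for even ones. It is therefore measurable, and bounded on the unit sphere.\<close>

lemma Gop_carr:
  assumes "\<phi> \<in> carr G" shows "Gop \<phi> \<in> carr G"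
    and "\<exists>C\<ge>0. \<forall>\<phi>'\<in>carr G. vdist G (Gop \<phi>) (Gop \<phi>') \<le> C * vdist G \<phi> \<phi>'"
proof -
  obtain K where K: "K \<ge> 0" "\<And>(M::complex^'q^'q) w. norm (M *v w) \<le> norm M * norm w * K"
    using bounded_bilinear.nonneg_bounded[OF bounded_bilinear_mv] by blast
  obtain K' where K': "\<And>x. norm (Gm x - Gm 0) \<le> K' * norm x" using linear_bounded[OF Gm_linear] by blast
  have K'0: "K' \<ge> 0" using order_trans[OF norm_ge_zero K'[of "axis undefined 1"]] by (simp add: norm_axis_1)
  have nb: "norm (Gm x *v w) \<le> ((norm (Gm 0) + K') * K) * norm w" if "norm x = 1" for x w
  proof -
    have "norm (Gm x) \<le> norm (Gm 0) + K'" using norm_triangle_ineq2[of "Gm x" "Gm 0"] K'[of x] that by simp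
    then have "norm (Gm x) * norm w * K \<le> (norm (Gm 0) + K') * norm w * K"
      using K by (intro mult_right_mono) auto
    then show ?thesis using K(2)[of "Gm x" w] by (simp add: mult_ac)
  qed
  have id: "(\<lambda>x. x) \<in> borel_measurable (sphere_measure :: (real^'m) measure)"
    unfolding measurable_cong_sets[OF sets_sphere_measure refl] by (rule measurable_restrict_space1) simp
  have "(\<lambda>x. (Gm x - Gm 0) + Gm 0) \<in> borel_measurable (sphere_measure :: (real^'m) measure)"
    by (intro borel_measurable_add borel_measurable_const linear_measurable[OF Gm_linear id])
  then have Gmeas: "Gm \<in> borel_measurable sphere_measure" by simp
  have meas: "Gop \<phi> \<in> borel_measurable sphere_measure" if "\<phi> \<in> carr G" for \<phi>
    using that by (intro measurable_mv Gmeas) (simp add: L2_carr)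
  have "integrable sphere_measure (\<lambda>x. (norm (Gop \<phi> x))\<^sup>2)"
    by (rule square_integrable_bound[OF meas[OF assms] assms nb]) (simp add: space_sphere_measure)
  then show "Gop \<phi> \<in> carr G"
    using meas[OF assms] assms Gm_F by (simp add: L2_carr space_sphere_measure)
  have "vdist G (Gop \<phi>) (Gop \<phi>') \<le> ((norm (Gm 0) + K') * K) * vdist G \<phi> \<phi>'" if "\<phi>' \<in> carr G" for \<phi>'
  proof (rule vdist_L2_pointwise_bound[OF G.semi_ip_axioms assms that meas[OF assms] meas[OF that]])
    show "norm (Gop \<phi> x - Gop \<phi>' x) \<le> ((norm (Gm 0) + K') * K) * norm (\<phi> x - \<phi>' x)"
      if "x \<in> space sphere_measure" for x
      using nb[of x "\<phi> x - \<phi>' x"] that by (simp add: space_sphere_measure matrix_vector_mult_diff_distrib)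
  qed (use K K'0 in simp)
  then show "\<exists>C\<ge>0. \<forall>\<phi>'\<in>carr G. vdist G (Gop \<phi>) (Gop \<phi>') \<le> C * vdist G \<phi> \<phi>'"
    using K K'0 by (intro exI[of _ "(norm (Gm 0) + K') * K"]) simp
qed

lemma \<tau>_carr:
  assumes "t \<in> carr (interval_L2 \<epsilon>)" shows "\<tau> t \<in> carr (interval_L2 \<epsilon>)"
    and "\<exists>C\<ge>0. \<forall>t'\<in>carr (interval_L2 \<epsilon>). vdist (interval_L2 \<epsilon>) (\<tau> t) (\<tau> t') \<le> C * vdist (interval_L2 \<epsilon>) t t'"
proof -
  let ?I = "restrict_space lborel {-\<epsilon><..<\<epsilon>}"
  have nb: "norm (complex_of_real (1 / (1 + s)) *s w) \<le> (1 / (1 - \<epsilon>)) * norm w"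
    if "s \<in> space ?I" for s and w :: "complex^2"
  proof -
    have "0 < 1 - \<epsilon>" "1 - \<epsilon> \<le> 1 + s" using that eps by (auto simp: space_restrict_space)
    then have "\<bar>1 / (1 + s)\<bar> \<le> 1 / (1 - \<epsilon>)" by (simp add: frac_le)
    then show ?thesis unfolding norm_scale norm_of_real by (rule mult_right_mono) simp
  qed
  have meas: "\<tau> t \<in> borel_measurable ?I" if "t \<in> carr (interval_L2 \<epsilon>)" for t
  proof (rule measurable_scale)
    show "(\<lambda>s. complex_of_real (1 / (1 + s))) \<in> borel_measurable ?I"
      by (rule measurable_restrict_space1) measurable
  qed (use that in \<open>simp add: interval_carr\<close>)
  have "integrable ?I (\<lambda>s. (norm (\<tau> t s))\<^sup>2)"
    by (rule square_integrable_bound[OF meas[OF assms] assms[unfolded interval_L2_def] nb])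
  then show "\<tau> t \<in> carr (interval_L2 \<epsilon>)" using meas[OF assms] by (simp add: interval_carr)
  have "vdist (interval_L2 \<epsilon>) (\<tau> t) (\<tau> t') \<le> (1 / (1 - \<epsilon>)) * vdist (interval_L2 \<epsilon>) t t'"
    if t': "t' \<in> carr (interval_L2 \<epsilon>)" for t'
    unfolding interval_L2_def
  proof (rule vdist_L2_pointwise_bound[OF _ _ _ meas[OF assms] meas[OF t']])
    show "semi_ip (L2 ?I (UNIV :: (complex^2) set))" by (rule semi_ip_L2) auto
    show "norm (\<tau> t s - \<tau> t' s) \<le> (1 / (1 - \<epsilon>)) * norm (t s - t' s)" if "s \<in> space ?I" for s
      using nb[OF that, of "t s - t' s"] by (simp only: vec.scale_right_diff_distrib)
  qed (use assms t' eps in \<open>simp_all add: interval_L2_def\<close>)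
  then show "\<exists>C\<ge>0. \<forall>t'\<in>carr (interval_L2 \<epsilon>). vdist (interval_L2 \<epsilon>) (\<tau> t) (\<tau> t') \<le> C * vdist (interval_L2 \<epsilon>) t t'"
    using eps by (intro exI[of _ "1 / (1 - \<epsilon>)"]) simp
qed

definition rhs_elem where
  "rhs_elem \<phi> \<phi>' t t' = {#(\<phi>', \<tau> t)#} + {#(Gop \<phi>, t')#}"

lemma rhs_elem_carr:
  "\<phi> \<in> carr G \<Longrightarrow> \<phi>' \<in> carr G \<Longrightarrow> t \<in> carr (interval_L2 \<epsilon>) \<Longrightarrow> t' \<in> carr (interval_L2 \<epsilon>) \<Longrightarrow>
    rhs_elem \<phi> \<phi>' t t' \<in> carr tgt"
  using Gop_carr(1) \<tau>_carr(1) by (simp add: rhs_elem_def pre_tensor_def)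

lemma J2_rhs_elem: "J2 (rhs_elem \<phi> \<phi>' t t') = (\<lambda>p. j2 (\<phi>', \<tau> t) p + j2 (Gop \<phi>, t') p)"
  by (simp add: J2_def[abs_def] rhs_elem_def add.commute)

text \<open>The assumption \<open>intertwine\<close> at the point \<open>immersion p\<close>: seen
  in Cartesian coordinates, the right-hand operator acts on test tensors as
  \<open>flat_op\<close>.\<close>

lemma rhs_test:
  assumes "\<phi> \<in> smooth_sphere_sections F" "t \<in> Cc_inf {-\<epsilon><..<\<epsilon>}" "p \<in> collar \<epsilon>"
  shows "J2 (rhs_elem \<phi> (Dq \<phi>) t (T0 \<epsilon> t)) p = flat (\<lambda>y. j2 (\<phi>, t) (polar y)) (immersion p)"
proof -
  have "norm (fst p) = 1" "- \<epsilon> < snd p" "snd p < \<epsilon>" using assms(3) by (auto simp: collar_def)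
  from intertwine[OF assms(1,2) this] show ?thesis
    by (simp add: J2_rhs_elem j2_def pull_def polar_def immersion_def matrix_vector_right_distrib)
qed

definition src_elem :: "'m mod2 \<Rightarrow> (real^'m \<Rightarrow> complex^'h) \<Rightarrow> (real^'m \<Rightarrow> complex^'h) \<Rightarrow>
    ('m mod2 \<times> (real^'m \<Rightarrow> complex^'h)) multiset" where
  "src_elem \<xi> \<psi> \<psi>' = {#(op_S \<epsilon> A \<xi>, \<psi>)#} + {#(\<lambda>p. pauli3 *v \<xi> p, \<psi>')#}
     + connection D \<epsilon> (\<lambda>p. pauli3 *v \<xi> p) \<psi>"

text \<open>The principal symbol of D at the differential of g, without the factor i.\<close>

definition symbol_matrix :: "(real^'m \<Rightarrow> real) \<Rightarrow> real^'m \<Rightarrow> complex^'h^'h" where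
  "symbol_matrix g y = (\<Sum>l\<in>UNIV. frechet_derivative g (at y) (axis l 1) *\<^sub>R a (axis l 1))"

text \<open>D has no zeroth order term and the commutator is evaluated on a constant spinor, so only
  the derivative of g survives.\<close>

lemma one_form_eq:
  assumes g: "smooth_on (- {0}) g"
  shows "one_form D \<epsilon> g \<psi> = (\<lambda>y. if y \<in> shell \<epsilon> then \<i> *s (symbol_matrix g y *v \<psi> y) else 0)"
proof
  fix y :: "real^'m"
  show "one_form D \<epsilon> g \<psi> y = (if y \<in> shell \<epsilon> then \<i> *s (symbol_matrix g y *v \<psi> y) else 0)"
  proof (cases "y \<in> shell \<epsilon>")
    case True
    then have y0: "y \<noteq> 0" using shell_nonzero[OF eps(2)] by blast
    define g' where "g' = frechet_derivative g (at y)"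
    have gd: "(g has_derivative g') (at y)"
      unfolding g'_def by (rule smooth_on_has_derivative[OF g]) (use y0 in simp)
    have d1: "((\<lambda>z. complex_of_real (g z) *s \<psi> y) has_derivative (\<lambda>h. g' h *\<^sub>R \<psi> y)) (at y)"
      unfolding scaleR_as_scale[symmetric] using gd by (auto intro!: derivative_eq_intros)
    have d2: "((\<lambda>z::real^'m. \<psi> y) has_derivative (\<lambda>h. 0)) (at y)" by simp
    have "(\<lambda>z. complex_of_real (g z) *s \<psi> y) differentiable (at y)" "(\<lambda>z::real^'m. \<psi> y) differentiable (at y)"
      using d1 d2 differentiable_def by blast+
    then have "commutator D (\<lambda>z. of_real (g z)) \<psi> y = \<i> *s (\<Sum>l\<in>UNIV. a (axis l 1) *v (g' (axis l 1) *\<^sub>R \<psi> y))"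
      by (simp add: commutator_def D_eq frechet_derivative_at[OF d1, symmetric] frechet_derivative_at[OF d2, symmetric])
    then show ?thesis using True
      by (simp add: one_form_def immersion_image[OF eps(2)] symbol_matrix_def g'_def sum_mv scaleR_mv mv_scaleR)
  qed (simp add: one_form_def immersion_image[OF eps(2)])
qed

lemma symbol_matrix_continuous:
  assumes g: "smooth_on (- {0}) g"
  shows "continuous_on (- {0}) (symbol_matrix g)"
  unfolding symbol_matrix_def[abs_def] by (intro continuous_intros smooth_on_frechet_continuous g)

text \<open>The symbol is continuous off the origin and hence bounded on the closed shell, which is
  compact; so [D, g] acts boundedly on all of L2.\<close>

lemma one_form_carr:
  assumes g: "smooth_on (- {0}) g" and \<psi>: "\<psi> \<in> carr H"
  shows "one_form D \<epsilon> g \<psi> \<in> carr H"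
    and "\<exists>C\<ge>0. \<forall>\<psi>'\<in>carr H. vdist H (one_form D \<epsilon> g \<psi>) (one_form D \<epsilon> g \<psi>') \<le> C * vdist H \<psi> \<psi>'"
proof -
  let ?K = "{y::real^'m. norm y - 1 \<in> {-\<epsilon>..\<epsilon>}}"
  have "?K = cball 0 (1 + \<epsilon>) - ball 0 (1 - \<epsilon>)" by auto
  then have "compact ?K" by (simp add: compact_diff)
  moreover have K0: "?K \<subseteq> - {0}" using eps by auto
  ultimately have "bounded (symbol_matrix g ` ?K)"
    using compact_continuous_image[OF continuous_on_subset[OF symbol_matrix_continuous[OF g]]] compact_imp_bounded by blast
  then obtain B where "\<forall>z\<in>symbol_matrix g ` ?K. norm z \<le> B" unfolding bounded_iff by blast
  then have B: "norm (symbol_matrix g y) \<le> B" if "y \<in> shell \<epsilon>" for y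
    using that by (auto simp: shell_def)
  have B0: "B \<ge> 0"
  proof -
    have "axis undefined 1 \<in> (shell \<epsilon> :: (real^'m) set)" using eps by (simp add: shell_def norm_axis_1)
    from order_trans[OF norm_ge_zero B[OF this]] show ?thesis .
  qed
  obtain K where K: "K \<ge> 0" "\<And>(M::complex^'h^'h) w. norm (M *v w) \<le> norm M * norm w * K"
    using bounded_bilinear.nonneg_bounded[OF bounded_bilinear_mv] by blast
  define C where "C = B * K"
  have C: "C \<ge> 0" using B0 K by (simp add: C_def)
  have nb: "norm (symbol_matrix g y *v w) \<le> C * norm w" if "y \<in> shell \<epsilon>" for y w
  proof -
    have "norm (symbol_matrix g y) * norm w * K \<le> B * norm w * K"
      using B[OF that] K by (intro mult_right_mono) auto
    then show ?thesis using K(2)[of "symbol_matrix g y" w] by (simp add: C_def mult_ac)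
  qed
  have meas: "one_form D \<epsilon> g \<psi> \<in> borel_measurable lborel" if "\<psi> \<in> carr H" for \<psi>
  proof -
    have "continuous_on (shell \<epsilon>) (symbol_matrix g)"
      by (rule continuous_on_subset[OF symbol_matrix_continuous[OF g]]) (use shell_nonzero[OF eps(2)] in auto)
    then have "symbol_matrix g \<in> borel_measurable (restrict_space borel (shell \<epsilon>))"
      by (rule borel_measurable_continuous_on_restrict)
    then have "(\<lambda>y. \<i> *s (symbol_matrix g y *v \<psi> y)) \<in> borel_measurable (restrict_space borel (shell \<epsilon>))"
      using that by (intro measurable_scale measurable_mv) (auto simp: L2_carr intro: measurable_restrict_space1)
    then have "(\<lambda>y. indicator (shell \<epsilon>) y *\<^sub>R (\<i> *s (symbol_matrix g y *v \<psi> y))) \<in> borel_measurable borel"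
      by (simp add: borel_measurable_restrict_space_iff)
    moreover have "(\<lambda>y. indicator (shell \<epsilon>) y *\<^sub>R (\<i> *s (symbol_matrix g y *v \<psi> y))) = one_form D \<epsilon> g \<psi>"
      unfolding one_form_eq[OF g] by (auto simp: indicator_def)
    ultimately show ?thesis by simp
  qed
  have "norm (one_form D \<epsilon> g \<psi> y) \<le> C * norm (\<psi> y)" for y
    unfolding one_form_eq[OF g] using nb[of y "\<psi> y"] C by (simp add: norm_scale)
  then show "one_form D \<epsilon> g \<psi> \<in> carr H"
    using meas[OF \<psi>] square_integrable_bound[OF meas[OF \<psi>] \<psi>, of C] by (simp add: L2_carr)
  have "vdist H (one_form D \<epsilon> g \<psi>) (one_form D \<epsilon> g \<psi>') \<le> C * vdist H \<psi> \<psi>'" if "\<psi>' \<in> carr H" for \<psi>'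
  proof (rule vdist_L2_pointwise_bound[OF H.semi_ip_axioms \<psi> that meas[OF \<psi>] meas[OF that] C])
    fix y
    show "norm (one_form D \<epsilon> g \<psi> y - one_form D \<epsilon> g \<psi>' y) \<le> C * norm (\<psi> y - \<psi>' y)"
    proof (cases "y \<in> shell \<epsilon>")
      case True
      have "one_form D \<epsilon> g \<psi> y - one_form D \<epsilon> g \<psi>' y = \<i> *s (symbol_matrix g y *v (\<psi> y - \<psi>' y))"
        unfolding one_form_eq[OF g] using True
        by (simp add: matrix_vector_mult_diff_distrib vec.scale_right_diff_distrib)
      then show ?thesis using nb[OF True] by (simp add: norm_scale)
    qed (use C in \<open>simp add: one_form_eq[OF g]\<close>)
  qed
  then show "\<exists>C\<ge>0. \<forall>\<psi>'\<in>carr H. vdist H (one_form D \<epsilon> g \<psi>) (one_form D \<epsilon> g \<psi>') \<le> C * vdist H \<psi> \<psi>'"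
    using C by blast
qed

end

section \<open>Stability of functions vanishing at infinity\<close>

lemma C0_dominated:
  fixes f :: "'a::t2_space \<Rightarrow> 'b::real_normed_vector" and g :: "'a \<Rightarrow> 'c::real_normed_vector"
  assumes f: "f \<in> C0 X" and g: "continuous_on X g" and b: "\<And>p. p \<in> X \<Longrightarrow> norm (g p) \<le> C * norm (f p)"
  shows "g \<in> C0 X"
  unfolding C0_def
proof (intro CollectI conjI allI impI g)
  fix \<delta> :: real assume \<delta>: "\<delta> > 0"
  have f': "\<forall>\<delta>>0. \<exists>K. compact K \<and> K \<subseteq> X \<and> (\<forall>p\<in>X - K. norm (f p) < \<delta>)" using f by (simp add: C0_def)
  have pos: "\<delta> / (\<bar>C\<bar> + 1) > 0" using \<delta> by simp
  obtain K where K: "compact K" "K \<subseteq> X" "\<And>p. p \<in> X - K \<Longrightarrow> norm (f p) < \<delta> / (\<bar>C\<bar> + 1)"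
    using f'[rule_format, OF pos] by auto
  have "norm (g p) < \<delta>" if "p \<in> X - K" for p
  proof -
    have "norm (g p) \<le> C * norm (f p)" using b that by blast
    also have "\<dots> \<le> (\<bar>C\<bar> + 1) * norm (f p)" by (intro mult_right_mono) auto
    also have "\<dots> < (\<bar>C\<bar> + 1) * (\<delta> / (\<bar>C\<bar> + 1))"
      using K(3)[OF that] by (intro mult_strict_left_mono) auto
    finally show ?thesis by simp
  qed
  then show "\<exists>K. compact K \<and> K \<subseteq> X \<and> (\<forall>p\<in>X - K. norm (g p) < \<delta>)" using K by blast
qed

lemma C0_diff:
  fixes f g :: "'a::t2_space \<Rightarrow> 'b::real_normed_vector"
  assumes f: "f \<in> C0 X" and g: "g \<in> C0 X"
  shows "(\<lambda>p. f p - g p) \<in> C0 X"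
  unfolding C0_def
proof (intro CollectI conjI allI impI)
  show "continuous_on X (\<lambda>p. f p - g p)" using f g by (intro continuous_intros) (simp_all add: C0_def)
  fix \<delta> :: real assume \<delta>: "\<delta> > 0"
  have f': "\<forall>\<delta>>0. \<exists>K. compact K \<and> K \<subseteq> X \<and> (\<forall>p\<in>X - K. norm (f p) < \<delta>)"
    and g': "\<forall>\<delta>>0. \<exists>K. compact K \<and> K \<subseteq> X \<and> (\<forall>p\<in>X - K. norm (g p) < \<delta>)" using f g by (simp_all add: C0_def)
  obtain K where K: "compact K" "K \<subseteq> X" "\<And>p. p \<in> X - K \<Longrightarrow> norm (f p) < \<delta> / 2"
    using f'[rule_format, OF half_gt_zero[OF \<delta>]] by auto
  obtain K' where K': "compact K'" "K' \<subseteq> X" "\<And>p. p \<in> X - K' \<Longrightarrow> norm (g p) < \<delta> / 2"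
    using g'[rule_format, OF half_gt_zero[OF \<delta>]] by auto
  have "norm (f p - g p) < \<delta>" if p: "p \<in> X - (K \<union> K')" for p
    using K(3)[of p] K'(3)[of p] p norm_triangle_ineq4[of "f p" "g p"] by simp
  moreover have "compact (K \<union> K')" "K \<union> K' \<subseteq> X" using K K' by auto
  ultimately show "\<exists>K. compact K \<and> K \<subseteq> X \<and> (\<forall>p\<in>X - K. norm (f p - g p) < \<delta>)" by blast
qed

lemma C0_mv:
  fixes f :: "'a::t2_space \<Rightarrow> complex^'i" and M :: "complex^'i^'j"
  assumes "f \<in> C0 X" shows "(\<lambda>p. M *v f p) \<in> C0 X"
proof -
  obtain K where K: "\<And>w. norm (M *v w) \<le> norm w * K"
    using bounded_linear.bounded[OF bounded_bilinear.bounded_linear_right[OF bounded_bilinear_mv]] by blast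
  show ?thesis
  proof (rule C0_dominated[OF assms])
    show "continuous_on X (\<lambda>p. M *v f p)"
      using assms by (intro bounded_bilinear.continuous_on[OF bounded_bilinear_mv] continuous_on_const) (simp add: C0_def)
    show "norm (M *v f p) \<le> K * norm (f p)" for p using K[of "f p"] by (simp add: mult.commute)
  qed
qed

section \<open>The product operator on smooth spinors\<close>

context collar_dirac begin

lemma m_scaleR_left: "m (r *\<^sub>R v) w = r *\<^sub>R m v w"
  and m_scaleR_right: "m v (r *\<^sub>R w) = r *\<^sub>R m v w"
  by (simp_all add: scaleR_as_scale m_scale_left m_scale_right)

lemma m_sum_left: "m (\<Sum>i\<in>I. f i) w = (\<Sum>i\<in>I. m (f i) w)"
  and m_sum_right: "m v (\<Sum>i\<in>I. g i) = (\<Sum>i\<in>I. m v (g i))"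
  using bounded_bilinear.sum_left[OF bounded_bilinear_m] bounded_bilinear.sum_right[OF bounded_bilinear_m] by blast+

lemma m_diff_left: "m (v - v') w = m v w - m v' w"
  by (rule bounded_bilinear.diff_left[OF bounded_bilinear_m])

text \<open>The \<open>pauli3\<close> in front of the connection is what allows the symbol to pass
  through the embedding, by \<open>m_ab\<close>.\<close>

lemma m_symbol_matrix:
  "m (pauli3 *v v) (\<i> *s (symbol_matrix g y *v w))
    = \<i> *s (\<Sum>l\<in>UNIV. frechet_derivative g (at y) (axis l 1) *\<^sub>R (b (axis l 1) *v m v w))"
  by (simp add: symbol_matrix_def sum_mv scaleR_mv m_scale_right m_sum_right m_scaleR_right m_ab)

lemma symbol_norm: "y \<noteq> 0 \<Longrightarrow> frechet_derivative norm (at y) (axis l 1) = (y /\<^sub>R norm y) \<bullet> axis l 1"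
  for y :: "real^'m"
  using fun_cong[OF frechet_derivative_at[OF has_derivative_norm_at], of y "axis l 1"] by simp

lemma section_product:
  fixes \<xi> :: "'m mod2" and \<psi> :: "real^'m \<Rightarrow> complex^'h"
  assumes \<xi>: "\<xi> \<in> C10 \<epsilon>" and \<psi>: "\<psi> \<in> Cc_inf UNIV"
  defines "\<Theta> \<equiv> \<lambda>y. m (\<xi> (polar y)) (\<psi> y)"
  shows "y \<in> shell \<epsilon> \<Longrightarrow> (\<Theta> has_derivative (\<lambda>h. m (\<xi> (polar y)) (frechet_derivative \<psi> (at y) h)
      + m (((y /\<^sub>R norm y) \<bullet> h) *\<^sub>R s_deriv \<xi> (polar y)
      + (\<Sum>j\<in>UNIV. frechet_derivative (\<lambda>z. z $ j / norm z) (at y) h *\<^sub>R ang_deriv j \<xi> (polar y))) (\<psi> y))) (at y)"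
    and "continuous_on (shell \<epsilon>) (\<lambda>y. frechet_derivative \<Theta> (at y) h)"
proof -
  have \<psi>s: "smooth_on UNIV \<psi>" using \<psi> by (simp add: Cc_inf_def)
  have d: "(\<Theta> has_derivative (\<lambda>h. m (\<xi> (polar y)) (frechet_derivative \<psi> (at y) h)
      + m (((y /\<^sub>R norm y) \<bullet> h) *\<^sub>R s_deriv \<xi> (polar y)
      + (\<Sum>j\<in>UNIV. frechet_derivative (\<lambda>z. z $ j / norm z) (at y) h *\<^sub>R ang_deriv j \<xi> (polar y))) (\<psi> y))) (at y)"
    if y: "y \<in> shell \<epsilon>" for y
    unfolding \<Theta>_def
    by (rule bounded_bilinear.FDERIV[OF bounded_bilinear_m module_section_deriv(1)[OF eps(2) \<xi> y]
        smooth_on_has_derivative[OF \<psi>s UNIV_I]])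
  then show "y \<in> shell \<epsilon> \<Longrightarrow> (\<Theta> has_derivative (\<lambda>h. m (\<xi> (polar y)) (frechet_derivative \<psi> (at y) h)
      + m (((y /\<^sub>R norm y) \<bullet> h) *\<^sub>R s_deriv \<xi> (polar y)
      + (\<Sum>j\<in>UNIV. frechet_derivative (\<lambda>z. z $ j / norm z) (at y) h *\<^sub>R ang_deriv j \<xi> (polar y))) (\<psi> y))) (at y)" .
  have c: "continuous_on (shell \<epsilon>) (\<lambda>y. f (polar y))" if "f \<in> C0 (collar \<epsilon>)" for f :: "'m mod2"
    by (rule continuous_polar[OF eps(2)]) (use that in \<open>simp add: C0_def\<close>)
  have \<xi>c: "\<xi> \<in> C0 (collar \<epsilon>)" "s_deriv \<xi> \<in> C0 (collar \<epsilon>)" "\<And>j. ang_deriv j \<xi> \<in> C0 (collar \<epsilon>)"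
    using \<xi> by (auto simp: C10_def)
  have nz: "shell \<epsilon> \<subseteq> - {0::real^'m}" using shell_nonzero[OF eps(2)] by auto
  have 1: "continuous_on (shell \<epsilon>) (\<lambda>y. frechet_derivative \<psi> (at y) h)" "continuous_on (shell \<epsilon>) \<psi>"
    using smooth_on_frechet_continuous[OF \<psi>s] smooth_on_continuous[OF \<psi>s] continuous_on_subset by blast+
  have 2: "continuous_on (shell \<epsilon>) (\<lambda>y. frechet_derivative (\<lambda>z. z $ j / norm z) (at y) h)" for j
    by (rule continuous_on_subset[OF smooth_on_frechet_continuous[OF smooth_coordinate] nz])
  have 3: "continuous_on (shell \<epsilon>) (\<lambda>y. (y /\<^sub>R norm y) \<bullet> h)"
    by (intro continuous_intros) (use nz in auto)
  have "continuous_on (shell \<epsilon>) (\<lambda>y. m (\<xi> (polar y)) (frechet_derivative \<psi> (at y) h)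
      + m (((y /\<^sub>R norm y) \<bullet> h) *\<^sub>R s_deriv \<xi> (polar y)
      + (\<Sum>j\<in>UNIV. frechet_derivative (\<lambda>z. z $ j / norm z) (at y) h *\<^sub>R ang_deriv j \<xi> (polar y))) (\<psi> y))"
    by (intro continuous_on_add bounded_bilinear.continuous_on[OF bounded_bilinear_m] continuous_on_scaleR
        continuous_on_sum c \<xi>c 1 2 3)
  then show "continuous_on (shell \<epsilon>) (\<lambda>y. frechet_derivative \<Theta> (at y) h)"
    by (rule continuous_on_cong[THEN iffD1, rotated -1])
      (use frechet_derivative_at[OF d] in \<open>auto dest: fun_cong\<close>)
qed

lemma pauli3_derivs:
  fixes \<xi> :: "'m mod2"
  assumes \<xi>: "\<xi> \<in> C10 \<epsilon>" and p: "p \<in> collar \<epsilon>"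
  shows "s_deriv (\<lambda>p. pauli3 *v \<xi> p) p = pauli3 *v s_deriv \<xi> p"
    and "ang_deriv j (\<lambda>p. pauli3 *v \<xi> p) p = pauli3 *v ang_deriv j \<xi> p"
proof -
  define y where "y = immersion p"
  have y: "y \<in> shell \<epsilon>" "polar y = p"
    using immersion_shell[OF eps(2) p] polar_immersion[OF eps(2) p] by (simp_all add: y_def)
  obtain x s where xs: "p = (x, s)" by (cases p)
  note d = module_section_deriv(2,3)[OF eps(2) \<xi> y(1), unfolded y(2) xs fst_conv snd_conv]
  have bl: "bounded_linear ((*v) pauli3)" by (rule bounded_bilinear.bounded_linear_right[OF bounded_bilinear_mv])
  have "((\<lambda>t. \<xi> (x, t)) has_vector_derivative s_deriv \<xi> p) (at s)"
    using d(1) by (simp add: xs s_deriv_def vector_derivative_works)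
  from bounded_linear.has_vector_derivative[OF bl this]
  show "s_deriv (\<lambda>p. pauli3 *v \<xi> p) p = pauli3 *v s_deriv \<xi> p"
    using vector_derivative_at by (fastforce simp: s_deriv_def xs)
  have "(hom_ext (\<lambda>z. \<xi> (z, s)) has_derivative frechet_derivative (hom_ext (\<lambda>z. \<xi> (z, s))) (at x)) (at x)"
    using d(2) frechet_derivative_works by blast
  from bounded_linear.has_derivative[OF bl this]
  have "(hom_ext (\<lambda>z. pauli3 *v \<xi> (z, s)) has_derivative
      (\<lambda>h. pauli3 *v frechet_derivative (hom_ext (\<lambda>z. \<xi> (z, s))) (at x) h)) (at x)"
    by (simp add: hom_ext_def)
  from fun_cong[OF frechet_derivative_at[OF this], of "axis j 1"]
  show "ang_deriv j (\<lambda>p. pauli3 *v \<xi> p) p = pauli3 *v ang_deriv j \<xi> p"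
    by (simp add: ang_deriv_def xs)
qed

lemma J1_src_elem:
  "J1 (src_elem \<xi> \<psi> \<psi>') p = j1 (op_S \<epsilon> A \<xi>, \<psi>) p + j1 (\<lambda>p. pauli3 *v \<xi> p, \<psi>') p
    + j1 (\<lambda>p. s_deriv (\<lambda>p. pauli3 *v \<xi> p) p - of_real (real (CARD('m) - 1) / (2 * (snd p + 1))) *s (pauli3 *v \<xi> p),
          one_form D \<epsilon> norm \<psi>) p
    + (\<Sum>j\<in>UNIV. j1 (ang_deriv j (\<lambda>p. pauli3 *v \<xi> p), one_form D \<epsilon> (\<lambda>y. y $ j / norm y) \<psi>) p)"
  by (simp add: J1_def src_elem_def connection_def sum_unfold_sum_mset image_mset.compositionality o_def add_ac)

text \<open>Leibniz rule. The derivative of \<psi> comes from D, the radial and angular derivatives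
  of \<xi> come from the connection, and together they form the derivative of the product. The
  summand -n/(2(s+1)) of the connection becomes the middle term of \<open>flat_op\<close>.\<close>

lemma src_elem_classical:
  fixes \<xi> :: "'m mod2"
  assumes \<xi>: "\<xi> \<in> C10 \<epsilon>" and \<psi>: "\<psi> \<in> Cc_inf UNIV" and p: "p \<in> collar \<epsilon>"
  shows "J1 (src_elem \<xi> \<psi> (D \<psi>)) p = flat (\<lambda>y. m (\<xi> (polar y)) (\<psi> y)) (immersion p)"
proof -
  define y where "y = immersion p"
  have y: "y \<in> shell \<epsilon>" "polar y = p"
    using immersion_shell[OF eps(2) p] polar_immersion[OF eps(2) p] by (simp_all add: y_def)
  have y0: "y \<noteq> 0" using shell_nonzero[OF eps(2) y(1)] by blast
  have sp: "snd p + 1 = norm y" "snd p = norm y - 1" using y(2) by (auto simp: polar_def)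
  define \<psi>' where "\<psi>' = frechet_derivative \<psi> (at y)"
  define d where "d j l = frechet_derivative (\<lambda>z. z $ j / norm z) (at y) (axis l (1::real))" for j l
  define r where "r l = (y /\<^sub>R norm y) \<bullet> axis l 1" for l
  define B where "B l v = b (axis l 1) *v m v (\<psi> y)" for l v
  define c where "c = complex_of_real (real (CARD('m) - 1) / (2 * norm y))"
  have Dy: "D \<psi> y = \<i> *s (\<Sum>l\<in>UNIV. a (axis l 1) *v \<psi>' (axis l 1))"
    unfolding \<psi>'_def by (rule D_eq, rule smooth_on_differentiable[of UNIV]) (use \<psi> in \<open>auto simp: Cc_inf_def\<close>)
  have oN: "one_form D \<epsilon> norm \<psi> y = \<i> *s (symbol_matrix norm y *v \<psi> y)"
    and oC: "one_form D \<epsilon> (\<lambda>z. z $ j / norm z) \<psi> y = \<i> *s (symbol_matrix (\<lambda>z. z $ j / norm z) y *v \<psi> y)" for j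
    using y(1) by (simp_all add: one_form_eq[OF smooth_on_norm] one_form_eq[OF smooth_coordinate])
  have bu: "b (y /\<^sub>R norm y) *v m v (\<psi> y) = (\<Sum>l\<in>UNIV. r l *\<^sub>R B l v)" for v
    unfolding linear_axis_sum[OF b_linear, of "y /\<^sub>R norm y"] sum_mv scaleR_mv B_def r_def
    by (simp add: inner_axis)
  have 1: "j1 (op_S \<epsilon> A \<xi>, \<psi>) p = of_real (pot \<epsilon> (norm y - 1)) *s (\<alpha> *v m (\<xi> p) (\<psi> y))"
    by (simp add: j1_def op_S_def m_scale_left m_A sp(2) flip: y_def)
  have 2: "j1 (\<lambda>p. pauli3 *v \<xi> p, D \<psi>) p = \<i> *s (\<Sum>l\<in>UNIV. b (axis l 1) *v m (\<xi> p) (\<psi>' (axis l 1)))"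
    by (simp add: j1_def Dy m_scale_right m_sum_right m_ab flip: y_def)
  have 3: "j1 (\<lambda>p. s_deriv (\<lambda>p. pauli3 *v \<xi> p) p - of_real (real (CARD('m) - 1) / (2 * (snd p + 1))) *s (pauli3 *v \<xi> p),
          one_form D \<epsilon> norm \<psi>) p = \<i> *s (\<Sum>l\<in>UNIV. r l *\<^sub>R B l (s_deriv \<xi> p)) - c *s (\<i> *s (\<Sum>l\<in>UNIV. r l *\<^sub>R B l (\<xi> p)))"
    unfolding j1_def fst_conv snd_conv y_def[symmetric] oN pauli3_derivs(1)[OF \<xi> p] sp(1) m_diff_left m_scale_left m_symbol_matrix
      symbol_norm[OF y0] B_def r_def c_def by simp
  have 4: "j1 (ang_deriv j (\<lambda>p. pauli3 *v \<xi> p), one_form D \<epsilon> (\<lambda>y. y $ j / norm y) \<psi>) p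
      = \<i> *s (\<Sum>l\<in>UNIV. d j l *\<^sub>R B l (ang_deriv j \<xi> p))" for j
    unfolding j1_def fst_conv snd_conv y_def[symmetric] oC pauli3_derivs(2)[OF \<xi> p] m_symbol_matrix B_def d_def by simp
  have fd: "frechet_derivative (\<lambda>y. m (\<xi> (polar y)) (\<psi> y)) (at y) (axis l 1)
      = m (\<xi> p) (\<psi>' (axis l 1)) + r l *\<^sub>R m (s_deriv \<xi> p) (\<psi> y) + (\<Sum>j\<in>UNIV. d j l *\<^sub>R m (ang_deriv j \<xi> p) (\<psi> y))" for l
    using fun_cong[OF frechet_derivative_at[OF section_product(1)[OF \<xi> \<psi> y(1)]], of "axis l 1", symmetric]
    by (simp add: add.assoc \<psi>'_def r_def d_def y(2) m_add_left m_sum_left m_scaleR_left)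
  have mvs: "b w *v (\<Sum>j\<in>UNIV. f j) = (\<Sum>j\<in>UNIV. b w *v f j)" for w and f :: "'m \<Rightarrow> complex^'p"
    by (rule linear_sum) simp
  have "flat (\<lambda>y. m (\<xi> (polar y)) (\<psi> y)) y
      = \<i> *s ((\<Sum>l\<in>UNIV. b (axis l 1) *v m (\<xi> p) (\<psi>' (axis l 1))) + (\<Sum>l\<in>UNIV. r l *\<^sub>R B l (s_deriv \<xi> p))
        + (\<Sum>l\<in>UNIV. \<Sum>j\<in>UNIV. d j l *\<^sub>R B l (ang_deriv j \<xi> p)))
      - (\<i> * c) *s (\<Sum>l\<in>UNIV. r l *\<^sub>R B l (\<xi> p)) + of_real (pot \<epsilon> (norm y - 1)) *s (\<alpha> *v m (\<xi> p) (\<psi> y))"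
    unfolding flat_op_def fd y(2) bu matrix_vector_right_distrib mvs mv_scaleR c_def
    by (simp add: sum.distrib B_def)
  also have "\<dots> = J1 (src_elem \<xi> \<psi> (D \<psi>)) p"
    unfolding J1_src_elem 1 2 3 4 sum.swap[of "\<lambda>l j. d j l *\<^sub>R B l (ang_deriv j \<xi> p)"]
    by (simp add: vec.scale_right_distrib vec.scale_sum_right mult.commute)
  finally show ?thesis by (simp add: y_def)
qed

text \<open>\<open>dom_S\<close> takes care of the potential and \<open>C10\<close> of the
  derivatives. The remaining coefficient is \<xi> times a function bounded by n/(2(1 -
  \<epsilon>)).\<close>

lemma src_elem_coeffs:
  fixes \<xi> :: "'m mod2"
  assumes \<xi>: "\<xi> \<in> dom_S \<epsilon> \<inter> C10 \<epsilon>"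
  shows "op_S \<epsilon> A \<xi> \<in> Emod \<epsilon>" and "(\<lambda>p. pauli3 *v \<xi> p) \<in> Emod \<epsilon>" and "\<xi> \<in> Emod \<epsilon>"
    and "(\<lambda>p. s_deriv (\<lambda>p. pauli3 *v \<xi> p) p
      - of_real (real (CARD('m) - 1) / (2 * (snd p + 1))) *s (pauli3 *v \<xi> p)) \<in> Emod \<epsilon>"
    and "ang_deriv j (\<lambda>p. pauli3 *v \<xi> p) \<in> Emod \<epsilon>"
proof -
  have x: "\<xi> \<in> C10 \<epsilon>" "\<xi> \<in> C0 (collar \<epsilon>)" "s_deriv \<xi> \<in> C0 (collar \<epsilon>)" "\<And>j. ang_deriv j \<xi> \<in> C0 (collar \<epsilon>)"
    "(\<lambda>p. of_real (pot \<epsilon> (snd p)) *s \<xi> p) \<in> C0 (collar \<epsilon>)"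
    using \<xi> by (auto simp: C10_def dom_S_def Emod_def)
  show "\<xi> \<in> Emod \<epsilon>" using x by (simp add: Emod_def)
  show "op_S \<epsilon> A \<xi> \<in> Emod \<epsilon>"
    using C0_mv[OF x(5), of A] by (simp add: op_S_def Emod_def vector_scalar_commute)
  show g: "(\<lambda>p. pauli3 *v \<xi> p) \<in> Emod \<epsilon>" unfolding Emod_def by (rule C0_mv[OF x(2)])
  have "s_deriv (\<lambda>p. pauli3 *v \<xi> p) \<in> C0 (collar \<epsilon>)"
    using C0_mv[OF x(3), of pauli3] C0_cong[of "collar \<epsilon>" "s_deriv (\<lambda>p. pauli3 *v \<xi> p)" "\<lambda>p. pauli3 *v s_deriv \<xi> p"]
      pauli3_derivs(1)[OF x(1)] by simp
  moreover have "(\<lambda>p. of_real (real (CARD('m) - 1) / (2 * (snd p + 1))) *s (pauli3 *v \<xi> p)) \<in> C0 (collar \<epsilon>)"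
  proof (rule C0_dominated[OF g[unfolded Emod_def]])
    show "continuous_on (collar \<epsilon>) (\<lambda>p. complex_of_real (real (CARD('m) - 1) / (2 * (snd p + 1))) *s (pauli3 *v \<xi> p))"
      using g eps by (intro bounded_bilinear.continuous_on[OF bounded_bilinear_scale] continuous_intros)
        (auto simp: Emod_def C0_def collar_def)
    fix p :: "(real^'m) \<times> real" assume "p \<in> collar \<epsilon>"
    then have "0 < 1 - \<epsilon>" "1 - \<epsilon> \<le> snd p + 1" using eps by (auto simp: collar_def)
    then have "\<bar>real (CARD('m) - 1) / (2 * (snd p + 1))\<bar> \<le> real (CARD('m) - 1) / (2 * (1 - \<epsilon>))"
      by (simp add: frac_le)
    then show "norm (complex_of_real (real (CARD('m) - 1) / (2 * (snd p + 1))) *s (pauli3 *v \<xi> p))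
        \<le> real (CARD('m) - 1) / (2 * (1 - \<epsilon>)) * norm (pauli3 *v \<xi> p)"
      unfolding norm_scale norm_of_real by (rule mult_right_mono) simp
  qed
  ultimately show "(\<lambda>p. s_deriv (\<lambda>p. pauli3 *v \<xi> p) p
      - of_real (real (CARD('m) - 1) / (2 * (snd p + 1))) *s (pauli3 *v \<xi> p)) \<in> Emod \<epsilon>"
    unfolding Emod_def by (rule C0_diff)
  show "ang_deriv j (\<lambda>p. pauli3 *v \<xi> p) \<in> Emod \<epsilon>"
    using C0_mv[OF x(4), of pauli3 j] C0_cong[of "collar \<epsilon>" "ang_deriv j (\<lambda>p. pauli3 *v \<xi> p)" "\<lambda>p. pauli3 *v ang_deriv j \<xi> p"]
      pauli3_derivs(2)[OF x(1)] by (simp add: Emod_def)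
qed

lemma src_elem_carr:
  assumes \<xi>: "\<xi> \<in> dom_S \<epsilon> \<inter> C10 \<epsilon>" and "\<psi> \<in> carr H" "\<psi>' \<in> carr H"
  shows "src_elem \<xi> \<psi> \<psi>' \<in> carr src"
  using src_elem_coeffs[OF \<xi>] assms one_form_carr(1)[OF smooth_on_norm] one_form_carr(1)[OF smooth_coordinate]
  by (auto simp: src_elem_def connection_def pre_tensor_def)

lemma ip_src_elem:
  assumes \<xi>: "\<xi> \<in> dom_S \<epsilon> \<inter> C10 \<epsilon>" and \<psi>: "\<psi> \<in> carr H" "\<psi>' \<in> carr H" and g: "g \<in> carr L"
  shows "ip L g (J1 (src_elem \<xi> \<psi> \<psi>')) = ip L g (j1 (op_S \<epsilon> A \<xi>, \<psi>)) + ip L g (j1 (\<lambda>p. pauli3 *v \<xi> p, \<psi>'))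
    + ip L g (j1 (\<lambda>p. s_deriv (\<lambda>p. pauli3 *v \<xi> p) p - of_real (real (CARD('m) - 1) / (2 * (snd p + 1))) *s (pauli3 *v \<xi> p),
          one_form D \<epsilon> norm \<psi>))
    + (\<Sum>j\<in>UNIV. ip L g (j1 (ang_deriv j (\<lambda>p. pauli3 *v \<xi> p), one_form D \<epsilon> (\<lambda>y. y $ j / norm y) \<psi>)))"
proof -
  have "ip L g (J1 (src_elem \<xi> \<psi> \<psi>')) = (\<Sum>x\<in>#src_elem \<xi> \<psi> \<psi>'. ip L g (j1 x))"
    unfolding J1_def[abs_def]
  proof (rule L2_sum_mset(2)[OF _ g])
    fix x assume "x \<in># src_elem \<xi> \<psi> \<psi>'"
    then have "fst x \<in> Emod \<epsilon>" "snd x \<in> carr H"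
      using src_elem_carr[OF assms(1-3)] by (auto simp: pre_tensor_def)
    then show "j1 x \<in> carr L" using j1_carr(1)[of "fst x" "snd x"] by simp
  qed
  then show ?thesis
    by (simp add: src_elem_def connection_def sum_unfold_sum_mset image_mset.compositionality o_def add_ac)
qed

end

section \<open>Symmetry against test tensors and its passage to closed domains\<close>

lemma op_closureD:
  assumes "(x, y) \<in> op_closure H G"
  shows "x \<in> carr H" "y \<in> carr H"
    and "\<exists>X Y. (\<forall>n. (X n, Y n) \<in> G) \<and> (\<lambda>n. vdist H (X n) x) \<longlonglongrightarrow> 0 \<and> (\<lambda>n. vdist H (Y n) y) \<longlonglongrightarrow> 0"
  using assms unfolding op_closure_def by blast+

lemma op_closureI:
  assumes "semi_ip H" "(x, y) \<in> G" "x \<in> carr H" "y \<in> carr H"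
  shows "(x, y) \<in> op_closure H G"
proof -
  have "\<exists>X Y. (\<forall>n. (X n, Y n) \<in> G) \<and> (\<lambda>n. vdist H (X n) x) \<longlonglongrightarrow> 0 \<and> (\<lambda>n. vdist H (Y n) y) \<longlonglongrightarrow> 0"
    by (rule exI[of _ "\<lambda>_. x"], rule exI[of _ "\<lambda>_. y"])
      (simp add: assms semi_ip.vdist_self[OF assms(1)])
  then show ?thesis using assms by (simp add: op_closure_def)
qed

context collar_dirac begin

lemma test_carr:
  assumes "\<phi> \<in> smooth_sphere_sections F" "t \<in> Cc_inf {-\<epsilon><..<\<epsilon>}"
  shows "\<phi> \<in> carr G" "Dq \<phi> \<in> carr G" "t \<in> carr (interval_L2 \<epsilon>)" "T0 \<epsilon> t \<in> carr (interval_L2 \<epsilon>)"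
  using assms smooth_sphere_carr Dq_carr Cc_inf_carr T0_carr[OF eps(1)] by blast+

lemma Cc_inf_H:
  assumes \<psi>: "\<psi> \<in> Cc_inf UNIV"
  shows "\<psi> \<in> carr H" "D \<psi> \<in> carr H"
proof -
  obtain K where K: "compact K" "\<And>y. y \<notin> K \<Longrightarrow> \<psi> y = 0" and s: "smooth_on UNIV \<psi>"
    using \<psi> unfolding Cc_inf_def by blast
  show "\<psi> \<in> carr H" by (rule L2_compact_support[OF smooth_on_continuous[OF s] K])
  have D: "D \<psi> = (\<lambda>y. \<i> *s (\<Sum>l\<in>UNIV. a (axis l 1) *v frechet_derivative \<psi> (at y) (axis l 1)))"
    using D_eq smooth_on_differentiable[OF s] by blast
  show "D \<psi> \<in> carr H"
  proof (rule L2_compact_support[OF _ K(1)])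
    show "continuous_on UNIV (D \<psi>)"
      unfolding D by (intro bounded_bilinear.continuous_on[OF bounded_bilinear_scale] continuous_on_const continuous_on_sum
          bounded_bilinear.continuous_on[OF bounded_bilinear_mv] smooth_on_frechet_continuous s)
    fix y assume y: "y \<notin> K"
    have "frechet_derivative \<psi> (at y) = frechet_derivative (\<lambda>_. 0) (at y)"
      by (rule frechet_derivative_cong_open[of "- K"]) (use y K in \<open>auto simp: compact_imp_closed open_Compl\<close>)
    then show "D \<psi> y = 0" by (simp add: D)
  qed
qed

lemma j1_collar: "p \<in> space N \<Longrightarrow> j1 (\<xi>, \<psi>) p = m (\<xi> (polar (immersion p))) (\<psi> (immersion p))"
  using polar_immersion[OF eps(2), of p] by (simp add: j1_def space_collar_measure)

lemma j2_collar: "p \<in> space N \<Longrightarrow> j2 x (polar (immersion p)) = j2 x p"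
  using polar_immersion[OF eps(2), of p] by (simp add: space_collar_measure)

lemma J_singleton: "J1 {#x#} = j1 x" "J2 {#z#} = j2 z"
  by (simp_all add: J1_def[abs_def] J2_def[abs_def])

lemma J1_carr: "M \<in> carr src \<Longrightarrow> J1 M \<in> carr L" and J2_carr: "M' \<in> carr tgt \<Longrightarrow> J2 M' \<in> carr L"
  using isometric_map.J_carr[OF J1_isometric] isometric_map.J_carr[OF J2_isometric] by blast+

lemma ip_cong:
  "(\<And>p. p \<in> space N \<Longrightarrow> f p = f' p) \<Longrightarrow> (\<And>p. p \<in> space N \<Longrightarrow> g p = g' p) \<Longrightarrow> ip L f g = ip L f' g'"
  unfolding L2_ip by (rule Bochner_Integration.integral_cong) simp_all

text \<open>Both pairings become integrals of \<open>flat_op\<close>, the left one by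
  \<open>rhs_test\<close> and the right one by \<open>src_elem_classical\<close>. The test section
  fills the compactly supported slot of \<open>flat_op_symmetric\<close>.\<close>

lemma symmetric_classical:
  assumes \<phi>: "\<phi> \<in> smooth_sphere_sections F" and t: "t \<in> Cc_inf {-\<epsilon><..<\<epsilon>}"
    and \<xi>: "\<xi> \<in> dom_S \<epsilon> \<inter> C10 \<epsilon>" and \<psi>: "\<psi> \<in> Cc_inf UNIV"
  shows "ip L (J2 (rhs_elem \<phi> (Dq \<phi>) t (T0 \<epsilon> t))) (j1 (\<xi>, \<psi>)) = ip L (j2 (\<phi>, t)) (J1 (src_elem \<xi> \<psi> (D \<psi>)))"
proof -
  let ?\<Psi> = "\<lambda>y. j2 (\<phi>, t) (polar y)" and ?\<Theta> = "\<lambda>y. m (\<xi> (polar y)) (\<psi> y)"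
  have \<xi>': "\<xi> \<in> C10 \<epsilon>" using \<xi> by blast
  note tc = test_carr[OF \<phi> t] and \<psi>c = Cc_inf_H[OF \<psi>]
  have c: "J2 (rhs_elem \<phi> (Dq \<phi>) t (T0 \<epsilon> t)) \<in> carr L" "j1 (\<xi>, \<psi>) \<in> carr L" "j2 (\<phi>, t) \<in> carr L"
      "J1 (src_elem \<xi> \<psi> (D \<psi>)) \<in> carr L"
    using J2_carr[OF rhs_elem_carr] J1_carr[OF src_elem_carr[OF \<xi>]] j1_carr(1)[OF src_elem_coeffs(3)[OF \<xi>]]
      j2_carr tc \<psi>c by blast+
  have e: "J2 (rhs_elem \<phi> (Dq \<phi>) t (T0 \<epsilon> t)) p = flat ?\<Psi> (immersion p)" "j1 (\<xi>, \<psi>) p = ?\<Theta> (immersion p)"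
    "j2 (\<phi>, t) p = ?\<Psi> (immersion p)" "J1 (src_elem \<xi> \<psi> (D \<psi>)) p = flat ?\<Theta> (immersion p)"
    if "p \<in> space N" for p
    using rhs_test[OF \<phi> t, of p] src_elem_classical[OF \<xi>' \<psi>, of p] j1_collar[OF that] j2_collar[OF that] that
    by (simp_all add: space_collar_measure)
  obtain K where K: "compact K" "K \<subseteq> shell \<epsilon>" "\<And>y. y \<notin> K \<Longrightarrow> ?\<Psi> y = 0" "smooth_on (shell \<epsilon>) ?\<Psi>"
    using test_section[OF \<phi> t] by blast
  have "ip L (J2 (rhs_elem \<phi> (Dq \<phi>) t (T0 \<epsilon> t))) (j1 (\<xi>, \<psi>))
      = (LINT p|N. cip (flat ?\<Psi> (immersion p)) (?\<Theta> (immersion p)))"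
    unfolding L2_ip by (rule Bochner_Integration.integral_cong) (simp_all add: e)
  also have "\<dots> = (LINT p|N. cip (?\<Psi> (immersion p)) (flat ?\<Theta> (immersion p)))"
  proof (rule flat_op_symmetric[OF eps b_linear b_herm \<alpha>_herm K(1,2,3)])
    show "integrable N (\<lambda>p. cip (flat ?\<Psi> (immersion p)) (?\<Theta> (immersion p)))"
      using integrable_cip[OF c(1,2)]
      by (rule Bochner_Integration.integrable_cong[THEN iffD1, rotated -1]) (simp_all add: e)
    show "integrable N (\<lambda>p. cip (?\<Psi> (immersion p)) (flat ?\<Theta> (immersion p)))"
      using integrable_cip[OF c(3,4)]
      by (rule Bochner_Integration.integrable_cong[THEN iffD1, rotated -1]) (simp_all add: e)
    show "?\<Psi> differentiable at y" if "y \<in> shell \<epsilon>" for y by (rule smooth_on_differentiable[OF K(4) that])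
    show "continuous_on (shell \<epsilon>) (\<lambda>y. frechet_derivative ?\<Psi> (at y) v)" for v
      by (rule smooth_on_frechet_continuous[OF K(4)])
    show "?\<Theta> differentiable at y" if "y \<in> shell \<epsilon>" for y
      using section_product(1)[OF \<xi>' \<psi> that] differentiable_def by blast
    show "continuous_on (shell \<epsilon>) (\<lambda>y. frechet_derivative ?\<Theta> (at y) v)" for v
      by (rule section_product(2)[OF \<xi>' \<psi>])
  qed
  also have "\<dots> = ip L (j2 (\<phi>, t)) (J1 (src_elem \<xi> \<psi> (D \<psi>)))"
    unfolding L2_ip by (rule Bochner_Integration.integral_cong) (simp_all add: e)
  finally show ?thesis .
qed

lemma tendsto_bounded_map:
  assumes f: "\<exists>C\<ge>0. \<forall>x'\<in>carr X. vdist Y (f x) (f x') \<le> C * vdist X x x'"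
    and X: "semi_ip X" and Y: "semi_ip Y" and fc: "\<And>x. x \<in> carr X \<Longrightarrow> f x \<in> carr Y"
    and x: "x \<in> carr X" "\<And>n. S n \<in> carr X" "(\<lambda>n. vdist X (S n) x) \<longlonglongrightarrow> 0"
  shows "(\<lambda>n. vdist Y (f (S n)) (f x)) \<longlonglongrightarrow> 0"
proof -
  interpret X: semi_ip X by fact
  interpret Y: semi_ip Y by fact
  obtain C where C: "C \<ge> 0" "\<And>x'. x' \<in> carr X \<Longrightarrow> vdist Y (f x) (f x') \<le> C * vdist X x x'" using f by blast
  show ?thesis
  proof (rule tendsto_sandwich[OF _ _ tendsto_const])
    show "\<forall>\<^sub>F n in sequentially. 0 \<le> vdist Y (f (S n)) (f x)" using fc x Y.vdist_nonneg by simp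
    show "\<forall>\<^sub>F n in sequentially. vdist Y (f (S n)) (f x) \<le> C * vdist X (S n) x"
      using C(2)[OF x(2)] X.vdist_commute[OF x(1,2)] Y.vdist_commute[OF fc[OF x(1)] fc[OF x(2)]] by simp
    show "(\<lambda>n. C * vdist X (S n) x) \<longlonglongrightarrow> 0" using tendsto_mult_right_zero[OF x(3)] .
  qed
qed

text \<open>For fixed \<xi> every summand is a bounded operator applied to \<psi> or to \<psi>', so
  convergence in the graph norm of D suffices.\<close>

lemma src_elem_tendsto:
  assumes \<xi>: "\<xi> \<in> dom_S \<epsilon> \<inter> C10 \<epsilon>" and g: "g \<in> carr L"
    and \<psi>: "\<psi> \<in> carr H" "\<And>n. X n \<in> carr H" "(\<lambda>n. vdist H (X n) \<psi>) \<longlonglongrightarrow> 0"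
    and \<psi>': "\<psi>' \<in> carr H" "\<And>n. X' n \<in> carr H" "(\<lambda>n. vdist H (X' n) \<psi>') \<longlonglongrightarrow> 0"
  shows "(\<lambda>n. ip L g (J1 (src_elem \<xi> (X n) (X' n)))) \<longlonglongrightarrow> ip L g (J1 (src_elem \<xi> \<psi> \<psi>'))"
proof -
  have j: "(\<lambda>n. ip L g (j1 (\<eta>, S n))) \<longlonglongrightarrow> ip L g (j1 (\<eta>, h))"
    if "\<eta> \<in> Emod \<epsilon>" "h \<in> carr H" "\<And>n. S n \<in> carr H" "(\<lambda>n. vdist H (S n) h) \<longlonglongrightarrow> 0" for \<eta> S h
    by (rule L.ip_tendsto_right[OF _ _ g j1_tendsto[OF that]]) (use j1_carr(1) that in auto)
  have o: "(\<lambda>n. vdist H (one_form D \<epsilon> k (X n)) (one_form D \<epsilon> k \<psi>)) \<longlonglongrightarrow> 0" if "smooth_on (- {0}) k" for k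
    by (rule tendsto_bounded_map[OF one_form_carr(2)[OF that \<psi>(1)] H.semi_ip_axioms H.semi_ip_axioms
        one_form_carr(1)[OF that] \<psi>])
  note co = src_elem_coeffs[OF \<xi>] and oc = one_form_carr(1)[OF smooth_on_norm] one_form_carr(1)[OF smooth_coordinate]
  show ?thesis
    unfolding ip_src_elem[OF \<xi> \<psi>(1) \<psi>'(1) g] ip_src_elem[OF \<xi> \<psi>(2) \<psi>'(2) g]
    by (intro tendsto_add tendsto_sum j co \<psi> \<psi>' oc o smooth_on_norm smooth_coordinate)
qed

lemma symmetric_src:
  assumes \<phi>: "\<phi> \<in> smooth_sphere_sections F" and t: "t \<in> Cc_inf {-\<epsilon><..<\<epsilon>}"
    and \<xi>: "\<xi> \<in> dom_S \<epsilon> \<inter> C10 \<epsilon>" and \<psi>: "(\<psi>, \<psi>') \<in> op_on_Rm D"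
  shows "ip L (J2 (rhs_elem \<phi> (Dq \<phi>) t (T0 \<epsilon> t))) (j1 (\<xi>, \<psi>)) = ip L (j2 (\<phi>, t)) (J1 (src_elem \<xi> \<psi> \<psi>'))"
proof -
  note c = op_closureD(1,2)[OF \<psi>[unfolded op_on_Rm_def]]
  obtain X Y where XY: "\<And>n. (X n, Y n) \<in> {(\<psi>, D \<psi>) | \<psi>. \<psi> \<in> Cc_inf UNIV}"
    and l: "(\<lambda>n. vdist H (X n) \<psi>) \<longlonglongrightarrow> 0" "(\<lambda>n. vdist H (Y n) \<psi>') \<longlonglongrightarrow> 0"
    using op_closureD(3)[OF \<psi>[unfolded op_on_Rm_def]] by blast
  have X: "X n \<in> Cc_inf UNIV" and Y: "Y n = D (X n)" for n using XY[of n] by auto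
  have Xc: "X n \<in> carr H" "Y n \<in> carr H" for n using Cc_inf_H[OF X] Y by auto
  note tc = test_carr[OF \<phi> t]
  have E: "\<xi> \<in> Emod \<epsilon>" by (rule src_elem_coeffs(3)[OF \<xi>])
  have "(\<lambda>n. ip L (J2 (rhs_elem \<phi> (Dq \<phi>) t (T0 \<epsilon> t))) (j1 (\<xi>, X n)))
      \<longlonglongrightarrow> ip L (J2 (rhs_elem \<phi> (Dq \<phi>) t (T0 \<epsilon> t))) (j1 (\<xi>, \<psi>))"
    by (rule L.ip_tendsto_right[OF _ _ _ j1_tendsto[OF E c(1) Xc(1) l(1)]])
      (use j1_carr(1)[OF E] c Xc J2_carr[OF rhs_elem_carr] tc in auto)
  moreover have "(\<lambda>n. ip L (j2 (\<phi>, t)) (J1 (src_elem \<xi> (X n) (Y n)))) \<longlonglongrightarrow> ip L (j2 (\<phi>, t)) (J1 (src_elem \<xi> \<psi> \<psi>'))"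
    by (rule src_elem_tendsto[OF \<xi> j2_carr[OF tc(1,3)] c(1) Xc(1) l(1) c(2) Xc(2) l(2)])
  moreover have "ip L (J2 (rhs_elem \<phi> (Dq \<phi>) t (T0 \<epsilon> t))) (j1 (\<xi>, X n)) = ip L (j2 (\<phi>, t)) (J1 (src_elem \<xi> (X n) (Y n)))" for n
    unfolding Y by (rule symmetric_classical[OF \<phi> t \<xi> X])
  ultimately show ?thesis using LIMSEQ_unique by simp
qed

text \<open>The norm of an elementary tensor is the product of the norms; this lets one factor be
  approximated while the other stays fixed.\<close>

lemma j2_vdist:
  assumes "\<phi> \<in> carr G" "\<phi>' \<in> carr G" "t \<in> carr (interval_L2 \<epsilon>)"
  shows "vdist L (j2 (\<phi>, t)) (j2 (\<phi>', t)) = vdist G \<phi> \<phi>' * sqrt (Re (ip (interval_L2 \<epsilon>) t t))"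
proof -
  let ?d = "vadd G \<phi> (vscale G (-1) \<phi>')"
  have d: "?d \<in> carr G" using assms G.vadd_closed G.vscale_closed by blast
  have "vadd L (j2 (\<phi>, t)) (vscale L (-1) (j2 (\<phi>', t))) = j2 (?d, t)"
    by (simp add: L2_vadd L2_vscale j2_def fun_eq_iff tens_diff_left pull_diff)
  then have "vdist L (j2 (\<phi>, t)) (j2 (\<phi>', t)) = sqrt (Re (ip G ?d ?d * ip (interval_L2 \<epsilon>) t t))"
    by (simp add: vdist_def Let_def j2_ip[OF d assms(3) d assms(3)])
  also have "\<dots> = sqrt (Re (ip G ?d ?d)) * sqrt (Re (ip (interval_L2 \<epsilon>) t t))"
    by (subst G.ip_self_real[OF d], subst I.ip_self_real[OF assms(3)]) (simp add: real_sqrt_mult)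
  finally show ?thesis by (simp add: vdist_def Let_def)
qed

lemma j2_vdist':
  assumes "\<phi> \<in> carr G" "t \<in> carr (interval_L2 \<epsilon>)" "t' \<in> carr (interval_L2 \<epsilon>)"
  shows "vdist L (j2 (\<phi>, t)) (j2 (\<phi>, t')) = sqrt (Re (ip G \<phi> \<phi>)) * vdist (interval_L2 \<epsilon>) t t'"
proof -
  let ?d = "vadd (interval_L2 \<epsilon>) t (vscale (interval_L2 \<epsilon>) (-1) t')"
  have d: "?d \<in> carr (interval_L2 \<epsilon>)" using assms I.vadd_closed I.vscale_closed by blast
  have "vadd L (j2 (\<phi>, t)) (vscale L (-1) (j2 (\<phi>, t'))) = j2 (\<phi>, ?d)"
    by (simp add: interval_L2_def L2_vadd L2_vscale j2_def fun_eq_iff tens_diff_right pull_diff)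
  then have "vdist L (j2 (\<phi>, t)) (j2 (\<phi>, t')) = sqrt (Re (ip G \<phi> \<phi> * ip (interval_L2 \<epsilon>) ?d ?d))"
    by (simp add: vdist_def Let_def j2_ip[OF assms(1) d assms(1) d])
  also have "\<dots> = sqrt (Re (ip G \<phi> \<phi>)) * sqrt (Re (ip (interval_L2 \<epsilon>) ?d ?d))"
    by (subst G.ip_self_real[OF assms(1)], subst I.ip_self_real[OF d]) (simp add: real_sqrt_mult)
  finally show ?thesis by (simp add: vdist_def Let_def)
qed

lemma j2_ip_tendsto:
  assumes g: "g \<in> carr L" and \<phi>: "\<phi> \<in> carr G" "\<And>n. X n \<in> carr G" "(\<lambda>n. vdist G (X n) \<phi>) \<longlonglongrightarrow> 0"
    and t: "t \<in> carr (interval_L2 \<epsilon>)"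
  shows "(\<lambda>n. ip L (j2 (X n, t)) g) \<longlonglongrightarrow> ip L (j2 (\<phi>, t)) g"
proof (rule L.ip_tendsto_left)
  show "(\<lambda>n. vdist L (j2 (X n, t)) (j2 (\<phi>, t))) \<longlonglongrightarrow> 0"
    unfolding j2_vdist[OF \<phi>(2,1) t] using tendsto_mult_left_zero[OF \<phi>(3)] .
qed (use g \<phi> t j2_carr in auto)

lemma j2_ip_tendsto':
  assumes g: "g \<in> carr L" and \<phi>: "\<phi> \<in> carr G"
    and t: "t \<in> carr (interval_L2 \<epsilon>)" "\<And>n. X n \<in> carr (interval_L2 \<epsilon>)" "(\<lambda>n. vdist (interval_L2 \<epsilon>) (X n) t) \<longlonglongrightarrow> 0"
  shows "(\<lambda>n. ip L (j2 (\<phi>, X n)) g) \<longlonglongrightarrow> ip L (j2 (\<phi>, t)) g"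
proof (rule L.ip_tendsto_left)
  show "(\<lambda>n. vdist L (j2 (\<phi>, X n)) (j2 (\<phi>, t))) \<longlonglongrightarrow> 0"
    unfolding j2_vdist'[OF \<phi> t(2,1)] using tendsto_mult_right_zero[OF t(3)] .
qed (use g \<phi> t j2_carr in auto)

lemma ip_rhs_elem:
  assumes "\<phi> \<in> carr G" "\<phi>' \<in> carr G" "t \<in> carr (interval_L2 \<epsilon>)" "t' \<in> carr (interval_L2 \<epsilon>)" "g \<in> carr L"
  shows "ip L (J2 (rhs_elem \<phi> \<phi>' t t')) g = ip L (j2 (\<phi>', \<tau> t)) g + ip L (j2 (Gop \<phi>, t')) g"
  using L.ip_vadd_left[of "j2 (\<phi>', \<tau> t)" "j2 (Gop \<phi>, t')" g] assms Gop_carr(1) \<tau>_carr(1) j2_carr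
  by (simp add: J2_rhs_elem L2_vadd)

text \<open>Both sides are continuous in the graph norm of each tensor factor separately.\<close>

lemma rhs_closure:
  assumes X: "X \<in> carr L" "X' \<in> carr L"
    and cl: "\<And>\<phi> t. \<phi> \<in> smooth_sphere_sections F \<Longrightarrow> t \<in> Cc_inf {-\<epsilon><..<\<epsilon>} \<Longrightarrow>
      ip L (J2 (rhs_elem \<phi> (Dq \<phi>) t (T0 \<epsilon> t))) X = ip L (j2 (\<phi>, t)) X'"
    and \<phi>: "(\<phi>, \<phi>') \<in> op_on_sphere F Dq" and t: "(t, t') \<in> op_T \<epsilon>"
  shows "ip L (J2 (rhs_elem \<phi> \<phi>' t t')) X = ip L (j2 (\<phi>, t)) X'"
proof -
  note c = op_closureD(1,2)[OF \<phi>[unfolded op_on_sphere_def]]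
  obtain S S' where S0: "\<And>n. (S n, S' n) \<in> {(\<phi>, Dq \<phi>) | \<phi>. \<phi> \<in> smooth_sphere_sections F}"
    and l: "(\<lambda>n. vdist G (S n) \<phi>) \<longlonglongrightarrow> 0" "(\<lambda>n. vdist G (S' n) \<phi>') \<longlonglongrightarrow> 0"
    using op_closureD(3)[OF \<phi>[unfolded op_on_sphere_def]] by blast
  have S: "S n \<in> smooth_sphere_sections F" "S' n = Dq (S n)" for n using S0[of n] by auto
  have Sc: "S n \<in> carr G" "S' n \<in> carr G" for n using S smooth_sphere_carr Dq_carr by auto
  note d = op_closureD(1,2)[OF t[unfolded op_T_def]]
  obtain R R' where R0: "\<And>n. (R n, R' n) \<in> {(\<phi>, T0 \<epsilon> \<phi>) | \<phi>. \<phi> \<in> Cc_inf {-\<epsilon><..<\<epsilon>}}"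
    and k: "(\<lambda>n. vdist (interval_L2 \<epsilon>) (R n) t) \<longlonglongrightarrow> 0" "(\<lambda>n. vdist (interval_L2 \<epsilon>) (R' n) t') \<longlonglongrightarrow> 0"
    using op_closureD(3)[OF t[unfolded op_T_def]] by blast
  have R: "R n \<in> Cc_inf {-\<epsilon><..<\<epsilon>}" "R' n = T0 \<epsilon> (R n)" for n using R0[of n] by auto
  have Rc: "R n \<in> carr (interval_L2 \<epsilon>)" "R' n \<in> carr (interval_L2 \<epsilon>)" for n
    using R Cc_inf_carr T0_carr[OF eps(1)] by auto
  have Gl: "(\<lambda>n. vdist G (Gop (S n)) (Gop \<phi>)) \<longlonglongrightarrow> 0"
    by (rule tendsto_bounded_map[OF Gop_carr(2)[OF c(1)] G.semi_ip_axioms G.semi_ip_axioms Gop_carr(1) c(1) Sc(1) l(1)])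
  have \<tau>l: "(\<lambda>n. vdist (interval_L2 \<epsilon>) (\<tau> (R n)) (\<tau> t)) \<longlonglongrightarrow> 0"
    by (rule tendsto_bounded_map[OF \<tau>_carr(2)[OF d(1)] I.semi_ip_axioms I.semi_ip_axioms \<tau>_carr(1) d(1) Rc(1) k(1)])
  have 1: "ip L (J2 (rhs_elem \<phi> \<phi>' s (T0 \<epsilon> s))) X = ip L (j2 (\<phi>, s)) X'" if s: "s \<in> Cc_inf {-\<epsilon><..<\<epsilon>}" for s
  proof -
    note sc = Cc_inf_carr[OF s] T0_carr[OF eps(1) s]
    have "(\<lambda>n. ip L (j2 (S' n, \<tau> s)) X + ip L (j2 (Gop (S n), T0 \<epsilon> s)) X)
        \<longlonglongrightarrow> ip L (j2 (\<phi>', \<tau> s)) X + ip L (j2 (Gop \<phi>, T0 \<epsilon> s)) X"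
      by (intro tendsto_add j2_ip_tendsto[OF X(1) c(2) Sc(2) l(2) \<tau>_carr(1)[OF sc(1)]]
          j2_ip_tendsto[OF X(1) Gop_carr(1)[OF c(1)] Gop_carr(1)[OF Sc(1)] Gl sc(2)])
    moreover have "(\<lambda>n. ip L (j2 (S n, s)) X') \<longlonglongrightarrow> ip L (j2 (\<phi>, s)) X'"
      by (rule j2_ip_tendsto[OF X(2) c(1) Sc(1) l(1) sc(1)])
    moreover have "ip L (j2 (S' n, \<tau> s)) X + ip L (j2 (Gop (S n), T0 \<epsilon> s)) X = ip L (j2 (S n, s)) X'" for n
      using cl[OF S(1)[of n] s] ip_rhs_elem[OF Sc(1)[of n] Sc(2)[of n] sc X(1)] S(2)[of n] by simp
    ultimately show ?thesis
      unfolding ip_rhs_elem[OF c sc X(1)] using LIMSEQ_unique by simp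
  qed
  have "(\<lambda>n. ip L (j2 (\<phi>', \<tau> (R n))) X + ip L (j2 (Gop \<phi>, R' n)) X)
      \<longlonglongrightarrow> ip L (j2 (\<phi>', \<tau> t)) X + ip L (j2 (Gop \<phi>, t')) X"
    by (intro tendsto_add j2_ip_tendsto'[OF X(1) c(2) \<tau>_carr(1)[OF d(1)] \<tau>_carr(1)[OF Rc(1)] \<tau>l]
        j2_ip_tendsto'[OF X(1) Gop_carr(1)[OF c(1)] d(2) Rc(2) k(2)])
  moreover have "(\<lambda>n. ip L (j2 (\<phi>, R n)) X') \<longlonglongrightarrow> ip L (j2 (\<phi>, t)) X'"
    by (rule j2_ip_tendsto'[OF X(2) c(1) d(1) Rc(1) k(1)])
  moreover have "ip L (j2 (\<phi>', \<tau> (R n))) X + ip L (j2 (Gop \<phi>, R' n)) X = ip L (j2 (\<phi>, R n)) X'" for n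
    using 1[OF R(1)[of n]] ip_rhs_elem[OF c Rc(1)[of n] Rc(2)[of n] X(1)] R(2)[of n] by simp
  ultimately show ?thesis
    unfolding ip_rhs_elem[OF c d X(1)] using LIMSEQ_unique by simp
qed

end

text \<open>Where the cosine is nonzero, tan cos^2 equals sin cos. This extends continuously to the
  closed collar and vanishes at its ends because k \<epsilon> = \<pi>/2.\<close>

lemma C0_pot_bump: "0 < \<epsilon> \<Longrightarrow> (\<lambda>p. of_real (pot \<epsilon> (snd p)) *s (of_real (bump \<epsilon> (snd p)) *s v)) \<in> C0 (collar \<epsilon> :: ((real^'m) \<times> real) set)"
  for v :: "complex^2"
proof -
  assume e: "0 < \<epsilon>"
  define k where "k = pi / (2 * \<epsilon>)"
  have k: "k * \<epsilon> = pi / 2" using e by (simp add: k_def)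
  have "(\<lambda>p. (k * (sin (k * snd p) * cos (k * snd p))) *\<^sub>R v) \<in> C0 (collar \<epsilon> :: ((real^'m) \<times> real) set)"
    by (rule C0_collar_vanishing_boundary) (auto simp: k intro!: continuous_intros)
  note A = this
  have B: "(k * (sin (k * snd p) * cos (k * snd p))) *\<^sub>R v = of_real (pot \<epsilon> (snd p)) *s (of_real (bump \<epsilon> (snd p)) *s v)"
    if "p \<in> collar \<epsilon>" for p :: "(real^'m) \<times> real"
  proof -
    have "cos (k * snd p) > 0" using bump_cos_pos[OF e, of "snd p"] that by (auto simp: k_def collar_def)
    then have "k * (sin (k * snd p) * cos (k * snd p)) = pot \<epsilon> (snd p) * bump \<epsilon> (snd p)"
      unfolding pot_def bump_def Let_def k_def[symmetric] tan_def by (simp add: power2_eq_square)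
    then show ?thesis by (simp add: scaleR_as_scale)
  qed
  show ?thesis by (rule C0_cong[THEN iffD1, OF B A])
qed

lemma bump_has_derivative:
  "(bump \<epsilon> has_real_derivative
    - (2 * (pi / (2 * \<epsilon>))) * (cos (pi / (2 * \<epsilon>) * s) * sin (pi / (2 * \<epsilon>) * s))) (at s)"
proof -
  have "((\<lambda>s. (cos (k * s))\<^sup>2) has_real_derivative - (2 * k) * (cos (k * s) * sin (k * s))) (at s)" for k
    by (auto intro!: derivative_eq_intros)
  from this[of "pi / (2 * \<epsilon>)"] show ?thesis unfolding bump_def[abs_def] .
qed

text \<open>The section depends on s alone, so the angular derivatives vanish. The derivative in s
  is a multiple of sin cos, which is zero at both ends.\<close>

lemma C10_bump: "0 < \<epsilon> \<Longrightarrow> (\<lambda>p. of_real (bump \<epsilon> (snd p)) *s v) \<in> (C10 \<epsilon> :: ('m::finite) mod2 set)"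
  for v :: "complex^2"
proof -
  assume e: "0 < \<epsilon>"
  define k where "k = pi / (2 * \<epsilon>)"
  have k: "k * \<epsilon> = pi / 2" using e by (simp add: k_def)
  define \<xi> :: "'m mod2" where "\<xi> = (\<lambda>p. of_real (bump \<epsilon> (snd p)) *s v)"
  define b' where "b' s = - (2 * k) * (cos (k * s) * sin (k * s))" for s
  have bd: "(bump \<epsilon> has_derivative (\<lambda>h. b' s * h)) (at s)" for s
    using bump_has_derivative[of \<epsilon> s] unfolding has_field_derivative_def b'_def k_def .
  have "((\<lambda>p::(real^'m) \<times> real. bump \<epsilon> (snd p)) has_derivative (\<lambda>h. b' (snd p) * snd h)) (at p)" for p
    using diff_chain_at[OF bounded_linear_imp_has_derivative[OF bounded_linear_snd] bd] by (simp add: o_def)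
  then have "((\<lambda>p::(real^'m) \<times> real. bump \<epsilon> (snd p) *\<^sub>R v) has_derivative (\<lambda>h. (b' (snd p) * snd h) *\<^sub>R v)) (at p)" for p
    by (rule has_derivative_scaleR_left)
  note dv = this
  have d: "(\<lambda>(z, t). \<xi> (z /\<^sub>R norm z, t)) differentiable at p" for p
    using dv[of p] unfolding \<xi>_def scaleR_as_scale[symmetric] case_prod_unfold snd_conv by (rule differentiableI)
  have "((\<lambda>t. bump \<epsilon> t *\<^sub>R v) has_derivative (\<lambda>h. (b' s * h) *\<^sub>R v)) (at s)" for s
    by (rule has_derivative_scaleR_left[OF bd])
  then have "((\<lambda>t. bump \<epsilon> t *\<^sub>R v) has_vector_derivative b' s *\<^sub>R v) (at s)" for s
    by (simp add: has_vector_derivative_def mult.commute)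
  then have s: "s_deriv \<xi> = (\<lambda>p. b' (snd p) *\<^sub>R v)"
    by (auto simp: s_deriv_def \<xi>_def scaleR_as_scale[symmetric] vector_derivative_at fun_eq_iff)
  have "(\<lambda>p. b' (snd p) *\<^sub>R v) \<in> C0 (collar \<epsilon> :: ((real^'m) \<times> real) set)"
    by (rule C0_collar_vanishing_boundary) (auto simp: b'_def k intro!: continuous_intros)
  moreover have "ang_deriv j \<xi> = (\<lambda>p. 0)" for j
    by (auto simp: ang_deriv_def \<xi>_def hom_ext_def fun_eq_iff frechet_derivative_const)
  moreover have "(\<lambda>p. 0) \<in> C0 (collar \<epsilon> :: ((real^'m) \<times> real) set)" by (auto simp: C0_def)
  ultimately show ?thesis
    using C0_bump[OF e, of v, where 'm = 'm, folded \<xi>_def] d s unfolding C10_def \<xi>_def[symmetric]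
    by simp
qed

section \<open>The graphs of the two operators and their comparison\<close>

context collar_dirac begin

lemma bump_frame_dom: "bump_frame i \<in> dom_S \<epsilon> \<inter> C10 \<epsilon>"
  unfolding bump_frame_def dom_S_def Emod_def
  using C0_bump[OF eps(1), where 'm = 'm] C0_pot_bump[OF eps(1), where 'm = 'm] C10_bump[OF eps(1), where 'm = 'm]
  by simp

text \<open>Argument and value are kept in one pair, so that a single multiset of pairs describes an
  element of the graph of the span.\<close>

definition product_gen where
  "product_gen = {({#(\<xi>, \<psi>)#}, src_elem \<xi> \<psi> \<psi>') | \<xi> \<psi> \<psi>'. \<xi> \<in> dom_S \<epsilon> \<inter> C10 \<epsilon> \<and> (\<psi>, \<psi>') \<in> op_on_Rm D}"

definition index_gen where
  "index_gen = {({#(\<phi>, t)#}, rhs_elem \<phi> \<phi>' t t') | \<phi> \<phi>' t t'. (\<phi>, \<phi>') \<in> op_on_sphere F Dq \<and> (t, t') \<in> op_T \<epsilon>}"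

lemma product_op_gen: "product_op D A \<epsilon> = span_op product_gen"
  by (simp add: product_op_def product_gen_def src_elem_def)

lemma sphere_index_op_gen: "sphere_index_op (op_on_sphere F Dq) Gop \<epsilon> = span_op index_gen"
  by (simp add: sphere_index_op_def index_gen_def rhs_elem_def)

lemma product_gen_carr: "g \<in> product_gen \<Longrightarrow> fst g \<in> carr src \<and> snd g \<in> carr src"
proof -
  assume "g \<in> product_gen"
  then obtain \<xi> \<psi> \<psi>' where g: "g = ({#(\<xi>, \<psi>)#}, src_elem \<xi> \<psi> \<psi>')" "\<xi> \<in> dom_S \<epsilon> \<inter> C10 \<epsilon>" "(\<psi>, \<psi>') \<in> op_on_Rm D"
    unfolding product_gen_def by blast
  note c = op_closureD(1,2)[OF g(3)[unfolded op_on_Rm_def]]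
  show ?thesis
    using src_elem_carr[OF g(2) c] src_elem_coeffs(3)[OF g(2)] c by (simp add: g(1) pre_tensor_def)
qed

lemma index_gen_carr: "g \<in> index_gen \<Longrightarrow> fst g \<in> carr tgt \<and> snd g \<in> carr tgt"
proof -
  assume "g \<in> index_gen"
  then obtain \<phi> \<phi>' t t' where g: "g = ({#(\<phi>, t)#}, rhs_elem \<phi> \<phi>' t t')" "(\<phi>, \<phi>') \<in> op_on_sphere F Dq" "(t, t') \<in> op_T \<epsilon>"
    unfolding index_gen_def by blast
  note c = op_closureD(1,2)[OF g(2)[unfolded op_on_sphere_def]] op_closureD(1,2)[OF g(3)[unfolded op_T_def]]
  show ?thesis
    using rhs_elem_carr[OF c] c by (simp add: g(1) pre_tensor_def)
qed

lemma src_sum: "(\<And>g. g \<in># Q \<Longrightarrow> f g \<in> carr src) \<Longrightarrow> (\<Sum>g\<in>#Q. f g) \<in> carr src"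
  and tgt_sum: "(\<And>g. g \<in># Q' \<Longrightarrow> f' g \<in> carr tgt) \<Longrightarrow> (\<Sum>g\<in>#Q'. f' g) \<in> carr tgt"
proof -
  show "(\<And>g. g \<in># Q \<Longrightarrow> f g \<in> carr src) \<Longrightarrow> (\<Sum>g\<in>#Q. f g) \<in> carr src"
    by (induction Q) (auto simp: pre_tensor_def)
  show "(\<And>g. g \<in># Q' \<Longrightarrow> f' g \<in> carr tgt) \<Longrightarrow> (\<Sum>g\<in>#Q'. f' g) \<in> carr tgt"
    by (induction Q') (auto simp: pre_tensor_def)
qed

lemma J1_sum: "J1 (\<Sum>g\<in>#Q. f g) = (\<lambda>p. \<Sum>g\<in>#Q. J1 (f g) p)"
  and J2_sum: "J2 (\<Sum>g\<in>#Q'. f' g) = (\<lambda>p. \<Sum>g\<in>#Q'. J2 (f' g) p)"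
proof -
  show "J1 (\<Sum>g\<in>#Q. f g) = (\<lambda>p. \<Sum>g\<in>#Q. J1 (f g) p)"
    by (induction Q) (auto simp: J1_def[abs_def] fun_eq_iff)
  show "J2 (\<Sum>g\<in>#Q'. f' g) = (\<lambda>p. \<Sum>g\<in>#Q'. J2 (f' g) p)"
    by (induction Q') (auto simp: J2_def[abs_def] fun_eq_iff)
qed

lemma ip_double_sum:
  assumes "\<And>g. g \<in># Q \<Longrightarrow> \<beta> g \<in> carr L" "\<And>h. h \<in># R \<Longrightarrow> \<gamma> h \<in> carr L"
  shows "ip L (\<lambda>p. \<Sum>g\<in>#Q. \<beta> g p) (\<lambda>p. \<Sum>h\<in>#R. \<gamma> h p) = (\<Sum>g\<in>#Q. \<Sum>h\<in>#R. ip L (\<beta> g) (\<gamma> h))"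
proof -
  have Qc: "(\<lambda>p. \<Sum>g\<in>#Q. \<beta> g p) \<in> carr L" by (rule L2_sum_mset(1)) (use assms in auto)
  have *: "ip L (\<lambda>p. \<Sum>g\<in>#Q. \<beta> g p) \<eta> = (\<Sum>g\<in>#Q. ip L (\<beta> g) \<eta>)" if \<eta>: "\<eta> \<in> carr L" for \<eta>
  proof -
    have "ip L (\<lambda>p. \<Sum>g\<in>#Q. \<beta> g p) \<eta> = cnj (ip L \<eta> (\<lambda>p. \<Sum>g\<in>#Q. \<beta> g p))"
      by (rule L.ip_cnj[OF \<eta> Qc])
    also have "\<dots> = cnj (\<Sum>g\<in>#Q. ip L \<eta> (\<beta> g))"
      using L2_sum_mset(2)[of Q \<beta> N \<eta>] assms(1) \<eta> by simp
    also have "\<dots> = (\<Sum>g\<in>#Q. cnj (ip L \<eta> (\<beta> g)))" by (induction Q) auto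
    also have "\<dots> = (\<Sum>g\<in>#Q. ip L (\<beta> g) \<eta>)"
      using L.ip_cnj[OF \<eta>] assms(1) by (intro arg_cong[where f = sum_mset] image_mset_cong) simp
    finally show ?thesis .
  qed
  have "ip L (\<lambda>p. \<Sum>g\<in>#Q. \<beta> g p) (\<lambda>p. \<Sum>h\<in>#R. \<gamma> h p) = (\<Sum>h\<in>#R. ip L (\<lambda>p. \<Sum>g\<in>#Q. \<beta> g p) (\<gamma> h))"
    by (rule L2_sum_mset(2)[OF _ Qc]) (use assms in auto)
  also have "\<dots> = (\<Sum>h\<in>#R. \<Sum>g\<in>#Q. ip L (\<beta> g) (\<gamma> h))"
    using * assms(2) by (intro arg_cong[where f = sum_mset] image_mset_cong) simp
  also have "\<dots> = (\<Sum>g\<in>#Q. \<Sum>h\<in>#R. ip L (\<beta> g) (\<gamma> h))" by (rule sum_mset.swap)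
  finally show ?thesis .
qed

text \<open>\<open>symmetric_src\<close> is the case of a test tensor on the left, and
  \<open>rhs_closure\<close> extends it to the closed domains of the sphere operator and of
  T.\<close>

lemma symmetric_src_closure:
  assumes g: "g \<in> index_gen" and h: "h \<in> product_gen"
  shows "ip L (J2 (snd g)) (J1 (fst h)) = ip L (J2 (fst g)) (J1 (snd h))"
proof -
  obtain \<phi> \<phi>' t t' where g': "g = ({#(\<phi>, t)#}, rhs_elem \<phi> \<phi>' t t')" "(\<phi>, \<phi>') \<in> op_on_sphere F Dq" "(t, t') \<in> op_T \<epsilon>"
    using g by (auto simp: index_gen_def)
  obtain \<xi> \<psi> \<psi>' where h': "h = ({#(\<xi>, \<psi>)#}, src_elem \<xi> \<psi> \<psi>')" "\<xi> \<in> dom_S \<epsilon> \<inter> C10 \<epsilon>" "(\<psi>, \<psi>') \<in> op_on_Rm D"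
    using h unfolding product_gen_def by blast
  have "ip L (J2 (rhs_elem \<phi> \<phi>' t t')) (j1 (\<xi>, \<psi>)) = ip L (j2 (\<phi>, t)) (J1 (src_elem \<xi> \<psi> \<psi>'))"
    by (rule rhs_closure[OF _ _ _ g'(2,3)])
      (use J1_carr product_gen_carr[OF h] h' symmetric_src[OF _ _ h'(2,3)] in \<open>auto simp: J_singleton[symmetric]\<close>)
  then show ?thesis by (simp add: g' h' J_singleton)
qed

definition test_pairs where
  "test_pairs = smooth_sphere_sections F \<times> Cc_inf {-\<epsilon><..<\<epsilon>}"

definition test_rhs where
  "test_rhs = (\<lambda>(\<phi>, t). rhs_elem \<phi> (Dq \<phi>) t (T0 \<epsilon> t))"

lemma op_on_sphere_test: "\<phi> \<in> smooth_sphere_sections F \<Longrightarrow> (\<phi>, Dq \<phi>) \<in> op_on_sphere F Dq"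
  unfolding op_on_sphere_def
  by (rule op_closureI) (use G.semi_ip_axioms smooth_sphere_carr Dq_carr in auto)

lemma op_T_test: "t \<in> Cc_inf {-\<epsilon><..<\<epsilon>} \<Longrightarrow> (t, T0 \<epsilon> t) \<in> op_T \<epsilon>"
  unfolding op_T_def
  by (rule op_closureI) (use I.semi_ip_axioms Cc_inf_carr T0_carr[OF eps(1)] in auto)

lemma test_index_gen: "x \<in> test_pairs \<Longrightarrow> ({#x#}, test_rhs x) \<in> index_gen"
proof -
  assume "x \<in> test_pairs"
  then obtain \<phi> t where x: "x = (\<phi>, t)" "\<phi> \<in> smooth_sphere_sections F" "t \<in> Cc_inf {-\<epsilon><..<\<epsilon>}"
    by (auto simp: test_pairs_def)
  show ?thesis
    unfolding index_gen_def x(1) test_rhs_def prod.case using op_on_sphere_test[OF x(2)] op_T_test[OF x(3)] by blast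
qed

text \<open>A test tensor is the sum of the elementary tensors \<open>cos\<^sup>2 e\<^sub>i \<otimes> \<psi>\<^sub>i\<close>; the factor \<open>cos\<^sup>2\<close> is
  in the domain of the potential and is compensated in \<open>\<psi>\<^sub>i\<close>.\<close>

lemma test_represented:
  assumes \<phi>: "\<phi> \<in> smooth_sphere_sections F" and t: "t \<in> Cc_inf {-\<epsilon><..<\<epsilon>}"
  shows "\<exists>Q. set_mset Q \<subseteq> product_gen \<and> (\<forall>p\<in>space N. J1 (\<Sum>g\<in>#Q. fst g) p = j2 (\<phi>, t) p \<and>
    J1 (\<Sum>g\<in>#Q. snd g) p = J2 (rhs_elem \<phi> (Dq \<phi>) t (T0 \<epsilon> t)) p)"
proof -
  define t2 where "t2 s = inverse (bump \<epsilon> s) *\<^sub>R t s" for s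
  define \<psi> where "\<psi> i y = pr i *v j2 (\<phi>, t2) (polar y)" for i y
  have t2: "t2 \<in> Cc_inf {-\<epsilon><..<\<epsilon>}" unfolding t2_def[abs_def] by (rule bump_inverse_Cc_inf[OF eps(1) t])
  obtain K where K: "compact K" "K \<subseteq> shell \<epsilon>" "\<And>y. y \<notin> K \<Longrightarrow> j2 (\<phi>, t2) (polar y) = 0"
    "smooth_on (shell \<epsilon>) (\<lambda>y. j2 (\<phi>, t2) (polar y))" using test_section[OF \<phi> t2] by blast
  have \<psi>: "\<psi> i \<in> Cc_inf UNIV" for i
  proof (rule Cc_inf_extend[OF open_shell _ K(1,2)])
    show "smooth_on (shell \<epsilon>) (\<psi> i)"
      unfolding \<psi>_def[abs_def]
      by (rule smooth_on_bounded_linear_compose[OF open_shell bounded_bilinear.bounded_linear_right[OF bounded_bilinear_mv] K(4)])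
    show "\<psi> i y = 0" if "y \<notin> K" for y using K(3)[OF that] by (simp add: \<psi>_def)
  qed
  have \<psi>op: "(\<psi> i, D (\<psi> i)) \<in> op_on_Rm D" for i
    unfolding op_on_Rm_def by (rule op_closureI) (use H.semi_ip_axioms \<psi> Cc_inf_H in auto)
  have sum: "(\<Sum>i\<in>UNIV. m (bump_frame i p) (\<psi> i y)) = of_real (bump \<epsilon> (snd p)) *s j2 (\<phi>, t2) (polar y)" for p y
    using m_bump_frame_sum[of p 1 "j2 (\<phi>, t2) (polar y)"] by (simp add: \<psi>_def)
  have t2': "of_real (bump \<epsilon> (snd p)) *s j2 (\<phi>, t2) p = j2 (\<phi>, t) p" if "p \<in> collar \<epsilon>" for p
  proof -
    have "bump \<epsilon> (snd p) > 0" by (rule bump_pos[OF eps(1)]) (use that in \<open>auto simp: collar_def\<close>)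
    then show ?thesis
      by (simp add: j2_def t2_def scaleR_as_scale tens_scale_right pull_scale)
  qed
  define Q where "Q = image_mset (\<lambda>i. ({#(bump_frame i, \<psi> i)#}, src_elem (bump_frame i) (\<psi> i) (D (\<psi> i)))) (mset_set UNIV)"
  have Q: "set_mset Q \<subseteq> product_gen" unfolding Q_def product_gen_def using bump_frame_dom \<psi>op by auto blast
  have "J1 (\<Sum>g\<in>#Q. fst g) p = j2 (\<phi>, t) p \<and>
    J1 (\<Sum>g\<in>#Q. snd g) p = J2 (rhs_elem \<phi> (Dq \<phi>) t (T0 \<epsilon> t)) p" if pN: "p \<in> space N" for p
  proof
    have p: "p \<in> collar \<epsilon>" using pN by (simp add: space_collar_measure)
    define y where "y = immersion p"
    have y: "y \<in> shell \<epsilon>" "polar y = p"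
      using immersion_shell[OF eps(2) p] polar_immersion[OF eps(2) p] by (simp_all add: y_def)
    have "J1 (\<Sum>g\<in>#Q. fst g) p = (\<Sum>i\<in>UNIV. m (bump_frame i p) (\<psi> i y))"
      unfolding J1_sum by (simp add: Q_def image_mset.compositionality o_def J_singleton j1_def y_def sum_unfold_sum_mset)
    then show "J1 (\<Sum>g\<in>#Q. fst g) p = j2 (\<phi>, t) p" using sum[of p y] y(2) t2'[OF p] by simp
    have frame_C10: "bump_frame i \<in> C10 \<epsilon>" for i using bump_frame_dom by blast
    have "J1 (\<Sum>g\<in>#Q. snd g) p = (\<Sum>i\<in>UNIV. J1 (src_elem (bump_frame i) (\<psi> i) (D (\<psi> i))) p)"
      unfolding J1_sum by (simp add: Q_def image_mset.compositionality o_def sum_unfold_sum_mset)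
    also have "\<dots> = (\<Sum>i\<in>UNIV. flat (\<lambda>y. m (bump_frame i (polar y)) (\<psi> i y)) y)"
      using src_elem_classical[OF frame_C10 \<psi> p] by (simp add: y_def)
    also have "\<dots> = flat (\<lambda>y. \<Sum>i\<in>UNIV. m (bump_frame i (polar y)) (\<psi> i y)) y"
      by (rule flat_op_sum[symmetric]) (use section_product(1)[OF frame_C10 \<psi> y(1)] differentiable_def in blast, simp)
    \<comment> \<open>The cutoff cancels its inverse on the whole shell; this is an open set, so the
      derivatives agree as well as the values.\<close>
    also have "\<dots> = flat (\<lambda>y. j2 (\<phi>, t) (polar y)) y"
    proof (rule flat_op_cong[OF open_shell y(1)])
      fix z :: "real^'m" assume "z \<in> shell \<epsilon>"
      then show "(\<Sum>i\<in>UNIV. m (bump_frame i (polar z)) (\<psi> i z)) = j2 (\<phi>, t) (polar z)"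
        using sum[of "polar z" z] t2'[OF polar_collar[OF eps(2)]] by simp
    qed
    also have "\<dots> = J2 (rhs_elem \<phi> (Dq \<phi>) t (T0 \<epsilon> t)) p"
      using rhs_test[OF \<phi> t p] by (simp add: y_def)
    finally show "J1 (\<Sum>g\<in>#Q. snd g) p = J2 (rhs_elem \<phi> (Dq \<phi>) t (T0 \<epsilon> t)) p" .
  qed
  then show ?thesis using Q by blast
qed

lemma test_sum_represented:
  assumes "set_mset M \<subseteq> test_pairs"
  shows "\<exists>Q. set_mset Q \<subseteq> product_gen \<and> (\<forall>p\<in>space N. J1 (\<Sum>g\<in>#Q. fst g) p = J2 M p \<and>
    J1 (\<Sum>g\<in>#Q. snd g) p = J2 (\<Sum>x\<in>#M. test_rhs x) p)"
  using assms
proof (induction M)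
  case empty
  then show ?case by (intro exI[of _ "{#}"]) (simp add: J1_def J2_def)
next
  case (add x M)
  then obtain Q where Q: "set_mset Q \<subseteq> product_gen" "\<And>p. p \<in> space N \<Longrightarrow> J1 (\<Sum>g\<in>#Q. fst g) p = J2 M p"
    "\<And>p. p \<in> space N \<Longrightarrow> J1 (\<Sum>g\<in>#Q. snd g) p = J2 (\<Sum>x\<in>#M. test_rhs x) p" by auto
  obtain \<phi> t where x: "x = (\<phi>, t)" "\<phi> \<in> smooth_sphere_sections F" "t \<in> Cc_inf {-\<epsilon><..<\<epsilon>}"
    using add.prems by (cases x) (auto simp: test_pairs_def)
  obtain Q' where Q': "set_mset Q' \<subseteq> product_gen" "\<And>p. p \<in> space N \<Longrightarrow> J1 (\<Sum>g\<in>#Q'. fst g) p = j2 x p"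
    "\<And>p. p \<in> space N \<Longrightarrow> J1 (\<Sum>g\<in>#Q'. snd g) p = J2 (test_rhs x) p"
    using test_represented[OF x(2,3)] by (auto simp: x(1) test_rhs_def)
  have "J1 (U + V) p = J1 U p + J1 V p" "J2 (U' + V') p = J2 U' p + J2 V' p" for U V U' V' p
    by (simp_all add: J1_def J2_def)
  then show ?case
    using Q Q' by (intro exI[of _ "Q' + Q"]) (auto simp: J2_def[of "add_mset x M"] J2_def[of M, symmetric])
qed

text \<open>A test tensor and its value agree on the collar with an element of the graph of the
  product operator. Pairing the right-hand operator with a test tensor is therefore an instance of
  \<open>symmetric_src_closure\<close>, and no new integration by parts occurs.\<close>

lemma symmetric_test_rhs:
  assumes x: "x \<in> test_pairs" and g: "g \<in> index_gen"
  shows "ip L (J2 (snd g)) (j2 x) = ip L (J2 (fst g)) (J2 (test_rhs x))"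
proof -
  obtain \<phi> t where x': "x = (\<phi>, t)" "\<phi> \<in> smooth_sphere_sections F" "t \<in> Cc_inf {-\<epsilon><..<\<epsilon>}"
    using x by (cases x) (auto simp: test_pairs_def)
  obtain Q where Q: "set_mset Q \<subseteq> product_gen" "\<And>p. p \<in> space N \<Longrightarrow> J1 (\<Sum>g\<in>#Q. fst g) p = j2 x p"
    "\<And>p. p \<in> space N \<Longrightarrow> J1 (\<Sum>g\<in>#Q. snd g) p = J2 (test_rhs x) p"
    using test_represented[OF x'(2,3)] by (auto simp: x'(1) test_rhs_def)
  have gc: "J2 (fst g) \<in> carr L" "J2 (snd g) \<in> carr L" using index_gen_carr[OF g] J2_carr by auto
  have Qc: "J1 (fst h) \<in> carr L" "J1 (snd h) \<in> carr L" if "h \<in># Q" for h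
    using product_gen_carr[of h] that Q(1) J1_carr by auto
  have "ip L (J2 (snd g)) (j2 x) = ip L (J2 (snd g)) (J1 (\<Sum>g\<in>#Q. fst g))" by (rule ip_cong) (simp_all add: Q)
  also have "\<dots> = (\<Sum>h\<in>#Q. ip L (J2 (snd g)) (J1 (fst h)))"
    unfolding J1_sum by (rule L2_sum_mset(2)[OF Qc(1) gc(2)])
  also have "\<dots> = (\<Sum>h\<in>#Q. ip L (J2 (fst g)) (J1 (snd h)))"
    using symmetric_src_closure[OF g] Q(1) by (intro arg_cong[where f = sum_mset] image_mset_cong) auto
  also have "\<dots> = ip L (J2 (fst g)) (J1 (\<Sum>g\<in>#Q. snd g))"
    unfolding J1_sum by (rule L2_sum_mset(2)[OF Qc(2) gc(1), symmetric])
  also have "\<dots> = ip L (J2 (fst g)) (J2 (test_rhs x))" by (rule ip_cong) (simp_all add: Q)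
  finally show ?thesis .
qed

text \<open>A second use of \<open>rhs_closure\<close>: the fixed pair is now g, and it is h that is
  approximated by test tensors. The required test case is \<open>symmetric_test_rhs\<close>, with
  the two arguments exchanged by complex conjugation.\<close>

lemma symmetric_rhs_closure:
  assumes g: "g \<in> index_gen" and h: "h \<in> index_gen"
  shows "ip L (J2 (snd g)) (J2 (fst h)) = ip L (J2 (fst g)) (J2 (snd h))"
proof -
  have gc: "J2 (fst g) \<in> carr L" "J2 (snd g) \<in> carr L" and hc: "J2 (fst h) \<in> carr L" "J2 (snd h) \<in> carr L"
    using index_gen_carr[OF g] index_gen_carr[OF h] J2_carr by auto
  obtain \<phi> \<phi>' t t' where h': "h = ({#(\<phi>, t)#}, rhs_elem \<phi> \<phi>' t t')" "(\<phi>, \<phi>') \<in> op_on_sphere F Dq" "(t, t') \<in> op_T \<epsilon>"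
    using h by (auto simp: index_gen_def)
  have "ip L (J2 (rhs_elem \<phi> \<phi>' t t')) (J2 (fst g)) = ip L (j2 (\<phi>, t)) (J2 (snd g))"
  proof (rule rhs_closure[OF gc _ h'(2,3)])
    fix \<phi> :: "real^'m \<Rightarrow> complex^'q" and t :: "real \<Rightarrow> complex^2"
    assume \<phi>: "\<phi> \<in> smooth_sphere_sections F" and t: "t \<in> Cc_inf {-\<epsilon><..<\<epsilon>}"
    then have x: "(\<phi>, t) \<in> test_pairs" by (simp add: test_pairs_def)
    have c: "j2 (\<phi>, t) \<in> carr L" "J2 (test_rhs (\<phi>, t)) \<in> carr L"
      using index_gen_carr[OF test_index_gen[OF x]] J2_carr[of "{#(\<phi>, t)#}"] J2_carr[of "test_rhs (\<phi>, t)"] by (auto simp: J_singleton)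
    have "ip L (J2 (test_rhs (\<phi>, t))) (J2 (fst g)) = cnj (ip L (J2 (fst g)) (J2 (test_rhs (\<phi>, t))))"
      by (rule L.ip_cnj[OF gc(1) c(2)])
    also have "\<dots> = cnj (ip L (J2 (snd g)) (j2 (\<phi>, t)))" by (simp only: symmetric_test_rhs[OF x g])
    also have "\<dots> = ip L (j2 (\<phi>, t)) (J2 (snd g))" by (rule L.ip_cnj[OF gc(2) c(1), symmetric])
    finally show "ip L (J2 (rhs_elem \<phi> (Dq \<phi>) t (T0 \<epsilon> t))) (J2 (fst g)) = ip L (j2 (\<phi>, t)) (J2 (snd g))"
      by (simp add: test_rhs_def)
  qed
  then have "ip L (J2 (snd h)) (J2 (fst g)) = ip L (J2 (fst h)) (J2 (snd g))"
    by (simp add: h' J_singleton)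
  then show ?thesis using L.ip_cnj[OF hc(2) gc(1)] L.ip_cnj[OF hc(1) gc(2)] by simp
qed

text \<open>For agreement on a test tensor the witnesses are its representation from
  \<open>test_sum_represented\<close> and the tensor itself, and \<open>veq\<close> holds because
  the images in L coincide on the collar. For the adjoint condition both graphs consist of sums of
  generating pairs, so sesquilinearity reduces it to \<open>symmetric_src_closure\<close> and
  \<open>symmetric_rhs_closure\<close>.\<close>

theorem collar_product:
  "\<exists>U. unitary_iso (interior_tensor (Emod \<epsilon>) inn act H) (hilbert_tensor G (interval_L2 \<epsilon>)) U \<and>
    same_differential_expression (hilbert_tensor G (interval_L2 \<epsilon>)) (test_tensors F \<epsilon>)
      (transport U (product_op D A \<epsilon>)) (sphere_index_op (op_on_sphere F Dq) Gop \<epsilon>)"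
proof -
  let ?T = "hilbert_tensor G (interval_L2 \<epsilon>)"
  obtain U where U: "unitary_iso (interior_tensor (Emod \<epsilon>) inn act H) ?T U"
    "\<And>x y. x \<in> carr src \<Longrightarrow> y \<in> carr tgt \<Longrightarrow> ip ?T (fin_tensor y) (U (fin_tensor x)) = ip L (J2 y) (J1 x)"
    "\<And>x y. x \<in> carr src \<Longrightarrow> y \<in> carr tgt \<Longrightarrow> (\<And>p. p \<in> space N \<Longrightarrow> J1 x p = J2 y p) \<Longrightarrow>
      veq ?T (U (fin_tensor x)) (fin_tensor y)"
    using unitary by blast
  have sA: "(\<Sum>g\<in>#Q. fst g) \<in> carr src" "(\<Sum>g\<in>#Q. snd g) \<in> carr src" if "set_mset Q \<subseteq> product_gen" for Q
    by (rule src_sum, use that product_gen_carr in blast)+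
  have sB: "(\<Sum>g\<in>#Q. fst g) \<in> carr tgt" "(\<Sum>g\<in>#Q. snd g) \<in> carr tgt" if "set_mset Q \<subseteq> index_gen" for Q
    by (rule tgt_sum, use that index_gen_carr in blast)+
  have "same_differential_expression ?T (test_tensors F \<epsilon>) (transport U (span_op product_gen)) (span_op index_gen)"
    unfolding same_differential_expression_def
  proof (intro conjI ballI)
    fix u assume "u \<in> (test_tensors F \<epsilon> :: (nat \<Rightarrow> ((real^'m \<Rightarrow> complex^'q) \<times> (real \<Rightarrow> complex^2)) multiset) set)"
    then obtain M where M: "u = fin_tensor M" "set_mset M \<subseteq> test_pairs"
      by (auto simp: test_tensors_def test_pairs_def)
    obtain Q where Q: "set_mset Q \<subseteq> product_gen" "\<And>p. p \<in> space N \<Longrightarrow> J1 (\<Sum>g\<in>#Q. fst g) p = J2 M p"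
      "\<And>p. p \<in> space N \<Longrightarrow> J1 (\<Sum>g\<in>#Q. snd g) p = J2 (\<Sum>x\<in>#M. test_rhs x) p"
      using test_sum_represented[OF M(2)] by blast
    define R where "R = image_mset (\<lambda>x. ({#x#}, test_rhs x)) M"
    have R: "set_mset R \<subseteq> index_gen" using M(2) test_index_gen by (auto simp: R_def)
    have Rs: "(\<Sum>g\<in>#R. fst g) = M" "(\<Sum>g\<in>#R. snd g) = (\<Sum>x\<in>#M. test_rhs x)"
      by (simp_all add: R_def image_mset.compositionality o_def)
    have "(fin_tensor (\<Sum>g\<in>#R. fst g), fin_tensor (\<Sum>g\<in>#R. snd g)) \<in> span_op index_gen"
      unfolding span_op_def by (rule CollectI, rule exI[of _ R]) (simp add: R)
    then have SB: "(fin_tensor M, fin_tensor (\<Sum>x\<in>#M. test_rhs x)) \<in> span_op index_gen"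
      unfolding Rs .
    have "(U (fin_tensor (\<Sum>g\<in>#Q. fst g)), U (fin_tensor (\<Sum>g\<in>#Q. snd g))) \<in> transport U (span_op product_gen)"
      unfolding transport_def span_op_def using Q(1) by force
    moreover have "veq ?T (U (fin_tensor (\<Sum>g\<in>#Q. fst g))) u"
      unfolding M(1) using U(3)[OF sA(1)[OF Q(1)] sB(1)[OF R]] Rs Q(2) by simp
    moreover have "veq ?T (fin_tensor M) u"
      unfolding M(1) using fin_tensor_veq[OF sB(1)[OF R]] Rs by simp
    moreover have "veq ?T (U (fin_tensor (\<Sum>g\<in>#Q. snd g))) (fin_tensor (\<Sum>x\<in>#M. test_rhs x))"
      using U(3)[OF sA(2)[OF Q(1)] sB(2)[OF R]] Rs Q(3) by simp
    moreover note SB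
    ultimately show "\<exists>(x, x')\<in>transport U (span_op product_gen). \<exists>(y, y')\<in>span_op index_gen.
        veq ?T x u \<and> veq ?T y u \<and> veq ?T x' y'"
      by - (rule bexI[of _ "(U (fin_tensor (\<Sum>g\<in>#Q. fst g)), U (fin_tensor (\<Sum>g\<in>#Q. snd g)))"],
        simp only: prod.case, rule bexI[of _ "(fin_tensor M, fin_tensor (\<Sum>x\<in>#M. test_rhs x))"], simp_all)
  next
    fix z assume z: "z \<in> transport U (span_op product_gen) \<union> span_op index_gen"
    show "case z of (x, x') \<Rightarrow> \<forall>(u, u')\<in>span_op index_gen. u \<in> test_tensors F \<epsilon> \<longrightarrow> ip ?T u' x = ip ?T u x'"
    proof (clarify)
      fix x x' u u' assume zx: "z = (x, x')" and "(u, u') \<in> span_op index_gen"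
      then obtain R where R: "set_mset R \<subseteq> index_gen" "u = fin_tensor (\<Sum>g\<in>#R. fst g)" "u' = fin_tensor (\<Sum>g\<in>#R. snd g)"
        by (auto simp: span_op_def)
      have Rc: "J2 (fst g) \<in> carr L" "J2 (snd g) \<in> carr L" if "g \<in># R" for g
        using index_gen_carr[of g] that R(1) J2_carr by auto
      from z zx consider (A) "(x, x') \<in> transport U (span_op product_gen)" | (B) "(x, x') \<in> span_op index_gen" by blast
      then show "ip ?T u' x = ip ?T u x'"
      proof cases
        case A
        then obtain Q where Q: "set_mset Q \<subseteq> product_gen" "x = U (fin_tensor (\<Sum>g\<in>#Q. fst g))" "x' = U (fin_tensor (\<Sum>g\<in>#Q. snd g))"
          by (auto simp: transport_def span_op_def)
        have Qc: "J1 (fst g) \<in> carr L" "J1 (snd g) \<in> carr L" if "g \<in># Q" for g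
          using product_gen_carr[of g] that Q(1) J1_carr by auto
        have "ip ?T u' x = (\<Sum>g\<in>#R. \<Sum>h\<in>#Q. ip L (J2 (snd g)) (J1 (fst h)))"
          unfolding R Q U(2)[OF sA(1)[OF Q(1)] sB(2)[OF R(1)]] J1_sum J2_sum by (rule ip_double_sum) (use Rc Qc in auto)
        also have "\<dots> = (\<Sum>g\<in>#R. \<Sum>h\<in>#Q. ip L (J2 (fst g)) (J1 (snd h)))"
          by (intro arg_cong[where f = sum_mset] image_mset_cong symmetric_src_closure) (use R(1) Q(1) in auto)
        also have "\<dots> = ip ?T u x'"
          unfolding R Q U(2)[OF sA(2)[OF Q(1)] sB(1)[OF R(1)]] J1_sum J2_sum
          by (rule ip_double_sum[symmetric]) (use Rc Qc in auto)
        finally show ?thesis .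
      next
        case B
        then obtain Q where Q: "set_mset Q \<subseteq> index_gen" "x = fin_tensor (\<Sum>g\<in>#Q. fst g)" "x' = fin_tensor (\<Sum>g\<in>#Q. snd g)"
          by (auto simp: span_op_def)
        have Qc: "J2 (fst g) \<in> carr L" "J2 (snd g) \<in> carr L" if "g \<in># Q" for g
          using index_gen_carr[of g] that Q(1) J2_carr by auto
        have "ip ?T u' x = (\<Sum>g\<in>#R. \<Sum>h\<in>#Q. ip L (J2 (snd g)) (J2 (fst h)))"
          unfolding R Q fin_tensor_ip[OF sB(2)[OF R(1)] sB(1)[OF Q(1)]] J2_sum by (rule ip_double_sum) (use Rc Qc in auto)
        also have "\<dots> = (\<Sum>g\<in>#R. \<Sum>h\<in>#Q. ip L (J2 (fst g)) (J2 (snd h)))"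
          by (intro arg_cong[where f = sum_mset] image_mset_cong symmetric_rhs_closure) (use R(1) Q(1) in auto)
        also have "\<dots> = ip ?T u x'"
          unfolding R Q fin_tensor_ip[OF sB(1)[OF R(1)] sB(2)[OF Q(1)]] J2_sum
          by (rule ip_double_sum[symmetric]) (use Rc Qc in auto)
        finally show ?thesis .
      qed
    qed
  qed
  then show ?thesis using U(1) unfolding product_op_gen sphere_index_op_gen by blast
qed

end

section \<open>Clifford multiplication and blocks of spinors\<close>

lemma clifford_square: "clifford_mult c \<Longrightarrow> c v *v (c v *v u) = (norm v)\<^sup>2 *\<^sub>R u"
proof -
  assume c: "clifford_mult c"
  have "c v *v (c v *v u) = mat (of_real ((norm v)\<^sup>2)) *v u"
    using c by (simp add: clifford_mult_def matrix_vector_mul_assoc)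
  also have "\<dots> = (norm v)\<^sup>2 *\<^sub>R u"
    by (simp add: vec_eq_iff matrix_vector_mult_def mat_def if_distrib[of "\<lambda>a. a * _"]
        scaleR_conv_of_real[where 'a=complex] cong: if_cong)
  finally show ?thesis .
qed

text \<open>Polarisation of the Clifford relation: for orthogonal vectors the mixed terms in the
  square of c(v + u) must cancel.\<close>

lemma clifford_anticommute:
  assumes c: "clifford_mult c" and vu: "v \<bullet> u = 0"
  shows "c v *v (c u *v z) = - (c u *v (c v *v z))"
proof -
  have "c (v + u) *v (c (v + u) *v z) = (norm (v + u))\<^sup>2 *\<^sub>R z" by (rule clifford_square[OF c])
  moreover have "c (v + u) = c v + c u" using c by (simp add: clifford_mult_def linear_add)
  moreover have "(norm (v + u))\<^sup>2 = (norm v)\<^sup>2 + (norm u)\<^sup>2"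
    using vu by (simp add: power2_norm_eq_inner inner_add inner_commute)
  ultimately have "c v *v (c u *v z) + c u *v (c v *v z) = 0"
    using clifford_square[OF c, of v z] clifford_square[OF c, of u z]
    by (simp add: matrix_vector_mult_add_rdistrib matrix_vector_right_distrib scaleR_add_left algebra_simps)
  then show ?thesis by (simp add: eq_neg_iff_add_eq_0)
qed

lemma hermitian_cip: "hermitian A \<Longrightarrow> cip (A *v u) w = cip u (A *v w)"
proof -
  assume h: "hermitian A"
  have "cip (A *v u) w = (\<Sum>i\<in>UNIV. \<Sum>j\<in>UNIV. cnj (A $ i $ j) * cnj (u $ j) * w $ i)"
    by (simp add: cip_def matrix_vector_mult_def sum_distrib_right)
  also have "\<dots> = (\<Sum>j\<in>UNIV. \<Sum>i\<in>UNIV. cnj (A $ i $ j) * cnj (u $ j) * w $ i)" by (rule sum.swap)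
  also have "\<dots> = cip u (A *v w)"
  proof -
    have "cnj (A $ i $ j) = A $ j $ i" for i j using h by (metis hermitian_def complex_cnj_cnj)
    then show ?thesis by (simp add: cip_def matrix_vector_mult_def sum_distrib_left mult_ac)
  qed
  finally show ?thesis .
qed

lemma hermitian_clifford: "clifford_mult c \<Longrightarrow> cip (c v *v u) w = cip u (c v *v w)"
  by (rule hermitian_cip) (simp add: clifford_mult_def)

text \<open>Reads off the component for a basis vector of the C^2 factor, which is the second factor
  as in \<open>kron\<close>; identities between spinors with this multiplicity are checked on the
  two components.\<close>

definition column :: "2 \<Rightarrow> complex^('a::finite \<times> 2) \<Rightarrow> complex^'a" where
  "column a Z = (\<chi> s. Z $ (s, a))"

definition block :: "complex^'a \<Rightarrow> complex^'a \<Rightarrow> complex^('a::finite \<times> 2)" where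
  "block u v = (\<chi> p. if snd p = 1 then u $ fst p else v $ fst p)"

lemma column_block [simp]: "column 1 (block u v) = u" "column 2 (block u v) = v"
  by (simp_all add: column_def block_def)

lemma block_column [simp]: "block (column 1 Z) (column 2 Z) = Z"
proof -
  have "block (column 1 Z) (column 2 Z) $ p = Z $ p" for p
    using exhaust_2[of "snd p"] by (cases p) (auto simp: column_def block_def)
  then show ?thesis by (rule vec_eq_iff[THEN iffD2, rule_format])
qed

lemma block_eqI: "column 1 Z = column 1 W \<Longrightarrow> column 2 Z = column 2 W \<Longrightarrow> Z = W"
  by (metis block_column)

lemma column_add [simp]: "column a (Z + W) = column a Z + column a W"
  and column_diff [simp]: "column a (Z - W) = column a Z - column a W"
  and column_minus [simp]: "column a (- Z) = - column a Z"
  and column_scale [simp]: "column a (x *s Z) = x *s column a Z"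
  and column_scaleR [simp]: "column a (r *\<^sub>R Z) = r *\<^sub>R column a Z"
  and column_zero [simp]: "column a 0 = 0"
  by (simp_all add: column_def vec_eq_iff)

lemma column_sum [simp]: "column a (\<Sum>l\<in>I. f l) = (\<Sum>l\<in>I. column a (f l))"
  by (induction I rule: infinite_finite_induct) simp_all

lemma bounded_linear_column: "bounded_linear (column a)"
  by (simp add: linear_conv_bounded_linear[symmetric] linearI)

lemma column_tens [simp]: "column a (tens z t) = t $ a *s z"
  by (simp add: column_def tens_def vec_eq_iff mult.commute)

lemma sum_UNIV_prod2: "(\<Sum>p\<in>UNIV. f p) = (\<Sum>s\<in>UNIV. f (s, 1)) + (\<Sum>s\<in>UNIV. f (s, 2))"
  for f :: "'a::finite \<times> 2 \<Rightarrow> 'b::comm_monoid_add"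
proof -
  have "(\<Sum>p\<in>UNIV. f p) = (\<Sum>s\<in>UNIV. \<Sum>a\<in>UNIV. f (s, a))"
    unfolding UNIV_Times_UNIV[symmetric] sum.cartesian_product by (simp add: case_prod_unfold)
  then show ?thesis by (simp add: sum_2 sum.distrib)
qed

lemma column_kron [simp]: "column a (kron A B *v Z) = B $ a $ 1 *s (A *v column 1 Z) + B $ a $ 2 *s (A *v column 2 Z)"
  by (simp add: vec_eq_iff column_def kron_def matrix_vector_mult_def sum_UNIV_prod2 sum_distrib_left mult_ac)

lemma cip_column: "cip Z W = cip (column 1 Z) (column 1 W) + cip (column 2 Z) (column 2 W)"
  unfolding cip_def sum_UNIV_prod2 column_def by simp

lemma tens_column: "Z = tens (column 1 Z) (axis 1 1) + tens (column 2 Z) (axis 2 1)"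
  by (rule block_eqI) (simp_all add: axis_def)

lemma column_op_tensor: "column a (op_tensor D A \<Psi> x) = A $ a $ 1 *s D (\<lambda>y. column 1 (\<Psi> y)) x + A $ a $ 2 *s D (\<lambda>y. column 2 (\<Psi> y)) x"
  by (simp add: vec_eq_iff column_def op_tensor_def sum_2)

lemma pauli_entries [simp]:
  "pauli1 $ 1 $ 1 = 0" "pauli1 $ 1 $ 2 = 1" "pauli1 $ 2 $ 1 = 1" "pauli1 $ 2 $ 2 = 0"
  "pauli2 $ 1 $ 1 = 0" "pauli2 $ 1 $ 2 = - \<i>" "pauli2 $ 2 $ 1 = \<i>" "pauli2 $ 2 $ 2 = 0"
  "pauli3 $ 1 $ 1 = 1" "pauli3 $ 1 $ 2 = 0" "pauli3 $ 2 $ 1 = 0" "pauli3 $ 2 $ 2 = -1"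
  by (simp_all add: pauli1_def pauli2_def pauli3_def)

lemma mat_entries [simp]: "(mat x :: complex^2^2) $ 1 $ 1 = x" "(mat x :: complex^2^2) $ 1 $ 2 = 0"
  "(mat x :: complex^2^2) $ 2 $ 1 = 0" "(mat x :: complex^2^2) $ 2 $ 2 = x"
  by (simp_all add: mat_def)

lemma hermitian_kron: "hermitian A \<Longrightarrow> hermitian B \<Longrightarrow> hermitian (kron A B)"
proof -
  assume h: "hermitian A" "hermitian B"
  have "kron A B $ p $ q = cnj (kron A B $ q $ p)" for p q
  proof -
    have "A $ fst p $ fst q = cnj (A $ fst q $ fst p)" "B $ snd p $ snd q = cnj (B $ snd q $ snd p)"
      using h unfolding hermitian_def by blast+
    then show ?thesis by (simp add: kron_def)
  qed
  then show ?thesis unfolding hermitian_def by blast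
qed

lemma hermitian_pauli: "hermitian pauli1" "hermitian pauli2" "hermitian pauli3"
  by (simp_all add: hermitian_def forall_2)

lemma hermitian_mat: "hermitian (mat 1)"
  by (simp add: hermitian_def mat_def)

lemma mv_matrix:
  assumes "\<And>v w. f (v + w) = f v + f w" "\<And>a v. f (a *s v) = a *s f v"
  shows "matrix f *v v = (f v :: complex^'i)"
  by (rule matrix_works, unfold_locales) (simp_all add: assms)

section \<open>The Dirac operator of the sphere\<close>

lemma dirac_sphere_cong:
  fixes c :: "real^'m \<Rightarrow> complex^'s^'s"
  assumes x: "norm x = 1" and eq: "\<And>z. norm z = 1 \<Longrightarrow> \<phi> z = \<phi>' z"
  shows "dirac_sphere c \<phi> x = dirac_sphere c \<phi>' x"
proof -
  have "frechet_derivative (hom_ext \<phi>) (at x) = frechet_derivative (hom_ext \<phi>') (at x)"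
    by (rule frechet_derivative_cong_open[of "- {0}"]) (use x in \<open>auto simp: hom_ext_def intro!: eq\<close>)
  moreover have "\<phi> x = \<phi>' x" using eq x by blast
  ultimately show ?thesis by (simp only: dirac_sphere_def spin_connection_def)
qed

text \<open>Clifford multiplications enter \<open>dirac_sphere\<close> only in pairs, one pair from
  the action of tangent vectors and one from the spin connection. The lemma thus covers scalars, and
  also \<Gamma>, which anticommutes with each single factor.\<close>

lemma dirac_sphere_commute:
  fixes c :: "real^'m \<Rightarrow> complex^'s^'s"
  assumes d: "hom_ext \<phi> differentiable (at x)"
    and M: "\<And>v w u. M *v (c v *v (c w *v u)) = c v *v (c w *v (M *v u))"
  shows "dirac_sphere c (\<lambda>z. M *v \<phi> z) x = M *v dirac_sphere c \<phi> x"
proof -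
  have "((\<lambda>z. M *v hom_ext \<phi> z) has_derivative (\<lambda>h. M *v frechet_derivative (hom_ext \<phi>) (at x) h)) (at x)"
    using d frechet_derivative_works
    by (intro bounded_linear.has_derivative[OF bounded_bilinear.bounded_linear_right[OF bounded_bilinear_mv]]) blast
  then have "(hom_ext (\<lambda>z. M *v \<phi> z) has_derivative (\<lambda>h. M *v frechet_derivative (hom_ext \<phi>) (at x) h)) (at x)"
    by (simp add: hom_ext_def[abs_def])
  from frechet_derivative_at[OF this, symmetric]
  have fr: "frechet_derivative (hom_ext (\<lambda>z. M *v \<phi> z)) (at x) = (\<lambda>h. M *v frechet_derivative (hom_ext \<phi>) (at x) h)" .
  have lin: "linear ((*v) M)" by simp
  show ?thesis
    unfolding dirac_sphere_def Let_def sphere_cliff_def spin_connection_def fr mv_scale linear_sum[OF lin]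
    by (simp add: M matrix_vector_mult_diff_distrib mv_scale)
qed

lemma tangential_orthogonal: "norm x = 1 \<Longrightarrow> x \<bullet> tangential x v = 0"
  by (simp add: tangential_def inner_diff_right dot_square_norm)

text \<open>\<open>\<gamma>\<^sub>r\<close> is parallel up to the sign that comes from \<open>c(v) c(\<partial>\<^sub>r) = - c(\<partial>\<^sub>r) c(v)\<close>.\<close>

lemma dirac_sphere_clifford:
  fixes c :: "real^'m \<Rightarrow> complex^'s^'s"
  assumes c: "clifford_mult c" and x: "norm x = 1" and d: "hom_ext \<phi> differentiable (at x)"
  shows "dirac_sphere c (\<lambda>z. c z *v \<phi> z) x = - (c x *v dirac_sphere c \<phi> x)"
proof -
  define L where "L = frechet_derivative (hom_ext \<phi>) (at x)"
  define N where "N = frechet_derivative (hom_ext (\<lambda>z. z)) (at x)"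
  have x0: "x \<noteq> 0" using x by auto
  have L: "(hom_ext \<phi> has_derivative L) (at x)" using d frechet_derivative_works L_def by auto
  have "hom_ext (\<lambda>z::real^'m. z) differentiable (at x)"
    unfolding hom_ext_def[abs_def] by (rule smooth_on_differentiable[OF smooth_on_normalize]) (use x0 in simp)
  then have N: "(hom_ext (\<lambda>z. z) has_derivative N) (at x)" using frechet_derivative_works N_def by auto
  have Nt: "N t = t" if "x \<bullet> t = 0" for t
    using hom_ext_deriv[of "\<lambda>z. z" x t] x that by (simp add: N_def frechet_derivative_ident)
  have lc: "bounded_linear c" using c by (simp add: clifford_mult_def linear_conv_bounded_linear)
  have x1: "x /\<^sub>R norm x = x" using x by simp
  have sq: "c x *v (c x *v u) = u" for u using clifford_square[OF c, of x u] x by simp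
  have "((\<lambda>z. c (hom_ext (\<lambda>z. z) z) *v hom_ext \<phi> z) has_derivative
      (\<lambda>h. c (hom_ext (\<lambda>z. z) x) *v L h + c (N h) *v hom_ext \<phi> x)) (at x)"
    by (rule bounded_bilinear.FDERIV[OF bounded_bilinear_mv bounded_linear.has_derivative[OF lc N] L])
  then have "(hom_ext (\<lambda>z. c z *v \<phi> z) has_derivative (\<lambda>h. c x *v L h + c (N h) *v \<phi> x)) (at x)"
    by (simp add: hom_ext_def x1)
  from frechet_derivative_at[OF this, symmetric]
  have fr: "frechet_derivative (hom_ext (\<lambda>z. c z *v \<phi> z)) (at x) t = c x *v L t + c t *v \<phi> x" if "x \<bullet> t = 0" for t
    using Nt[OF that] by simp
  have summand: "sphere_cliff c x t (spin_connection c t (\<lambda>z. c z *v \<phi> z) x)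
      = - (c x *v sphere_cliff c x t (spin_connection c t \<phi> x))" if t: "x \<bullet> t = 0" for t
  proof -
    have anti: "c x *v (c t *v u) = - (c t *v (c x *v u))" for u by (rule clifford_anticommute[OF c t])
    have neg: "B *v (- u) = - (B *v u)" for B :: "complex^'s^'s" and u
      using linear_neg[of "(*v) B" u] by simp
    \<comment> \<open>Half of the derivative c(t) \<phi> of the factor c(x) survives. It equals -1/2
      c(x) c(t) c(x) \<phi>, the connection term of \<phi> multiplied by c(x), so the connection
      commutes with c(x).\<close>
    have half: "c x *v L t + c t *v \<phi> x - (1/2) *s (c t *v (c x *v (c x *v \<phi> x))) = c x *v L t + (1/2) *s (c t *v \<phi> x)"
      unfolding sq by (simp add: vec_eq_iff)
    show ?thesis
      unfolding sphere_cliff_def spin_connection_def fr[OF t] half L_def[symmetric]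
      by (simp add: anti neg sq mv_scale matrix_vector_mult_diff_distrib matrix_vector_right_distrib)
  qed
  have lin: "linear ((*v) (c x))" by simp
  show ?thesis
    unfolding dirac_sphere_def Let_def summand[OF tangential_orthogonal[OF x]] mv_scale linear_sum[OF lin]
    by (simp add: sum_negf)
qed

lemma frechet_derivative_axis_sum:
  "f differentiable at x \<Longrightarrow> frechet_derivative f (at x) v = (\<Sum>l\<in>UNIV. (v $ l) *\<^sub>R frechet_derivative f (at x) (axis l 1))"
  for f :: "real^'m \<Rightarrow> 'b::real_normed_vector"
  by (rule linear_axis_sum) (rule linear_frechet_derivative)

text \<open>The direction of differentiation varies with x. Expanding it in the standard basis
  leaves continuous partial derivatives with continuous coefficients.\<close>

lemma dirac_sphere_continuous:
  fixes c :: "real^'m \<Rightarrow> complex^'s^'s"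
  assumes c: "clifford_mult c" and \<phi>: "smooth_on (- {0}) (hom_ext \<phi>)"
  shows "continuous_on (sphere 0 1) (dirac_sphere c \<phi>)"
proof -
  let ?S = "sphere 0 1 :: (real^'m) set"
  have sub: "?S \<subseteq> - {0}" by auto
  have "continuous_on ?S (hom_ext \<phi>)" by (rule continuous_on_subset[OF smooth_on_continuous[OF \<phi>] sub])
  then have p: "continuous_on ?S \<phi>"
    by (rule continuous_on_eq) (simp add: hom_ext_def)
  have t: "continuous_on ?S (\<lambda>x. tangential x v)" for v
    unfolding tangential_def by (intro continuous_intros)
  have cc: "continuous_on ?S (\<lambda>x. c (g x))" if "continuous_on ?S g" for g
    using continuous_on_compose2[OF linear_continuous_on[of c UNIV] that] c
    by (simp add: clifford_mult_def linear_conv_bounded_linear)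
  have mv: "continuous_on ?S (\<lambda>x. A x *v u x)" if "continuous_on ?S A" "continuous_on ?S u"
    for A :: "real^'m \<Rightarrow> complex^'s^'s" and u
    by (rule bounded_bilinear.continuous_on[OF bounded_bilinear_mv that])
  have sc: "continuous_on ?S (\<lambda>x. a *s u x)" if "continuous_on ?S u" for a and u :: "real^'m \<Rightarrow> complex^'s"
    by (rule bounded_bilinear.continuous_on[OF bounded_bilinear_scale continuous_on_const that])
  have "continuous_on ?S (\<lambda>x. \<Sum>l\<in>UNIV. (tangential x v $ l) *\<^sub>R frechet_derivative (hom_ext \<phi>) (at x) (axis l 1))" for v
    by (intro continuous_on_sum continuous_on_scaleR continuous_on_component t
        continuous_on_subset[OF smooth_on_frechet_continuous[OF \<phi>] sub])
  then have f: "continuous_on ?S (\<lambda>x. frechet_derivative (hom_ext \<phi>) (at x) (tangential x v))" for v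
    by (rule continuous_on_eq)
      (rule frechet_derivative_axis_sum[symmetric], rule smooth_on_differentiable[OF \<phi>], use sub in blast)
  show ?thesis
    unfolding dirac_sphere_def[abs_def] Let_def sphere_cliff_def spin_connection_def
    by (intro sc continuous_on_sum mv cc t f p continuous_on_diff continuous_on_id)
qed

section \<open>Separated variables\<close>

text \<open>The correction by \<open>i n/(2r) c(\<partial>\<^sub>r)\<close> cancels the zeroth order term of \<open>D\<close> in polar coordinates.\<close>

definition density_dirac :: "(real^'m \<Rightarrow> complex^'s^'s) \<Rightarrow> (real^'m \<Rightarrow> complex^'s) \<Rightarrow> real^'m \<Rightarrow> complex^'s" where
  "density_dirac c \<psi> y = dirac c \<psi> y
    - (\<i> * of_real (real (CARD('m) - 1) / (2 * norm y))) *s (c (y /\<^sub>R norm y) *v \<psi> y)"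

text \<open>Bundles differentiability with the value, so that the operator on the linear
  combinations produced by the fibre maps can be computed by introduction rules.\<close>

definition has_dirac :: "(real^'m \<Rightarrow> complex^'s^'s) \<Rightarrow> (real^'m \<Rightarrow> complex^'s) \<Rightarrow> real^'m \<Rightarrow> complex^'s \<Rightarrow> bool" where
  "has_dirac c \<psi> y w \<longleftrightarrow> \<psi> differentiable (at y) \<and> density_dirac c \<psi> y = w"

lemma has_dirac_add:
  fixes c :: "real^'m \<Rightarrow> complex^'s^'s"
  assumes "has_dirac c \<psi> y w" "has_dirac c \<psi>' y w'"
  shows "has_dirac c (\<lambda>z. \<psi> z + \<psi>' z) y (w + w')"
proof -
  have d: "\<psi> differentiable (at y)" "\<psi>' differentiable (at y)" using assms by (simp_all add: has_dirac_def)
  have "((\<lambda>z. \<psi> z + \<psi>' z) has_derivative (\<lambda>h. frechet_derivative \<psi> (at y) h + frechet_derivative \<psi>' (at y) h)) (at y)"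
    using d frechet_derivative_works by (intro has_derivative_add) blast+
  note fr = frechet_derivative_at[OF this, symmetric]
  show ?thesis
    using assms d
    by (auto simp: has_dirac_def density_dirac_def dirac_def fr matrix_vector_right_distrib sum.distrib
        vec.scale_right_distrib)
qed

lemma has_dirac_scale:
  fixes c :: "real^'m \<Rightarrow> complex^'s^'s"
  assumes "has_dirac c \<psi> y w"
  shows "has_dirac c (\<lambda>z. a *s \<psi> z) y (a *s w)"
proof -
  have d: "\<psi> differentiable (at y)" using assms by (simp add: has_dirac_def)
  have "((\<lambda>z. a *s \<psi> z) has_derivative (\<lambda>h. a *s frechet_derivative \<psi> (at y) h)) (at y)"
    using d frechet_derivative_works
    by (intro bounded_linear.has_derivative[OF bounded_bilinear.bounded_linear_right[OF bounded_bilinear_scale]]) blast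
  note d' = this and fr = frechet_derivative_at[OF this, symmetric]
  have "density_dirac c (\<lambda>z. a *s \<psi> z) y = a *s density_dirac c \<psi> y"
    unfolding density_dirac_def dirac_def fr mv_scale
    by (simp add: vec_eq_iff sum_distrib_left algebra_simps)
  then show ?thesis using assms d' by (auto simp: has_dirac_def differentiable_def)
qed

lemma has_dirac_diff:
  "has_dirac c \<psi> y w \<Longrightarrow> has_dirac c \<psi>' y w' \<Longrightarrow> has_dirac c (\<lambda>z. \<psi> z - \<psi>' z) y (w - w')"
  using has_dirac_add[OF _ has_dirac_scale[of c \<psi>' y w' "-1"]] by simp

text \<open>In polar coordinates the angular part sees t(r - 1) as a constant, and the radial part
  sees only t because the homogeneous extension of \<phi> is constant along rays.\<close>

lemma has_dirac_separated:
  fixes c :: "real^'m \<Rightarrow> complex^'s^'s" and t :: "real \<Rightarrow> complex"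
  assumes c: "clifford_mult c" and x: "norm x = 1" and r: "r > 0"
    and \<phi>: "smooth_on (- {0}) (hom_ext \<phi>)" and t: "(t has_vector_derivative t') (at (r - 1))"
  shows "has_dirac c (\<lambda>y. t (norm y - 1) *s \<phi> (y /\<^sub>R norm y)) (r *\<^sub>R x)
    ((\<i> * of_real (1 / r) * t (r - 1)) *s (c x *v dirac_sphere c \<phi> x) + (\<i> * t') *s (c x *v \<phi> x))"
proof -
  define \<theta> where "\<theta> = (\<lambda>y. t (norm y - 1) *s \<phi> (y /\<^sub>R norm y))"
  have y0: "r *\<^sub>R x \<noteq> 0" and x0: "x \<noteq> 0" using x r by auto
  have ny: "norm (r *\<^sub>R x) = r" and py: "(r *\<^sub>R x) /\<^sub>R norm (r *\<^sub>R x) = x" using x r by auto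
  have d: "hom_ext \<phi> differentiable (at (r *\<^sub>R x))" "hom_ext \<phi> differentiable (at x)"
    using smooth_on_differentiable[OF \<phi>] y0 x0 by auto
  have td: "(t has_derivative (\<lambda>h. h *\<^sub>R t')) (at (norm (r *\<^sub>R x) - 1))"
    using t unfolding ny has_vector_derivative_def .
  have "((\<lambda>y. norm y - 1) has_derivative (\<lambda>h. ((r *\<^sub>R x) /\<^sub>R norm (r *\<^sub>R x)) \<bullet> h)) (at (r *\<^sub>R x))"
    using has_derivative_diff[OF has_derivative_norm_at[OF y0] has_derivative_const[of 1]] by simp
  from diff_chain_at[OF this td]
  have "((\<lambda>y. t (norm y - 1)) has_derivative (\<lambda>h. (x \<bullet> h) *\<^sub>R t')) (at (r *\<^sub>R x))"
    by (simp only: o_def py)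
  from bounded_bilinear.FDERIV[OF bounded_bilinear_scale this d(1)[unfolded frechet_derivative_works]]
  have D: "(\<theta> has_derivative (\<lambda>h. t (r - 1) *s frechet_derivative (hom_ext \<phi>) (at (r *\<^sub>R x)) h
      + ((x \<bullet> h) *\<^sub>R t') *s \<phi> x)) (at (r *\<^sub>R x))"
    unfolding \<theta>_def hom_ext_def py py[unfolded ny] ny .
  then have \<theta>d: "\<theta> differentiable (at (r *\<^sub>R x))" using differentiable_def by blast
  have radial: "frechet_derivative (hom_ext \<phi>) (at (r *\<^sub>R x)) x = 0"
  proof -
    have "((\<lambda>u. u *\<^sub>R x) has_derivative (\<lambda>h. h *\<^sub>R x)) (at r)" by (auto intro!: derivative_eq_intros)
    from diff_chain_at[OF this d(1)[unfolded frechet_derivative_works]]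
    have "((\<lambda>u. hom_ext \<phi> (u *\<^sub>R x)) has_derivative (\<lambda>h. frechet_derivative (hom_ext \<phi>) (at (r *\<^sub>R x)) (h *\<^sub>R x))) (at r)"
      by (simp only: o_def)
    moreover have "((\<lambda>u. hom_ext \<phi> (u *\<^sub>R x)) has_derivative (\<lambda>h. 0)) (at r)"
      by (rule has_derivative_transform_within_open[of "\<lambda>_. \<phi> x" _ _ _ "{0<..}"])
        (use r x in \<open>auto simp: hom_ext_def\<close>)
    ultimately have "(\<lambda>h. frechet_derivative (hom_ext \<phi>) (at (r *\<^sub>R x)) (h *\<^sub>R x)) = (\<lambda>h. 0)"
      by (rule has_derivative_unique)
    from fun_cong[OF this, of 1] show ?thesis by simp
  qed
  have xx: "x \<bullet> x = 1" using x by (simp add: dot_square_norm)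
  have fx: "frechet_derivative \<theta> (at (r *\<^sub>R x)) x = t' *s \<phi> x"
    unfolding frechet_derivative_at[OF D, symmetric] radial xx by simp
  have "dirac_sphere c (\<lambda>z. \<theta> (r *\<^sub>R z)) x = dirac_sphere c (\<lambda>z. mat (t (r - 1)) *v \<phi> z) x"
    by (rule dirac_sphere_cong[OF x]) (use r in \<open>simp add: \<theta>_def matrix_vector_mult_def mat_def vec_eq_iff if_distrib[of "\<lambda>a. a * _"] cong: if_cong\<close>)
  also have "\<dots> = mat (t (r - 1)) *v dirac_sphere c \<phi> x"
  proof (rule dirac_sphere_commute[OF d(2)])
    have m: "mat z *v u = z *s u" for z :: complex and u :: "complex^'s"
      by (simp add: matrix_vector_mult_def mat_def vec_eq_iff if_distrib[of "\<lambda>a. a * _"] cong: if_cong)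
    show "mat (t (r - 1)) *v (c v *v (c w *v u)) = c v *v (c w *v (mat (t (r - 1)) *v u))" for v w u
      by (simp add: m mv_scale)
  qed
  also have "\<dots> = t (r - 1) *s dirac_sphere c \<phi> x"
    by (simp add: matrix_vector_mult_def mat_def vec_eq_iff if_distrib[of "\<lambda>a. a * _"] cong: if_cong)
  finally have ds: "dirac_sphere c (\<lambda>z. \<theta> (r *\<^sub>R z)) x = t (r - 1) *s dirac_sphere c \<phi> x" .
  have "density_dirac c \<theta> (r *\<^sub>R x) = (\<i> * of_real (1 / r) * t (r - 1)) *s (c x *v dirac_sphere c \<phi> x) + (\<i> * t') *s (c x *v \<phi> x)"
    unfolding density_dirac_def dirac_polar[OF c x r \<theta>d] ds fx py py[unfolded ny] ny mv_scale
    using r by (simp add: vec_eq_iff)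
  then show ?thesis using \<theta>d unfolding has_dirac_def \<theta>_def by blast
qed

text \<open>The separated formula with c(x) \<phi> in place of \<phi>. The sphere operator changes
  sign when c(x) is pulled out, and the outer c(x) cancels the inner one; so the angular term
  changes sign and the radial term does not.\<close>

lemma has_dirac_separated_clifford:
  fixes c :: "real^'m \<Rightarrow> complex^'s^'s" and t :: "real \<Rightarrow> complex"
  assumes c: "clifford_mult c" and x: "norm x = 1" and r: "r > 0"
    and \<phi>: "smooth_on (- {0}) (hom_ext \<phi>)" and t: "(t has_vector_derivative t') (at (r - 1))"
  shows "has_dirac c (\<lambda>y. t (norm y - 1) *s (c (y /\<^sub>R norm y) *v \<phi> (y /\<^sub>R norm y))) (r *\<^sub>R x)
    ((\<i> * t') *s \<phi> x - (\<i> * of_real (1 / r) * t (r - 1)) *s dirac_sphere c \<phi> x)"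
proof -
  have lc: "bounded_linear c" using c by (simp add: clifford_mult_def linear_conv_bounded_linear)
  have x0: "x \<noteq> 0" using x by auto
  have sq: "c x *v (c x *v u) = u" for u using clifford_square[OF c, of x u] x by simp
  have neg: "c x *v (- u) = - (c x *v u)" for u using linear_neg[of "(*v) (c x)" u] by simp
  have "smooth_on (- {0}) (\<lambda>y. c (y /\<^sub>R norm y) *v hom_ext \<phi> y)"
    by (rule smooth_on_bilinear[OF _ bounded_bilinear_mv smooth_on_bounded_linear_compose[OF _ lc smooth_on_normalize] \<phi>])
      (simp_all add: open_Compl)
  then have s: "smooth_on (- {0}) (hom_ext (\<lambda>z. c z *v \<phi> z))" by (simp add: hom_ext_def[abs_def])
  have d: "hom_ext \<phi> differentiable (at x)" using smooth_on_differentiable[OF \<phi>] x0 by auto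
  show ?thesis
    using has_dirac_separated[OF c x r s t] unfolding dirac_sphere_clifford[OF c x d] neg sq
    by (simp add: vec_eq_iff has_dirac_def)
qed

lemma flat_op_kron:
  fixes c :: "real^'m \<Rightarrow> complex^'s^'s"
  assumes d: "\<And>a. has_dirac c (\<lambda>y. column a (\<Psi> y)) y (w a)"
  shows "column a (flat_op \<epsilon> (\<lambda>v. kron (c v) B) (kron (mat 1) A) \<Psi> y)
    = B $ a $ 1 *s w 1 + B $ a $ 2 *s w 2
      + of_real (pot \<epsilon> (norm y - 1)) *s (A $ a $ 1 *s column 1 (\<Psi> y) + A $ a $ 2 *s column 2 (\<Psi> y))"
proof -
  have cd: "(\<lambda>y. column a (\<Psi> y)) differentiable (at y)" for a using d by (simp add: has_dirac_def)
  let ?e = "\<lambda>a. axis a 1 :: complex^2"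
  have "((\<lambda>y. tens (column 1 (\<Psi> y)) (?e 1) + tens (column 2 (\<Psi> y)) (?e 2)) has_derivative
      (\<lambda>h. tens (frechet_derivative (\<lambda>y. column 1 (\<Psi> y)) (at y) h) (?e 1)
        + tens (frechet_derivative (\<lambda>y. column 2 (\<Psi> y)) (at y) h) (?e 2))) (at y)"
    by (rule has_derivative_add;
        rule bounded_linear.has_derivative[OF bounded_bilinear.bounded_linear_left[OF bounded_bilinear_tens]
          cd[unfolded frechet_derivative_works]])
  then have "(\<lambda>y. tens (column 1 (\<Psi> y)) (?e 1) + tens (column 2 (\<Psi> y)) (?e 2)) differentiable (at y)"
    by (rule differentiableI)
  then have "\<Psi> differentiable (at y)" unfolding tens_column[symmetric] .
  then have "(\<Psi> has_derivative frechet_derivative \<Psi> (at y)) (at y)" using frechet_derivative_works by blast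
  from frechet_derivative_at[OF bounded_linear.has_derivative[OF bounded_linear_column this]]
  have fr: "column a (frechet_derivative \<Psi> (at y) h) = frechet_derivative (\<lambda>y. column a (\<Psi> y)) (at y) h" for a h
    by metis
  have w: "w a = \<i> *s (\<Sum>l\<in>UNIV. c (axis l 1) *v frechet_derivative (\<lambda>y. column a (\<Psi> y)) (at y) (axis l 1))
    - (\<i> * of_real (real (CARD('m) - 1) / (2 * norm y))) *s (c (y /\<^sub>R norm y) *v column a (\<Psi> y))" for a
    using d[of a] by (simp add: has_dirac_def density_dirac_def dirac_def)
  show ?thesis
    unfolding flat_op_def w
    by (simp add: fr sum.distrib vec_eq_iff sum_distrib_left algebra_simps del: of_nat_diff)
qed

section \<open>Scalars and matrix families for the fibre maps\<close>

definition root_half :: complex where "root_half = of_real (1 / sqrt 2)"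

lemma root_half_square: "root_half * root_half = 1 / 2"
proof -
  have "1 / sqrt 2 * (1 / sqrt 2) = (1 / 2 :: real)" by simp
  then have "root_half * root_half = of_real (1 / 2)"
    unfolding root_half_def of_real_mult[symmetric] by (rule arg_cong)
  then show ?thesis by simp
qed

lemma cnj_root_half: "cnj root_half = root_half"
  by (simp add: root_half_def)

lemma cip_root_half: "cip (root_half *s u) (root_half *s w) = cip u w / 2"
proof -
  have "cip (root_half *s u) (root_half *s w) = root_half * root_half * cip u w"
    by (simp add: cip_scale_left cip_scale_right cnj_root_half)
  then show ?thesis by (simp add: root_half_square)
qed

lemma cip_diff_left: "cip (u - v) w = cip u w - cip v w"
  and cip_diff_right: "cip w (u - v) = cip w u - cip w v"
  by (simp_all add: bounded_bilinear.diff_left[OF bounded_bilinear_cip] bounded_bilinear.diff_right[OF bounded_bilinear_cip])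

lemma mv_minus: "A *v (- u) = - (A *v u)" for A :: "complex^'i^'j"
  using linear_neg[of "(*v) A" u] by simp

lemmas mv_distrib = matrix_vector_right_distrib matrix_vector_mult_diff_distrib mv_scale mv_minus

lemma linear_matrix_family:
  fixes K :: "'a::real_vector \<Rightarrow> complex^'j^'i"
  assumes "\<And>x u. K x *v u = f x u" "\<And>u. linear (\<lambda>x. f x u)"
  shows "linear K"
proof (rule linearI)
  have "(r *\<^sub>R M) *v u = r *\<^sub>R (M *v u)" for r u and M :: "complex^'j^'i"
    by (simp add: vec_eq_iff matrix_vector_mult_def scaleR_sum_right)
  then show "K (r *\<^sub>R x) = r *\<^sub>R K x" for r x
    by (simp add: matrix_eq assms(1) linear_scale[OF assms(2)])
qed (simp add: matrix_eq matrix_vector_mult_add_rdistrib assms(1) linear_add[OF assms(2)])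

lemma kron_tens: "kron A B *v tens z v = tens (A *v z) (B *v v)" for B :: "complex^2^2"
  by (rule block_eqI) (simp_all add: mv_scale, simp_all add: vec_eq_iff matrix_vector_mult_def sum_2 algebra_simps)

lemma i_times_i: "\<i> * (\<i> * z) = - z"
  by (simp add: mult.assoc[symmetric])

lemma Cc_inf_component_derivative:
  assumes t: "t \<in> Cc_inf {-\<epsilon><..<\<epsilon>}" and s: "-\<epsilon> < s" "s < \<epsilon>"
  shows "((\<lambda>s. t s $ d) has_vector_derivative vector_derivative t (at s) $ d) (at s)"
proof -
  have "smooth_on {-\<epsilon><..<\<epsilon>} t" using t by (simp add: Cc_inf_def)
  then have "t differentiable at s" by (rule smooth_on_differentiable) (use s in simp)
  then have "(t has_vector_derivative vector_derivative t (at s)) (at s)" by (simp add: vector_derivative_works)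
  then show ?thesis by (rule bounded_linear.has_vector_derivative[OF bounded_linear_vec_nth])
qed

lemma T0_entries:
  "T0 \<epsilon> t s $ 1 = \<i> * (vector_derivative t (at s) $ 2 - of_real (pot \<epsilon> s) * t s $ 2)"
  "T0 \<epsilon> t s $ 2 = \<i> * (vector_derivative t (at s) $ 1 + of_real (pot \<epsilon> s) * t s $ 1)"
  by (simp_all add: T0_def matrix_vector_mult_def sum_2 algebra_simps)

lemma smooth_column:
  assumes "\<phi> \<in> smooth_sphere_sections F" shows "smooth_on (- {0}) (hom_ext (\<lambda>z. column b (\<phi> z)))"
proof -
  have "smooth_on (- {0}) (\<lambda>z. column b (hom_ext \<phi> z))"
    by (rule smooth_on_bounded_linear_compose[OF _ bounded_linear_column])
      (use assms in \<open>simp_all add: open_Compl smooth_sphere_sections_def\<close>)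
  then show ?thesis by (simp add: hom_ext_def[abs_def])
qed

section \<open>Odd-dimensional spheres\<close>

lemma splus2_column: "w \<in> splus2 \<Gamma> \<longleftrightarrow> \<Gamma> *v column 1 w = column 1 w \<and> \<Gamma> *v column 2 w = column 2 w"
  unfolding splus2_def mem_Collect_eq
proof
  assume w: "kron \<Gamma> (mat 1) *v w = w"
  show "\<Gamma> *v column 1 w = column 1 w \<and> \<Gamma> *v column 2 w = column 2 w"
    using arg_cong[OF w, of "column 1"] arg_cong[OF w, of "column 2"] by simp
qed (rule block_eqI; simp)

text \<open>On \<open>S = S\<^sup>+ \<oplus> c(x) S\<^sup>+\<close> the fibre map is the matrix
  \<open>(1 \<otimes> \<gamma>\<^sup>1 - \<gamma>\<^sup>1 \<otimes> \<gamma>\<^sup>3) / \<surd>2\<close> on the multiplicity space \<open>\<complex>\<^sup>2 \<otimes> \<complex>\<^sup>2\<close>, with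
  \<open>c(x)\<close> in the component whose second index is 2.\<close>

definition odd_K0 :: "complex^(('s::finite \<times> 2) \<times> 2)^('s \<times> 2)" where
  "odd_K0 = matrix (\<lambda>Z. root_half *s block (column 1 (column 2 Z) - column 2 (column 1 Z)) (column 2 (column 2 Z) - column 1 (column 1 Z)))"

definition odd_K1 :: "complex^'s^'s \<Rightarrow> complex^(('s::finite \<times> 2) \<times> 2)^('s \<times> 2)" where
  "odd_K1 A = matrix (\<lambda>Z. root_half *s block (A *v (column 1 (column 1 Z) + column 2 (column 2 Z))) (A *v (column 2 (column 1 Z) + column 1 (column 2 Z))))"

text \<open>The two terms of the multiplicity matrix are anticommuting Hermitian involutions, so
  with the factor 1/sqrt 2 the matrix is its own inverse and the same combinations recur here. The
  components land in S^+ only after the projection P that follows.\<close>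

definition odd_R0 :: "complex^('s \<times> 2)^(('s::finite \<times> 2) \<times> 2)" where
  "odd_R0 = matrix (\<lambda>u. root_half *s block (block (- column 2 u) (- column 1 u)) u)"

definition odd_R1 :: "complex^'s^'s \<Rightarrow> complex^('s \<times> 2)^(('s::finite \<times> 2) \<times> 2)" where
  "odd_R1 A = matrix (\<lambda>u. root_half *s block (block (A *v column 1 u) (A *v column 2 u)) (block (A *v column 2 u) (A *v column 1 u)))"

lemma odd_K0_mv: "odd_K0 *v Z = root_half *s block (column 1 (column 2 Z) - column 2 (column 1 Z)) (column 2 (column 2 Z) - column 1 (column 1 Z))"
  unfolding odd_K0_def by (rule mv_matrix; rule block_eqI) (simp_all add: vec_eq_iff algebra_simps)

lemma odd_K1_mv: "odd_K1 A *v Z = root_half *s block (A *v (column 1 (column 1 Z) + column 2 (column 2 Z))) (A *v (column 2 (column 1 Z) + column 1 (column 2 Z)))"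
  unfolding odd_K1_def by (rule mv_matrix; rule block_eqI) (simp_all add: mv_distrib, simp_all add: vec_eq_iff algebra_simps)

lemma odd_R0_mv: "odd_R0 *v u = root_half *s block (block (- column 2 u) (- column 1 u)) u"
  unfolding odd_R0_def by (rule mv_matrix; rule block_eqI; (rule block_eqI)?) (simp_all add: vec_eq_iff algebra_simps)

lemma odd_R1_mv: "odd_R1 A *v u = root_half *s block (block (A *v column 1 u) (A *v column 2 u)) (block (A *v column 2 u) (A *v column 1 u))"
  unfolding odd_R1_def by (rule mv_matrix; rule block_eqI; rule block_eqI) (simp_all add: mv_distrib vec.scale_right_distrib mult.commute)

lemma odd_pull:
  "(odd_K0 + odd_K1 A) *v Z = root_half *s
    block (column 1 (column 2 Z) - column 2 (column 1 Z) + A *v (column 1 (column 1 Z) + column 2 (column 2 Z)))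
        (column 2 (column 2 Z) - column 1 (column 1 Z) + A *v (column 2 (column 1 Z) + column 1 (column 2 Z)))"
  unfolding matrix_vector_mult_add_rdistrib odd_K0_mv odd_K1_mv
  by (rule block_eqI) (simp_all add: vec.scale_right_distrib)

lemma odd_push:
  "(odd_R0 + odd_R1 A) *v u = root_half *s
    block (block (A *v column 1 u - column 2 u) (A *v column 2 u - column 1 u)) (block (column 1 u + A *v column 2 u) (column 2 u + A *v column 1 u))"
  unfolding matrix_vector_mult_add_rdistrib odd_R0_mv odd_R1_mv
  by (rule block_eqI; rule block_eqI) (simp_all add: vec_eq_iff algebra_simps)

lemma odd_K1_linear: "linear c \<Longrightarrow> linear (\<lambda>x. odd_K1 (c x))"
  by (rule linear_matrix_family[OF odd_K1_mv], rule linearI; rule block_eqI)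
    (simp_all add: linear_add linear_scale matrix_vector_mult_add_rdistrib scaleR_mv vec_eq_iff algebra_simps)

lemma odd_R1_linear: "linear c \<Longrightarrow> linear (\<lambda>x. odd_R1 (c x))"
  by (rule linear_matrix_family[OF odd_R1_mv], rule linearI; rule block_eqI; rule block_eqI)
    (simp_all add: linear_add linear_scale matrix_vector_mult_add_rdistrib scaleR_mv vec_eq_iff algebra_simps)

context
  fixes c :: "real^'m \<Rightarrow> complex^'s^'s" and \<Gamma> :: "complex^'s^'s"
  assumes c: "clifford_mult c" and g: "grading c \<Gamma>"
begin

lemma grading_anticommute: "\<Gamma> *v (c v *v u) = - (c v *v (\<Gamma> *v u))"
proof -
  have "(\<Gamma> ** c v) *v u = (- (c v ** \<Gamma>)) *v u" using g by (simp add: grading_def)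
  also have "\<dots> = - ((c v ** \<Gamma>) *v u)" by (simp add: vec_eq_iff matrix_vector_mult_def sum_negf)
  finally show ?thesis by (simp add: matrix_vector_mul_assoc)
qed

lemma grading_square: "\<Gamma> *v (\<Gamma> *v u) = u"
  using g by (simp add: grading_def matrix_vector_mul_assoc)

text \<open>c(x) maps S^+ into the -1 eigenspace of \<Gamma>, and eigenspaces of a Hermitian matrix
  are orthogonal.\<close>

lemma splus_orthogonal:
  assumes "\<Gamma> *v u = u" "\<Gamma> *v w = w"
  shows "cip u (c x *v w) = 0" "cip (c x *v w) u = 0"
proof -
  have "cip u (c x *v w) = cip (\<Gamma> *v u) (c x *v w)" by (simp only: assms)
  also have "\<dots> = cip u (\<Gamma> *v (c x *v w))" using g by (intro hermitian_cip) (simp add: grading_def)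
  also have "\<dots> = - cip u (c x *v w)"
    unfolding grading_anticommute assms by (simp add: cip_def sum_negf)
  finally show "cip u (c x *v w) = 0" by simp
  then show "cip (c x *v w) u = 0" using cip_cnj[of "c x *v w" u] by simp
qed

text \<open>The cross terms between S^+ and c(x) S^+ vanish by orthogonality. Within each of them
  the mixed products cancel between the components, and the remaining ones add up to twice the
  claim, which the factor 1/sqrt 2 on both sides compensates.\<close>

lemma odd_pull_isometric:
  assumes x: "norm x = 1" and z: "z \<in> splus2 \<Gamma>" "z' \<in> splus2 \<Gamma>"
  shows "cip ((odd_K0 + odd_K1 (c x)) *v tens z t) ((odd_K0 + odd_K1 (c x)) *v tens z' t') = cip z z' * cip t t'"
proof -
  have "c x *v (c x *v u) = u" for u using clifford_square[OF c, of x u] x by simp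
  then have cc: "cip (c x *v u) (c x *v w) = cip u w" for u w by (simp add: hermitian_clifford[OF c])
  have z: "\<Gamma> *v column 1 z = column 1 z" "\<Gamma> *v column 2 z = column 2 z" "\<Gamma> *v column 1 z' = column 1 z'" "\<Gamma> *v column 2 z' = column 2 z'"
    using z by (simp_all add: splus2_column)
  have o: "cip (column a z) (c x *v column b z') = 0" "cip (c x *v column a z) (column b z') = 0" if "a = 1 \<or> a = 2" "b = 1 \<or> b = 2" for a b
    using that z splus_orthogonal by auto
  have cip2: "cip t t' = cnj (t $ 1) * t' $ 1 + cnj (t $ 2) * t' $ 2" by (simp add: cip_def sum_2)
  show ?thesis
    unfolding odd_pull cip_root_half cip2 cip_column[of "block _ _"] cip_column[of z z']
    by (simp add: mv_distrib cip_add_left cip_add_right cip_diff_left cip_diff_right cip_scale_left cip_scale_right cc o)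
      (simp add: algebra_simps)
qed

text \<open>With P the projection onto S^+, the matrix c(x) P c(x) is the projection onto the
  complement, because c(x) anticommutes with \<Gamma>; the two add up to the identity.\<close>

lemma odd_pull_push:
  assumes x: "norm x = 1"
  shows "(odd_K0 + odd_K1 (c x)) *v (kron (kron ((1/2) *\<^sub>R (mat 1 + \<Gamma>)) (mat 1)) (mat 1) *v ((odd_R0 + odd_R1 (c x)) *v u)) = u"
proof -
  define P where "P = (1/2) *\<^sub>R (mat 1 + \<Gamma>)"
  have sq: "c x *v (c x *v u) = u" for u using clifford_square[OF c, of x u] x by simp
  have Pv: "P *v u = (1/2) *s (u + \<Gamma> *v u)" for u
    by (simp add: P_def scaleR_mv scaleR_as_scale matrix_vector_mult_add_rdistrib)
  have P: "P *v v + c x *v (P *v (c x *v v)) = v" for v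
    unfolding Pv mv_distrib grading_anticommute sq by (simp add: vec_eq_iff algebra_simps)
  have two: "2 * w = 2 *s w" for w :: "complex^'s" by (simp add: vec_eq_iff)
  have h': "root_half * (root_half * a) = a / 2" for a by (simp add: mult.assoc[symmetric] root_half_square)
  have P': "c x *v (P *v (c x *v v)) = v - P *v v" for v using P[of v] by (simp add: eq_diff_eq add.commute)
  show ?thesis
    unfolding P_def[symmetric] odd_pull odd_push
    by (rule block_eqI; simp add: mv_distrib P' two)
      (simp_all add: vec_eq_iff algebra_simps h')
qed

text \<open>The values stay in S^+ because \<Gamma> commutes with products of two Clifford
  multiplications and hence with \<open>dirac_sphere\<close>.\<close>

lemma odd_section:
  assumes \<phi>: "\<phi> \<in> smooth_sphere_sections (splus2 \<Gamma>)"
  shows "op_tensor (dirac_sphere c) pauli2 \<phi> \<in> carr (L2 sphere_measure (splus2 \<Gamma>))"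
proof (rule L2_sphere_continuous)
  let ?D = "\<lambda>b. dirac_sphere c (\<lambda>z. column b (\<phi> z))"
  have tc: "op_tensor (dirac_sphere c) pauli2 \<phi> x = tens (- \<i> *s ?D 2 x) (axis 1 1) + tens (\<i> *s ?D 1 x) (axis 2 1)" for x
    by (subst tens_column) (simp add: column_op_tensor)
  have "continuous_on (sphere 0 1) (\<lambda>x. tens (- \<i> *s ?D 2 x) (axis 1 1) + tens (\<i> *s ?D 1 x) (axis 2 1))"
    by (intro continuous_on_add bounded_bilinear.continuous_on[OF bounded_bilinear_tens] continuous_on_const
        bounded_bilinear.continuous_on[OF bounded_bilinear_scale] dirac_sphere_continuous[OF c] smooth_column[OF \<phi>])
  then show "continuous_on (sphere 0 1) (op_tensor (dirac_sphere c) pauli2 \<phi>)" by (simp add: tc[abs_def])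
  fix x :: "real^'m" assume x: "norm x = 1"
  then have "x \<noteq> 0" by auto
  have "\<Gamma> *v ?D b x = ?D b x" if b: "b = 1 \<or> b = 2" for b
  proof -
    have "dirac_sphere c (\<lambda>z. \<Gamma> *v column b (\<phi> z)) x = \<Gamma> *v ?D b x"
    proof (rule dirac_sphere_commute)
      show "hom_ext (\<lambda>z. column b (\<phi> z)) differentiable at x"
        by (rule smooth_on_differentiable[OF smooth_column[OF \<phi>]]) (use \<open>x \<noteq> 0\<close> in simp)
    qed (simp add: grading_anticommute mv_minus)
    moreover have "dirac_sphere c (\<lambda>z. \<Gamma> *v column b (\<phi> z)) x = ?D b x"
    proof (rule dirac_sphere_cong[OF x])
      fix z :: "real^'m" assume "norm z = 1"
      then have "\<phi> z \<in> splus2 \<Gamma>" using \<phi> by (simp add: smooth_sphere_sections_def)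
      then show "\<Gamma> *v column b (\<phi> z) = column b (\<phi> z)" using b by (auto simp: splus2_column)
    qed
    ultimately show ?thesis by simp
  qed
  then show "op_tensor (dirac_sphere c) pauli2 \<phi> x \<in> splus2 \<Gamma>"
    by (simp add: splus2_column column_op_tensor mv_distrib)
qed

end

text \<open>Let W be the multiplicity matrix, and let the first factor of C^2 \<otimes> C^2 be the
  C^2 of the module after W and the one of S^+ \<otimes> C^2 before it. The angular, radial and
  potential parts ask for (\<gamma>3 \<otimes> \<gamma>2) W = W (\<gamma>2 \<otimes> 1), (\<gamma>3
  \<otimes> \<gamma>1) W = W (\<gamma>3 \<otimes> \<gamma>1) and (\<gamma>2 \<otimes> 1) W = W
  (\<gamma>3 \<otimes> \<gamma>2): conjugation by W exchanges two of these matrices and fixes the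
  third.\<close>

lemma odd_intertwine:
  fixes c :: "real^'m \<Rightarrow> complex^'s^'s" and \<phi> :: "real^'m \<Rightarrow> complex^('s \<times> 2)"
  assumes c: "clifford_mult c" and e: "\<epsilon> < 1"
    and \<phi>: "\<phi> \<in> smooth_sphere_sections F" and t: "t \<in> Cc_inf {-\<epsilon><..<\<epsilon>}" and x: "norm x = 1"
    and s: "-\<epsilon> < s" "s < \<epsilon>"
  shows "flat_op \<epsilon> (\<lambda>v. kron (c v) pauli3) (kron (mat 1) pauli2)
      (\<lambda>y. (odd_K0 + odd_K1 (c (y /\<^sub>R norm y))) *v tens (\<phi> (y /\<^sub>R norm y)) (t (norm y - 1))) ((1 + s) *\<^sub>R x)
    = (odd_K0 + odd_K1 (c x)) *v (tens (op_tensor (dirac_sphere c) pauli2 \<phi> x) (of_real (1 / (1 + s)) *s t s)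
        + tens (kron (mat 1) pauli3 *v \<phi> x) (T0 \<epsilon> t s))" (is "flat_op \<epsilon> ?b ?\<alpha> ?\<Psi> ?y = _")
proof -
  define r where "r = 1 + s"
  have r: "r > 0" using s e by (simp add: r_def)
  have y: "norm (r *\<^sub>R x) = r" "(r *\<^sub>R x) /\<^sub>R r = x" using x r by simp_all
  have rs: "r - 1 = s" by (simp add: r_def)
  define q where "q = complex_of_real (1 / r)"
  define t' where "t' = vector_derivative t (at s)"
  define D where "D b = dirac_sphere c (\<lambda>z. column b (\<phi> z)) x" for b
  define p where "p b = column b (\<phi> x)" for b
  have td: "((\<lambda>s. t s $ d) has_vector_derivative t' $ d) (at (r - 1))" for d
    using Cc_inf_component_derivative[OF t s] by (simp add: r_def t'_def)
  \<comment> \<open>\<open>f\<close> and \<open>h\<close> are the values of the operator on t_d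
    \<phi>_b and on t_d c(x) \<phi>_b, the two kinds of terms in the fibre map.\<close>
  define f where "f d b = (\<i> * q * t s $ d) *s (c x *v D b) + (\<i> * t' $ d) *s (c x *v p b)" for d b
  define h where "h d b = (\<i> * t' $ d) *s p b - (\<i> * q * t s $ d) *s D b" for d b
  have f: "has_dirac c (\<lambda>y. t (norm y - 1) $ d *s column b (\<phi> (y /\<^sub>R norm y))) (r *\<^sub>R x) (f d b)"
    and h: "has_dirac c (\<lambda>y. t (norm y - 1) $ d *s (c (y /\<^sub>R norm y) *v column b (\<phi> (y /\<^sub>R norm y)))) (r *\<^sub>R x) (h d b)" for d b
    using has_dirac_separated[OF c x r smooth_column[OF \<phi>] td] has_dirac_separated_clifford[OF c x r smooth_column[OF \<phi>] td]
    by (simp_all add: f_def h_def D_def p_def r_def q_def)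
  have 1: "has_dirac c (\<lambda>y. column 1 (?\<Psi> y)) (r *\<^sub>R x) (root_half *s ((f 2 1 - f 1 2) + (h 1 1 + h 2 2)))"
    unfolding odd_pull column_scale column_block column_tens mv_distrib
    by (intro has_dirac_scale has_dirac_add has_dirac_diff f h)
  have 2: "has_dirac c (\<lambda>y. column 2 (?\<Psi> y)) (r *\<^sub>R x) (root_half *s ((f 2 2 - f 1 1) + (h 1 2 + h 2 1)))"
    unfolding odd_pull column_scale column_block column_tens mv_distrib
    by (intro has_dirac_scale has_dirac_add has_dirac_diff f h)
  define w where "w a = root_half *s (if a = (1::2) then (f 2 1 - f 1 2) + (h 1 1 + h 2 2) else (f 2 2 - f 1 1) + (h 1 2 + h 2 1))" for a
  have hd: "has_dirac c (\<lambda>y. column a (?\<Psi> y)) (r *\<^sub>R x) (w a)" for a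
    using 1 2 exhaust_2[of a] by (auto simp: w_def)
  have \<Psi>: "?\<Psi> (r *\<^sub>R x) = (odd_K0 + odd_K1 (c x)) *v tens (\<phi> x) (t s)" unfolding y by (simp add: r_def)
  have "column a (flat_op \<epsilon> ?b ?\<alpha> ?\<Psi> (r *\<^sub>R x)) = column a ((odd_K0 + odd_K1 (c x)) *v (tens (op_tensor (dirac_sphere c) pauli2 \<phi> x) (q *s t s)
        + tens (kron (mat 1) pauli3 *v \<phi> x) (T0 \<epsilon> t s)))" if a: "a = 1 \<or> a = 2" for a
    unfolding flat_op_kron[OF hd] unfolding \<Psi> unfolding y(1) rs unfolding odd_pull
    using a
    by (elim disjE; simp add: y column_op_tensor D_def[symmetric] p_def[symmetric] T0_entries t'_def[symmetric] w_def f_def h_def mv_distrib)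
      (simp_all add: vec_eq_iff algebra_simps i_times_i)
  then have "flat_op \<epsilon> ?b ?\<alpha> ?\<Psi> (r *\<^sub>R x) = (odd_K0 + odd_K1 (c x)) *v (tens (op_tensor (dirac_sphere c) pauli2 \<phi> x) (q *s t s)
        + tens (kron (mat 1) pauli3 *v \<phi> x) (T0 \<epsilon> t s))" by (intro block_eqI) blast+
  then show ?thesis by (simp only: r_def q_def)
qed

text \<open>The order in tens h \<xi> puts the C^2 of the module last, where \<open>column\<close>
  reads it. A fibre vector splits into its two columns, each tensored with the matching basis vector
  of the module.\<close>

lemma odd_product:
  fixes c :: "real^'m \<Rightarrow> complex^'s^'s"
  assumes eps: "0 < \<epsilon>" "\<epsilon> < 1" and c: "clifford_mult c" and g: "grading c \<Gamma>"
  shows "collar_dirac \<epsilon> (\<lambda>\<xi> h. tens h \<xi>) (splus2 \<Gamma>) (kron ((1/2) *\<^sub>R (mat 1 + \<Gamma>)) (mat 1))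
    odd_K0 (\<lambda>x. odd_K1 (c x)) odd_R0 (\<lambda>x. odd_R1 (c x)) (\<lambda>i. axis i 1) (\<lambda>i. matrix (column i))
    (inn_odd \<epsilon>) (\<lambda>b \<psi> y. b y *s \<psi> y) (dirac c) c (\<lambda>v. kron (c v) pauli3) pauli2 (kron (mat 1) pauli2)
    (op_tensor (dirac_sphere c) pauli2) (\<lambda>x. kron (mat 1) pauli3)"
proof -
  have lc: "linear c" using c by (simp add: clifford_mult_def)
  have column: "matrix (column i) *v (u :: complex^('s \<times> 2)) = column i u" for i u by (rule mv_matrix) simp_all
  have G: "\<Gamma> *v (\<Gamma> *v u) = u" for u by (rule grading_square[OF c g])
  show ?thesis
  proof (intro collar_dirac.intro collar_model.intro collar_dirac_axioms.intro)
    show "(\<Sum>i\<in>UNIV. tens (matrix (column i) *v u) (axis i 1)) = u" for u :: "complex^('s \<times> 2)"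
      unfolding column sum_2 by (rule tens_column[symmetric])
    show "kron ((1/2) *\<^sub>R (mat 1 + \<Gamma>)) (mat 1) *v z \<in> splus2 \<Gamma>" for z
      by (simp add: splus2_column scaleR_mv mv_scaleR matrix_vector_mult_add_rdistrib mv_distrib G add.commute)
    show "kron ((1/2) *\<^sub>R (mat 1 + \<Gamma>)) (mat 1) *v z = z" if "z \<in> splus2 \<Gamma>" for z
      using that by (intro block_eqI) (simp_all add: splus2_column scaleR_mv matrix_vector_mult_add_rdistrib scaleR_2[symmetric])
    show "cip (h y) (inn_odd \<epsilon> \<xi> \<eta> y *s h' y) = (if y \<in> shell \<epsilon>
        then cip (tens (h y) (\<xi> (polar y))) (tens (h' y) (\<eta> (polar y))) / of_real (norm y ^ (CARD('m) - 1)) else 0)"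
      for h h' :: "real^'m \<Rightarrow> complex^'s" and \<xi> \<eta> and y :: "real^'m"
      using immersion_inv_polar[OF eps(2), of y]
      by (simp add: inn_odd_def immersion_image[OF eps(2)] cip_scale_right cip_tens)
    show "dirac c \<psi> y = \<i> *s (\<Sum>l\<in>UNIV. c (axis l 1) *v frechet_derivative \<psi> (at y) (axis l 1))" for \<psi> y
      by (simp add: dirac_def)
    show "linear (\<lambda>v. kron (c v) pauli3)"
      by (rule linear_matrix_family[where f = "\<lambda>v u. kron (c v) pauli3 *v u"], simp, rule linearI; rule block_eqI)
        (simp_all add: linear_add[OF lc] linear_scale[OF lc] matrix_vector_mult_add_rdistrib scaleR_mv)
    show "cip (kron (c w) pauli3 *v u) u' = cip u (kron (c w) pauli3 *v u')" for w u u'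
      by (rule hermitian_cip[OF hermitian_kron]) (use c in \<open>simp_all add: clifford_mult_def hermitian_pauli\<close>)
    show "cip (kron (mat 1) pauli2 *v u) u' = cip u (kron (mat 1) pauli2 *v u')" for u u' :: "complex^('s \<times> 2)"
      by (rule hermitian_cip[OF hermitian_kron[OF hermitian_mat hermitian_pauli(2)]])
    show "linear (\<lambda>x::real^'m. kron (mat 1) pauli3 - (kron (mat 1) pauli3 :: complex^('s \<times> 2)^('s \<times> 2)))"
      by (simp add: linear_zero)
    show "kron (mat 1) pauli3 *v f \<in> splus2 \<Gamma>" if "f \<in> splus2 \<Gamma>" for f
      using that by (simp add: splus2_column mv_distrib)
  qed (use eps in \<open>simp_all add: tens_add_left tens_add_right tens_scale_left tens_scale_right kron_tens lc
        odd_K1_linear odd_R1_linear odd_pull_isometric[OF c g] odd_pull_push[OF c g] odd_section[OF c g] odd_intertwine[OF c]\<close>)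
qed

section \<open>Even-dimensional spheres\<close>

lemma cl1_matrix_entries [simp]:
  "cl1_matrix a $ 1 $ 1 = a $ 1" "cl1_matrix a $ 1 $ 2 = a $ 2"
  "cl1_matrix a $ 2 $ 1 = a $ 2" "cl1_matrix a $ 2 $ 2 = a $ 1"
  by (simp_all add: cl1_matrix_def matrix_matrix_mult_def sum_2)

text \<open>On the eigenspaces \<open>c(x) = 1\<close> and \<open>c(x) = -1\<close> the fibre map is \<open>Q = (\<gamma>\<^sup>1 + \<gamma>\<^sup>2) / \<surd>2\<close> and
  \<open>Q = (-i - \<gamma>\<^sup>3) / \<surd>2\<close>, the solutions of \<open>\<gamma>\<^sup>2 Q = Q \<gamma>\<^sup>1\<close>, \<open>\<gamma>\<^sup>1 Q = \<plusminus> Q \<gamma>\<^sup>2\<close>; the phase of the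
  second is forced by the angular part of the operator, which exchanges the eigenspaces.\<close>

definition even_K0 :: "complex^('s::finite \<times> 2)^('s \<times> 2)" where
  "even_K0 = matrix (\<lambda>Z. (root_half / 2) *s
    block ((1 - \<i>) *s column 2 Z - (1 + \<i>) *s column 1 Z) ((1 + \<i>) *s column 1 Z + (1 - \<i>) *s column 2 Z))"

text \<open>As c(x) is \<plusminus>1 on its eigenspaces, \<open>even_K0\<close> is half the sum of
  the two matrices Q, and this one is c(x) times half their difference. The coefficient is 1/sqrt 2
  from Q times 1/2 from the averaging.\<close>

definition even_K1 :: "complex^'s^'s \<Rightarrow> complex^('s::finite \<times> 2)^('s \<times> 2)" where
  "even_K1 A = matrix (\<lambda>Z. (root_half / 2) *s
    block (A *v ((1 + \<i>) *s column 1 Z + (1 - \<i>) *s column 2 Z)) (A *v ((1 + \<i>) *s column 1 Z - (1 - \<i>) *s column 2 Z)))"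

text \<open>Both matrices Q are unitary. \<open>even_R0\<close> and \<open>even_R1\<close> are built
  from their adjoints as \<open>even_K0\<close> and \<open>even_K1\<close> are from the matrices
  themselves.\<close>

definition even_R0 :: "complex^('s::finite \<times> 2)^('s \<times> 2)" where
  "even_R0 = matrix (\<lambda>u. (root_half / 2) *s
    block ((1 - \<i>) *s (column 2 u - column 1 u)) ((1 + \<i>) *s (column 1 u + column 2 u)))"

definition even_R1 :: "complex^'s^'s \<Rightarrow> complex^('s::finite \<times> 2)^('s \<times> 2)" where
  "even_R1 A = matrix (\<lambda>u. (root_half / 2) *s
    block (A *v ((1 - \<i>) *s (column 1 u + column 2 u))) (A *v ((1 + \<i>) *s (column 1 u - column 2 u))))"

lemma even_K0_mv: "even_K0 *v Z = (root_half / 2) *s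
    block ((1 - \<i>) *s column 2 Z - (1 + \<i>) *s column 1 Z) ((1 + \<i>) *s column 1 Z + (1 - \<i>) *s column 2 Z)"
  unfolding even_K0_def by (rule mv_matrix; rule block_eqI) (simp_all add: vec_eq_iff field_simps)

lemma even_K1_mv: "even_K1 A *v Z = (root_half / 2) *s
    block (A *v ((1 + \<i>) *s column 1 Z + (1 - \<i>) *s column 2 Z)) (A *v ((1 + \<i>) *s column 1 Z - (1 - \<i>) *s column 2 Z))"
  unfolding even_K1_def by (rule mv_matrix; rule block_eqI) (simp_all add: mv_distrib, simp_all add: vec_eq_iff field_simps)

lemma even_R0_mv: "even_R0 *v u = (root_half / 2) *s
    block ((1 - \<i>) *s (column 2 u - column 1 u)) ((1 + \<i>) *s (column 1 u + column 2 u))"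
  unfolding even_R0_def by (rule mv_matrix; rule block_eqI) (simp_all add: vec_eq_iff field_simps)

lemma even_R1_mv: "even_R1 A *v u = (root_half / 2) *s
    block (A *v ((1 - \<i>) *s (column 1 u + column 2 u))) (A *v ((1 + \<i>) *s (column 1 u - column 2 u)))"
  unfolding even_R1_def by (rule mv_matrix; rule block_eqI) (simp_all add: mv_distrib, simp_all add: vec_eq_iff field_simps)

lemma even_pull:
  "(even_K0 + even_K1 A) *v Z = (root_half / 2) *s
    block ((1 - \<i>) *s column 2 Z - (1 + \<i>) *s column 1 Z + A *v ((1 + \<i>) *s column 1 Z + (1 - \<i>) *s column 2 Z))
        ((1 + \<i>) *s column 1 Z + (1 - \<i>) *s column 2 Z + A *v ((1 + \<i>) *s column 1 Z - (1 - \<i>) *s column 2 Z))"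
  unfolding matrix_vector_mult_add_rdistrib even_K0_mv even_K1_mv
  by (rule block_eqI) (simp_all add: vec.scale_right_distrib)

lemma even_push:
  "(even_R0 + even_R1 A) *v u = (root_half / 2) *s
    block ((1 - \<i>) *s (column 2 u - column 1 u + A *v (column 1 u + column 2 u)))
        ((1 + \<i>) *s (column 1 u + column 2 u + A *v (column 1 u - column 2 u)))"
  unfolding matrix_vector_mult_add_rdistrib even_R0_mv even_R1_mv
  by (rule block_eqI) (simp_all add: mv_distrib vec.scale_right_distrib vec.scale_right_diff_distrib)

lemma even_K1_linear: "linear c \<Longrightarrow> linear (\<lambda>x. even_K1 (c x))"
  by (rule linear_matrix_family[OF even_K1_mv], rule linearI; rule block_eqI)
    (simp_all add: linear_add linear_scale matrix_vector_mult_add_rdistrib scaleR_mv, simp_all add: vec_eq_iff algebra_simps)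

lemma even_R1_linear: "linear c \<Longrightarrow> linear (\<lambda>x. even_R1 (c x))"
  by (rule linear_matrix_family[OF even_R1_mv], rule linearI; rule block_eqI)
    (simp_all add: linear_add linear_scale matrix_vector_mult_add_rdistrib scaleR_mv, simp_all add: vec_eq_iff algebra_simps)

lemma even_pull_isometric:
  fixes c :: "real^'m \<Rightarrow> complex^'s^'s"
  assumes c: "clifford_mult c" and x: "norm x = 1"
  shows "cip ((even_K0 + even_K1 (c x)) *v tens z t) ((even_K0 + even_K1 (c x)) *v tens z' t') = cip z z' * cip t t'"
proof -
  have sq: "c x *v (c x *v u) = u" for u using clifford_square[OF c, of x u] x by simp
  have cc: "cip (c x *v u) w = cip u (c x *v w)" for u w by (rule hermitian_clifford[OF c])
  have half: "(root_half / 2) *s U = root_half *s ((1 / 2) *s U)" for U :: "complex^('s \<times> 2)" by simp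
  have cip2: "cip t t' = cnj (t $ 1) * t' $ 1 + cnj (t $ 2) * t' $ 2" by (simp add: cip_def sum_2)
  show ?thesis
    unfolding even_pull half cip_root_half cip2 cip_column[of "_ *s block _ _"]
    by (simp add: mv_distrib cip_add_left cip_add_right cip_diff_left cip_diff_right cip_scale_left cip_scale_right cc sq)
      (simp add: algebra_simps i_times_i add_divide_distrib diff_divide_distrib)
qed

lemma even_pull_push:
  fixes c :: "real^'m \<Rightarrow> complex^'s^'s"
  assumes c: "clifford_mult c" and x: "norm x = 1"
  shows "(even_K0 + even_K1 (c x)) *v (kron (mat 1) (mat 1) *v ((even_R0 + even_R1 (c x)) *v u)) = u"
proof -
  have sq: "c x *v (c x *v u) = u" for u using clifford_square[OF c, of x u] x by simp
  have kron: "kron (mat 1) (mat 1) *v Z = Z" for Z :: "complex^('s \<times> 2)" by (rule block_eqI) simp_all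
  have h: "root_half * (root_half * a) = a / 2" for a by (simp add: mult.assoc[symmetric] root_half_square)
  have two: "2 * w = 2 *s w" for w :: "complex^'s" by (simp add: vec_eq_iff)
  show ?thesis
    unfolding kron even_pull even_push
    by (rule block_eqI; simp add: mv_distrib sq two)
      (simp_all add: vec_eq_iff algebra_simps i_times_i h add_divide_distrib diff_divide_distrib)
qed

text \<open>On the eigenspace c(x) = \<sigma> the radial part needs \<gamma>2 Q = Q \<gamma>1 and
  the potential needs \<gamma>1 Q = \<sigma> Q \<gamma>2. The angular part (i/r) c(x) D_S \<otimes>
  \<gamma>2 leads into the eigenspace -\<sigma>, so the matrix there must be -i \<sigma> \<gamma>2
  Q. The chosen pair satisfies all of these.\<close>

lemma even_intertwine:
  fixes c :: "real^'m \<Rightarrow> complex^'s^'s" and \<phi> :: "real^'m \<Rightarrow> complex^'s"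
  assumes c: "clifford_mult c" and e: "\<epsilon> < 1"
    and \<phi>: "\<phi> \<in> smooth_sphere_sections F" and t: "t \<in> Cc_inf {-\<epsilon><..<\<epsilon>}" and x: "norm x = 1"
    and s: "-\<epsilon> < s" "s < \<epsilon>"
  shows "flat_op \<epsilon> (\<lambda>v. kron (c v) pauli2) (kron (mat 1) pauli1)
      (\<lambda>y. (even_K0 + even_K1 (c (y /\<^sub>R norm y))) *v tens (\<phi> (y /\<^sub>R norm y)) (t (norm y - 1))) ((1 + s) *\<^sub>R x)
    = (even_K0 + even_K1 (c x)) *v (tens (dirac_sphere c \<phi> x) (of_real (1 / (1 + s)) *s t s)
        + tens (c x *v \<phi> x) (T0 \<epsilon> t s))" (is "flat_op \<epsilon> ?b ?\<alpha> ?\<Psi> ?y = _")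
proof -
  define r where "r = 1 + s"
  have r: "r > 0" using s e by (simp add: r_def)
  have y: "norm (r *\<^sub>R x) = r" "(r *\<^sub>R x) /\<^sub>R r = x" using x r by simp_all
  have rs: "r - 1 = s" by (simp add: r_def)
  define \<kappa> where "\<kappa> = root_half / 2"
  define q where "q = complex_of_real (1 / r)"
  have sq: "c x *v (c x *v u) = u" for u using clifford_square[OF c, of x u] x by simp
  have sm: "smooth_on (- {0}) (hom_ext \<phi>)" using \<phi> by (simp add: smooth_sphere_sections_def)
  define t' where "t' = vector_derivative t (at s)"
  define D where "D = dirac_sphere c \<phi> x"
  define p where "p = \<phi> x"
  have td: "((\<lambda>s. t s $ d) has_vector_derivative t' $ d) (at (r - 1))" for d
    using Cc_inf_component_derivative[OF t s] by (simp add: r_def t'_def)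
  define f where "f d = (\<i> * q * t s $ d) *s (c x *v D) + (\<i> * t' $ d) *s (c x *v p)" for d
  define h where "h d = (\<i> * t' $ d) *s p - (\<i> * q * t s $ d) *s D" for d
  have f: "has_dirac c (\<lambda>y. t (norm y - 1) $ d *s \<phi> (y /\<^sub>R norm y)) (r *\<^sub>R x) (f d)"
    and h: "has_dirac c (\<lambda>y. t (norm y - 1) $ d *s (c (y /\<^sub>R norm y) *v \<phi> (y /\<^sub>R norm y))) (r *\<^sub>R x) (h d)" for d
    using has_dirac_separated[OF c x r sm td] has_dirac_separated_clifford[OF c x r sm td]
    by (simp_all add: f_def h_def D_def p_def r_def q_def)
  have 1: "has_dirac c (\<lambda>y. column 1 (?\<Psi> y)) (r *\<^sub>R x)
      ((root_half / 2) *s (((1 - \<i>) *s f 2 - (1 + \<i>) *s f 1) + ((1 + \<i>) *s h 1 + (1 - \<i>) *s h 2)))"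
    unfolding even_pull column_scale column_block column_tens mv_distrib
    by (intro has_dirac_scale[where a = "root_half / 2"] has_dirac_scale[where a = "1 - \<i>"] has_dirac_scale[where a = "1 + \<i>"]
        has_dirac_add has_dirac_diff f h)
  have 2: "has_dirac c (\<lambda>y. column 2 (?\<Psi> y)) (r *\<^sub>R x)
      ((root_half / 2) *s (((1 + \<i>) *s f 1 + (1 - \<i>) *s f 2) + ((1 + \<i>) *s h 1 - (1 - \<i>) *s h 2)))"
    unfolding even_pull column_scale column_block column_tens mv_distrib
    by (intro has_dirac_scale[where a = "root_half / 2"] has_dirac_scale[where a = "1 - \<i>"] has_dirac_scale[where a = "1 + \<i>"]
        has_dirac_add has_dirac_diff f h)
  define w where "w a = \<kappa> *s (if a = (1::2) then ((1 - \<i>) *s f 2 - (1 + \<i>) *s f 1) + ((1 + \<i>) *s h 1 + (1 - \<i>) *s h 2)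
    else ((1 + \<i>) *s f 1 + (1 - \<i>) *s f 2) + ((1 + \<i>) *s h 1 - (1 - \<i>) *s h 2))" for a
  have hd: "has_dirac c (\<lambda>y. column a (?\<Psi> y)) (r *\<^sub>R x) (w a)" for a
    using 1 2 exhaust_2[of a] by (auto simp: w_def \<kappa>_def)
  have \<Psi>: "?\<Psi> (r *\<^sub>R x) = (even_K0 + even_K1 (c x)) *v tens (\<phi> x) (t s)" unfolding y by (simp add: r_def)
  have "column a (flat_op \<epsilon> ?b ?\<alpha> ?\<Psi> (r *\<^sub>R x)) = column a ((even_K0 + even_K1 (c x)) *v (tens (dirac_sphere c \<phi> x) (q *s t s)
        + tens (c x *v \<phi> x) (T0 \<epsilon> t s)))" if a: "a = 1 \<or> a = 2" for a
    unfolding flat_op_kron[OF hd] unfolding \<Psi> unfolding y(1) rs unfolding even_pull \<kappa>_def[symmetric]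
    using a
    by (elim disjE; simp add: D_def[symmetric] p_def[symmetric] T0_entries t'_def[symmetric] w_def f_def h_def mv_distrib sq)
      (simp_all add: vec_eq_iff algebra_simps i_times_i)
  then have "flat_op \<epsilon> ?b ?\<alpha> ?\<Psi> (r *\<^sub>R x) = (even_K0 + even_K1 (c x)) *v (tens (dirac_sphere c \<phi> x) (q *s t s)
        + tens (c x *v \<phi> x) (T0 \<epsilon> t s))" by (intro block_eqI) blast+
  then show ?thesis by (simp only: r_def q_def)
qed

text \<open>The module is free of rank one over Cl_1, so the unit alone generates: \<open>eb\<close>
  is constantly the unit and the second summand of the splitting is set to zero. On Cl_1 the matrix
  \<gamma>3 is the automorphism e -> -e, and e acts on spinors as \<gamma>1, which anticommutes with
  \<gamma>2; this is why the symbol passes through the embedding.\<close>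

lemma even_product:
  fixes c :: "real^'m \<Rightarrow> complex^'s^'s"
  assumes eps: "0 < \<epsilon>" "\<epsilon> < 1" and c: "clifford_mult c"
  shows "collar_dirac \<epsilon> (\<lambda>\<xi> h. kron (mat 1) (cl1_matrix \<xi>) *v h) UNIV (mat 1)
    even_K0 (\<lambda>x. even_K1 (c x)) even_R0 (\<lambda>x. even_R1 (c x)) (\<lambda>i. axis 1 1) (\<lambda>i. if i = 1 then mat 1 else 0)
    (inn_even \<epsilon>) (\<lambda>b \<psi> y. kron (mat 1) (cl1_matrix (b y)) *v \<psi> y) (op_tensor (dirac c) pauli2)
    (\<lambda>v. kron (c v) pauli2) (\<lambda>v. kron (c v) pauli2) pauli1 (kron (mat 1) pauli1) (dirac_sphere c) c"
proof -
  have lc: "linear c" using c by (simp add: clifford_mult_def)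
  have mvp: "(pauli1 *v v) $ 1 = v $ 2" "(pauli1 *v v) $ 2 = v $ 1" "(pauli3 *v v) $ 1 = v $ 1" "(pauli3 *v v) $ 2 = - v $ 2" for v
    by (simp_all add: matrix_vector_mult_def sum_2)
  show ?thesis
  proof (intro collar_dirac.intro collar_model.intro collar_dirac_axioms.intro)
    show "kron (mat 1) (cl1_matrix (v + v')) *v w = kron (mat 1) (cl1_matrix v) *v w + kron (mat 1) (cl1_matrix v') *v w"
      for v v' and w :: "complex^('s \<times> 2)"
      by (rule block_eqI) (simp_all add: vec_eq_iff algebra_simps)
    show "kron (mat 1) (cl1_matrix (a *s v)) *v w = a *s (kron (mat 1) (cl1_matrix v) *v w)" for a v and w :: "complex^('s \<times> 2)"
      by (rule block_eqI) (simp_all add: vec_eq_iff algebra_simps)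
    show "(\<Sum>i\<in>UNIV. kron (mat 1) (cl1_matrix (axis 1 1)) *v ((if i = (1::2) then mat 1 else 0) *v u)) = u" for u :: "complex^('s \<times> 2)"
      unfolding sum_2 by (rule block_eqI) (simp_all add: axis_def)
    show "cip (h y) (kron (mat 1) (cl1_matrix (inn_even \<epsilon> \<xi> \<eta> y)) *v h' y) = (if y \<in> shell \<epsilon>
        then cip (kron (mat 1) (cl1_matrix (\<xi> (polar y))) *v h y) (kron (mat 1) (cl1_matrix (\<eta> (polar y))) *v h' y)
          / of_real (norm y ^ (CARD('m) - 1)) else 0)"
      for h h' :: "real^'m \<Rightarrow> complex^('s \<times> 2)" and \<xi> \<eta> and y :: "real^'m"
    proof (cases "y \<in> shell \<epsilon>")
      case True
      then show ?thesis
        using immersion_inv_polar[OF eps(2) True]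
        by (simp add: inn_even_def immersion_image[OF eps(2)] cip_column cl1_mult_def cl1_star_def cip_add_left cip_add_right
            cip_scale_left cip_scale_right) (simp add: algebra_simps add_divide_distrib)
    next
      case False
      then show ?thesis by (simp add: inn_even_def immersion_image[OF eps(2)] cip_column cip_def)
    qed
    show "op_tensor (dirac c) pauli2 \<psi> y = \<i> *s (\<Sum>l\<in>UNIV. kron (c (axis l 1)) pauli2 *v frechet_derivative \<psi> (at y) (axis l 1))"
      if "\<psi> differentiable (at y)" for \<psi> y
    proof -
      have "(\<psi> has_derivative frechet_derivative \<psi> (at y)) (at y)" using that frechet_derivative_works by blast
      from frechet_derivative_at[OF bounded_linear.has_derivative[OF bounded_linear_column this]]
      have fr: "frechet_derivative (\<lambda>y. column a (\<psi> y)) (at y) h = column a (frechet_derivative \<psi> (at y) h)" for a h by metis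
      show ?thesis
        by (rule block_eqI) (simp_all add: column_op_tensor dirac_def fr vec.scale_sum_right mult.commute)
    qed
    show "linear (\<lambda>v. kron (c v) pauli2)"
      by (rule linear_matrix_family[where f = "\<lambda>v u. kron (c v) pauli2 *v u"], simp, rule linearI; rule block_eqI;
        simp add: linear_add[OF lc] linear_scale[OF lc] matrix_vector_mult_add_rdistrib scaleR_mv vec_eq_iff algebra_simps)
    show "kron (mat 1) (cl1_matrix (pauli3 *v v)) *v (kron (c w) pauli2 *v z) = kron (c w) pauli2 *v (kron (mat 1) (cl1_matrix v) *v z)" for v w z
      by (rule block_eqI) (simp_all add: mvp mv_distrib, simp_all add: vec_eq_iff algebra_simps)
    show "cip (kron (c w) pauli2 *v u) u' = cip u (kron (c w) pauli2 *v u')" for w u u'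
      by (rule hermitian_cip[OF hermitian_kron]) (use c in \<open>simp_all add: clifford_mult_def hermitian_pauli\<close>)
    show "kron (mat 1) (cl1_matrix (pauli1 *v v)) *v z = kron (mat 1) pauli1 *v (kron (mat 1) (cl1_matrix v) *v z)"
      for v and z :: "complex^('s \<times> 2)"
      by (rule block_eqI) (simp_all add: mvp)
    show "cip (kron (mat 1) pauli1 *v u) u' = cip u (kron (mat 1) pauli1 *v u')" for u u' :: "complex^('s \<times> 2)"
      by (rule hermitian_cip[OF hermitian_kron[OF hermitian_mat hermitian_pauli(1)]])
    show "dirac_sphere c \<phi> \<in> carr (L2 sphere_measure UNIV)" if "\<phi> \<in> smooth_sphere_sections UNIV" for \<phi>
      by (rule L2_sphere_continuous[OF dirac_sphere_continuous[OF c]])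
        (use that in \<open>simp_all add: smooth_sphere_sections_def\<close>)
    show "linear (\<lambda>x. c x - c 0)" using lc by (simp add: linear_0)
  qed (use eps in \<open>simp_all add: matrix_vector_right_distrib vector_scalar_commute
        even_K1_linear[OF lc] even_R1_linear[OF lc] even_pull_isometric[OF c] even_pull_push[OF c] even_intertwine[OF c]\<close>)
qed

theorem proposition3p1:
  fixes \<epsilon> :: real and k :: nat
    and c :: "real^'m \<Rightarrow> complex^'s^'s" and \<Gamma> :: "complex^'s^'s"
  assumes "0 < \<epsilon>" and "\<epsilon> < 1" and "k \<ge> 1"
    and "clifford_mult c" and "CARD('s) = 2 ^ k"
  shows
    "(CARD('m) = 2 * k \<and> grading c \<Gamma> \<longrightarrow>
       (\<exists>U. unitary_iso (source_odd \<epsilon>) (target_odd \<Gamma> \<epsilon>) U \<and>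
            same_differential_expression (target_odd \<Gamma> \<epsilon>) (test_tensors (splus2 \<Gamma>) \<epsilon>)
              (transport U (Dx_odd c \<epsilon>)) (rhs_odd c \<Gamma> \<epsilon>))) \<and>
     (CARD('m) = 2 * k + 1 \<longrightarrow>
       (\<exists>U. unitary_iso (source_even \<epsilon>) (target_even \<epsilon>) U \<and>
            same_differential_expression (target_even \<epsilon>) (test_tensors UNIV \<epsilon>)
              (transport U (Dx_even c \<epsilon>)) (rhs_even c \<epsilon>)))"
  using collar_dirac.collar_product[OF odd_product[OF assms(1,2,4)]]
    collar_dirac.collar_product[OF even_product[OF assms(1,2,4)]]
  unfolding source_odd_def target_odd_def Dx_odd_def rhs_odd_def source_even_def target_even_def Dx_even_def rhs_even_def
  by blast

end
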